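(* Let $f=u\chi_\Omega$, where $\Omega\subset B=\{|\mathbf{x}|<1\}\subset\mathbb{R}^2$ is a compact domain with smooth boundary and $u\in C^\infty(\mathbb{R}^2)$ with $u>0$. Let the smoothing kernel satisfy $\varphi\in H^{\lambda,\infty}(\mathbb{R}^2)$ with $\lambda>1$. For $\theta\in[-\pi,\pi]$ let $\Pi_\theta$ be the set of $s\in\mathbb{R}$ such that $L(s,\theta)$ is tangent to $\partial\Omega$ exactly in one line segment or at a single point where the curvature of $\partial\Omega$ is not zero. Then, for almost every $\theta_0\in[-\pi,\pi]$, $$\Pi_{\theta_0}\subset \mathrm{ssupp}(\mathcal{R}f(\cdot,\theta_0))\setminus\mathrm{ssupp}^1(\mathcal{R}f(\cdot,\theta_0))\subset \mathrm{ssupp}(R_wf)\cap\{\theta=\theta_0\},$$ where the last set is identified with a subset of $\mathbb{R}$ via $(s,\theta_0)\mapsto s$.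
   Context: Fourier transform: $\hat f(\xi)=\mathcal{F}f(\xi)=\int e^{-i\mathbf{x}\cdot\xi}f(\mathbf{x})\,d\mathbf{x}$. For $\alpha\in\mathbb{R}$, $1\le p\le\infty$, $H^{\alpha,p}(\mathbb{R}^n)$ is the space of tempered distributions $f$ whose Fourier transform is a measurable function with $\|(1+|\xi|^2)^{\alpha/2}\hat f\|_{L^p(\mathbb{R}^n)}<\infty$. A distribution $g$ is in $H^{\alpha,p}$ microlocally near $(y_0,\xi_0)$ if there are $\eta\in C_c^\infty(\mathbb{R}^n)$ with $\eta(y_0)\ne 0$ and a function $m$, smooth on $\mathbb{R}^n\setminus\{0\}$ and homogeneous of degree zero, with $m(\xi_0)\neq0$, such that $(1+|\xi|^2)^{\alpha/2}m(\xi)\mathcal{F}(\eta g)(\xi)\in L^p(\mathbb{R}^n)$. $\mathrm{WF}$ is the $C^\infty$ wavefront set, $\mathrm{ssupp}(g)$ is the projection of $\mathrm{WF}(g)$ to the base, and (note the convention) $\mathrm{ssupp}^{\alpha}(g)$ is the projection to the base of $\mathrm{WF}^\alpha(g)=\{(y,\xi)\in\mathrm{WF}(g): g\text{ is in }H^{\alpha,2}\text{ microlocally near }(y,\xi)\}$. Fix $a,b>0$ and $2\psi\in(0,\pi)$. The V-line transform is $$\mathcal{V}_{a,b}f(\mathbf{x},\phi)=a\int_0^\infty f(\mathbf{x}+t\Phi)\,dt+b\int_0^\infty f(\mathbf{x}+t\Phi')\,dt,$$ with $\Phi=(\cos(\phi+2\psi-\pi/2),\sin(\phi+2\psi-\pi/2))$,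 $\Phi'=(\cos(\phi-\pi/2),\sin(\phi-\pi/2))$. Its smoothed version is $\widetilde{\mathcal{V}_{a,b}}f(\cdot,\phi)=\varphi*\mathcal{V}_{a,b}f(\cdot,\phi)$ (convolution in $\mathbf{x}$), where $\varphi\ge0$ is a smoothing kernel with bounded support and $\int_{\mathbb{R}^2}\varphi=1$. For $s\in\mathbb{R}$, $\theta\in[-\pi,\pi]$ let $\Theta=(\cos\theta,\sin\theta)$ and $L(s,\theta)=\{\mathbf{x}\in\mathbb{R}^2:\mathbf{x}\cdot\Theta=s\}$. With $c_0>0$ a constant, $w$ a fixed smooth weight with $w>0$ on $B$, and $dl$ arc length, $$\mathcal{R}f(s,\theta)=c_0\int_{L(s,\theta)}w f e^{-\widetilde{\mathcal{V}_{a,b}}f(\cdot,\theta)}\,dl,\qquad R_wf(s,\theta)=\int_{L(s,\theta)}wf\,dl.$$ *)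

theory Defs
  imports "HOL-Analysis.Analysis"
begin

primrec iter_deriv ::
  "'a list \<Rightarrow> ('a::real_normed_vector \<Rightarrow> 'b::real_normed_vector) \<Rightarrow> 'a \<Rightarrow> 'b" where
  "iter_deriv [] f = f"
| "iter_deriv (v # vs) f = (\<lambda>x. frechet_derivative (iter_deriv vs f) (at x) v)"

text \<open>The notion \<open>C\<^sup>\<infinity>\<close>, meant for open \<open>S\<close>: every iterated directional derivative is itself
  differentiable, hence also continuous, on \<open>S\<close>.\<close>

definition smooth_on ::
  "'a::euclidean_space set \<Rightarrow> ('a \<Rightarrow> 'b::real_normed_vector) \<Rightarrow> bool" where
  "smooth_on S f \<longleftrightarrow> (\<forall>vs. \<forall>x\<in>S. iter_deriv vs f differentiable (at x))"

definition test_function :: "('a::euclidean_space \<Rightarrow> complex) \<Rightarrow> bool" where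
  "test_function \<psi> \<longleftrightarrow> smooth_on UNIV \<psi> \<and> compact (closure {x. \<psi> x \<noteq> 0})"

definition schwartz :: "('a::euclidean_space \<Rightarrow> complex) \<Rightarrow> bool" where
  "schwartz \<psi> \<longleftrightarrow> smooth_on UNIV \<psi> \<and>
     (\<forall>N vs. \<exists>M. \<forall>x. (1 + norm x) ^ N * norm (iter_deriv vs \<psi> x) \<le> M)"

text \<open>Functionals are total functions; only their values on test functions (respectively on
  Schwartz functions) matter.  Continuity is expressed by the usual seminorm estimates, where
  \<open>M\<close> ranges over the common upper bounds of the finitely many seminorms of order at most \<open>N\<close>.\<close>

definition distribution :: "(('a::euclidean_space \<Rightarrow> complex) \<Rightarrow> complex) \<Rightarrow> bool" where
  "distribution T \<longleftrightarrow>
     (\<forall>\<psi> \<zeta>. test_function \<psi> \<longrightarrow> test_function \<zeta> \<longrightarrow> T (\<lambda>x. \<psi> x + \<zeta> x) = T \<psi> + T \<zeta>) \<and>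
     (\<forall>c \<psi>. test_function \<psi> \<longrightarrow> T (\<lambda>x. c * \<psi> x) = c * T \<psi>) \<and>
     (\<forall>K. compact K \<longrightarrow>
        (\<exists>C N. \<forall>\<psi> M. test_function \<psi> \<longrightarrow> {x. \<psi> x \<noteq> 0} \<subseteq> K \<longrightarrow>
           (\<forall>vs x. set vs \<subseteq> Basis \<longrightarrow> length vs \<le> N \<longrightarrow> norm (iter_deriv vs \<psi> x) \<le> M) \<longrightarrow>
           norm (T \<psi>) \<le> C * M))"

definition tempered_distribution :: "(('a::euclidean_space \<Rightarrow> complex) \<Rightarrow> complex) \<Rightarrow> bool" where
  "tempered_distribution T \<longleftrightarrow>
     (\<forall>\<psi> \<zeta>. schwartz \<psi> \<longrightarrow> schwartz \<zeta> \<longrightarrow> T (\<lambda>x. \<psi> x + \<zeta> x) = T \<psi> + T \<zeta>) \<and>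
     (\<forall>c \<psi>. schwartz \<psi> \<longrightarrow> T (\<lambda>x. c * \<psi> x) = c * T \<psi>) \<and>
     (\<exists>C N. \<forall>\<psi> M. schwartz \<psi> \<longrightarrow>
        (\<forall>vs x. set vs \<subseteq> Basis \<longrightarrow> length vs \<le> N \<longrightarrow>
           (1 + norm x) ^ N * norm (iter_deriv vs \<psi> x) \<le> M) \<longrightarrow>
        norm (T \<psi>) \<le> C * M)"

text \<open>A (locally integrable) real function regarded as a distribution.\<close>

definition distr_of :: "('a::euclidean_space \<Rightarrow> real) \<Rightarrow> ('a \<Rightarrow> complex) \<Rightarrow> complex" where
  "distr_of g \<psi> = (LINT x|lebesgue. complex_of_real (g x) * \<psi> x)"

definition fourier :: "('a::euclidean_space \<Rightarrow> complex) \<Rightarrow> 'a \<Rightarrow> complex" where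
  "fourier f \<xi> = (LINT x|lebesgue. exp (- (\<i> * complex_of_real (x \<bullet> \<xi>))) * f x)"

text \<open>The Fourier transform of the compactly supported distribution \<open>\<eta> g\<close>, a smooth function
  of \<open>\<xi>\<close>, obtained by applying \<open>g\<close> to \<open>x \<mapsto> \<eta>(x) exp (- \<i> x\<cdot>\<xi>)\<close>.\<close>

definition fourier_loc ::
  "('a::euclidean_space \<Rightarrow> complex) \<Rightarrow> (('a \<Rightarrow> complex) \<Rightarrow> complex) \<Rightarrow> 'a \<Rightarrow> complex" where
  "fourier_loc \<eta> g \<xi> = g (\<lambda>x. \<eta> x * exp (- (\<i> * complex_of_real (x \<bullet> \<xi>))))"

definition in_Lp :: "ennreal \<Rightarrow> ('a::euclidean_space \<Rightarrow> complex) \<Rightarrow> bool" where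
  "in_Lp p h \<longleftrightarrow> h \<in> borel_measurable lebesgue \<and>
     (if p = \<infinity> then \<exists>C. AE \<xi> in lebesgue. norm (h \<xi>) \<le> C
      else (\<integral>\<^sup>+ \<xi>. ennreal (norm (h \<xi>) powr enn2real p) \<partial>lebesgue) < \<infinity>)"

text \<open>The space \<open>H\<^sup>\<alpha>\<^sup>,\<^sup>p\<close> for \<open>1 \<le> p \<le> \<infinity>\<close>.  The Fourier transform of a tempered distribution is
  defined by duality; that it is a measurable function \<open>h\<close> is the second conjunct.\<close>

definition sobolev ::
  "real \<Rightarrow> ennreal \<Rightarrow> (('a::euclidean_space \<Rightarrow> complex) \<Rightarrow> complex) set" where
  "sobolev \<alpha> p = {T. tempered_distribution T \<and>
     (\<exists>h. h \<in> borel_measurable lebesgue \<and>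
        (\<forall>\<psi>. schwartz \<psi> \<longrightarrow>
           integrable lebesgue (\<lambda>\<xi>. h \<xi> * \<psi> \<xi>) \<and>
           T (fourier \<psi>) = (LINT \<xi>|lebesgue. h \<xi> * \<psi> \<xi>)) \<and>
        in_Lp p (\<lambda>\<xi>. complex_of_real ((1 + (norm \<xi>)\<^sup>2) powr (\<alpha> / 2)) * h \<xi>))}"

definition microlocally_sobolev ::
  "real \<Rightarrow> ennreal \<Rightarrow> (('a::euclidean_space \<Rightarrow> complex) \<Rightarrow> complex) \<Rightarrow> 'a \<Rightarrow> 'a \<Rightarrow> bool" where
  "microlocally_sobolev \<alpha> p g y\<^sub>0 \<xi>\<^sub>0 \<longleftrightarrow> distribution g \<and>
     (\<exists>\<eta> m :: 'a \<Rightarrow> complex.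
        test_function \<eta> \<and> \<eta> y\<^sub>0 \<noteq> 0 \<and>
        smooth_on (UNIV - {0}) m \<and>
        (\<forall>t \<xi>. t > 0 \<longrightarrow> \<xi> \<noteq> 0 \<longrightarrow> m (t *\<^sub>R \<xi>) = m \<xi>) \<and> m \<xi>\<^sub>0 \<noteq> 0 \<and>
        in_Lp p (\<lambda>\<xi>. complex_of_real ((1 + (norm \<xi>)\<^sup>2) powr (\<alpha> / 2)) * m \<xi> * fourier_loc \<eta> g \<xi>))"

definition WF :: "(('a::euclidean_space \<Rightarrow> complex) \<Rightarrow> complex) \<Rightarrow> ('a \<times> 'a) set" where
  "WF g = {(y\<^sub>0, \<xi>\<^sub>0). \<xi>\<^sub>0 \<noteq> 0 \<and>
     \<not> (\<exists>\<eta> \<Gamma>. test_function \<eta> \<and> \<eta> y\<^sub>0 \<noteq> 0 \<and>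
          open \<Gamma> \<and> \<xi>\<^sub>0 \<in> \<Gamma> \<and> (\<forall>t \<xi>. t > 0 \<longrightarrow> \<xi> \<in> \<Gamma> \<longrightarrow> t *\<^sub>R \<xi> \<in> \<Gamma>) \<and>
          (\<forall>N. \<exists>C. \<forall>\<xi>\<in>\<Gamma>. (1 + norm \<xi>) ^ N * norm (fourier_loc \<eta> g \<xi>) \<le> C))}"

definition ssupp :: "(('a::euclidean_space \<Rightarrow> complex) \<Rightarrow> complex) \<Rightarrow> 'a set" where
  "ssupp g = fst ` WF g"

text \<open>Beware of the convention: \<open>WF_sobolev \<alpha> g\<close> collects the elements of the wavefront set at
  which \<open>g\<close> \<^emph>\<open>is\<close> microlocally in \<open>H\<^sup>\<alpha>\<^sup>,\<^sup>2\<close>, not those at which it fails to be.\<close>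

definition WF_sobolev ::
  "real \<Rightarrow> (('a::euclidean_space \<Rightarrow> complex) \<Rightarrow> complex) \<Rightarrow> ('a \<times> 'a) set" where
  "WF_sobolev \<alpha> g = {(y, \<xi>) \<in> WF g. microlocally_sobolev \<alpha> 2 g y \<xi>}"

definition ssupp_sobolev ::
  "real \<Rightarrow> (('a::euclidean_space \<Rightarrow> complex) \<Rightarrow> complex) \<Rightarrow> 'a set" where
  "ssupp_sobolev \<alpha> g = fst ` WF_sobolev \<alpha> g"

text \<open>The plane is \<open>real \<times> real\<close>, whose norm and inner product are the Euclidean ones.\<close>

definition dir :: "real \<Rightarrow> real \<times> real" where
  "dir \<theta> = (cos \<theta>, sin \<theta>)"

definition dir_perp :: "real \<Rightarrow> real \<times> real" where
  "dir_perp \<theta> = (- sin \<theta>, cos \<theta>)"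

definition Line :: "real \<Rightarrow> real \<Rightarrow> (real \<times> real) set" where
  "Line s \<theta> = {x. x \<bullet> dir \<theta> = s}"

text \<open>Arc length integral over \<open>Line s \<theta>\<close>, by its unit speed parametrization.\<close>

definition line_integral :: "real \<Rightarrow> real \<Rightarrow> (real \<times> real \<Rightarrow> real) \<Rightarrow> real" where
  "line_integral s \<theta> g = (LINT t|lebesgue. g (s *\<^sub>R dir \<theta> + t *\<^sub>R dir_perp \<theta>))"

definition vline ::
  "real \<Rightarrow> real \<Rightarrow> real \<Rightarrow> (real \<times> real \<Rightarrow> real) \<Rightarrow> real \<times> real \<Rightarrow> real \<Rightarrow> real" where
  "vline a b \<psi> f x \<phi> =
     a * (LINT t:{0..}|lebesgue. f (x + t *\<^sub>R dir (\<phi> + 2 * \<psi> - pi / 2))) +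
     b * (LINT t:{0..}|lebesgue. f (x + t *\<^sub>R dir (\<phi> - pi / 2)))"

definition smoothed_vline ::
  "(real \<times> real \<Rightarrow> real) \<Rightarrow> real \<Rightarrow> real \<Rightarrow> real \<Rightarrow> (real \<times> real \<Rightarrow> real) \<Rightarrow>
   real \<times> real \<Rightarrow> real \<Rightarrow> real" where
  "smoothed_vline k a b \<psi> f x \<phi> = (LINT y|lebesgue. k y * vline a b \<psi> f (x - y) \<phi>)"

definition radon_V ::
  "real \<Rightarrow> (real \<times> real \<Rightarrow> real) \<Rightarrow> (real \<times> real \<Rightarrow> real) \<Rightarrow> real \<Rightarrow> real \<Rightarrow> real \<Rightarrow>
   (real \<times> real \<Rightarrow> real) \<Rightarrow> real \<Rightarrow> real \<Rightarrow> real" where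
  "radon_V c\<^sub>0 w k a b \<psi> f s \<theta> =
     c\<^sub>0 * line_integral s \<theta> (\<lambda>x. w x * f x * exp (- smoothed_vline k a b \<psi> f x \<theta>))"

text \<open>Regarded as a function on the whole plane of pairs \<open>(s, \<theta>)\<close>, i.e. extended
  \<open>2\<pi>\<close>-periodically in \<open>\<theta>\<close>; wavefront sets being local, this does not affect what
  happens over \<open>-\<pi> < \<theta> < \<pi>\<close>.\<close>

definition radon_w ::
  "(real \<times> real \<Rightarrow> real) \<Rightarrow> (real \<times> real \<Rightarrow> real) \<Rightarrow> real \<Rightarrow> real \<Rightarrow> real" where
  "radon_w w f s \<theta> = line_integral s \<theta> (\<lambda>x. w x * f x)"

text \<open>Local smooth defining functions with nonvanishing differential.  Connectedness is not
  required.\<close>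

definition compact_smooth_domain :: "(real \<times> real) set \<Rightarrow> bool" where
  "compact_smooth_domain \<Omega> \<longleftrightarrow> compact \<Omega> \<and>
     (\<forall>x\<in>frontier \<Omega>. \<exists>U (\<rho> :: real \<times> real \<Rightarrow> real). open U \<and> x \<in> U \<and> smooth_on U \<rho> \<and>
        (\<forall>y\<in>U. frechet_derivative \<rho> (at y) \<noteq> (\<lambda>v. 0)) \<and>
        \<Omega> \<inter> U = {y\<in>U. \<rho> y \<le> 0})"

definition curve_through ::
  "(real \<times> real) set \<Rightarrow> real \<times> real \<Rightarrow> (real \<Rightarrow> real \<times> real) \<Rightarrow> bool" where
  "curve_through M x \<gamma> \<longleftrightarrow>
     (\<exists>\<epsilon>>0. smooth_on {-\<epsilon><..<\<epsilon>} \<gamma> \<and> \<gamma> ` {-\<epsilon><..<\<epsilon>} \<subseteq> M) \<and> \<gamma> 0 = x"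

definition tangent_vector :: "(real \<times> real) set \<Rightarrow> real \<times> real \<Rightarrow> real \<times> real \<Rightarrow> bool" where
  "tangent_vector M x v \<longleftrightarrow>
     (\<exists>\<gamma>. curve_through M x \<gamma> \<and> (\<gamma> has_vector_derivative v) (at 0))"

definition curvature :: "(real \<Rightarrow> real \<times> real) \<Rightarrow> real \<Rightarrow> real" where
  "curvature \<gamma> t =
     (let \<gamma>' = \<lambda>r. vector_derivative \<gamma> (at r); d1 = \<gamma>' t; d2 = vector_derivative \<gamma>' (at t)
      in (fst d1 * snd d2 - snd d1 * fst d2) / norm d1 ^ 3)"

text \<open>For a smooth one-dimensional submanifold \<open>M\<close>, all regular curves in \<open>M\<close> through \<open>x\<close> have the
  same curvature at \<open>x\<close> up to sign.\<close>

definition nonzero_curvature_at :: "(real \<times> real) set \<Rightarrow> real \<times> real \<Rightarrow> bool" where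
  "nonzero_curvature_at M x \<longleftrightarrow>
     (\<exists>\<gamma>. curve_through M x \<gamma> \<and> vector_derivative \<gamma> (at 0) \<noteq> 0 \<and> curvature \<gamma> 0 \<noteq> 0)"

definition tangency_set :: "(real \<times> real) set \<Rightarrow> real \<Rightarrow> real \<Rightarrow> (real \<times> real) set" where
  "tangency_set \<Omega> s \<theta> = {x \<in> Line s \<theta>. tangent_vector (frontier \<Omega>) x (dir_perp \<theta>)}"

definition Pi_set :: "(real \<times> real) set \<Rightarrow> real \<Rightarrow> real set" where
  "Pi_set \<Omega> \<theta> = {s.
     (\<exists>p q. p \<noteq> q \<and> tangency_set \<Omega> s \<theta> = closed_segment p q) \<or>
     (\<exists>x. tangency_set \<Omega> s \<theta> = {x} \<and> nonzero_curvature_at (frontier \<Omega>) x)}"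

end

theory Submission
 imports Defs "HOL-Probability.Characteristic_Functions"
begin

text \<open>Fix a generic direction.  By Sard's theorem, and because nondegenerate bitangents are isolated, every
 line in that direction meets the boundary of the domain in a countable set and is tangent to it in
 at most one point, where moreover the curvature does not vanish.  Convolution with the kernel maps
 \<open>L\<^sup>1\<close> to \<open>L\<^sup>2\<close>, since its Fourier transform is square integrable; as the V-line transform of \<open>f\<close> is
 Lipschitz in \<open>L\<^sup>1\<close> under translations, the attenuated weight \<open>F = w u exp (- V)\<close> is continuous
 and Lipschitz in \<open>L\<^sup>2\<close>.  Integrating over the part of the line away from the tangency hence gives an
 \<open>H\<^sup>1\<close> function of \<open>s\<close>, whereas the part near the tangency vanishes at \<open>s\<^sub>0\<close> and grows at least like
 a multiple of \<open>sqrt \<bar>s - s\<^sub>0\<bar>\<close> on one side.  This is neither Lipschitz nor, because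
 \<open>H\<^sup>1\<close> functions on the line are \<open>o(sqrt \<bar>s - s\<^sub>0\<bar>)\<close>, of class \<open>H\<^sup>1\<close>.  As the transform is real, \<open>H\<^sup>1\<close>
 regularity in one of the two directions \<open>\<xi>\<close> implies it in the other, so both inclusions follow
 from the dichotomy between tangent and transversal lines.\<close>

section \<open>Fourier transforms of integrable functions\<close>

text \<open>Under the stated convention, \<open>ssupp\<close> minus \<open>ssupp_sobolev 1\<close>
  is the set of points near which the function is not in \<open>H^1\<close> (lemma
  \<open>ssupp_sobolev_iff\<close>), so both inclusions concern plain \<open>H^1\<close> regularity
  in \<open>s\<close> for one fixed direction. Order one is borderline: the chord cut off near a
  tangency has length of order \<open>sqrt \<bar>s - s0\<bar>\<close>, which the Hoelder bound of
  exponent 1/2 for \<open>H^1\<close> still permits; only the little-o refinement excludes it. The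
  second obstacle is the attenuated weight, which is not known to be Lipschitz pointwise. The
  condition \<open>lam > 1\<close>, half the dimension of the plane, makes the transform of the
  kernel square integrable, and the weight is estimated in \<open>L^2\<close> over families of
  parallel lines; the pointwise Lipschitz comparison is kept for the smooth weight of
  \<open>radon_w\<close>. The exceptional null set contains, besides directions with degenerate or
  double tangencies, those for which a branch of the V runs along such a line, because the V-line
  transform has to be continuous in its vertex, and those with \<open>cos th = 0\<close>, where the
  coordinates used for rotating the plane break down.\<close>

abbreviation nn_lborel :: "('a::euclidean_space => ennreal) => ennreal" (binder "NN " 60)
 where "nn_lborel f \<equiv> integral\<^sup>N lborel f"

abbreviation int_lborel :: "('a::euclidean_space => 'b::{banach, second_countable_topology}) => 'b" (binder "LB " 60)
 where "int_lborel f \<equiv> integral\<^sup>L lborel f"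

text \<open>Taken over \<open>lborel\<close>, so that measurability and Fubini act on Borel
  functions; \<open>fourier_eq_ft\<close> identifies it with \<open>fourier\<close> for Borel
  arguments.\<close>

definition ft :: "('a::euclidean_space => complex) => 'a => complex" where
 "ft f \<xi> = (LB x. cis (- (x \<bullet> \<xi>)) * f x)"

section \<open>Gaussians and approximate identities\<close>

definition gauss :: "'a::euclidean_space => real" where
 "gauss x = exp (- ((norm x)\<^sup>2 / 2))"

lemma gauss_pos: "gauss x > 0"
 by (simp add: gauss_def)

lemma gauss_le_1: "gauss x \<le> 1"
 by (simp add: gauss_def)

lemma gauss_nonneg [simp]: "0 \<le> gauss x" "\<bar>gauss x\<bar> = gauss x"
 using gauss_pos[of x] by simp_all

lemma continuous_on_gauss: "continuous_on S gauss"
 unfolding gauss_def by (intro continuous_intros) auto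

lemma gauss_measurable [measurable]: "gauss \<in> borel_measurable borel"
 using continuous_on_gauss borel_measurable_continuous_onI by blast

lemma cis_measurable [measurable]: "cis \<in> borel_measurable borel"
 by (intro borel_measurable_continuous_onI continuous_intros)

lemma cnj_measurable [measurable]: "cnj \<in> borel_measurable borel"
 by (intro borel_measurable_continuous_onI continuous_intros)

lemma borel_measurable_integrable_lborel:
 fixes f :: "'a::euclidean_space => 'b::{banach, second_countable_topology}"
 shows "integrable lborel f ==> f \<in> borel_measurable borel"
 using borel_measurable_integrable by fastforce

lemma gauss_prod: "gauss (x::'a::euclidean_space) = (\<Prod>b\<in>Basis. exp (- (x \<bullet> b)\<^sup>2 / 2))"
proof -
 have "(norm x)\<^sup>2 = (\<Sum>b\<in>Basis. (x \<bullet> b)\<^sup>2)"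
  by (metis (no_types, lifting) euclidean_inner power2_eq_square power2_norm_eq_inner sum.cong)
 then have "- ((norm x)\<^sup>2 / 2) = (\<Sum>b\<in>Basis. - (x \<bullet> b)\<^sup>2 / 2)"
  by (simp add: sum_divide_distrib sum_negf)
 then show ?thesis
  unfolding gauss_def by (simp add: exp_sum)
qed

lemma gauss_1_integrable:
 "integrable lborel (\<lambda>x::real. complex_of_real (exp (- x\<^sup>2 / 2)))"
proof -
 have "integrable lborel (\<lambda>x::real. sqrt (2 * pi) * (std_normal_density x * x ^ 0))"
  by (intro integrable_mult_right integrable_std_normal_moment)
 then have "integrable lborel (\<lambda>x::real. exp (- x\<^sup>2 / 2))"
  by (simp add: std_normal_density_def)
 then show ?thesis by simp
qed

text \<open>The characteristic function of the standard normal law at \<open>- t\<close>, with the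
  normalising factor of the density removed.\<close>

lemma ft_gauss_1:
 "(LB x. cis (- (x * t)) * complex_of_real (exp (- x\<^sup>2 / 2)))
  = complex_of_real (sqrt (2 * pi) * exp (- t\<^sup>2 / 2))"
proof -
 have "complex_of_real (exp (- t\<^sup>2 / 2)) = char std_normal_distribution (- t)"
  by (simp add: char_std_normal_distribution)
 also have "... = (LB x. std_normal_density x *\<^sub>R cis (- (x * t)))"
  unfolding char_def by (subst integral_density) (auto simp: cis_conv_exp mult.commute)
 also have "... = (LB x. complex_of_real (1 / sqrt (2 * pi)) *
   (cis (- (x * t)) * complex_of_real (exp (- x\<^sup>2 / 2))))"
  by (rule Bochner_Integration.integral_cong)
    (auto simp: std_normal_density_def scaleR_conv_of_real field_simps)
 also have "... = complex_of_real (1 / sqrt (2 * pi)) *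
   (LB x. cis (- (x * t)) * complex_of_real (exp (- x\<^sup>2 / 2)))"
  by simp
 finally show ?thesis
  by (simp add: field_simps)
qed

text \<open>\<open>lborel\<close> is the image of a product of one-dimensional Lebesgue measures
  under the coordinate map, so product functions integrate factor by factor; Gaussians times
  exponentials are of this kind.\<close>

lemma lborel_complex_prod:
 fixes f :: "'a::euclidean_space => real => complex"
 assumes "\<And>b. b \<in> Basis ==> integrable lborel (f b)"
 shows "(LB x. (\<Prod>b\<in>Basis. f b (x \<bullet> b))) = (\<Prod>b\<in>Basis. LB t. f b t)"
  and "integrable lborel (\<lambda>x::'a. \<Prod>b\<in>Basis. f b (x \<bullet> b))"
proof -
 interpret product_sigma_finite "\<lambda>_::'a. lborel :: real measure" ..
 have [measurable]: "\<And>b. b \<in> Basis ==> f b \<in> borel_measurable borel"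
  using assms by (auto intro: borel_measurable_integrable_lborel)
 have m: "(\<lambda>x::'a. \<Prod>b\<in>Basis. f b (x \<bullet> b)) \<in> borel_measurable borel"
  by measurable
 have e: "(\<Prod>b\<in>Basis. f b ((\<Sum>b'\<in>Basis. g b' *\<^sub>R b') \<bullet> b)) = (\<Prod>b\<in>Basis. f b (g b))" for g :: "'a => real"
  by (intro prod.cong refl) simp
 show "(LB x. (\<Prod>b\<in>Basis. f b (x \<bullet> b))) = (\<Prod>b\<in>Basis. LB t. f b t)"
  using m assms by (subst lborel_eq) (simp add: integral_distr e product_integral_prod)
 have "integrable (Pi\<^sub>M Basis (\<lambda>_. lborel)) (\<lambda>g. \<Prod>b\<in>Basis. f b (g b))"
  by (intro product_integrable_prod assms) auto
 then show "integrable lborel (\<lambda>x::'a. \<Prod>b\<in>Basis. f b (x \<bullet> b))"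
  using m by (subst lborel_eq) (simp add: integrable_distr_eq e)
qed

lemma integrable_gauss: "integrable lborel (gauss :: 'a::euclidean_space => real)"
proof -
 have "integrable lborel (\<lambda>x::'a. \<Prod>b\<in>Basis. complex_of_real (exp (- (x \<bullet> b)\<^sup>2 / 2)))"
  by (rule lborel_complex_prod(2)) (rule gauss_1_integrable)
 then have "integrable lborel (\<lambda>x::'a. complex_of_real (gauss x))"
  by (simp add: gauss_prod)
 then show ?thesis
  by (simp only: complex_of_real_integrable_eq)
qed

lemma prod_cis: "finite A ==> (\<Prod>b\<in>A. cis (f b)) = cis (\<Sum>b\<in>A. f b)"
 by (induction A rule: finite_induct) (auto simp: cis_mult)

text \<open>This is \<open>(2 pi)^(n/2)\<close>; its square is the constant \<open>(2 pi)^n\<close>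
  of the inversion and Plancherel formulas and appears in that form below.\<close>

definition gauss_mass :: "'a::euclidean_space itself => real" where
 "gauss_mass _ = sqrt (2 * pi) ^ DIM('a)"

lemma gauss_mass_pos: "gauss_mass TYPE('a::euclidean_space) > 0"
 by (simp add: gauss_mass_def)

lemma ft_gauss:
 "ft (\<lambda>x. complex_of_real (gauss x)) \<xi> = complex_of_real (gauss_mass TYPE('a) * gauss (\<xi>::'a::euclidean_space))"
proof -
 have e: "cis (- (x \<bullet> \<xi>)) * complex_of_real (gauss x) =
   (\<Prod>b\<in>Basis. cis (- ((x \<bullet> b) * (\<xi> \<bullet> b))) * complex_of_real (exp (- (x \<bullet> b)\<^sup>2 / 2)))" for x
  by (simp add: gauss_prod prod.distrib prod_cis euclidean_inner[of x \<xi>] sum_negf)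
 have i: "integrable lborel (\<lambda>t. cis (- (t * (\<xi> \<bullet> b))) * complex_of_real (exp (- t\<^sup>2 / 2)))" for b
  by (rule Bochner_Integration.integrable_bound[OF gauss_1_integrable]) (auto simp: norm_mult)
 show ?thesis
  unfolding ft_def e
  by (subst lborel_complex_prod(1)[OF i])
    (simp only: ft_gauss_1 gauss_prod prod.distrib gauss_mass_def of_real_mult of_real_prod prod_constant of_real_power)
qed

lemma integral_gauss: "(LB x. gauss (x::'a::euclidean_space)) = gauss_mass TYPE('a)"
proof -
 have "complex_of_real (LB x. gauss (x::'a)) = ft (\<lambda>x. complex_of_real (gauss x)) (0::'a)"
  by (simp add: ft_def)
 also have "... = complex_of_real (gauss_mass TYPE('a))"
  by (simp only: ft_gauss) (simp add: gauss_def)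
 finally show ?thesis by simp
qed

lemma lborel_integral_scale:
 fixes f :: "'a::euclidean_space => 'b::{banach, second_countable_topology}"
 assumes "c \<noteq> 0" and [measurable]: "f \<in> borel_measurable borel"
 shows "(LB x. f x) = \<bar>c\<bar> ^ DIM('a) *\<^sub>R (LB x. f (t + c *\<^sub>R x))"
 by (subst lborel_affine[OF assms(1), of t], subst integral_density)
   (auto simp: integral_distr)

lemma lborel_integrable_scale:
 fixes f :: "'a::euclidean_space => 'b::{banach, second_countable_topology}"
 assumes "c \<noteq> 0" "integrable lborel f"
 shows "integrable lborel (\<lambda>x. f (t + c *\<^sub>R x))"
proof -
 have [measurable]: "f \<in> borel_measurable borel"
  using assms by (auto intro: borel_measurable_integrable_lborel)
 from assms(2) have "integrable (density (distr lborel borel (\<lambda>x. t + c *\<^sub>R x)) (\<lambda>_. \<bar>c\<bar>^DIM('a))) f"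
  by (subst (asm) lborel_affine[OF assms(1), of t])
 then have i: "integrable lborel (\<lambda>x. \<bar>c\<bar> ^ DIM('a) *\<^sub>R f (t + c *\<^sub>R x))"
  by (simp add: integrable_density integrable_distr_eq del: integrable_scaleR_right)
 have "integrable lborel (\<lambda>x. (1 / \<bar>c\<bar> ^ DIM('a)) *\<^sub>R (\<bar>c\<bar> ^ DIM('a) *\<^sub>R f (t + c *\<^sub>R x)))"
  by (rule integrable_scaleR_right) (rule i)
 moreover have "(\<lambda>x. (1 / \<bar>c\<bar> ^ DIM('a)) *\<^sub>R (\<bar>c\<bar> ^ DIM('a) *\<^sub>R f (t + c *\<^sub>R x))) = (\<lambda>x. f (t + c *\<^sub>R x))"
  using assms(1) by (auto simp: fun_eq_iff)
 ultimately show ?thesis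
  by (simp only:)
qed

lemma lborel_nn_integral_scale:
 fixes f :: "'a::euclidean_space => ennreal"
 assumes "c \<noteq> 0" and [measurable]: "f \<in> borel_measurable borel"
 shows "(NN x. f x) = ennreal (\<bar>c\<bar> ^ DIM('a)) * (NN x. f (t + c *\<^sub>R x))"
 using assms(1)
 by (subst lborel_affine[OF assms(1), of t], subst nn_integral_density)
   (auto simp: nn_integral_distr nn_integral_cmult simp del: ennreal_power)

lemma lborel_nn_integral_shift:
 fixes f :: "'a::euclidean_space => ennreal"
 assumes "f \<in> borel_measurable borel"
 shows "(NN x. f (t + x)) = (NN x. f x)"
  and "(NN x. f (t - x)) = (NN x. f x)"
 using lborel_nn_integral_scale[of 1 f t] lborel_nn_integral_scale[of "-1" f t] assms by simp_all

text \<open>The Fourier transform of \<open>x \<mapsto> gauss (a x)\<close>, an approximate identity as \<open>a \<rightarrow> 0\<close>.\<close>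

definition gker :: "real => 'a::euclidean_space => real" where
 "gker a z = gauss_mass TYPE('a) / a ^ DIM('a) * gauss (z /\<^sub>R a)"

lemma gker_nonneg: "a > 0 ==> gker a z \<ge> 0"
 using gauss_pos[of "z /\<^sub>R a"] gauss_mass_pos[where 'a='a] by (simp add: gker_def)

lemma gker_minus: "gker a (- z) = gker a z"
 by (simp add: gker_def gauss_def)

lemma gker_measurable [measurable]: "gker a \<in> borel_measurable borel"
 unfolding gker_def by measurable

lemma ft_gauss_scaled:
 assumes "a > 0"
 shows "ft (\<lambda>x. complex_of_real (gauss (a *\<^sub>R x))) \<xi> = complex_of_real (gker a (\<xi>::'a::euclidean_space))"
proof -
 have "ft (\<lambda>x. complex_of_real (gauss x)) (\<xi> /\<^sub>R a) =
   \<bar>a\<bar> ^ DIM('a) *\<^sub>R (LB x. cis (- ((0 + a *\<^sub>R x) \<bullet> (\<xi> /\<^sub>R a))) * complex_of_real (gauss (0 + a *\<^sub>R x)))"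
  unfolding ft_def using assms by (intro lborel_integral_scale) auto
 also have "... = a ^ DIM('a) *\<^sub>R ft (\<lambda>x. complex_of_real (gauss (a *\<^sub>R x))) \<xi>"
  using assms by (simp add: ft_def mult.assoc[symmetric])
 finally show ?thesis
  using assms by (simp add: ft_gauss gker_def scaleR_conv_of_real field_simps)
qed

lemma integrable_gauss_scaled:
 "a > 0 ==> integrable lborel (\<lambda>x::'a::euclidean_space. gauss (a *\<^sub>R x))"
 using lborel_integrable_scale[OF _ integrable_gauss, of a 0] by simp

lemma gker_scaled:
 assumes "a > 0"
 shows "a ^ DIM('a) * gker a (a *\<^sub>R z) = gauss_mass TYPE('a) * gauss (z::'a::euclidean_space)"
 using assms by (simp add: gker_def)

lemma nn_integral_gker:
 assumes "a > 0"
 shows "(NN z. ennreal (gker a (z::'a::euclidean_space))) = ennreal ((gauss_mass TYPE('a))\<^sup>2)"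
proof -
 have "(NN z. ennreal (gker a (z::'a))) =
   ennreal (a ^ DIM('a)) * (NN z. ennreal (gker a (0 + a *\<^sub>R z::'a)))"
  using assms by (subst lborel_nn_integral_scale[of a _ 0]) (auto simp del: ennreal_power)
 also have "... = (NN z. ennreal (a ^ DIM('a) * gker a (a *\<^sub>R z::'a)))"
  using assms by (subst nn_integral_cmult[symmetric]) (auto simp: ennreal_mult gker_nonneg)
 also have "... = (NN z. ennreal (gauss_mass TYPE('a) * gauss (z::'a)))"
  using assms by (simp only: gker_scaled)
 also have "... = ennreal (LB z. gauss_mass TYPE('a) * gauss (z::'a))"
  using gauss_mass_pos[where 'a='a] gauss_pos
  by (intro nn_integral_eq_integral integrable_mult_right integrable_gauss)
    (auto simp: less_imp_le intro!: AE_I2)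
 also have "... = ennreal ((gauss_mass TYPE('a))\<^sup>2)"
  by (simp add: integral_gauss power2_eq_square)
 finally show ?thesis .
qed

text \<open>Substituting \<open>y = x + a z\<close> turns the kernel into a fixed Gaussian and moves
  the dependence on \<open>a\<close> into the argument of \<open>f\<close>, where continuity at the
  single point \<open>x\<close> allows dominated convergence.\<close>

lemma gker_tendsto:
 fixes f :: "'a::euclidean_space => complex"
 assumes [measurable]: "f \<in> borel_measurable borel" and M: "\<And>x. norm (f x) \<le> M"
  and c: "isCont f x"
 shows "(\<lambda>n. LB y. f y * complex_of_real (gker (1 / real (Suc n)) (x - y)))
   \<longlonglongrightarrow> complex_of_real ((gauss_mass TYPE('a))\<^sup>2) * f x"
proof -
 let ?a = "\<lambda>n. 1 / real (Suc n)"
 have eq: "(LB y. f y * complex_of_real (gker (?a n) (x - y))) =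
   (LB z. f (x + ?a n *\<^sub>R z) * complex_of_real (gauss_mass TYPE('a) * gauss z))" for n
 proof -
  have "(LB y. f y * complex_of_real (gker (?a n) (x - y))) =
   \<bar>?a n\<bar> ^ DIM('a) *\<^sub>R (LB z. f (x + ?a n *\<^sub>R z) * complex_of_real (gker (?a n) (x - (x + ?a n *\<^sub>R z))))"
   by (rule lborel_integral_scale) auto
  also have "... = (LB z. (?a n ^ DIM('a)) *\<^sub>R (f (x + ?a n *\<^sub>R z) * complex_of_real (gker (?a n) (?a n *\<^sub>R z))))"
   by (subst integral_scaleR_right) (auto simp: gker_minus[symmetric, of _ "_ *\<^sub>R _"])
  also have "... = (LB z. f (x + ?a n *\<^sub>R z) * complex_of_real (?a n ^ DIM('a) * gker (?a n) (?a n *\<^sub>R z)))"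
   by (simp add: scaleR_conv_of_real mult_ac)
  finally show ?thesis by (simp add: gker_scaled del: of_nat_Suc)
 qed
 have "(\<lambda>n. LB z. f (x + ?a n *\<^sub>R z) * complex_of_real (gauss_mass TYPE('a) * gauss z))
   \<longlonglongrightarrow> (LB z. f x * complex_of_real (gauss_mass TYPE('a) * gauss (z::'a)))"
 proof (rule integral_dominated_convergence)
  show "integrable lborel (\<lambda>z. M * (gauss_mass TYPE('a) * gauss (z::'a)))"
   by (intro integrable_mult_right integrable_gauss)
  show "AE z in lborel. (\<lambda>n. f (x + ?a n *\<^sub>R z) * complex_of_real (gauss_mass TYPE('a) * gauss z))
    \<longlonglongrightarrow> f x * complex_of_real (gauss_mass TYPE('a) * gauss (z::'a))"
  proof (intro AE_I2 tendsto_mult tendsto_const)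
   fix z :: 'a
   have "(\<lambda>n. x + ?a n *\<^sub>R z) \<longlonglongrightarrow> x + 0 *\<^sub>R z"
    by (intro tendsto_intros LIMSEQ_Suc[OF lim_1_over_n])
   then show "(\<lambda>n. f (x + ?a n *\<^sub>R z)) \<longlonglongrightarrow> f x"
    using isCont_tendsto_compose[OF c] by simp
  qed
  show "AE z in lborel. norm (f (x + ?a n *\<^sub>R z) * complex_of_real (gauss_mass TYPE('a) * gauss z))
    \<le> M * (gauss_mass TYPE('a) * gauss (z::'a))" for n
   using M gauss_pos gauss_mass_pos[where 'a='a]
   by (intro AE_I2) (auto simp: norm_mult abs_mult abs_of_pos simp del: of_nat_Suc
     intro!: mult_right_mono)
 qed auto
 also have "(LB z. f x * complex_of_real (gauss_mass TYPE('a) * gauss (z::'a))) =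
   complex_of_real ((gauss_mass TYPE('a))\<^sup>2) * f x"
  using integral_gauss[where 'a='a] by (simp add: power2_eq_square)
 finally show ?thesis
  by (simp only: eq)
qed


lemma cis_norm_mult [simp]: "norm (cis t * z) = norm z" "norm (z * cis t) = norm z"
 by (simp_all add: norm_mult)

lemma integrable_cis_mult:
 fixes f :: "'a::euclidean_space => complex"
 assumes "integrable lborel f" and [measurable]: "g \<in> borel_measurable borel"
 shows "integrable lborel (\<lambda>x. cis (g x) * f x)"
proof -
 have [measurable]: "f \<in> borel_measurable borel"
  using assms(1) by (rule borel_measurable_integrable_lborel)
 show ?thesis
  by (rule Bochner_Integration.integrable_bound[OF assms(1)]) auto
qed

lemma norm_ft_le: "norm (ft f \<xi>) \<le> (LB x. norm (f x))"
 unfolding ft_def by (rule order_trans[OF integral_norm_bound]) simp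

lemma continuous_on_ft:
 assumes f: "integrable lborel (f :: 'a::euclidean_space => complex)"
 shows "continuous_on UNIV (ft f)"
proof (rule continuous_at_imp_continuous_on, rule ballI)
 fix \<xi> :: 'a
 have [measurable]: "f \<in> borel_measurable borel"
  using assms(1) by (rule borel_measurable_integrable_lborel)
 show "isCont (ft f) \<xi>"
  unfolding continuous_at_sequentially
 proof (intro allI impI)
  fix u :: "nat => 'a" assume u: "u \<longlonglongrightarrow> \<xi>"
  show "(ft f \<circ> u) \<longlonglongrightarrow> ft f \<xi>"
   unfolding comp_def ft_def
   by (rule integral_dominated_convergence[where w="\<lambda>x. norm (f x)"])
     (use f u in \<open>auto intro!: tendsto_intros AE_I2\<close>)
 qed
qed

lemma ft_measurable [measurable]: "integrable lborel f ==> ft f \<in> borel_measurable borel"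
 using continuous_on_ft borel_measurable_continuous_onI by blast

section \<open>Duality, inversion and the Bessel inequality\<close>

lemma integrable_mult_bounded:
 fixes f g :: "'a::euclidean_space => complex"
 assumes "integrable lborel f" "g \<in> borel_measurable borel" "\<And>x. norm (g x) \<le> M"
 shows "integrable lborel (\<lambda>x. g x * f x)"
proof (rule Bochner_Integration.integrable_bound)
 show "integrable lborel (\<lambda>x. M *\<^sub>R f x)" using assms(1) by auto
 show "(\<lambda>x. g x * f x) \<in> borel_measurable lborel"
  using assms(2) borel_measurable_integrable_lborel[OF assms(1)] by measurable
 have "norm (g x) \<le> \<bar>M\<bar>" for x using assms(3)[of x] by linarith
 then show "AE x in lborel. norm (g x * f x) \<le> norm (M *\<^sub>R f x)"
  by (intro AE_I2) (auto simp: norm_mult intro!: mult_right_mono)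
qed

lemma integrable_pair_bounded:
 fixes f :: "'a::euclidean_space => complex" and k :: "'b::euclidean_space => complex"
 assumes f: "integrable lborel f" and k: "integrable lborel k"
  and [measurable]: "h \<in> borel_measurable (borel \<Otimes>\<^sub>M borel)" and h: "\<And>x y. norm (h (x, y)) \<le> M"
 shows "integrable (lborel \<Otimes>\<^sub>M lborel) (\<lambda>(x, y). h (x, y) * (f x * k y))"
proof -
 have [measurable]: "f \<in> borel_measurable borel" "k \<in> borel_measurable borel"
  using assms by (auto intro: borel_measurable_integrable_lborel)
 have "integrable (lborel \<Otimes>\<^sub>M lborel) (\<lambda>(x, y). f x * k y)"
 proof (rule lborel_pair.Fubini_integrable)
  show "(\<lambda>(x, y). f x * k y) \<in> borel_measurable (lborel \<Otimes>\<^sub>M lborel)" by measurable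
  show "integrable lborel (\<lambda>x. LB y. norm (case (x, y) of (x, y) => f x * k y))"
   using f by (simp add: norm_mult)
  show "AE x in lborel. integrable lborel (\<lambda>y. case (x, y) of (x, y) => f x * k y)"
   using k by simp
 qed
 then have "integrable (lborel \<Otimes>\<^sub>M lborel) (\<lambda>z. M *\<^sub>R (case z of (x, y) => f x * k y))"
  by auto
 moreover have "(\<lambda>(x, y). h (x, y) * (f x * k y)) \<in> borel_measurable (lborel \<Otimes>\<^sub>M lborel)"
  by measurable
 moreover have "norm (h (x, y)) \<le> \<bar>M\<bar>" for x y using h[of x y] by linarith
 ultimately show ?thesis
  by (elim Bochner_Integration.integrable_bound) (auto simp: norm_mult intro!: mult_right_mono AE_I2)
qed

text \<open>Fubini for a bounded kernel. Inversion, the product formula and the \<open>L^2\<close>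
  bound below all come from suitable choices of \<open>k\<close>.\<close>

lemma ft_duality:
 fixes f k :: "'a::euclidean_space => complex"
 assumes f: "integrable lborel f" and k: "integrable lborel k"
 shows "(LB \<xi>. ft f \<xi> * k \<xi>) = (LB x. f x * ft k x)"
proof -
 have "integrable (lborel \<Otimes>\<^sub>M lborel) (\<lambda>(x, y). (\<lambda>(x, y). cis (- (x \<bullet> y))) (x, y) * (f x * k y))"
  by (rule integrable_pair_bounded[OF f k, where M=1]) auto
 then have i: "integrable (lborel \<Otimes>\<^sub>M lborel) (\<lambda>(x, y). cis (- (x \<bullet> y)) * (f x * k y))"
  by simp
 have "(LB \<xi>. ft f \<xi> * k \<xi>) = (LB y. LB x. cis (- (x \<bullet> y)) * (f x * k y))"
  unfolding ft_def by (subst integral_mult_left_zero[symmetric]) (simp add: mult.assoc)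
 also have "... = (LB x. LB y. cis (- (x \<bullet> y)) * (f x * k y))"
  by (rule lborel_pair.Fubini_integral[OF i])
 also have "... = (LB x. f x * ft k x)"
  unfolding ft_def by (subst integral_mult_right_zero[symmetric]) (simp add: mult_ac inner_commute)
 finally show ?thesis .
qed

lemma integrable_mod_gauss:
 "a > 0 ==> integrable lborel (\<lambda>\<xi>. cis (x \<bullet> \<xi>) * complex_of_real (gauss (a *\<^sub>R \<xi>)))"
 by (intro integrable_cis_mult) (auto simp: integrable_gauss_scaled)

text \<open>Modulation on one side is translation on the other; pairing with these functions
  evaluates Gaussian means at the point \<open>x\<close>.\<close>

lemma ft_mod_gauss:
 assumes "a > 0"
 shows "ft (\<lambda>\<xi>. cis (x \<bullet> \<xi>) * complex_of_real (gauss (a *\<^sub>R \<xi>))) y = complex_of_real (gker a (x - y))"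
proof -
 have "ft (\<lambda>\<xi>. cis (x \<bullet> \<xi>) * complex_of_real (gauss (a *\<^sub>R \<xi>))) y =
   ft (\<lambda>\<xi>. complex_of_real (gauss (a *\<^sub>R \<xi>))) (y - x)"
  unfolding ft_def
  by (intro Bochner_Integration.integral_cong refl)
    (simp add: mult.assoc[symmetric] cis_mult inner_diff_right inner_commute)
 then show ?thesis
  using assms gker_minus[of a "x - y"] by (simp add: ft_gauss_scaled)
qed

lemma ft_gauss_inverse:
 fixes f :: "'a::euclidean_space => complex"
 assumes "integrable lborel f" "a > 0"
 shows "(LB \<xi>. ft f \<xi> * (cis (x \<bullet> \<xi>) * complex_of_real (gauss (a *\<^sub>R \<xi>)))) =
   (LB y. f y * complex_of_real (gker a (x - y)))"
 using assms by (simp add: ft_duality integrable_mod_gauss ft_mod_gauss)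

lemma ft_cnj: "cnj (ft f \<xi>) = ft (\<lambda>x. cnj (f x)) (- \<xi>)"
 unfolding ft_def by (subst Bochner_Integration.integral_cnj[symmetric]) (simp add: cis_cnj)

lemma nn_integral_limit_le:
 fixes u :: "nat => 'a => ennreal"
 assumes "\<And>n. u n \<in> borel_measurable M" "\<And>x. (\<lambda>n. u n x) \<longlonglongrightarrow> v x"
  and "\<And>n. (\<integral>\<^sup>+x. u n x \<partial>M) \<le> C"
 shows "(\<integral>\<^sup>+x. v x \<partial>M) \<le> C"
proof -
 have "v x = liminf (\<lambda>n. u n x)" for x
  using lim_imp_Liminf[OF _ assms(2)] by simp
 then have "(\<integral>\<^sup>+x. v x \<partial>M) \<le> liminf (\<lambda>n. \<integral>\<^sup>+x. u n x \<partial>M)"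
  using nn_integral_liminf[of u M] assms(1) by simp
 also have "... \<le> C"
  using Liminf_mono[of "\<lambda>n. \<integral>\<^sup>+x. u n x \<partial>M" "\<lambda>_. C" sequentially] assms(3) by (simp add: Liminf_const)
 finally show ?thesis .
qed

lemma gauss_scaled_tendsto: "(\<lambda>n. gauss ((1 / real (Suc n)) *\<^sub>R x)) \<longlonglongrightarrow> 1"
proof -
 have "(\<lambda>n. gauss ((1 / real (Suc n)) *\<^sub>R x)) \<longlonglongrightarrow> exp (- ((norm (0 *\<^sub>R x))\<^sup>2 / 2))"
  unfolding gauss_def by (intro tendsto_intros LIMSEQ_Suc[OF lim_1_over_n]) auto
 then show ?thesis by simp
qed

text \<open>Take for \<open>k\<close> the conjugate of \<open>ft f\<close> times a Gaussian: duality
  turns the left side into the integral of \<open>f\<close> against \<open>ft k\<close>, and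
  \<open>ft k\<close> is \<open>cnj f\<close> averaged by \<open>gker\<close>. The inequality
  \<open>2 x y \<le> x\<^sup>2 + y\<^sup>2\<close> and the equal mass of \<open>gker\<close> in both
  variables then give the bound, whether or not the right side is finite.\<close>

lemma bessel_gauss:
 fixes f :: "'a::euclidean_space => complex"
 assumes f: "integrable lborel f" and a: "a > 0"
 shows "(NN \<xi>. ennreal ((norm (ft f \<xi>))\<^sup>2 * gauss (a *\<^sub>R \<xi>)))
   \<le> ennreal ((gauss_mass TYPE('a))\<^sup>2) * (NN x. ennreal ((norm (f x))\<^sup>2))"
proof -
 have [measurable]: "f \<in> borel_measurable borel"
  using assms(1) by (rule borel_measurable_integrable_lborel)
 have [measurable]: "ft f \<in> borel_measurable borel" using f by measurable
 have fc: "integrable lborel (\<lambda>x. cnj (f x))" using f by simp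
 define k where "k \<xi> = cnj (ft f \<xi>) * complex_of_real (gauss (a *\<^sub>R \<xi>))" for \<xi>
 have k: "integrable lborel k"
  unfolding k_def
  by (rule integrable_mult_bounded[where M="LB x. norm (f x)"])
    (use a integrable_gauss_scaled[of a] norm_ft_le[of f] in \<open>auto\<close>)
 have ftk: "ft k x = (LB y. cnj (f y) * complex_of_real (gker a (x - y)))" for x
 proof -
  have m: "(\<lambda>\<xi>. cis (- (x \<bullet> \<xi>)) * k \<xi>) \<in> borel_measurable borel"
   unfolding k_def by measurable
  have "ft k x = (LB \<xi>. cis (- (x \<bullet> \<xi>)) * k \<xi>)"
   by (simp add: ft_def inner_commute)
  also have "... = (LB \<xi>. cis (x \<bullet> \<xi>) * k (- \<xi>))"
   by (subst lborel_integral_scale[of "-1" _ 0, OF _ m]) auto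
  also have "... = (LB \<xi>. ft (\<lambda>x. cnj (f x)) \<xi> * (cis (x \<bullet> \<xi>) * complex_of_real (gauss (a *\<^sub>R \<xi>))))"
   by (simp add: k_def ft_cnj mult_ac gauss_def)
  finally show ?thesis by (simp add: ft_gauss_inverse[OF fc a])
 qed
 have nk: "ennreal (norm (ft k x)) \<le> (NN y. ennreal (norm (f y) * gker a (x - y)))" for x
 proof -
  have "integrable lborel (\<lambda>y. complex_of_real (gker a (x - y)) * cnj (f y))"
   by (rule integrable_mult_bounded[OF fc, where M="gauss_mass TYPE('a) / a ^ DIM('a)"])
     (use a gauss_mass_pos[where 'a='a] gauss_le_1 gauss_pos in
      \<open>auto simp: gker_def norm_mult norm_divide norm_power intro!: divide_right_mono mult_left_le\<close>)
  then have "ennreal (norm (ft k x)) \<le> (NN y. ennreal (norm (cnj (f y) * complex_of_real (gker a (x - y)))))"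
   unfolding ftk by (intro integral_norm_bound_ennreal) (simp add: mult.commute)
  then show ?thesis using a by (simp add: norm_mult gker_nonneg)
 qed
 have g1: "(NN y. ennreal (gker a (x - y))) = ennreal ((gauss_mass TYPE('a))\<^sup>2)" for x :: 'a
  by (subst lborel_nn_integral_shift(2)[of "\<lambda>y. ennreal (gker a y)"]) (use a nn_integral_gker in auto)
 have g2: "(NN x. ennreal (gker a (x - y))) = ennreal ((gauss_mass TYPE('a))\<^sup>2)" for y :: 'a
  using lborel_nn_integral_shift(1)[of "\<lambda>y. ennreal (gker a y)" "- y"] a nn_integral_gker by simp
 let ?A = "\<lambda>x. ennreal ((norm (f x))\<^sup>2 / 2)"
 have "(NN \<xi>. ennreal ((norm (ft f \<xi>))\<^sup>2 * gauss (a *\<^sub>R \<xi>))) =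
  (NN \<xi>. ennreal (norm (ft f \<xi> * k \<xi>)))"
  using gauss_pos by (intro nn_integral_cong) (simp add: k_def norm_mult power2_eq_square abs_of_pos)
 also have "... = ennreal (LB \<xi>. norm (ft f \<xi> * k \<xi>))"
  by (intro nn_integral_eq_integral integrable_norm integrable_mult_bounded[OF k, of "ft f"])
    (auto intro: norm_ft_le)
 \<comment> \<open>The product is a nonnegative real, so nothing is lost in passing to real
   parts.\<close>
 also have "(LB \<xi>. norm (ft f \<xi> * k \<xi>)) = (LB \<xi>. Re (ft f \<xi> * k \<xi>))"
 proof (rule Bochner_Integration.integral_cong[OF refl])
  fix \<xi>
  have "ft f \<xi> * k \<xi> = complex_of_real ((norm (ft f \<xi>))\<^sup>2 * gauss (a *\<^sub>R \<xi>))"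
   by (simp add: k_def mult.assoc[symmetric] complex_norm_square[symmetric] del: of_real_power)
  then show "norm (ft f \<xi> * k \<xi>) = Re (ft f \<xi> * k \<xi>)"
   by (simp only: norm_of_real Re_complex_of_real abs_mult gauss_nonneg abs_power2)
 qed
 also have "... = Re (LB \<xi>. ft f \<xi> * k \<xi>)"
  by (intro integral_Re integrable_mult_bounded[OF k, of "ft f"]) (auto intro: norm_ft_le)
 also have "... = Re (LB x. f x * ft k x)"
  by (simp add: ft_duality[OF f k])
 also have "ennreal ... \<le> ennreal (norm (LB x. f x * ft k x))"
  by (intro ennreal_leI complex_Re_le_cmod)
 also have "... \<le> (NN x. ennreal (norm (f x * ft k x)))"
 proof (rule integral_norm_bound_ennreal)
  have "integrable lborel (\<lambda>x. ft k x * f x)"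
   by (rule integrable_mult_bounded[OF f _ norm_ft_le]) (use k in measurable)
  then show "integrable lborel (\<lambda>x. f x * ft k x)" by (simp add: mult.commute)
 qed
 also have "... \<le> (NN x. ennreal (norm (f x)) * (NN y. ennreal (norm (f y) * gker a (x - y))))"
  by (intro nn_integral_mono) (auto simp: norm_mult ennreal_mult intro!: mult_left_mono nk)
 also have "... = (NN x. \<integral>\<^sup>+y. ennreal (norm (f x) * norm (f y) * gker a (x - y)) \<partial>lborel)"
  using a by (simp add: nn_integral_cmult[symmetric] ennreal_mult gker_nonneg mult.assoc)
 also have "... \<le> (NN x. \<integral>\<^sup>+y. ?A x * ennreal (gker a (x - y)) + ?A y * ennreal (gker a (x - y)) \<partial>lborel)"
 proof (intro nn_integral_mono)
  fix x y
  have "norm (f x) * norm (f y) \<le> (norm (f x))\<^sup>2 / 2 + (norm (f y))\<^sup>2 / 2"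
   using sum_squares_bound[of "norm (f x)" "norm (f y)"] by simp
  then have "norm (f x) * norm (f y) * gker a (x - y) \<le>
   (norm (f x))\<^sup>2 / 2 * gker a (x - y) + (norm (f y))\<^sup>2 / 2 * gker a (x - y)"
   using gker_nonneg[OF a, of "x - y"] by (metis distrib_right mult_right_mono)
  then show "ennreal (norm (f x) * norm (f y) * gker a (x - y)) \<le> ?A x * ennreal (gker a (x - y)) + ?A y * ennreal (gker a (x - y))"
   using gker_nonneg[OF a, of "x - y"]
   by (auto simp: ennreal_mult[symmetric] ennreal_plus[symmetric] simp del: ennreal_plus intro!: ennreal_leI)
 qed
 also have "... = (NN x. \<integral>\<^sup>+y. ?A x * ennreal (gker a (x - y)) \<partial>lborel) +
   (NN x. \<integral>\<^sup>+y. ?A y * ennreal (gker a (x - y)) \<partial>lborel)"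
  by (subst nn_integral_add[symmetric]) (auto simp: nn_integral_add)
 also have "(NN x. \<integral>\<^sup>+y. ?A y * ennreal (gker a (x - y)) \<partial>lborel) =
  (NN y. \<integral>\<^sup>+x. ?A y * ennreal (gker a (x - y)) \<partial>lborel)"
  by (rule lborel_pair.Fubini') measurable
 also have "... = (NN y. ?A y) * ennreal ((gauss_mass TYPE('a))\<^sup>2)"
  by (simp add: nn_integral_cmult g2 nn_integral_multc)
 also have "(NN x. \<integral>\<^sup>+y. ?A x * ennreal (gker a (x - y)) \<partial>lborel) = (NN y. ?A y) * ennreal ((gauss_mass TYPE('a))\<^sup>2)"
  by (simp add: nn_integral_cmult g1 nn_integral_multc)
 also have "(NN y. ?A y) * ennreal ((gauss_mass TYPE('a))\<^sup>2) + (NN y. ?A y) * ennreal ((gauss_mass TYPE('a))\<^sup>2)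
  = ennreal ((gauss_mass TYPE('a))\<^sup>2) * (NN x. ?A x + ?A x)"
  by (subst nn_integral_add) (auto simp: algebra_simps)
 also have "(NN x. ?A x + ?A x) = (NN x. ennreal ((norm (f x))\<^sup>2))"
  by (simp add: ennreal_plus[symmetric] del: ennreal_plus)
 finally show ?thesis .
qed

text \<open>Fatou as the Gaussian damping of \<open>bessel_gauss\<close> tends to one.\<close>

theorem bessel_ft:
 fixes f :: "'a::euclidean_space => complex"
 assumes f: "integrable lborel f"
 shows "(NN \<xi>. ennreal ((norm (ft f \<xi>))\<^sup>2))
   \<le> ennreal ((gauss_mass TYPE('a))\<^sup>2) * (NN x. ennreal ((norm (f x))\<^sup>2))"
proof (rule nn_integral_limit_le)
 have [measurable]: "ft f \<in> borel_measurable borel" using f by measurable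
 show "(\<lambda>\<xi>. ennreal ((norm (ft f \<xi>))\<^sup>2 * gauss ((1 / real (Suc n)) *\<^sub>R \<xi>))) \<in> borel_measurable lborel" for n
  by measurable
 show "(\<lambda>n. ennreal ((norm (ft f \<xi>))\<^sup>2 * gauss ((1 / real (Suc n)) *\<^sub>R \<xi>))) \<longlonglongrightarrow> ennreal ((norm (ft f \<xi>))\<^sup>2)" for \<xi>
  using tendsto_mult[OF tendsto_const gauss_scaled_tendsto, of "(norm (ft f \<xi>))\<^sup>2"]
  by (intro tendsto_ennrealI) simp
qed (intro bessel_gauss f, simp)

text \<open>Stated at one point of continuity, because the two-variable transform is later known to
  be continuous only along a generic direction. The damped integrals converge to the left side by
  dominated convergence and to the right side as an approximate identity.\<close>

theorem ft_inversion:
 fixes f :: "'a::euclidean_space => complex"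
 assumes f: "integrable lborel f" and M: "\<And>x. norm (f x) \<le> M" and c: "isCont f x"
  and ff: "integrable lborel (ft f)"
 shows "(LB \<xi>. ft f \<xi> * cis (x \<bullet> \<xi>)) = complex_of_real ((gauss_mass TYPE('a))\<^sup>2) * f x"
proof -
 have [measurable]: "f \<in> borel_measurable borel"
  using assms(1) by (rule borel_measurable_integrable_lborel)
 have [measurable]: "ft f \<in> borel_measurable borel" using f by measurable
 let ?a = "\<lambda>n. 1 / real (Suc n)"
 have "(\<lambda>n. LB \<xi>. ft f \<xi> * (cis (x \<bullet> \<xi>) * complex_of_real (gauss (?a n *\<^sub>R \<xi>))))
   \<longlonglongrightarrow> (LB \<xi>. ft f \<xi> * cis (x \<bullet> \<xi>))"
 proof (rule integral_dominated_convergence)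
  show "integrable lborel (\<lambda>\<xi>. norm (ft f \<xi>))" using ff by simp
  show "AE \<xi> in lborel. (\<lambda>n. ft f \<xi> * (cis (x \<bullet> \<xi>) * complex_of_real (gauss (?a n *\<^sub>R \<xi>)))) \<longlonglongrightarrow> ft f \<xi> * cis (x \<bullet> \<xi>)"
  proof (rule AE_I2)
   fix \<xi> :: 'a
   have "(\<lambda>n. ft f \<xi> * (cis (x \<bullet> \<xi>) * complex_of_real (gauss (?a n *\<^sub>R \<xi>)))) \<longlonglongrightarrow> ft f \<xi> * (cis (x \<bullet> \<xi>) * complex_of_real 1)"
    by (intro tendsto_mult tendsto_const tendsto_of_real gauss_scaled_tendsto)
   then show "(\<lambda>n. ft f \<xi> * (cis (x \<bullet> \<xi>) * complex_of_real (gauss (?a n *\<^sub>R \<xi>)))) \<longlonglongrightarrow> ft f \<xi> * cis (x \<bullet> \<xi>)"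
    by simp
  qed
  show "AE \<xi> in lborel. norm (ft f \<xi> * (cis (x \<bullet> \<xi>) * complex_of_real (gauss (?a n *\<^sub>R \<xi>)))) \<le> norm (ft f \<xi>)" for n
   using gauss_le_1 gauss_pos
   by (intro AE_I2) (auto simp: norm_mult intro!: mult_left_le simp del: of_nat_Suc)
 qed auto
 moreover have "(\<lambda>n. LB y. f y * complex_of_real (gker (?a n) (x - y)))
   \<longlonglongrightarrow> complex_of_real ((gauss_mass TYPE('a))\<^sup>2) * f x"
  by (rule gker_tendsto[OF _ M c]) auto
 ultimately show ?thesis
  by (simp add: ft_gauss_inverse[OF f] LIMSEQ_unique)
qed

text \<open>Duality with \<open>k\<close> the reflected translate of \<open>ft g\<close>: by
  inversion the transform of \<open>k\<close> is a modulation of \<open>g\<close>, up to the factor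
  \<open>(2 pi)^n\<close>.\<close>

theorem ft_mult:
 fixes f g :: "'a::euclidean_space => complex"
 assumes g: "integrable lborel g" "\<And>x. norm (g x) \<le> M" "\<And>x. isCont g x" "integrable lborel (ft g)"
  and f: "integrable lborel f"
 shows "complex_of_real ((gauss_mass TYPE('a))\<^sup>2) * ft (\<lambda>x. g x * f x) \<xi> =
   (LB \<tau>. ft g (\<xi> - \<tau>) * ft f \<tau>)"
proof -
 have [measurable]: "ft g \<in> borel_measurable borel" using g by measurable
 define k where "k \<tau> = ft g (\<xi> - \<tau>)" for \<tau>
 have k: "integrable lborel k"
  using lborel_integrable_scale[OF _ g(4), of "-1" \<xi>] by (simp add: k_def[abs_def])
 have ftk: "ft k x = complex_of_real ((gauss_mass TYPE('a))\<^sup>2) * (cis (- (x \<bullet> \<xi>)) * g x)" for x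
 proof -
  have [measurable]: "k \<in> borel_measurable borel"
   using k by (rule borel_measurable_integrable_lborel)
  have "ft k x = (LB \<tau>. cis (- ((\<xi> - \<tau>) \<bullet> x)) * k (\<xi> - \<tau>))"
   unfolding ft_def by (subst lborel_integral_scale[of "-1" _ \<xi>]) auto
  also have "... = (LB \<tau>. cis (- (\<xi> \<bullet> x)) * (ft g \<tau> * cis (x \<bullet> \<tau>)))"
   by (intro Bochner_Integration.integral_cong refl)
     (simp add: k_def inner_diff_left inner_diff_right inner_commute mult_ac cis_mult)
  also have "... = cis (- (\<xi> \<bullet> x)) * (complex_of_real ((gauss_mass TYPE('a))\<^sup>2) * g x)"
   by (simp add: ft_inversion[OF g(1,2,3,4)])
  finally show ?thesis by (simp add: inner_commute mult_ac)
 qed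
 have "(LB \<tau>. ft g (\<xi> - \<tau>) * ft f \<tau>) = (LB \<tau>. ft f \<tau> * k \<tau>)"
  by (simp add: k_def mult.commute)
 also have "... = (LB x. f x * ft k x)"
  by (rule ft_duality[OF f k])
 also have "... = (LB x. complex_of_real ((gauss_mass TYPE('a))\<^sup>2) * (cis (- (x \<bullet> \<xi>)) * (g x * f x)))"
  by (simp add: ftk mult_ac)
 finally show ?thesis by (simp add: ft_def)
qed

section \<open>Smooth functions and cutoffs\<close>

text \<open>Smoothness quantifies over all lists of directions. It is shown by placing the function
  in a family of differentiable functions closed under directional derivatives; such a family is
  typically the algebra generated by a few functions.\<close>

inductive_set alg :: "('a::real_normed_vector => complex) set => ('a => complex) set"
 for B where
 base: "f \<in> B ==> f \<in> alg B"
| const: "(\<lambda>_. c) \<in> alg B"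
| add: "f \<in> alg B ==> g \<in> alg B ==> (\<lambda>x. f x + g x) \<in> alg B"
| mult: "f \<in> alg B ==> g \<in> alg B ==> (\<lambda>x. f x * g x) \<in> alg B"

definition deriv_closed :: "('a::real_normed_vector => 'b::real_normed_vector) set => bool" where
 "deriv_closed F \<longleftrightarrow> (\<forall>f\<in>F. (\<forall>x. f differentiable (at x)) \<and>
   (\<forall>v. (\<lambda>x. frechet_derivative f (at x) v) \<in> F))"

lemma frechet_derivative_eqI: "(f has_derivative f') (at x) ==> frechet_derivative f (at x) = f'"
 using frechet_derivative_at by metis

lemma alg_deriv_closed:
 assumes B: "\<And>f v. f \<in> B ==> (\<forall>x. f differentiable (at x)) \<and> (\<lambda>x. frechet_derivative f (at x) v) \<in> alg B"
 shows "deriv_closed (alg B)"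
proof -
 have "(\<forall>x. f differentiable (at x)) \<and> (\<forall>v. (\<lambda>x. frechet_derivative f (at x) v) \<in> alg B)" if "f \<in> alg B" for f
  using that
 proof induction
  case (base f)
  then show ?case using B by auto
 next
  case (const c)
  then show ?case by (auto intro: alg.const)
 next
  case (add f g)
  have "frechet_derivative (\<lambda>x. f x + g x) (at x) =
    (\<lambda>v. frechet_derivative f (at x) v + frechet_derivative g (at x) v)" for x
   using add by (intro frechet_derivative_eqI derivative_intros) (auto simp: frechet_derivative_works)
  then show ?case using add by (auto intro: alg.add)
 next
  case (mult f g)
  have "frechet_derivative (\<lambda>x. f x * g x) (at x) =
    (\<lambda>v. f x * frechet_derivative g (at x) v + frechet_derivative f (at x) v * g x)" for x
   using mult by (intro frechet_derivative_eqI has_derivative_mult) (auto simp: frechet_derivative_works)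
  then show ?case using mult by (auto intro!: alg.add alg.mult)
 qed
 then show ?thesis by (auto simp: deriv_closed_def)
qed

lemma deriv_closed_iter_deriv: "deriv_closed F ==> f \<in> F ==> iter_deriv vs f \<in> F"
 by (induction vs) (auto simp: deriv_closed_def)

lemma deriv_closed_smooth: "deriv_closed F ==> f \<in> F ==> smooth_on UNIV f"
 using deriv_closed_iter_deriv unfolding deriv_closed_def smooth_on_def by blast

lemma iter_deriv_append: "iter_deriv ws (iter_deriv vs f) = iter_deriv (ws @ vs) f"
 by (induction ws) auto

lemma smooth_on_differentiable: "smooth_on S f ==> x \<in> S ==> f differentiable (at x)"
 unfolding smooth_on_def by (metis iter_deriv.simps(1))

lemma smooth_on_iter_deriv: "smooth_on S f ==> smooth_on S (iter_deriv vs f)"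
 unfolding smooth_on_def iter_deriv_append by blast

lemma smooth_on_deriv: "smooth_on S f ==> smooth_on S (\<lambda>x. frechet_derivative f (at x) v)"
 using smooth_on_iter_deriv[of S f "[v]"] by simp

lemma smooth_on_isCont: "smooth_on S f ==> x \<in> S ==> isCont f x"
 by (meson differentiable_imp_continuous_within smooth_on_differentiable)

lemma smooth_on_continuous_on: "smooth_on S f ==> continuous_on S f"
 by (simp add: continuous_at_imp_continuous_on smooth_on_isCont)

lemma smooth_deriv_closed:
 assumes "smooth_on UNIV f"
 shows "deriv_closed (range (\<lambda>vs. iter_deriv vs f))"
 unfolding deriv_closed_def
proof (safe)
 fix vs v
 have "(\<lambda>x. frechet_derivative (iter_deriv vs f) (at x) v) = iter_deriv (v # vs) f" by simp
 then show "(\<lambda>x. frechet_derivative (iter_deriv vs f) (at x) v) \<in> range (\<lambda>vs. iter_deriv vs f)"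
  by blast
qed (use assms in \<open>auto simp: smooth_on_def\<close>)

text \<open>The algebra generated by all iterated derivatives of both factors is closed under
  derivatives, which replaces a Leibniz formula for lists of directions.\<close>

lemma smooth_on_mult:
 fixes f g :: "'a::euclidean_space => complex"
 assumes "smooth_on UNIV f" "smooth_on UNIV g"
 shows "smooth_on UNIV (\<lambda>x. f x * g x)"
proof -
 let ?B = "range (\<lambda>vs. iter_deriv vs f) \<union> range (\<lambda>vs. iter_deriv vs g)"
 have "deriv_closed (alg ?B)"
  using smooth_deriv_closed[OF assms(1)] smooth_deriv_closed[OF assms(2)]
  by (intro alg_deriv_closed) (auto simp: deriv_closed_def intro!: alg.base)
 moreover have "f \<in> alg ?B" "g \<in> alg ?B"
  by (metis alg.base UnI1 rangeI iter_deriv.simps(1), metis alg.base UnI2 rangeI iter_deriv.simps(1))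
 ultimately show ?thesis
  using deriv_closed_smooth alg.mult by blast
qed

lemma smooth_on_cnj:
 fixes f :: "'a::euclidean_space => complex"
 assumes "smooth_on UNIV f"
 shows "smooth_on UNIV (\<lambda>x. cnj (f x))"
proof -
 let ?F = "(\<lambda>g x. cnj (g x)) ` range (\<lambda>vs. iter_deriv vs f)"
 have d: "((\<lambda>x. cnj (iter_deriv vs f x)) has_derivative (\<lambda>v. cnj (iter_deriv (v # vs) f x))) (at x)" for vs x
  using assms bounded_linear.has_derivative[OF bounded_linear_cnj]
  by (auto simp: smooth_on_def frechet_derivative_works[symmetric])
 have "deriv_closed ?F"
  unfolding deriv_closed_def using d frechet_derivative_eqI[OF d]
  by (auto simp: differentiable_def simp del: iter_deriv.simps)
 moreover have "(\<lambda>x. cnj (f x)) \<in> ?F"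
  by (rule image_eqI[where x=f]) (auto intro: range_eqI[where x="[]"])
 ultimately show ?thesis by (rule deriv_closed_smooth)
qed

lemma smooth_on_const: "smooth_on UNIV (\<lambda>x::'a::euclidean_space. c::complex)"
proof (rule deriv_closed_smooth)
 show "deriv_closed (range (\<lambda>(c::complex) (x::'a). c))"
  unfolding deriv_closed_def by auto
qed auto

lemma smooth_on_prod:
 fixes f :: "'i => 'a::euclidean_space => complex"
 assumes "\<And>i. i \<in> I ==> smooth_on UNIV (f i)"
 shows "smooth_on UNIV (\<lambda>x. \<Prod>i\<in>I. f i x)"
 using assms by (induction I rule: infinite_finite_induct) (auto intro: smooth_on_const smooth_on_mult)

section \<open>Test functions and the decay of their transforms\<close>

lemma test_function_mult:
 assumes "test_function \<eta>" "smooth_on UNIV g"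
 shows "test_function (\<lambda>x. \<eta> x * g x)"
proof -
 have "closure {x. \<eta> x * g x \<noteq> 0} \<subseteq> closure {x. \<eta> x \<noteq> 0}" by (rule closure_mono) auto
 then show ?thesis
  using assms smooth_on_mult[of \<eta> g] unfolding test_function_def
  by (meson closed_closure compact_Int_closed compact_closure bounded_closure bounded_subset closure_subset compact_imp_bounded)
qed

lemma test_function_smooth: "test_function \<eta> ==> smooth_on UNIV \<eta>"
 by (simp add: test_function_def)

lemma test_function_cnj:
 assumes "test_function \<eta>"
 shows "test_function (\<lambda>x. cnj (\<eta> x))"
 using assms smooth_on_cnj[of \<eta>] unfolding test_function_def by simp

lemma test_function_isCont: "test_function \<eta> ==> isCont \<eta> x"
 unfolding test_function_def using smooth_on_isCont by blast

lemma test_function_measurable [measurable]: "test_function \<eta> ==> \<eta> \<in> borel_measurable borel"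
 by (simp add: borel_measurable_continuous_onI continuous_at_imp_continuous_on test_function_isCont)

lemma test_function_bounded_support:
 assumes "test_function \<eta>"
 obtains R where "R > 0" "\<And>x. \<eta> x \<noteq> 0 ==> norm x \<le> R"
proof -
 have "bounded {x. \<eta> x \<noteq> 0}"
  using assms unfolding test_function_def
  by (meson bounded_subset closure_subset compact_imp_bounded)
 then obtain R where "\<And>x. \<eta> x \<noteq> 0 ==> norm x \<le> R" "R > 0"
  unfolding bounded_pos by blast
 then show ?thesis using that by blast
qed

lemma test_function_bounded:
 assumes "test_function \<eta>"
 obtains M where "M > 0" "\<And>x. norm (\<eta> x) \<le> M"
proof -
 obtain R where R: "R > 0" "\<And>x. \<eta> x \<noteq> 0 ==> norm x \<le> R"
  using test_function_bounded_support assms by blast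
 have "compact (\<eta> ` cball 0 R)"
  using assms by (intro compact_continuous_image)
   (auto intro: continuous_at_imp_continuous_on test_function_isCont)
 then obtain M where M: "M > 0" "\<And>x. x \<in> cball 0 R ==> norm (\<eta> x) \<le> M"
  using compact_imp_bounded[of "\<eta> ` cball 0 R"] unfolding bounded_pos by auto
 have "norm (\<eta> x) \<le> M" for x
  using M R by (cases "\<eta> x = 0") auto
 then show ?thesis using M that by blast
qed

lemma integrable_bounded_support:
 fixes f :: "'a::euclidean_space => 'b::{banach, second_countable_topology}"
 assumes "f \<in> borel_measurable borel" "\<And>x. norm (f x) \<le> M" "\<And>x. f x \<noteq> 0 ==> norm x \<le> R"
 shows "integrable lborel f"
proof (rule Bochner_Integration.integrable_bound)
 show "integrable lborel (\<lambda>x. indicator (cball (0::'a) R) x *\<^sub>R M)"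
  using borel_integrable_compact[of "cball (0::'a) R" "\<lambda>_. M"] by auto
 show "AE x in lborel. norm (f x) \<le> norm (indicator (cball (0::'a) R) x *\<^sub>R M)"
 proof (rule AE_I2)
  fix x
  show "norm (f x) \<le> norm (indicator (cball (0::'a) R) x *\<^sub>R M)"
   using assms(2)[of x] assms(3)[of x] by (cases "f x = 0") auto
 qed
qed (use assms in auto)

lemma test_function_integrable:
 fixes \<eta> :: "'a::euclidean_space => complex"
 assumes "test_function \<eta>" shows "integrable lborel \<eta>"
proof -
 obtain R where "\<And>x. \<eta> x \<noteq> 0 ==> norm x \<le> R"
  using test_function_bounded_support assms by blast
 moreover obtain M where "\<And>x. norm (\<eta> x) \<le> M"
  using test_function_bounded assms by blast
 ultimately show ?thesis using assms
  by (intro integrable_bounded_support) auto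
qed

lemma frechet_derivative_eq_0_outside:
 assumes "\<And>y. norm y > R ==> \<eta> y = 0" "norm x > R"
 shows "frechet_derivative \<eta> (at x) = (\<lambda>v. 0)"
proof (rule frechet_derivative_eqI, rule has_derivative_transform_within_open)
 show "((\<lambda>_. 0) has_derivative (\<lambda>v. 0)) (at x)" by simp
 show "open {x. norm x > R}" by (intro open_Collect_less continuous_intros)
qed (use assms in auto)

lemma test_function_deriv:
 fixes \<eta> :: "'a::euclidean_space => complex"
 assumes "test_function \<eta>"
 shows "test_function (\<lambda>x. frechet_derivative \<eta> (at x) v)"
proof -
 obtain R where R: "R > 0" "\<And>x. \<eta> x \<noteq> 0 ==> norm x \<le> R"
  using test_function_bounded_support assms by blast
 have "frechet_derivative \<eta> (at x) v = 0" if "norm x > R" for x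
  using frechet_derivative_eq_0_outside[of R \<eta> x] R that by force
 then have "{x. frechet_derivative \<eta> (at x) v \<noteq> 0} \<subseteq> cball 0 R"
  by (auto simp: not_less[symmetric])
 then have "bounded (closure {x. frechet_derivative \<eta> (at x) v \<noteq> 0})"
  by (meson bounded_cball bounded_closure bounded_subset)
 then show ?thesis
  using smooth_on_deriv[of UNIV \<eta> v] assms unfolding test_function_def
  by (simp add: compact_eq_bounded_closed)
qed

lemma directional_mvt:
 fixes f :: "'a::real_normed_vector => 'b::real_normed_vector"
 assumes d: "\<And>t. t \<in> {0..h} ==> f differentiable (at (x + t *\<^sub>R v))"
  and B: "\<And>t. t \<in> {0..h} ==> norm (frechet_derivative f (at (x + t *\<^sub>R v)) v) \<le> B" and "h \<ge> 0"
 shows "norm (f (x + h *\<^sub>R v) - f x) \<le> B * h"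
proof -
 have "norm (f (x + h *\<^sub>R v) - f (x + 0 *\<^sub>R v)) \<le> B * norm (h - 0)"
 proof (rule differentiable_bound[where S="{0..h}"])
  fix t assume t: "t \<in> {0..h}"
  have D: "(f has_derivative frechet_derivative f (at (x + t *\<^sub>R v))) (at (x + t *\<^sub>R v))"
   using d[OF t] by (simp add: frechet_derivative_works)
  have "((\<lambda>t. f (x + t *\<^sub>R v)) has_derivative (\<lambda>s. frechet_derivative f (at (x + t *\<^sub>R v)) (s *\<^sub>R v))) (at t within {0..h})"
   by (rule has_derivative_compose[of "\<lambda>t. x + t *\<^sub>R v", OF _ D])
     (auto intro!: derivative_eq_intros)
  moreover have "frechet_derivative f (at (x + t *\<^sub>R v)) (s *\<^sub>R v) = s *\<^sub>R frechet_derivative f (at (x + t *\<^sub>R v)) v" for s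
   using D by (simp add: has_derivative_linear linear_scale)
  ultimately show "((\<lambda>t. f (x + t *\<^sub>R v)) has_derivative (\<lambda>s. s *\<^sub>R frechet_derivative f (at (x + t *\<^sub>R v)) v)) (at t within {0..h})"
   by simp
  show "onorm (\<lambda>s. s *\<^sub>R frechet_derivative f (at (x + t *\<^sub>R v)) v) \<le> B"
   using B[OF t] by (intro onorm_le) (auto simp: mult.commute[of B] intro!: mult_left_mono)
 qed (use assms in auto)
 then show ?thesis using assms by simp
qed

lemma cis_quotient_tendsto:
 "(\<lambda>n. (cis (1 / real (Suc n) * t) - 1) / complex_of_real (1 / real (Suc n))) \<longlonglongrightarrow> \<i> * complex_of_real t"
proof -
 have "((\<lambda>z. exp (\<i> * complex_of_real t * z)) has_field_derivative (\<i> * complex_of_real t)) (at 0)"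
  by (auto intro!: derivative_eq_intros)
 then have l: "(\<lambda>h. (exp (\<i> * complex_of_real t * (0 + h)) - exp (\<i> * complex_of_real t * 0)) / h) \<midarrow>0\<rightarrow> \<i> * complex_of_real t"
  by (rule DERIV_D)
 have "filterlim (\<lambda>n. complex_of_real (1 / real (Suc n))) (at 0) sequentially"
  unfolding filterlim_at
  using tendsto_of_real[OF LIMSEQ_Suc[OF lim_1_over_n], where 'a=complex] by (simp del: of_nat_Suc)
 from filterlim_compose[OF l this] show ?thesis
  by (simp add: cis_conv_exp mult_ac del: of_nat_Suc)
qed

text \<open>Translating \<open>\<eta>\<close> multiplies its transform by a phase; the difference
  quotients are dominated by a bounded function of compact support, so the limit may be taken under
  the integral.\<close>

lemma ft_deriv:
 fixes \<eta> :: "'a::euclidean_space => complex"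
 assumes \<eta>: "test_function \<eta>"
 shows "ft (\<lambda>x. frechet_derivative \<eta> (at x) v) \<xi> = \<i> * complex_of_real (v \<bullet> \<xi>) * ft \<eta> \<xi>"
proof -
 let ?h = "\<lambda>n. 1 / real (Suc n)"
 define q where "q n x = (\<eta> (x + ?h n *\<^sub>R v) - \<eta> x) / complex_of_real (?h n)" for n x
 have [measurable]: "\<eta> \<in> borel_measurable borel" using \<eta> by measurable
 have dm [measurable]: "(\<lambda>x. frechet_derivative \<eta> (at x) v) \<in> borel_measurable borel"
  using test_function_deriv[OF \<eta>] by measurable
 have [measurable]: "q n \<in> borel_measurable borel" for n
  unfolding q_def by measurable
 obtain R where R: "R > 0" "\<And>x. \<eta> x \<noteq> 0 ==> norm x \<le> R"
  using test_function_bounded_support \<eta> by blast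
 obtain M where M: "M > 0" "\<And>x. norm (frechet_derivative \<eta> (at x) v) \<le> M"
  using test_function_bounded[OF test_function_deriv[OF \<eta>]] by blast
 have diff: "\<eta> differentiable (at x)" for x
  using \<eta> smooth_on_differentiable test_function_def by blast
 \<comment> \<open>All step sizes are at most one, so the quotients live in the ball enlarged by
   \<open>norm v\<close>.\<close>
 have qb: "norm (q n x) \<le> M * indicator (cball 0 (R + norm v)) x" for n x
 proof (cases "norm x \<le> R + norm v")
  case True
  have "norm (\<eta> (x + ?h n *\<^sub>R v) - \<eta> x) \<le> M * ?h n"
   using M diff by (intro directional_mvt) auto
  moreover have "norm (q n x) = norm (\<eta> (x + ?h n *\<^sub>R v) - \<eta> x) / ?h n"
   unfolding q_def norm_divide by (simp add: norm_divide del: of_nat_Suc)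
  ultimately show ?thesis using True by (simp only:) (simp add: field_simps)
 next
  case False
  have "norm x \<le> norm (x + ?h n *\<^sub>R v) + norm (?h n *\<^sub>R v)"
   by (metis add_diff_cancel_right' norm_triangle_ineq4)
  moreover have "norm (?h n *\<^sub>R v) \<le> norm v"
   using mult_right_mono[of "?h n" 1 "norm v"] by (simp del: of_nat_Suc)
  ultimately have "\<eta> (x + ?h n *\<^sub>R v) = 0" "\<eta> x = 0"
   using R(2)[of "x + ?h n *\<^sub>R v"] R(2)[of x] False norm_ge_zero[of v] by (smt (verit))+
  then show ?thesis using M(1) by (simp add: q_def)
 qed
 have i\<eta>: "integrable lborel \<eta>" using test_function_integrable \<eta> by blast
 have l1: "(\<lambda>n. ft (q n) \<xi>) \<longlonglongrightarrow> ft (\<lambda>x. frechet_derivative \<eta> (at x) v) \<xi>"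
  unfolding ft_def
 proof (rule integral_dominated_convergence)
  show "integrable lborel (\<lambda>x. M * indicator (cball (0::'a) (R + norm v)) x)"
   using borel_integrable_compact[of "cball (0::'a) (R + norm v)" "\<lambda>_. M"] by (auto simp: mult.commute)
  show "AE x in lborel. (\<lambda>n. cis (- (x \<bullet> \<xi>)) * q n x) \<longlonglongrightarrow> cis (- (x \<bullet> \<xi>)) * frechet_derivative \<eta> (at x) v"
  proof (intro AE_I2 tendsto_mult tendsto_const)
   fix x
   have D: "(\<eta> has_derivative frechet_derivative \<eta> (at (x + 0 *\<^sub>R v))) (at (x + 0 *\<^sub>R v))"
    using diff by (simp add: frechet_derivative_works)
   have "((\<lambda>t. \<eta> (x + t *\<^sub>R v)) has_derivative (\<lambda>s. frechet_derivative \<eta> (at (x + 0 *\<^sub>R v)) (s *\<^sub>R v))) (at 0)"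
    by (rule has_derivative_compose[of "\<lambda>t. x + t *\<^sub>R v", OF _ D]) (auto intro!: derivative_eq_intros)
   moreover have "frechet_derivative \<eta> (at x) (s *\<^sub>R v) = s *\<^sub>R frechet_derivative \<eta> (at x) v" for s
    using D by (simp add: has_derivative_linear linear_scale)
   ultimately have "((\<lambda>t. \<eta> (x + t *\<^sub>R v)) has_derivative (\<lambda>s. s *\<^sub>R frechet_derivative \<eta> (at x) v)) (at 0)"
    by simp
   then have l: "((\<lambda>y. (\<eta> (x + y *\<^sub>R v) - \<eta> (x + 0 *\<^sub>R v) - (y - 0) *\<^sub>R frechet_derivative \<eta> (at x) v) /\<^sub>R norm (y - 0)) \<longlongrightarrow> 0) (at 0)"
    unfolding has_derivative_at_within by blast
   have "filterlim ?h (at 0) sequentially"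
    unfolding filterlim_at using LIMSEQ_Suc[OF lim_1_over_n] by (simp del: of_nat_Suc)
   from filterlim_compose[OF l this]
   have "(\<lambda>n. (\<eta> (x + ?h n *\<^sub>R v) - \<eta> x - ?h n *\<^sub>R frechet_derivative \<eta> (at x) v) /\<^sub>R ?h n) \<longlonglongrightarrow> 0"
    by (simp del: of_nat_Suc)
   moreover have "(\<eta> (x + ?h n *\<^sub>R v) - \<eta> x - ?h n *\<^sub>R frechet_derivative \<eta> (at x) v) /\<^sub>R ?h n = q n x - frechet_derivative \<eta> (at x) v" for n
    by (simp add: q_def scaleR_conv_of_real divide_inverse algebra_simps del: of_nat_Suc)
   ultimately show "(\<lambda>n. q n x) \<longlonglongrightarrow> frechet_derivative \<eta> (at x) v"
    by (simp add: LIM_zero_iff)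
  qed
  show "AE x in lborel. norm (cis (- (x \<bullet> \<xi>)) * q n x) \<le> M * indicator (cball 0 (R + norm v)) x" for n
   using qb by auto
 qed measurable
 have "ft (q n) \<xi> = (cis (?h n * (v \<bullet> \<xi>)) - 1) / complex_of_real (?h n) * ft \<eta> \<xi>" for n
 proof -
  have i1: "integrable lborel (\<lambda>x. \<eta> (x + ?h n *\<^sub>R v))"
   using lborel_integrable_scale[OF _ i\<eta>, of 1 "?h n *\<^sub>R v"] by (simp add: add.commute)
  have "ft \<eta> \<xi> = (LB x. cis (- ((?h n *\<^sub>R v + 1 *\<^sub>R x) \<bullet> \<xi>)) * \<eta> (?h n *\<^sub>R v + 1 *\<^sub>R x))"
   unfolding ft_def by (subst lborel_integral_scale[of 1 _ "?h n *\<^sub>R v"]) auto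
  also have "... = (LB x. cis (- (?h n * (v \<bullet> \<xi>))) * (cis (- (x \<bullet> \<xi>)) * \<eta> (x + ?h n *\<^sub>R v)))"
   by (intro Bochner_Integration.integral_cong refl)
     (simp add: inner_add_left add.commute cis_mult mult.assoc[symmetric] del: of_nat_Suc)
  also have "... = cis (- (?h n * (v \<bullet> \<xi>))) * ft (\<lambda>x. \<eta> (x + ?h n *\<^sub>R v)) \<xi>"
   by (simp add: ft_def)
  finally have sh: "ft (\<lambda>x. \<eta> (x + ?h n *\<^sub>R v)) \<xi> = cis (?h n * (v \<bullet> \<xi>)) * ft \<eta> \<xi>"
   by (simp add: mult.assoc[symmetric] cis_mult)
  have "ft (q n) \<xi> = (LB x. (cis (- (x \<bullet> \<xi>)) * \<eta> (x + ?h n *\<^sub>R v) - cis (- (x \<bullet> \<xi>)) * \<eta> x) / complex_of_real (?h n))"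
   unfolding ft_def q_def by (simp add: algebra_simps diff_divide_distrib)
  also have "... = (ft (\<lambda>x. \<eta> (x + ?h n *\<^sub>R v)) \<xi> - ft \<eta> \<xi>) / complex_of_real (?h n)"
   unfolding ft_def
   by (subst integral_divide_zero, subst Bochner_Integration.integral_diff) (use i1 i\<eta> in \<open>auto intro!: integrable_cis_mult\<close>)
  finally show ?thesis by (simp only: sh) (simp add: left_diff_distrib del: of_nat_Suc)
 qed
 moreover have "(\<lambda>n. (cis (?h n * (v \<bullet> \<xi>)) - 1) / complex_of_real (?h n) * ft \<eta> \<xi>) \<longlonglongrightarrow> \<i> * complex_of_real (v \<bullet> \<xi>) * ft \<eta> \<xi>"
  by (intro tendsto_mult cis_quotient_tendsto tendsto_const)
 ultimately show ?thesis using l1 LIMSEQ_unique by auto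
qed

text \<open>The induction varies \<open>\<eta>\<close>: one more factor \<open>norm \<xi>\<close> is
  at most the sum of the absolute coordinates of \<open>\<xi>\<close>, and a coordinate times
  \<open>ft \<eta>\<close> is, up to a phase, the transform of a derivative, again a test
  function.\<close>

theorem test_function_ft_decay:
 fixes \<eta> :: "'a::euclidean_space => complex"
 assumes "test_function \<eta>"
 shows "\<exists>C. \<forall>\<xi>. (1 + norm \<xi>) ^ N * norm (ft \<eta> \<xi>) \<le> C"
 using assms
proof (induction N arbitrary: \<eta>)
 case 0
 then show ?case using norm_ft_le by auto
next
 case (Suc N)
 obtain C0 where C0: "\<And>\<xi>. (1 + norm \<xi>) ^ N * norm (ft \<eta> \<xi>) \<le> C0"
  using Suc by blast
 have "\<forall>b. \<exists>C. \<forall>\<xi>. (1 + norm \<xi>) ^ N * norm (ft (\<lambda>x. frechet_derivative \<eta> (at x) b) \<xi>) \<le> C"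
  using Suc test_function_deriv by blast
 then obtain C where C: "\<And>b \<xi>. (1 + norm \<xi>) ^ N * norm (ft (\<lambda>x. frechet_derivative \<eta> (at x) b) \<xi>) \<le> C b"
  by metis
 have "(1 + norm \<xi>) ^ Suc N * norm (ft \<eta> \<xi>) \<le> C0 + (\<Sum>b\<in>Basis. C b)" for \<xi>
 proof -
  have "(1 + norm \<xi>) ^ Suc N * norm (ft \<eta> \<xi>) =
   (1 + norm \<xi>) ^ N * norm (ft \<eta> \<xi>) + norm \<xi> * ((1 + norm \<xi>) ^ N * norm (ft \<eta> \<xi>))"
   by (simp add: algebra_simps)
  also have "... \<le> (1 + norm \<xi>) ^ N * norm (ft \<eta> \<xi>) + (\<Sum>b\<in>Basis. \<bar>\<xi> \<bullet> b\<bar>) * ((1 + norm \<xi>) ^ N * norm (ft \<eta> \<xi>))"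
   by (intro add_left_mono mult_right_mono norm_le_l1) auto
  also have "... = (1 + norm \<xi>) ^ N * norm (ft \<eta> \<xi>) +
    (\<Sum>b\<in>Basis. (1 + norm \<xi>) ^ N * norm (ft (\<lambda>x. frechet_derivative \<eta> (at x) b) \<xi>))"
   by (simp add: ft_deriv[OF Suc.prems] norm_mult sum_distrib_left sum_distrib_right inner_commute mult_ac)
  also have "... \<le> C0 + (\<Sum>b\<in>Basis. C b)"
   by (intro add_mono sum_mono C0 C)
  finally show ?thesis .
 qed
 then show ?case by blast
qed


text \<open>From \<open>(1 + x)\<^sup>2 \<le> 2 * (1 + x\<^sup>2)\<close> one may compare with a
  multiple of \<open>(1 + x) powr (- p)\<close>, whose antiderivative is explicit and tends to zero
  at infinity as \<open>p > 1\<close>.\<close>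

lemma nn_integral_japanese_half:
 assumes "p > 1"
 shows "(NN x. ennreal ((1 + x\<^sup>2) powr (- (p / 2))) * indicator {0..} x) < \<infinity>"
proof -
 have "(1 + x\<^sup>2) powr (- (p / 2)) \<le> 2 powr (p / 2) * (1 + x) powr (- p)" if "x \<ge> 0" for x :: real
 proof -
  have "(1 + x) powr p = ((1 + x)\<^sup>2) powr (p / 2)"
   using that by (simp add: powr_powr powr_numeral[symmetric] del: powr_numeral)
  also have "... \<le> (2 * (1 + x\<^sup>2)) powr (p / 2)"
   using that assms sum_squares_bound[of 1 x] by (intro powr_mono2) (auto simp: power2_eq_square algebra_simps)
  also have "... = 2 powr (p / 2) * (1 + x\<^sup>2) powr (p / 2)"
   by (rule powr_mult)
  finally have "(1 + x) powr p \<le> 2 powr (p / 2) * (1 + x\<^sup>2) powr (p / 2)" .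
  moreover have "(1 + x\<^sup>2) powr (p / 2) > 0" using sum_power2_gt_zero_iff[of 1 x] by simp
  moreover have "inverse A \<le> c * inverse D" if "D \<le> c * A" "A > 0" "D > 0" for A c D :: real
   using that by (simp add: field_simps)
  moreover have "(1 + x) powr p > 0" using that by simp
  ultimately show ?thesis
   unfolding powr_minus by blast
 qed
 then have "(NN x. ennreal ((1 + x\<^sup>2) powr (- (p / 2))) * indicator {0..} x) \<le>
  (NN x. ennreal (2 powr (p / 2) * (1 + x) powr (- p)) * indicator {0..} x)"
  by (intro nn_integral_mono) (auto simp: indicator_def intro!: ennreal_leI)
 also have "... = ennreal (0 - 2 powr (p / 2) * ((1 + 0) powr (1 - p) / (1 - p)))"
 proof (rule nn_integral_FTC_atLeast)
  show "((\<lambda>x. 2 powr (p / 2) * ((1 + x) powr (1 - p) / (1 - p))) has_real_derivative 2 powr (p / 2) * (1 + x) powr (- p)) (at x)"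
   if "0 \<le> x" for x
  proof -
   have "((\<lambda>x. (1 + x) powr (1 - p)) has_real_derivative ((1 - p) * (1 + x) powr (1 - p - 1)) * 1) (at x)"
   proof (rule DERIV_chain2[of "\<lambda>z. z powr (1 - p)" _ "\<lambda>x. 1 + x"])
    show "((\<lambda>z. z powr (1 - p)) has_real_derivative (1 - p) * (1 + x) powr (1 - p - 1)) (at (1 + x))"
     by (rule has_real_derivative_powr) (use that in simp)
    show "((\<lambda>x. 1 + x) has_real_derivative 1) (at x)"
     by (auto intro!: derivative_eq_intros)
   qed
   note DERIV_cmult[OF DERIV_cdivide[OF this, of "1 - p"], of "2 powr (p / 2)"]
   moreover have "1 - p - 1 = - p" "1 - p \<noteq> 0" using assms by auto
   ultimately show ?thesis
    by (simp only: mult_1_right nonzero_mult_div_cancel_left not_False_eq_True)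
  qed
  have "filterlim (\<lambda>x::real. 1 + x) at_top at_top"
   by (intro filterlim_tendsto_add_at_top[OF tendsto_const] filterlim_ident)
  then have "((\<lambda>x::real. (1 + x) powr (1 - p)) \<longlongrightarrow> 0) at_top"
   using assms by (intro tendsto_neg_powr) auto
  then have "((\<lambda>x. 2 powr (p / 2) * ((1 + x) powr (1 - p) / (1 - p))) \<longlongrightarrow> 2 powr (p / 2) * (0 / (1 - p))) at_top"
   using assms by (intro tendsto_intros) auto
  then show "((\<lambda>x. 2 powr (p / 2) * ((1 + x) powr (1 - p) / (1 - p))) \<longlongrightarrow> 0) at_top" by simp
 qed auto
 finally show ?thesis
  by (rule le_less_trans) simp
qed

lemma nn_integral_japanese:
 assumes "p > 1"
 shows "(NN x. ennreal ((1 + (x::real)\<^sup>2) powr (- (p / 2)))) < \<infinity>"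
proof -
 let ?f = "\<lambda>x::real. ennreal ((1 + x\<^sup>2) powr (- (p / 2)))"
 have "(NN x. ?f x) \<le> (NN x. ?f x * indicator {0..} x + ?f (- x) * indicator {0..} (- x))"
  by (intro nn_integral_mono) (auto simp: indicator_def)
 also have "... = (NN x. ?f x * indicator {0..} x) + (NN x. ?f (- x) * indicator {0..} (- x))"
  by (intro nn_integral_add) auto
 also have "(NN x. ?f (- x) * indicator {0..} (- x)) = (NN x. ?f x * indicator {0..} x)"
  using lborel_nn_integral_shift(2)[of "\<lambda>x. ?f x * indicator {0..} x" 0] by simp
 finally show ?thesis
  using nn_integral_japanese_half[OF assms] by (auto simp: less_top[symmetric] top_unique)
qed

text \<open>Each of the \<open>n\<close> coordinates receives the share \<open>q / n\<close> of the
  exponent, and \<open>1 + (norm \<xi>)\<^sup>2\<close> dominates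
  \<open>1 + (\<xi> \<bullet> b)\<^sup>2\<close>; the one-dimensional factors converge because
  \<open>2 * q / n > 1\<close>. In the plane with \<open>q = lam\<close> this is the condition
  \<open>lam > 1\<close>.\<close>

lemma nn_integral_japanese_euclidean:
 assumes "q > DIM('a) / 2"
 shows "(NN \<xi>. ennreal ((1 + (norm (\<xi>::'a::euclidean_space))\<^sup>2) powr (- q))) < \<infinity>"
proof -
 let ?n = "real DIM('a)"
 have n: "?n > 0" by simp
 have q: "q > 0" using assms n by linarith
 have "(NN \<xi>. ennreal ((1 + (norm (\<xi>::'a))\<^sup>2) powr (- q))) \<le>
  (NN \<xi>. (\<Prod>b\<in>Basis. ennreal ((1 + ((\<xi>::'a) \<bullet> b)\<^sup>2) powr (- ((2 * q / ?n) / 2)))))"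
 proof (intro nn_integral_mono)
  fix \<xi> :: 'a
  have 1: "1 + (norm \<xi>)\<^sup>2 > 0" by (simp add: add_pos_nonneg)
  have "(1 + (norm \<xi>)\<^sup>2) powr (- q) = (\<Prod>b\<in>(Basis::'a set). (1 + (norm \<xi>)\<^sup>2) powr (- (q / ?n)))"
   using n 1 by (simp only: prod_constant) (subst powr_power, auto)
  also have "... \<le> (\<Prod>b\<in>Basis. (1 + (\<xi> \<bullet> b)\<^sup>2) powr (- ((2 * q / ?n) / 2)))"
  proof (intro prod_mono conjI)
   fix b :: 'a assume "b \<in> Basis"
   then have "(\<xi> \<bullet> b)\<^sup>2 \<le> (norm \<xi>)\<^sup>2"
    using Basis_le_norm[of b \<xi>] by (metis abs_ge_zero power2_abs power_mono)
   moreover have "1 + (\<xi> \<bullet> b)\<^sup>2 > 0" by (simp add: add_pos_nonneg)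
   ultimately show "(1 + (norm \<xi>)\<^sup>2) powr (- (q / ?n)) \<le> (1 + (\<xi> \<bullet> b)\<^sup>2) powr (- ((2 * q / ?n) / 2))"
    using q n by (auto intro!: powr_mono2')
  qed auto
  finally show "ennreal ((1 + (norm \<xi>)\<^sup>2) powr (- q)) \<le> (\<Prod>b\<in>Basis. ennreal ((1 + (\<xi> \<bullet> b)\<^sup>2) powr (- ((2 * q / ?n) / 2))))"
   by (subst prod_ennreal) (auto intro!: ennreal_leI)
 qed
 also have "... = (\<Prod>b\<in>(Basis::'a set). (NN x. ennreal ((1 + (x::real)\<^sup>2) powr (- ((2 * q / ?n) / 2)))))"
  by (rule nn_integral_lborel_prod) auto
 also have "... < \<infinity>"
  using nn_integral_japanese[of "2 * q / ?n"] assms n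
  by (simp add: ennreal_prod_eq_top power_less_top_ennreal field_simps)
 finally show ?thesis .
qed

text \<open>Since \<open>(1 + norm \<xi>)\<^sup>2\<close> dominates
  \<open>1 + (norm \<xi>)\<^sup>2\<close>, twice the dimension as exponent reduces to the previous
  lemma with \<open>q\<close> equal to the dimension.\<close>

lemma nn_integral_decay_euclidean:
 shows "integrable lborel (\<lambda>\<xi>::'a::euclidean_space. 1 / (1 + norm \<xi>) ^ (2 * DIM('a)))"
proof (rule integrableI_bounded)
 have "(NN \<xi>. ennreal (norm (1 / (1 + norm (\<xi>::'a)) ^ (2 * DIM('a))))) \<le>
   (NN \<xi>. ennreal ((1 + (norm (\<xi>::'a))\<^sup>2) powr (- real DIM('a))))"
 proof (intro nn_integral_mono ennreal_leI)
  fix \<xi> :: 'a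
  have 1: "1 + (norm \<xi>)\<^sup>2 > 0" by (simp add: add_pos_nonneg)
  have "(1 + (norm \<xi>)\<^sup>2) ^ DIM('a) \<le> ((1 + norm \<xi>)\<^sup>2) ^ DIM('a)"
   by (intro power_mono) (auto simp: power2_eq_square algebra_simps)
  then have "1 / ((1 + norm \<xi>)\<^sup>2) ^ DIM('a) \<le> 1 / (1 + (norm \<xi>)\<^sup>2) ^ DIM('a)"
   using 1 by (intro divide_left_mono mult_pos_pos zero_less_power) (auto simp: add_pos_nonneg)
  then show "norm (1 / (1 + norm \<xi>) ^ (2 * DIM('a))) \<le> (1 + (norm \<xi>)\<^sup>2) powr (- real DIM('a))"
   using 1 by (simp add: powr_minus powr_realpow power_mult divide_inverse)
 qed
 also have "... < \<infinity>"
  by (rule nn_integral_japanese_euclidean) simp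
 finally show "(NN \<xi>. ennreal (norm (1 / (1 + norm (\<xi>::'a)) ^ (2 * DIM('a))))) < \<infinity>" .
qed measurable

lemma integrable_decay:
 fixes g :: "'a::euclidean_space => complex"
 assumes "g \<in> borel_measurable borel" "\<And>\<xi>. (1 + norm \<xi>) ^ (2 * DIM('a)) * norm (g \<xi>) \<le> C"
 shows "integrable lborel g"
proof (rule Bochner_Integration.integrable_bound)
 show "integrable lborel (\<lambda>\<xi>::'a. C * (1 / (1 + norm \<xi>) ^ (2 * DIM('a))))"
  by (intro integrable_mult_right nn_integral_decay_euclidean)
 show "AE \<xi> in lborel. norm (g \<xi>) \<le> norm (C * (1 / (1 + norm \<xi>) ^ (2 * DIM('a))))"
 proof (rule AE_I2)
  fix \<xi> :: 'a
  have p: "(1 + norm \<xi>) ^ (2 * DIM('a)) > 0" by (simp add: add_pos_nonneg)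
  have "norm (g \<xi>) \<le> C * (1 / (1 + norm \<xi>) ^ (2 * DIM('a)))"
   using assms(2)[of \<xi>] p by (simp add: field_simps)
  then show "norm (g \<xi>) \<le> norm (C * (1 / (1 + norm \<xi>) ^ (2 * DIM('a))))"
   by (metis abs_ge_self order_trans real_norm_def)
 qed
qed (use assms in auto)

lemma test_function_ft_integrable:
 assumes "test_function (\<eta> :: 'a::euclidean_space => complex)"
 shows "integrable lborel (ft \<eta>)"
 using test_function_ft_decay[OF assms, of "2 * DIM('a)"] test_function_integrable[OF assms]
 by (auto intro: integrable_decay)

lemma ft_test_mult:
 fixes f :: "'a::euclidean_space => complex"
 assumes \<eta>: "test_function \<eta>" and f: "integrable lborel f"
 shows "complex_of_real ((gauss_mass TYPE('a))\<^sup>2) * ft (\<lambda>x. \<eta> x * f x) \<xi> =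
   (LB \<tau>. ft \<eta> (\<xi> - \<tau>) * ft f \<tau>)"
proof -
 obtain M where M: "\<And>x. norm (\<eta> x) \<le> M" using test_function_bounded[OF \<eta>] by blast
 show ?thesis
  by (rule ft_mult[OF test_function_integrable[OF \<eta>] M test_function_isCont[OF \<eta>] test_function_ft_integrable[OF \<eta>] f])
qed

definition poly_growth :: "('a::real_normed_vector => complex) => bool" where
 "poly_growth f \<longleftrightarrow> (\<exists>M k. M \<ge> 0 \<and> (\<forall>x. norm (f x) \<le> M * (1 + norm x) ^ k))"

lemma poly_growthI: "M \<ge> 0 ==> (\<And>x. norm (f x) \<le> M * (1 + norm x) ^ k) ==> poly_growth f"
 unfolding poly_growth_def by blast

lemma poly_growthE:
 assumes "poly_growth f"
 obtains M k where "M \<ge> 0" "\<And>x. norm (f x) \<le> M * (1 + norm x) ^ k"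
 using assms unfolding poly_growth_def by blast

text \<open>The algebra generated by linear forms consists of polynomials; they are the factors that
  derivatives of a Gaussian acquire.\<close>

lemma alg_linear_growth:
 assumes "P \<in> alg (range (\<lambda>v (x::'a::euclidean_space). complex_of_real (x \<bullet> v)))"
 shows "poly_growth P"
 using assms
proof induction
 case (base f)
 then obtain v where f: "f = (\<lambda>x. complex_of_real (x \<bullet> v))" by auto
 show ?case
 proof (rule poly_growthI)
  fix x
  have "\<bar>x \<bullet> v\<bar> \<le> norm v * norm x" using Cauchy_Schwarz_ineq2[of x v] by (simp only: mult.commute)
  then show "norm (f x) \<le> norm v * (1 + norm x) ^ 1"
   unfolding f norm_of_real power_one_right distrib_left mult_1_right using norm_ge_zero[of v] by linarith
 qed simp
next
 case (const c)
 show ?case by (rule poly_growthI[of "norm c" _ 0]) auto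
next
 case (add f g)
 obtain M k where f: "M \<ge> 0" "\<And>x. norm (f x) \<le> M * (1 + norm x) ^ k"
  using poly_growthE[OF add.IH(1)] by metis
 obtain N l where g: "N \<ge> 0" "\<And>x. norm (g x) \<le> N * (1 + norm x) ^ l"
  using poly_growthE[OF add.IH(2)] by metis
 show ?case
 proof (rule poly_growthI)
  fix x
  have "norm (f x + g x) \<le> M * (1 + norm x) ^ k + N * (1 + norm x) ^ l"
   by (rule norm_triangle_mono[OF f(2) g(2)])
  also have "... \<le> M * (1 + norm x) ^ (k + l) + N * (1 + norm x) ^ (k + l)"
   using f(1) g(1) by (intro add_mono mult_left_mono power_increasing) auto
  finally show "norm (f x + g x) \<le> (M + N) * (1 + norm x) ^ (k + l)" by (simp add: algebra_simps)
 qed (use f g in simp)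
next
 case (mult f g)
 obtain M k where f: "M \<ge> 0" "\<And>x. norm (f x) \<le> M * (1 + norm x) ^ k"
  using poly_growthE[OF mult.IH(1)] by metis
 obtain N l where g: "N \<ge> 0" "\<And>x. norm (g x) \<le> N * (1 + norm x) ^ l"
  using poly_growthE[OF mult.IH(2)] by metis
 show ?case
 proof (rule poly_growthI)
  fix x
  have "norm (f x * g x) \<le> (M * (1 + norm x) ^ k) * (N * (1 + norm x) ^ l)"
   unfolding norm_mult using f g by (intro mult_mono) auto
  then show "norm (f x * g x) \<le> (M * N) * (1 + norm x) ^ (k + l)" by (simp add: power_add mult_ac)
 qed (use f g in simp)
qed

lemma exp_ge_power: "x \<ge> 0 ==> x ^ n / fact n \<le> exp (x::real)"
 using sum_le_suminf[OF summable_exp_generic[of x], of "{n}"]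
 by (simp add: exp_def divide_inverse mult.commute)

text \<open>One Taylor term bounds the power by an exponential, and completing the square bounds
  \<open>r - a\<^sup>2 * r\<^sup>2 / 2\<close> by \<open>1 / (2 * a\<^sup>2)\<close>.\<close>

lemma power_gauss_bounded:
 assumes "a > 0"
 shows "(1 + norm x) ^ n * gauss (a *\<^sub>R (x::'a::euclidean_space)) \<le> fact n * exp (1 + 1 / (2 * a\<^sup>2))"
proof -
 have 1: "(1 + r) ^ n \<le> fact n * exp (1 + r)" if "r \<ge> 0" for r :: real
  using exp_ge_power[of "1 + r" n] that by (simp add: field_simps)
 have "r + - (a\<^sup>2 * r\<^sup>2 / 2) \<le> 1 / (2 * a\<^sup>2)" for r
 proof -
  have "0 \<le> (a * r - 1 / a)\<^sup>2 / 2" by simp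
  then show ?thesis using assms by (simp add: power2_eq_square field_simps)
 qed
 then have "exp (1 + norm x) * gauss (a *\<^sub>R x) \<le> exp (1 + 1 / (2 * a\<^sup>2))"
  using assms by (simp add: gauss_def exp_add[symmetric] power_mult_distrib)
 then have "fact n * (exp (1 + norm x) * gauss (a *\<^sub>R x)) \<le> fact n * exp (1 + 1 / (2 * a\<^sup>2))"
  by (intro mult_left_mono) auto
 moreover have "(1 + norm x) ^ n * gauss (a *\<^sub>R x) \<le> fact n * (exp (1 + norm x) * gauss (a *\<^sub>R x))"
  unfolding mult.assoc[symmetric] by (intro mult_right_mono 1) auto
 ultimately show ?thesis by linarith
qed

text \<open>These are the functions on which the duality in \<open>sobolev\<close> is tested.
  Polynomials times the function form a family closed under derivatives, since its logarithmic
  derivative, \<open>l v\<close> below, is affine.\<close>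

lemma schwartz_mod_gauss:
 fixes z :: "'a::euclidean_space"
 assumes a: "a > 0"
 shows "schwartz (\<lambda>\<xi>. cis (z \<bullet> \<xi>) * complex_of_real (gauss (a *\<^sub>R \<xi>)))"
proof -
 define \<psi> where "\<psi> \<xi> = cis (z \<bullet> \<xi>) * complex_of_real (gauss (a *\<^sub>R \<xi>))" for \<xi>
 let ?B = "range (\<lambda>v (x::'a). complex_of_real (x \<bullet> v))"
 have dB: "deriv_closed (alg ?B)"
 proof (rule alg_deriv_closed)
  fix f :: "'a => complex" and w assume "f \<in> ?B"
  then obtain v where f: "f = (\<lambda>x. complex_of_real (x \<bullet> v))" by auto
  have d: "(f has_derivative (\<lambda>w. complex_of_real (w \<bullet> v))) (at x)" for x
   unfolding f by (auto intro!: derivative_eq_intros)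
  show "(\<forall>x. f differentiable at x) \<and> (\<lambda>x. frechet_derivative f (at x) w) \<in> alg ?B"
   using d frechet_derivative_eqI[OF d] alg.const by (auto simp: differentiable_def)
 qed
 define l where "l v \<xi> = \<i> * complex_of_real (z \<bullet> v) + complex_of_real (- (a\<^sup>2)) * complex_of_real (\<xi> \<bullet> v)" for v \<xi>
 have l: "l v \<in> alg ?B" for v
  unfolding l_def by (intro alg.add alg.mult alg.const alg.base) auto
 have \<psi>_exp: "\<psi> = (\<lambda>\<xi>. exp (\<i> * complex_of_real (z \<bullet> \<xi>) + complex_of_real (- (a\<^sup>2 * (\<xi> \<bullet> \<xi>) / 2))))"
  using a by (auto simp: \<psi>_def fun_eq_iff cis_conv_exp gauss_def power_mult_distrib power2_norm_eq_inner exp_of_real[symmetric] mult_exp_exp)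
 have d\<psi>: "(\<psi> has_derivative (\<lambda>v. l v \<xi> * \<psi> \<xi>)) (at \<xi>)" for \<xi>
 proof -
  have "((\<lambda>\<xi>. \<i> * complex_of_real (z \<bullet> \<xi>) + complex_of_real (- (a\<^sup>2 * (\<xi> \<bullet> \<xi>) / 2))) has_derivative (\<lambda>v. l v \<xi>)) (at \<xi>)"
   by (auto intro!: derivative_eq_intros simp: l_def fun_eq_iff inner_commute algebra_simps)
  from has_derivative_compose[OF this DERIV_exp[unfolded has_field_derivative_def]]
  show ?thesis unfolding \<psi>_exp by (simp add: mult.commute)
 qed
 define F where "F = {f. \<exists>P\<in>alg ?B. f = (\<lambda>x. P x * \<psi> x)}"
 have dF: "deriv_closed F"
  unfolding deriv_closed_def
 proof
  fix f assume "f \<in> F"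
  then obtain P where P: "P \<in> alg ?B" "f = (\<lambda>x. P x * \<psi> x)" by (auto simp: F_def)
  have dP: "(P has_derivative frechet_derivative P (at x)) (at x)" for x
   using dB P(1) by (auto simp: deriv_closed_def frechet_derivative_works)
  have df: "(f has_derivative (\<lambda>v. P x * (l v x * \<psi> x) + frechet_derivative P (at x) v * \<psi> x)) (at x)" for x
   unfolding P(2) by (intro has_derivative_mult dP d\<psi>)
  have "(\<lambda>x. frechet_derivative f (at x) v) = (\<lambda>x. (P x * l v x + frechet_derivative P (at x) v) * \<psi> x)" for v
   by (auto simp: fun_eq_iff frechet_derivative_eqI[OF df] algebra_simps)
  moreover have "(\<lambda>x. P x * l v x + frechet_derivative P (at x) v) \<in> alg ?B" for v
   using dB P(1) l by (intro alg.add alg.mult) (auto simp: deriv_closed_def)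
  ultimately show "(\<forall>x. f differentiable at x) \<and> (\<forall>v. (\<lambda>x. frechet_derivative f (at x) v) \<in> F)"
   using df by (auto simp: F_def differentiable_def)
 qed
 have \<psi>F: "\<psi> \<in> F"
  unfolding F_def using alg.const[of 1] by (auto intro!: bexI[of _ "\<lambda>_. 1"])
 have "\<exists>M. \<forall>x. (1 + norm x) ^ N * norm (iter_deriv vs \<psi> x) \<le> M" for N vs
 proof -
  obtain P where P: "P \<in> alg ?B" "iter_deriv vs \<psi> = (\<lambda>x. P x * \<psi> x)"
   using deriv_closed_iter_deriv[OF dF \<psi>F, of vs] by (auto simp: F_def)
  obtain M k where M: "M \<ge> 0" "\<And>x. norm (P x) \<le> M * (1 + norm x) ^ k"
   using poly_growthE[OF alg_linear_growth[OF P(1)]] by metis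
  have "(1 + norm x) ^ N * norm (iter_deriv vs \<psi> x) \<le> M * (fact (N + k) * exp (1 + 1 / (2 * a\<^sup>2)))" for x
  proof -
   have "(1 + norm x) ^ N * norm (iter_deriv vs \<psi> x) = (1 + norm x) ^ N * (norm (P x) * gauss (a *\<^sub>R x))"
    by (simp add: P(2) norm_mult \<psi>_def)
   also have "... \<le> (1 + norm x) ^ N * ((M * (1 + norm x) ^ k) * gauss (a *\<^sub>R x))"
    by (intro mult_left_mono mult_right_mono M) auto
   also have "... = M * ((1 + norm x) ^ (N + k) * gauss (a *\<^sub>R x))"
    by (simp add: power_add)
   also have "... \<le> M * (fact (N + k) * exp (1 + 1 / (2 * a\<^sup>2)))"
    by (intro mult_left_mono power_gauss_bounded a M)
   finally show ?thesis .
  qed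
  then show ?thesis by blast
 qed
 then have "schwartz \<psi>"
  unfolding schwartz_def using deriv_closed_smooth[OF dF \<psi>F] by blast
 then show ?thesis by (simp add: \<psi>_def[abs_def])
qed

text \<open>The classical flat function \<open>exp (- 1 / s)\<close>, together with the powers of
  \<open>1 / s\<close> that its derivatives bring in.\<close>

definition flat_exp :: "nat => real => real" where
 "flat_exp n s = (if s > 0 then (1 / s) ^ n * exp (- (1 / s)) else 0)"

text \<open>A single Taylor term of \<open>exp (1 / s)\<close> beats \<open>n + 2\<close> powers of
  \<open>1 / s\<close>. Being quadratically small, the function has derivative zero at the junction
  \<open>s = 0\<close>.\<close>

lemma flat_exp_bound: "\<bar>flat_exp n s\<bar> \<le> fact (n + 2) * s\<^sup>2"
proof (cases "s > 0")
 case True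
 have "(1 / s) ^ (n + 2) / fact (n + 2) \<le> exp (1 / s)"
  using exp_ge_power[of "1 / s" "n + 2"] True by simp
 then have "(1 / s) ^ (n + 2) \<le> exp (1 / s) * fact (n + 2)"
  by (subst (asm) pos_divide_le_eq) (auto simp del: fact_Suc)
 then have "(1 / s) ^ n * (1 / s)\<^sup>2 \<le> fact (n + 2) * exp (1 / s)"
  by (metis power_add mult.commute)
 then have "(1 / s) ^ n * (1 / s)\<^sup>2 * (s\<^sup>2 * exp (- (1 / s))) \<le> fact (n + 2) * exp (1 / s) * (s\<^sup>2 * exp (- (1 / s)))"
  by (intro mult_right_mono) auto
 then show ?thesis
  using True by (simp add: flat_exp_def exp_minus field_simps del: fact_Suc)
qed (simp add: flat_exp_def)

lemma flat_exp_deriv: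
 "(flat_exp n has_real_derivative flat_exp (n + 2) s - real n * flat_exp (n + 1) s) (at s)"
proof -
 consider "s > 0" | "s < 0" | "s = 0" by linarith
 then show ?thesis
 proof cases
  case 1
  define r where "r = 1 / s"
  have d1: "((\<lambda>s. 1 / s) has_real_derivative - (r * r)) (at s)"
   using 1 by (auto intro!: derivative_eq_intros simp: r_def)
  have d2: "((\<lambda>s. (1 / s) ^ n) has_real_derivative real n * (- (r * r) * r ^ (n - Suc 0))) (at s)"
   using DERIV_power[OF d1, of n] by (simp only: r_def)
  have d3: "((\<lambda>s. exp (- (1 / s))) has_real_derivative exp (- r) * (r * r)) (at s)"
   using DERIV_fun_exp[OF DERIV_minus[OF d1]] by (simp only: r_def minus_minus)
  have "real n * (- (r * r) * r ^ (n - Suc 0)) * exp (- r) + exp (- r) * (r * r) * r ^ n =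
    r ^ (n + 2) * exp (- r) - real n * (r ^ (n + 1) * exp (- r))"
   by (cases n) (simp_all add: algebra_simps)
  also have "... = flat_exp (n + 2) s - real n * flat_exp (n + 1) s"
   using 1 unfolding flat_exp_def r_def by (simp only: if_True)
  finally have "((\<lambda>s. (1 / s) ^ n * exp (- (1 / s))) has_real_derivative flat_exp (n + 2) s - real n * flat_exp (n + 1) s) (at s)"
   using DERIV_mult[OF d2 d3] by (simp only: r_def)
  then show ?thesis
   by (rule has_field_derivative_transform_within_open[where S="{0<..}"]) (use 1 in \<open>auto simp: flat_exp_def\<close>)
 next
  case 2
  have "((\<lambda>s. 0) has_real_derivative flat_exp (n + 2) s - real n * flat_exp (n + 1) s) (at s)"
   using 2 by (simp add: flat_exp_def)
  then show ?thesis
   by (rule has_field_derivative_transform_within_open[where S="{..<0}"]) (use 2 in \<open>auto simp: flat_exp_def\<close>)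
 next
  case 3
  have "((\<lambda>h. (flat_exp n (0 + h) - flat_exp n 0) / h) \<longlongrightarrow> 0) (at 0)"
  proof (rule Lim_null_comparison)
   have "norm ((flat_exp n (0 + h) - flat_exp n 0) / h) \<le> fact (n + 2) * \<bar>h\<bar>" if "h \<noteq> 0" for h
   proof -
    have "\<bar>flat_exp n h\<bar> / \<bar>h\<bar> \<le> fact (n + 2) * h\<^sup>2 / \<bar>h\<bar>"
     by (intro divide_right_mono flat_exp_bound) auto
    also have "h\<^sup>2 = \<bar>h\<bar> * \<bar>h\<bar>" by (simp add: power2_eq_square)
    also have "fact (n + 2) * (\<bar>h\<bar> * \<bar>h\<bar>) / \<bar>h\<bar> = fact (n + 2) * \<bar>h\<bar>"
     using that by (simp del: fact_Suc abs_mult_self_eq)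
    finally show ?thesis by (simp add: flat_exp_def[of n 0] del: fact_Suc)
   qed
   then show "\<forall>\<^sub>F h in at 0. norm ((flat_exp n (0 + h) - flat_exp n 0) / h) \<le> fact (n + 2) * \<bar>h\<bar>"
    by (simp add: eventually_at_filter del: fact_Suc)
   show "((\<lambda>h. fact (n + 2) * \<bar>h\<bar>) \<longlongrightarrow> 0) (at (0::real))"
    by (rule tendsto_eq_intros tendsto_rabs_zero refl | simp del: fact_Suc)+
  qed
  then show ?thesis using 3 by (simp add: DERIV_def flat_exp_def)
 qed
qed

text \<open>Product of two flat functions of affine arguments, one vanishing left of
  \<open>s0 - d\<close>, the other right of \<open>s0 + d\<close>; the generating family allows
  affine arguments to cover both.\<close>

lemma bump_function_exists:
 assumes "d > 0"
 shows "\<exists>\<eta>. test_function \<eta> \<and> \<eta> (s0::real) \<noteq> 0 \<and> (\<forall>s. \<eta> s \<noteq> 0 --> \<bar>s - s0\<bar> < d)"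
proof -
 let ?B = "{f. \<exists>n c e. f = (\<lambda>s. complex_of_real (flat_exp n (c * s + e)))}"
 have "deriv_closed (alg ?B)"
 proof (rule alg_deriv_closed)
  fix f :: "real => complex" and v assume "f \<in> ?B"
  then obtain n c e where f: "f = (\<lambda>s. complex_of_real (flat_exp n (c * s + e)))" by auto
  have d: "(f has_derivative (\<lambda>v. complex_of_real (v * c) * (complex_of_real (flat_exp (n + 2) (c * s + e)) +
    complex_of_real (- real n) * complex_of_real (flat_exp (n + 1) (c * s + e))))) (at s)" for s
  proof -
   have "((\<lambda>s. flat_exp n (c * s + e)) has_real_derivative
     (flat_exp (n + 2) (c * s + e) - real n * flat_exp (n + 1) (c * s + e)) * c) (at s)"
    by (rule DERIV_chain2[OF flat_exp_deriv]) (auto intro!: derivative_eq_intros)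
   then have "((\<lambda>s. flat_exp n (c * s + e)) has_derivative
     (\<lambda>v. (flat_exp (n + 2) (c * s + e) - real n * flat_exp (n + 1) (c * s + e)) * c * v)) (at s)"
    by (simp add: has_field_derivative_def)
   then have "(f has_derivative (\<lambda>v. complex_of_real
     ((flat_exp (n + 2) (c * s + e) - real n * flat_exp (n + 1) (c * s + e)) * c * v))) (at s)"
    unfolding f by (rule has_derivative_of_real)
   then show ?thesis
    by (simp add: algebra_simps)
  qed
  show "(\<forall>x. f differentiable at x) \<and> (\<lambda>x. frechet_derivative f (at x) v) \<in> alg ?B"
  proof
   show "\<forall>x. f differentiable at x" using d by (auto simp: differentiable_def)
   show "(\<lambda>x. frechet_derivative f (at x) v) \<in> alg ?B"
    unfolding frechet_derivative_eqI[OF d]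
    by (intro alg.mult alg.add alg.const alg.base) auto
  qed
 qed
 moreover have "(\<lambda>s. complex_of_real (flat_exp 0 (1 * s + (d - s0))) * complex_of_real (flat_exp 0 ((-1) * s + (d + s0)))) \<in> alg ?B"
  by (intro alg.mult alg.base) (blast+)
 ultimately have sm: "smooth_on UNIV (\<lambda>s. complex_of_real (flat_exp 0 (1 * s + (d - s0))) * complex_of_real (flat_exp 0 ((-1) * s + (d + s0))))"
  (is "smooth_on UNIV ?\<eta>")
  by (rule deriv_closed_smooth)
 have supp: "\<bar>s - s0\<bar> < d" if "?\<eta> s \<noteq> 0" for s
  using that by (auto simp: flat_exp_def split: if_splits)
 then have "{s. ?\<eta> s \<noteq> 0} \<subseteq> cball s0 d"
  by (auto simp: dist_real_def abs_minus_commute less_imp_le)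
 then have "bounded (closure {s. ?\<eta> s \<noteq> 0})"
  by (meson bounded_cball bounded_closure bounded_subset)
 then have "test_function ?\<eta>"
  using sm unfolding test_function_def by (simp add: compact_eq_bounded_closed)
 moreover have "?\<eta> s0 \<noteq> 0" using assms by (simp add: flat_exp_def)
 ultimately show ?thesis using supp by blast
qed

section \<open>Microlocal regularity of order one on the line\<close>

lemma exp_cis: "exp (- (\<i> * complex_of_real t)) = cis (- t)"
 by (simp add: cis_conv_exp)

lemma fourier_eq_ft:
 assumes [measurable]: "f \<in> borel_measurable borel"
 shows "fourier f \<xi> = ft f \<xi>"
 unfolding fourier_def ft_def exp_cis by (rule integral_completion) measurable

lemma distr_of_eq:
 assumes [measurable]: "g \<in> borel_measurable borel" "\<psi> \<in> borel_measurable borel"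
 shows "distr_of g \<psi> = (LB x. complex_of_real (g x) * \<psi> x)"
 unfolding distr_of_def by (rule integral_completion) measurable

lemma fourier_loc_distr_of:
 assumes [measurable]: "g \<in> borel_measurable borel" and \<eta>: "test_function \<eta>"
 shows "fourier_loc \<eta> (distr_of g) \<xi> = ft (\<lambda>x. \<eta> x * complex_of_real (g x)) \<xi>"
proof -
 have [measurable]: "\<eta> \<in> borel_measurable borel" using \<eta> by measurable
 show ?thesis
  unfolding fourier_loc_def ft_def exp_cis
  by (subst distr_of_eq) (auto simp: mult_ac)
qed

text \<open>Borel measurability is included so that the integrals over \<open>lebesgue\<close> in
  \<open>distr_of\<close> can be evaluated over \<open>lborel\<close>.\<close>

definition locally_bounded :: "('a::euclidean_space => real) => bool" where
 "locally_bounded g \<longleftrightarrow> g \<in> borel_measurable borel \<and> (\<forall>R. \<exists>M. \<forall>x. norm x \<le> R --> \<bar>g x\<bar> \<le> M)"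

lemma locally_bounded_measurable: "locally_bounded g ==> g \<in> borel_measurable borel"
 by (simp add: locally_bounded_def)

lemma test_mult_locally_bounded:
 assumes g: "locally_bounded g" and \<eta>: "test_function \<eta>"
 obtains M R where "\<And>x. norm (\<eta> x * complex_of_real (g x)) \<le> M" "\<And>x. \<eta> x * complex_of_real (g x) \<noteq> 0 ==> norm x \<le> R"
proof -
 obtain R where R: "R > 0" "\<And>x. \<eta> x \<noteq> 0 ==> norm x \<le> R"
  using test_function_bounded_support \<eta> by blast
 obtain M where M: "M > 0" "\<And>x. norm (\<eta> x) \<le> M"
  using test_function_bounded[OF \<eta>] by blast
 obtain B where B: "\<And>x. norm x \<le> R ==> \<bar>g x\<bar> \<le> B"
  using g unfolding locally_bounded_def by blast
 have "B \<ge> 0" using B[of 0] R by auto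
 have "norm (\<eta> x * complex_of_real (g x)) \<le> M * B" for x
 proof (cases "\<eta> x = 0")
  case False
  then show ?thesis using R(2)[OF False] B[of x] M(2)[of x] M(1)
   by (auto simp: norm_mult intro!: mult_mono)
 qed (use \<open>B \<ge> 0\<close> M in auto)
 then show ?thesis using R that by (metis mult_eq_0_iff)
qed

lemma integrable_test_mult:
 assumes g: "locally_bounded g" and \<eta>: "test_function \<eta>"
 shows "integrable lborel (\<lambda>x. \<eta> x * complex_of_real (g x))"
proof -
 have [measurable]: "\<eta> \<in> borel_measurable borel" "g \<in> borel_measurable borel"
  using g \<eta> by (auto intro: locally_bounded_measurable)
 obtain M R where *: "\<And>x. norm (\<eta> x * complex_of_real (g x)) \<le> M" "\<And>x. \<eta> x * complex_of_real (g x) \<noteq> 0 ==> norm x \<le> R"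
  using test_mult_locally_bounded[OF assms] by metis
 show ?thesis by (rule integrable_bounded_support[OF _ *]) auto
qed

text \<open>A distribution of order zero: the seminorm bound is used with the empty list of
  derivatives, and the constant is a bound of \<open>g\<close> on a ball times the volume of the
  ball.\<close>

lemma distribution_distr_of:
 fixes g :: "'a::euclidean_space => real"
 assumes g: "locally_bounded g"
 shows "distribution (distr_of g)"
proof -
 have [measurable]: "g \<in> borel_measurable borel" using g by (rule locally_bounded_measurable)
 have i: "integrable lborel (\<lambda>x. complex_of_real (g x) * \<psi> x)" if "test_function \<psi>" for \<psi>
  using integrable_test_mult[OF g that] by (simp add: mult.commute)
 have e: "distr_of g \<psi> = (LB x. complex_of_real (g x) * \<psi> x)" if "test_function \<psi>" for \<psi>
  using that by (intro distr_of_eq) auto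
 show ?thesis
  unfolding distribution_def
 proof (intro conjI allI impI)
  fix \<psi> \<zeta> :: "'a => complex" assume t: "test_function \<psi>" "test_function \<zeta>"
  then have [measurable]: "\<psi> \<in> borel_measurable borel" "\<zeta> \<in> borel_measurable borel" by auto
  have "distr_of g (\<lambda>x. \<psi> x + \<zeta> x) = (LB x. complex_of_real (g x) * \<psi> x + complex_of_real (g x) * \<zeta> x)"
   by (subst distr_of_eq) (auto simp: algebra_simps)
  then show "distr_of g (\<lambda>x. \<psi> x + \<zeta> x) = distr_of g \<psi> + distr_of g \<zeta>"
   using t i by (simp add: e)
 next
  fix c \<psi> assume t: "test_function (\<psi> :: 'a => complex)"
  then have [measurable]: "\<psi> \<in> borel_measurable borel" by auto
  have "distr_of g (\<lambda>x. c * \<psi> x) = (LB x. c * (complex_of_real (g x) * \<psi> x))"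
   by (subst distr_of_eq) (auto simp: algebra_simps)
  then show "distr_of g (\<lambda>x. c * \<psi> x) = c * distr_of g \<psi>"
   using t by (simp add: e)
 next
  fix K :: "'a set" assume "compact K"
  then obtain R where R: "\<And>x. x \<in> K ==> norm x \<le> R"
   using compact_imp_bounded bounded_iff by metis
  obtain B where B: "\<And>x. norm x \<le> R ==> \<bar>g x\<bar> \<le> B"
   using g unfolding locally_bounded_def by blast
  define B' where "B' = max B 0"
  show "\<exists>C N. \<forall>\<psi> M. test_function \<psi> --> {x. \<psi> x \<noteq> 0} \<subseteq> K -->
      (\<forall>vs x. set vs \<subseteq> Basis --> length vs \<le> N --> norm (iter_deriv vs \<psi> x) \<le> M) -->
      norm (distr_of g \<psi>) \<le> C * M"
  proof (intro exI allI impI)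
   fix \<psi> :: "'a => complex" and M
   assume t: "test_function \<psi>" and s: "{x. \<psi> x \<noteq> 0} \<subseteq> K"
    and M: "\<forall>vs x. set vs \<subseteq> Basis --> length vs \<le> 0 --> norm (iter_deriv vs \<psi> x) \<le> M"
   have M: "norm (\<psi> x) \<le> M" for x using M[rule_format, of "[]" x] by simp
   have "norm (distr_of g \<psi>) \<le> (LB x. norm (complex_of_real (g x) * \<psi> x))"
    unfolding e[OF t] by (rule integral_norm_bound)
   also have "... \<le> (LB x. B' * M * indicator (cball (0::'a) R) x)"
   proof (rule integral_mono)
    show "integrable lborel (\<lambda>x. norm (complex_of_real (g x) * \<psi> x))" using i[OF t] by simp
    show "integrable lborel (\<lambda>x. B' * M * indicator (cball (0::'a) R) x)"
     using borel_integrable_compact[of "cball (0::'a) R" "\<lambda>_. B' * M"] by (auto simp: mult.commute)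
    fix x
    have "\<bar>g x\<bar> * norm (\<psi> x) \<le> B' * M" if "\<psi> x \<noteq> 0"
    proof (rule mult_mono)
     have "x \<in> K" using s that by blast
     then show "\<bar>g x\<bar> \<le> B'" using B[OF R] by (fastforce simp: B'_def)
    qed (use M in \<open>auto simp: B'_def\<close>)
    moreover have "norm x \<le> R" if "\<psi> x \<noteq> 0" using s that R by blast
    moreover have "0 \<le> M" using M[of 0] norm_ge_zero order_trans by blast
    ultimately show "norm (complex_of_real (g x) * \<psi> x) \<le> B' * M * indicator (cball 0 R) x"
     by (cases "\<psi> x = 0") (auto simp: norm_mult B'_def)
   qed
   also have "... = (B' * measure lborel (cball (0::'a) R)) * M"
    by simp
   finally show "norm (distr_of g \<psi>) \<le> (B' * measure lborel (cball (0::'a) R)) * M" .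
  qed
 qed
qed

lemma norm_cis_diff_le: "norm (cis a - cis b) \<le> \<bar>a - b\<bar>"
proof -
 have "norm (cis a - cis b) = norm (cis b * (cis (a - b) - 1))"
  by (simp add: algebra_simps cis_mult)
 also have "... = norm (exp (\<i> * complex_of_real (a - b)) - 1)"
  by (simp add: norm_mult cis_conv_exp)
 also have "... \<le> \<bar>a - b\<bar>"
  using iexp_approx1[of "a - b" 0] by simp
 finally show ?thesis .
qed

lemma norm_cis_diff_le2: "norm (cis a - cis b) \<le> 2"
 using norm_triangle_ineq4[of "cis a" "cis b"] by simp

text \<open>The squared \<open>H^1\<close> norm restricted to frequencies in \<open>S\<close>. On
  the line the relevant cones are the two half-lines, which occur below as
  \<open>\<sigma> * \<xi> > 0\<close>.\<close>

definition wL2 :: "(real => complex) => real set => bool" where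
 "wL2 f S \<longleftrightarrow> (NN \<xi>. ennreal ((1 + \<xi>\<^sup>2) * (norm (ft f \<xi>))\<^sup>2) * indicator S \<xi>) < \<infinity>"

lemma gauss_mass_real: "(gauss_mass TYPE('a::euclidean_space))\<^sup>2 > 0"
 using gauss_mass_pos[where 'a='a] by simp

text \<open>The \<open>L^2\<close> bound on difference quotients passes to the Fourier side by
  \<open>bessel_ft\<close>; there the quotients converge to multiplication by
  \<open>\<i> * \<xi>\<close>, and Fatou keeps the bound.\<close>

lemma wL2_of_difference_quotients:
 fixes f :: "real => complex"
 assumes [measurable]: "f \<in> borel_measurable borel" and M: "\<And>x. norm (f x) \<le> M" and R: "\<And>x. f x \<noteq> 0 ==> norm x \<le> R"
  and h0: "h0 > 0"
  and C: "\<And>h. 0 < h ==> h < h0 ==> (NN s. ennreal ((norm (f (s + h) - f s))\<^sup>2)) \<le> ennreal (C * h\<^sup>2)"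
 shows "wL2 f UNIV"
proof -
 have i: "integrable lborel f" by (rule integrable_bounded_support[OF _ M R]) auto
 have [measurable]: "ft f \<in> borel_measurable borel" using i by measurable
 have "integrable lborel (\<lambda>x. complex_of_real ((norm (f x))\<^sup>2))"
  by (rule integrable_bounded_support[of _ "M\<^sup>2" R])
    (use M R in \<open>auto simp: norm_power intro!: power_mono\<close>)
 then have "(NN x. ennreal ((norm (f x))\<^sup>2)) < \<infinity>"
  by (subst (asm) integrable_iff_bounded) (auto simp: norm_power)
 then have b0: "(NN \<xi>. ennreal ((norm (ft f \<xi>))\<^sup>2)) < \<infinity>"
  by (intro le_less_trans[OF bessel_ft[OF i]]) (simp add: ennreal_mult_less_top)
 obtain n0 :: nat where n0: "1 / real (Suc n0) < h0"
  using h0 by (metis nat_approx_posE)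
 \<comment> \<open>The offset \<open>n0\<close> keeps every step below \<open>h0\<close>, where the
   hypothesis applies.\<close>
 let ?h = "\<lambda>n. 1 / real (Suc (n + n0))"
 have h: "0 < ?h n" "?h n < h0" for n
 proof -
  have "?h n \<le> 1 / real (Suc n0)" by (intro divide_left_mono) auto
  then show "?h n < h0" using n0 by linarith
 qed auto
 have sh: "ft (\<lambda>s. f (s + h) - f s) \<xi> = (cis (h * \<xi>) - 1) * ft f \<xi>" for h \<xi>
 proof -
  have i1: "integrable lborel (\<lambda>x. f (x + h))"
   using lborel_integrable_scale[OF _ i, of 1 h] by (simp add: add.commute)
  have "ft f \<xi> = (LB x. cis (- ((h + 1 *\<^sub>R x) \<bullet> \<xi>)) * f (h + 1 *\<^sub>R x))"
   unfolding ft_def by (subst lborel_integral_scale[of 1 _ h]) auto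
  also have "... = (LB x. cis (- (h * \<xi>)) * (cis (- (x \<bullet> \<xi>)) * f (x + h)))"
   by (intro Bochner_Integration.integral_cong refl)
     (simp add: algebra_simps cis_mult mult.assoc[symmetric])
  also have "... = cis (- (h * \<xi>)) * ft (\<lambda>x. f (x + h)) \<xi>"
   by (simp add: ft_def)
  finally have sh: "ft (\<lambda>x. f (x + h)) \<xi> = cis (h * \<xi>) * ft f \<xi>"
   by (simp add: mult.assoc[symmetric] cis_mult)
  have "ft (\<lambda>s. f (s + h) - f s) \<xi> = ft (\<lambda>x. f (x + h)) \<xi> - ft f \<xi>"
   unfolding ft_def right_diff_distrib
   by (rule Bochner_Integration.integral_diff) (use i1 i in \<open>auto intro!: integrable_cis_mult\<close>)
  then show ?thesis by (simp add: sh algebra_simps)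
 qed
 let ?u = "\<lambda>n \<xi>. ennreal ((norm ((cis (?h n * \<xi>) - 1) / complex_of_real (?h n) * ft f \<xi>))\<^sup>2)"
 have "(NN \<xi>. ennreal (\<xi>\<^sup>2 * (norm (ft f \<xi>))\<^sup>2)) \<le> ennreal ((gauss_mass TYPE(real))\<^sup>2) * ennreal C"
 proof (rule nn_integral_limit_le)
  fix n
  show "?u n \<in> borel_measurable lborel" by measurable
  have i1: "integrable lborel (\<lambda>x. f (x + ?h n))"
   using lborel_integrable_scale[OF _ i, of 1 "?h n"] by (simp add: add.commute)
  have "(NN \<xi>. ?u n \<xi>) = (NN \<xi>. ennreal (1 / (?h n)\<^sup>2) * ennreal ((norm (ft (\<lambda>s. f (s + ?h n) - f s) \<xi>))\<^sup>2))"
   unfolding sh using h(1)[of n]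
   by (intro nn_integral_cong)
     (simp add: ennreal_mult[symmetric] norm_mult norm_divide power_mult_distrib power_divide del: of_nat_Suc)
  also have "... = ennreal (1 / (?h n)\<^sup>2) * (NN \<xi>. ennreal ((norm (ft (\<lambda>s. f (s + ?h n) - f s) \<xi>))\<^sup>2))"
   unfolding sh by (rule nn_integral_cmult) measurable
  also have "... \<le> ennreal (1 / (?h n)\<^sup>2) * (ennreal ((gauss_mass TYPE(real))\<^sup>2) * ennreal (C * (?h n)\<^sup>2))"
   using i i1 C[OF h] by (intro mult_left_mono order_trans[OF bessel_ft]) auto
  also have "... = ennreal ((gauss_mass TYPE(real))\<^sup>2) * (ennreal (1 / (?h n)\<^sup>2) * ennreal (C * (?h n)\<^sup>2))"
   by (simp only: mult_ac)
  also have "ennreal (1 / (?h n)\<^sup>2) * ennreal (C * (?h n)\<^sup>2) = ennreal (1 / (?h n)\<^sup>2 * (C * (?h n)\<^sup>2))"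
   by (rule ennreal_mult'[symmetric]) simp
  finally show "(NN \<xi>. ?u n \<xi>) \<le> ennreal ((gauss_mass TYPE(real))\<^sup>2) * ennreal C"
   using h(1)[of n] by (simp del: of_nat_Suc)
 next
  fix \<xi>
  have "(\<lambda>n. (cis (?h n * \<xi>) - 1) / complex_of_real (?h n) * ft f \<xi>) \<longlonglongrightarrow> \<i> * complex_of_real \<xi> * ft f \<xi>"
   by (intro tendsto_mult tendsto_const LIMSEQ_ignore_initial_segment[OF cis_quotient_tendsto])
  then have "(\<lambda>n. ?u n \<xi>) \<longlonglongrightarrow> ennreal ((norm (\<i> * complex_of_real \<xi> * ft f \<xi>))\<^sup>2)"
   by (intro tendsto_ennrealI tendsto_power tendsto_norm)
  then show "(\<lambda>n. ?u n \<xi>) \<longlonglongrightarrow> ennreal (\<xi>\<^sup>2 * (norm (ft f \<xi>))\<^sup>2)"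
   by (simp add: norm_mult power_mult_distrib)
 qed
 then have b1: "(NN \<xi>. ennreal (\<xi>\<^sup>2 * (norm (ft f \<xi>))\<^sup>2)) < \<infinity>"
  by (rule le_less_trans) (simp add: ennreal_mult_less_top)
 have "(NN \<xi>. ennreal ((1 + \<xi>\<^sup>2) * (norm (ft f \<xi>))\<^sup>2) * indicator UNIV \<xi>) =
   (NN \<xi>. ennreal ((norm (ft f \<xi>))\<^sup>2) + ennreal (\<xi>\<^sup>2 * (norm (ft f \<xi>))\<^sup>2))"
  by (intro nn_integral_cong) (simp add: ennreal_plus[symmetric] algebra_simps del: ennreal_plus)
 also have "... = (NN \<xi>. ennreal ((norm (ft f \<xi>))\<^sup>2)) + (NN \<xi>. ennreal (\<xi>\<^sup>2 * (norm (ft f \<xi>))\<^sup>2))"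
  by (rule nn_integral_add) measurable
 also have "... < \<infinity>" using b0 b1 by (simp add: ennreal_add_less_top)
 finally show ?thesis unfolding wL2_def .
qed

lemma integrable_inverse_quadratic: "integrable lborel (\<lambda>y::real. 1 / (1 + y\<^sup>2))"
proof (rule integrableI_bounded)
 have p: "1 + y\<^sup>2 > 0" for y :: real by (simp add: add_pos_nonneg)
 have "(NN y. ennreal (norm (1 / (1 + (y::real)\<^sup>2)))) = (NN y. ennreal ((1 + y\<^sup>2) powr (- (2 / 2))))"
  using p by (intro nn_integral_cong) (simp add: powr_minus less_imp_le divide_inverse)
 then show "(NN y. ennreal (norm (1 / (1 + (y::real)\<^sup>2)))) < \<infinity>"
  using nn_integral_japanese[of 2] by simp
qed measurable

lemma integral_lin3:
 fixes f g h :: "'a => real"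
 assumes "integrable M f" "integrable M g" "integrable M h"
 shows "(LINT x|M. a * f x + b * g x + c * h x) = a * (LINT x|M. f x) + b * (LINT x|M. g x) + c * (LINT x|M. h x)"
  and "integrable M (\<lambda>x. a * f x + b * g x + c * h x)"
 using assms by simp_all

text \<open>Split the inversion integral at frequency \<open>N\<close>. High frequencies carry an
  arbitrarily small part of the weighted energy and contribute a small multiple of
  \<open>sqrt \<bar>r\<bar>\<close> by Cauchy-Schwarz; low frequencies contribute only
  \<open>O(r)\<close>.\<close>

theorem wL2_sqrt_modulus:
 fixes f :: "real => complex"
 assumes f: "integrable lborel f" and M: "\<And>x. norm (f x) \<le> M" and c: "\<And>x. isCont f x"
  and w: "wL2 f UNIV" and e: "e > 0"
 shows "\<exists>d>0. \<forall>r. \<bar>r\<bar> < d --> norm (f (s + r) - f s) \<le> e * sqrt \<bar>r\<bar>"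
proof -
 have [measurable]: "ft f \<in> borel_measurable borel" using f by measurable
 define G where "G \<xi> = (1 + \<xi>\<^sup>2) * (norm (ft f \<xi>))\<^sup>2" for \<xi>
 have [measurable]: "G \<in> borel_measurable borel" unfolding G_def by measurable
 have p: "1 + y\<^sup>2 > 0" for y :: real by (simp add: add_pos_nonneg)
 have G0: "G \<xi> \<ge> 0" for \<xi> by (simp add: G_def)
 have G: "integrable lborel G"
  using w unfolding wL2_def by (intro integrableI_nonneg) (auto simp: G_def)
 define Kc where "Kc = (LB y. 1 / (1 + (y::real)\<^sup>2))"
 have Kc0: "Kc \<ge> 0" unfolding Kc_def by (intro Bochner_Integration.integral_nonneg) simp
 \<comment> \<open>Cauchy-Schwarz against \<open>1 / (1 + \<xi>\<^sup>2)\<close>, in the pointwise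
   form of a square.\<close>
 have ff: "integrable lborel (ft f)"
 proof (rule Bochner_Integration.integrable_bound)
  show "integrable lborel (\<lambda>\<xi>. 1 / (1 + \<xi>\<^sup>2) + G \<xi>)" using G integrable_inverse_quadratic by simp
  show "AE \<xi> in lborel. norm (ft f \<xi>) \<le> norm (1 / (1 + \<xi>\<^sup>2) + G \<xi>)"
  proof (rule AE_I2)
   fix \<xi> :: real
   have "0 \<le> (1 / (1 + \<xi>\<^sup>2)) * (1 - (1 + \<xi>\<^sup>2) * norm (ft f \<xi>))\<^sup>2" using p[of \<xi>] by simp
   also have "... = 1 / (1 + \<xi>\<^sup>2) - 2 * norm (ft f \<xi>) + G \<xi>"
    using p[of \<xi>] by (simp add: G_def field_simps power2_eq_square)
   finally have "2 * norm (ft f \<xi>) \<le> 1 / (1 + \<xi>\<^sup>2) + G \<xi>" by simp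
   then show "norm (ft f \<xi>) \<le> norm (1 / (1 + \<xi>\<^sup>2) + G \<xi>)"
    using norm_ge_zero[of "ft f \<xi>"] unfolding real_norm_def by linarith
  qed
 qed measurable
 define A where "A = (LB \<xi>. norm (ft f \<xi>))"
 have A0: "A \<ge> 0" unfolding A_def by (intro Bochner_Integration.integral_nonneg) simp
 let ?m = "(gauss_mass TYPE(real))\<^sup>2"
 have m: "?m > 0" by (rule gauss_mass_real)
 \<comment> \<open>With \<open>t = sqrt \<bar>r\<bar>\<close> the contributions below add up to at
   most \<open>t * \<epsilon> * (1 + 1/2 + 5/2 * Kc)\<close>, which
   \<open>t * \<epsilon> * (2 + 3 * Kc)\<close> dominates; \<open>?m\<close> is the inversion
   constant.\<close>
 define \<epsilon> where "\<epsilon> = e * ?m / (2 + 3 * Kc)"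
 have \<epsilon>: "\<epsilon> > 0" using e m Kc0 by (simp add: \<epsilon>_def)
 have "(\<lambda>n. LB \<xi>. G \<xi> * indicator {\<xi>. \<bar>\<xi>\<bar> > real n} \<xi>) \<longlonglongrightarrow> (LINT \<xi>|(lborel::real measure). (0::real))"
 proof (rule integral_dominated_convergence[where w=G])
  show "integrable lborel G" by (rule G)
  show "AE \<xi> in lborel. (\<lambda>n. G \<xi> * indicator {\<xi>. \<bar>\<xi>\<bar> > real n} \<xi>) \<longlonglongrightarrow> 0"
  proof (rule AE_I2)
   fix \<xi> :: real
   obtain N :: nat where N: "\<bar>\<xi>\<bar> \<le> real N" using real_arch_simple by blast
   have "eventually (\<lambda>n. G \<xi> * indicator {\<xi>. \<bar>\<xi>\<bar> > real n} \<xi> = 0) sequentially"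
    using eventually_ge_at_top[of N] by eventually_elim (use N in \<open>auto simp: indicator_def\<close>)
   then show "(\<lambda>n. G \<xi> * indicator {\<xi>. \<bar>\<xi>\<bar> > real n} \<xi>) \<longlonglongrightarrow> 0"
    by (rule tendsto_eventually)
  qed
  show "AE \<xi> in lborel. norm (G \<xi> * indicator {\<xi>. \<bar>\<xi>\<bar> > real n} \<xi>) \<le> G \<xi>" for n
   using G0 by (intro AE_I2) (auto simp: indicator_def)
 qed measurable
 then have "eventually (\<lambda>n. (LB \<xi>. G \<xi> * indicator {\<xi>. \<bar>\<xi>\<bar> > real n} \<xi>) < \<epsilon>\<^sup>2) sequentially"
  using \<epsilon> by (intro order_tendstoD(2)) auto
 then obtain N :: nat where N: "(LB \<xi>. G \<xi> * indicator {\<xi>. \<bar>\<xi>\<bar> > real N} \<xi>) < \<epsilon>\<^sup>2"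
  by (auto simp: eventually_sequentially)
 \<comment> \<open>Below this threshold the low-frequency part \<open>\<bar>r\<bar> * N * A\<close>
   is at most \<open>\<epsilon> * sqrt \<bar>r\<bar>\<close>.\<close>
 define d where "d = (\<epsilon> / (real N * A + 1))\<^sup>2"
 have NA: "real N * A + 1 > 0" using A0 by (simp add: add_nonneg_pos)
 have d: "d > 0" using \<epsilon> NA by (simp add: d_def)
 have "norm (f (s + r) - f s) \<le> e * sqrt \<bar>r\<bar>" if r: "\<bar>r\<bar> < d" for r
 proof (cases "r = 0")
  case False
  define t where "t = sqrt \<bar>r\<bar>"
  have t: "t > 0" "t\<^sup>2 = \<bar>r\<bar>" using False by (auto simp: t_def)
  have "t < \<epsilon> / (real N * A + 1)"
   unfolding t_def using r \<epsilon> NA by (intro real_less_lsqrt) (auto simp: d_def)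
  then have tNA: "t * (real N * A) \<le> \<epsilon>"
   using NA t by (simp add: field_simps)
  have J: "integrable lborel (\<lambda>\<xi>. r\<^sup>2 / (1 + r\<^sup>2 * \<xi>\<^sup>2))" "(LB \<xi>. r\<^sup>2 / (1 + r\<^sup>2 * \<xi>\<^sup>2)) = \<bar>r\<bar> * Kc"
  proof -
   have "integrable lborel (\<lambda>\<xi>. 1 / (1 + (0 + r * \<xi>)\<^sup>2))"
    by (rule lborel_integrable_real_affine[OF integrable_inverse_quadratic False])
   then have "integrable lborel (\<lambda>\<xi>. r\<^sup>2 * (1 / (1 + (0 + r * \<xi>)\<^sup>2)))" by (rule integrable_mult_right)
   then show "integrable lborel (\<lambda>\<xi>. r\<^sup>2 / (1 + r\<^sup>2 * \<xi>\<^sup>2))" by (simp add: power_mult_distrib)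
   have "Kc = \<bar>r\<bar> *\<^sub>R (LB \<xi>. 1 / (1 + (0 + r * \<xi>)\<^sup>2))"
    unfolding Kc_def by (rule lborel_integral_real_affine[OF False])
   then have "\<bar>r\<bar> * Kc = (\<bar>r\<bar> * \<bar>r\<bar>) * (LB \<xi>. 1 / (1 + r\<^sup>2 * \<xi>\<^sup>2))"
    by (simp add: power_mult_distrib mult.assoc del: abs_mult_self_eq)
   also have "... = r\<^sup>2 * (LB \<xi>. 1 / (1 + r\<^sup>2 * \<xi>\<^sup>2))" by (simp add: power2_eq_square)
   also have "... = (LB \<xi>. r\<^sup>2 * (1 / (1 + r\<^sup>2 * \<xi>\<^sup>2)))"
    by (rule integral_mult_right_zero[symmetric])
   finally show "(LB \<xi>. r\<^sup>2 / (1 + r\<^sup>2 * \<xi>\<^sup>2)) = \<bar>r\<bar> * Kc" by simp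
  qed
  let ?F = "\<lambda>\<xi>. \<bar>r\<bar> * real N * norm (ft f \<xi>) + t / (2 * \<epsilon>) * (G \<xi> * indicator {\<xi>. \<bar>\<xi>\<bar> > real N} \<xi>) +
    5 * \<epsilon> / (2 * t) * (r\<^sup>2 / (1 + r\<^sup>2 * \<xi>\<^sup>2))"
  have GN: "integrable lborel (\<lambda>\<xi>. G \<xi> * indicator {\<xi>. \<bar>\<xi>\<bar> > real N} \<xi>)"
   by (rule Bochner_Integration.integrable_bound[OF G]) (auto simp: indicator_def)
  have bound: "norm (ft f \<xi> * (cis ((s + r) \<bullet> \<xi>) - cis (s \<bullet> \<xi>))) \<le> ?F \<xi>" for \<xi>
  proof -
   define m where "m = norm (cis ((s + r) \<bullet> \<xi>) - cis (s \<bullet> \<xi>))"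
   have m1: "m \<le> \<bar>r\<bar> * \<bar>\<xi>\<bar>" using norm_cis_diff_le[of "(s + r) \<bullet> \<xi>" "s \<bullet> \<xi>"] by (simp add: m_def algebra_simps abs_mult)
   have m2: "m \<le> 2" "m \<ge> 0" using norm_cis_diff_le2 by (auto simp: m_def)
   have q: "1 + r\<^sup>2 * \<xi>\<^sup>2 > 0" by (simp add: add_pos_nonneg)
   have J0: "5 * \<epsilon> / (2 * t) * (r\<^sup>2 / (1 + r\<^sup>2 * \<xi>\<^sup>2)) \<ge> 0" using \<epsilon> t q by simp
   show ?thesis
   proof (cases "\<bar>\<xi>\<bar> > real N")
    case True
    then have x: "\<bar>\<xi>\<bar> > 0" by linarith
    have "m\<^sup>2 \<le> (\<bar>r\<bar> * \<bar>\<xi>\<bar>)\<^sup>2" using m1 m2 by (intro power_mono) auto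
    then have "m\<^sup>2 \<le> r\<^sup>2 * \<xi>\<^sup>2" by (simp add: power_mult_distrib)
    moreover have "m\<^sup>2 \<le> 4" using m2 power_mono[of m 2 2] by simp
    \<comment> \<open>The five is 1 + 4, from the bounds
      \<open>m \<le> \<bar>r\<bar> * \<bar>\<xi>\<bar>\<close> and \<open>m \<le> 2\<close>. After
      division by \<open>\<xi>\<^sup>2\<close> the majorant has the explicit integral
      \<open>5 * \<bar>r\<bar> * Kc\<close>.\<close>
    ultimately have "m\<^sup>2 * (1 + r\<^sup>2 * \<xi>\<^sup>2) \<le> 5 * (r\<^sup>2 * \<xi>\<^sup>2)"
     using mult_right_mono[of "m\<^sup>2" 4 "r\<^sup>2 * \<xi>\<^sup>2"] by (simp add: algebra_simps)
    then have mm: "m\<^sup>2 / \<xi>\<^sup>2 \<le> 5 * (r\<^sup>2 / (1 + r\<^sup>2 * \<xi>\<^sup>2))"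
     using q x by (simp add: field_simps)
    \<comment> \<open>Cauchy-Schwarz in pointwise form, balanced so that both terms come out
      proportional to \<open>t\<close> after integration.\<close>
    have "0 \<le> (t * (\<bar>\<xi>\<bar> * norm (ft f \<xi>)) - \<epsilon> * (m / \<bar>\<xi>\<bar>))\<^sup>2" by simp
    also have "... = t\<^sup>2 * (\<xi>\<^sup>2 * (norm (ft f \<xi>))\<^sup>2) - 2 * \<epsilon> * t * (norm (ft f \<xi>) * m) + \<epsilon>\<^sup>2 * (m\<^sup>2 / \<xi>\<^sup>2)"
     using x by (simp add: power2_diff power_mult_distrib power_divide)
    finally have "2 * \<epsilon> * t * (norm (ft f \<xi>) * m) \<le> t\<^sup>2 * (\<xi>\<^sup>2 * (norm (ft f \<xi>))\<^sup>2) + \<epsilon>\<^sup>2 * (m\<^sup>2 / \<xi>\<^sup>2)" by simp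
    also have "... \<le> t\<^sup>2 * G \<xi> + \<epsilon>\<^sup>2 * (5 * (r\<^sup>2 / (1 + r\<^sup>2 * \<xi>\<^sup>2)))"
     by (intro add_mono mult_left_mono mm) (auto simp: G_def intro!: mult_right_mono)
    finally have "norm (ft f \<xi>) * m \<le> (t\<^sup>2 * G \<xi> + \<epsilon>\<^sup>2 * (5 * (r\<^sup>2 / (1 + r\<^sup>2 * \<xi>\<^sup>2)))) / (2 * \<epsilon> * t)"
     using \<epsilon> t by (simp add: pos_le_divide_eq mult.commute)
    also have "... = t / (2 * \<epsilon>) * G \<xi> + 5 * \<epsilon> / (2 * t) * (r\<^sup>2 / (1 + r\<^sup>2 * \<xi>\<^sup>2))"
    proof -
     have "(t\<^sup>2 * X + \<epsilon>\<^sup>2 * (5 * Y)) / (2 * \<epsilon> * t) = t / (2 * \<epsilon>) * X + 5 * \<epsilon> / (2 * t) * Y" for X Y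
      using \<epsilon> t(1) by (simp add: field_simps power2_eq_square)
     then show ?thesis by blast
    qed
    finally have "norm (ft f \<xi>) * m \<le> t / (2 * \<epsilon>) * G \<xi> + 5 * \<epsilon> / (2 * t) * (r\<^sup>2 / (1 + r\<^sup>2 * \<xi>\<^sup>2))" .
    moreover have "0 \<le> \<bar>r\<bar> * real N * norm (ft f \<xi>)" by simp
    moreover have ind: "indicator {\<xi>. \<bar>\<xi>\<bar> > real N} \<xi> = (1::real)" using True by simp
    ultimately show ?thesis unfolding norm_mult m_def[symmetric] ind mult_1_right by linarith
   next
    case False
    then have "m \<le> \<bar>r\<bar> * real N" using m1 by (meson abs_ge_zero linorder_not_less mult_left_mono order_trans)
    then have "norm (ft f \<xi>) * m \<le> norm (ft f \<xi>) * (\<bar>r\<bar> * real N)" by (intro mult_left_mono) auto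
    then show ?thesis using False J0 by (simp add: norm_mult m_def mult_ac)
   qed
  qed
  have ix: "integrable lborel (\<lambda>\<xi>. ft f \<xi> * cis (x \<bullet> \<xi>))" for x :: real
   using integrable_cis_mult[OF ff, of "\<lambda>\<xi>. x \<bullet> \<xi>"] by (simp add: mult.commute)
  have "complex_of_real ?m * (f (s + r) - f s) = (LB \<xi>. ft f \<xi> * (cis ((s + r) \<bullet> \<xi>) - cis (s \<bullet> \<xi>)))"
   unfolding right_diff_distrib ft_inversion[OF f M c ff, symmetric]
   by (rule Bochner_Integration.integral_diff[symmetric]) (rule ix)+
  then have "?m * norm (f (s + r) - f s) = norm (LB \<xi>. ft f \<xi> * (cis ((s + r) \<bullet> \<xi>) - cis (s \<bullet> \<xi>)))"
   using m by (metis abs_of_pos norm_mult norm_of_real)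
  also have "... \<le> (LB \<xi>. norm (ft f \<xi> * (cis ((s + r) \<bullet> \<xi>) - cis (s \<bullet> \<xi>))))"
   by (rule integral_norm_bound)
  also have "... \<le> (LB \<xi>. ?F \<xi>)"
  proof (rule integral_mono)
   show "integrable lborel (\<lambda>\<xi>. norm (ft f \<xi> * (cis ((s + r) \<bullet> \<xi>) - cis (s \<bullet> \<xi>))))"
    unfolding right_diff_distrib by (intro integrable_norm Bochner_Integration.integrable_diff ix)
   show "integrable lborel ?F"
    by (rule integral_lin3[OF integrable_norm[OF ff] GN J(1)])
  qed (rule bound)
  also have "... = \<bar>r\<bar> * real N * A + t / (2 * \<epsilon>) * (LB \<xi>. G \<xi> * indicator {\<xi>. \<bar>\<xi>\<bar> > real N} \<xi>) + 5 * \<epsilon> / (2 * t) * (\<bar>r\<bar> * Kc)"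
   unfolding A_def J(2)[symmetric] by (rule integral_lin3[OF integrable_norm[OF ff] GN J(1)])
  also have "... \<le> \<bar>r\<bar> * real N * A + t / (2 * \<epsilon>) * \<epsilon>\<^sup>2 + 5 * \<epsilon> / (2 * t) * (\<bar>r\<bar> * Kc)"
   using N t \<epsilon> by (intro add_mono mult_left_mono order_refl) auto
  also have "... = t * (t * (real N * A)) + t * (\<epsilon> / 2) + t * (5 / 2 * \<epsilon> * Kc)"
   using t(1) \<epsilon> unfolding t(2)[symmetric] by (simp add: power2_eq_square)
  also have "... \<le> t * \<epsilon> + t * (\<epsilon> / 2) + t * (5 / 2 * \<epsilon> * Kc)"
   using tNA t(1) by (intro add_mono mult_left_mono order_refl) auto
  also have "... \<le> t * (\<epsilon> * (2 + 3 * Kc))"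
  proof -
   have "t * \<epsilon> + t * (\<epsilon> / 2) + t * (5 / 2 * \<epsilon> * Kc) = (t * \<epsilon>) * (3 / 2) + (t * \<epsilon> * Kc) * (5 / 2)"
    "t * (\<epsilon> * (2 + 3 * Kc)) = (t * \<epsilon>) * 2 + (t * \<epsilon> * Kc) * 3"
    by (simp_all add: field_simps)
   moreover have "t * \<epsilon> > 0" "t * \<epsilon> * Kc \<ge> 0" using t(1) \<epsilon> Kc0 by simp_all
   ultimately show ?thesis by linarith
  qed
  also have "... = ?m * (e * t)"
   using Kc0 by (simp add: \<epsilon>_def)
  finally show ?thesis
   using m by (simp add: t_def)
 qed simp
 then show ?thesis using d by blast
qed


text \<open>Young's inequality for \<open>L^1\<close> and \<open>L^2\<close>: Cauchy-Schwarz with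
  the kernel split into two square roots, then Fubini.\<close>

lemma young_L2:
 fixes k q :: "'a::euclidean_space => real"
 assumes [measurable]: "k \<in> borel_measurable borel" "q \<in> borel_measurable borel"
  and k: "\<And>x. k x \<ge> 0" and q: "\<And>x. q x \<ge> 0"
 shows "(NN \<xi>. (NN \<tau>. ennreal (k (\<xi> - \<tau>) * q \<tau>))\<^sup>2) \<le>
   (NN x. ennreal (k x))\<^sup>2 * (NN x. ennreal ((q x)\<^sup>2))"
proof -
 let ?K = "NN x. ennreal (k x)"
 have k1: "(NN \<tau>. ennreal (k (\<xi> - \<tau>))) = ?K" for \<xi>
  by (rule lborel_nn_integral_shift(2)) measurable
 have k2: "(NN \<xi>. ennreal (k (\<xi> - \<tau>))) = ?K" for \<tau>
  using lborel_nn_integral_shift(1)[of "\<lambda>x. ennreal (k x)" "- \<tau>"] by simp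
 have "(NN \<tau>. ennreal (k (\<xi> - \<tau>) * q \<tau>))\<^sup>2 \<le> ?K * (NN \<tau>. ennreal (k (\<xi> - \<tau>) * (q \<tau>)\<^sup>2))" for \<xi>
 proof -
  have "(NN \<tau>. ennreal (k (\<xi> - \<tau>) * q \<tau>)) =
    (NN \<tau>. ennreal (sqrt (k (\<xi> - \<tau>))) * ennreal (sqrt (k (\<xi> - \<tau>)) * q \<tau>))"
   using k q by (intro nn_integral_cong) (simp add: ennreal_mult[symmetric] mult.assoc[symmetric])
  also have "...\<^sup>2 \<le> (NN \<tau>. (ennreal (sqrt (k (\<xi> - \<tau>))))\<^sup>2) * (NN \<tau>. (ennreal (sqrt (k (\<xi> - \<tau>)) * q \<tau>))\<^sup>2)"
   by (rule Cauchy_Schwarz_nn_integral) measurable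
  also have "... = (NN \<tau>. ennreal (k (\<xi> - \<tau>))) * (NN \<tau>. ennreal (k (\<xi> - \<tau>) * (q \<tau>)\<^sup>2))"
   using k q by (simp add: ennreal_power power_mult_distrib)
  finally show ?thesis by (simp add: k1)
 qed
 then have "(NN \<xi>. (NN \<tau>. ennreal (k (\<xi> - \<tau>) * q \<tau>))\<^sup>2) \<le>
   (NN \<xi>. ?K * (NN \<tau>. ennreal (k (\<xi> - \<tau>) * (q \<tau>)\<^sup>2)))"
  by (intro nn_integral_mono)
 also have "... = ?K * (NN \<xi>. \<integral>\<^sup>+\<tau>. ennreal (k (\<xi> - \<tau>) * (q \<tau>)\<^sup>2) \<partial>lborel)"
  by (rule nn_integral_cmult) measurable
 also have "(NN \<xi>. \<integral>\<^sup>+\<tau>. ennreal (k (\<xi> - \<tau>) * (q \<tau>)\<^sup>2) \<partial>lborel) =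
   (NN \<tau>. \<integral>\<^sup>+\<xi>. ennreal (k (\<xi> - \<tau>) * (q \<tau>)\<^sup>2) \<partial>lborel)"
  by (rule lborel_pair.Fubini') measurable
 also have "... = (NN \<tau>. ?K * ennreal ((q \<tau>)\<^sup>2))"
  using k by (simp add: ennreal_mult nn_integral_multc k2)
 also have "... = ?K * (NN \<tau>. ennreal ((q \<tau>)\<^sup>2))"
  by (rule nn_integral_cmult) measurable
 finally show ?thesis by (simp add: power2_eq_square mult.assoc)
qed

lemma integrable_decay_real:
 assumes "n \<ge> 2"
 shows "integrable lborel (\<lambda>\<xi>::real. 1 / (1 + \<bar>\<xi>\<bar>) ^ n)"
proof (rule Bochner_Integration.integrable_bound)
 show "integrable lborel (\<lambda>\<xi>::real. 1 / (1 + norm \<xi>) ^ (2 * DIM(real)))"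
  by (rule nn_integral_decay_euclidean)
 show "AE \<xi>::real in lborel. norm (1 / (1 + \<bar>\<xi>\<bar>) ^ n) \<le> norm (1 / (1 + norm \<xi>) ^ (2 * DIM(real)))"
  using assms by (intro AE_I2) (auto intro!: divide_left_mono power_increasing)
qed measurable

text \<open>Peetre's inequality: a weight at \<open>x\<close> is moved to \<open>y\<close> at the
  price of a weight in the difference.\<close>

lemma one_add_le_mult: "1 + norm x \<le> (1 + norm (x - y)) * (1 + norm (y::'a::real_normed_vector))"
proof -
 have "norm x \<le> norm (x - y) + norm y" by (metis diff_add_cancel norm_triangle_ineq)
 moreover have "0 \<le> norm (x - y) * norm y" by simp
 moreover have "(1 + norm (x - y)) * (1 + norm y) = 1 + norm (x - y) + norm y + norm (x - y) * norm y"
  by (simp add: algebra_simps)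
 ultimately show ?thesis by linarith
qed

lemma power2_add_le_ennreal: "(a + b)\<^sup>2 \<le> 2 * a\<^sup>2 + 2 * (b::ennreal)\<^sup>2"
proof (cases "a = top \<or> b = top")
 case True
 then show ?thesis by (auto simp: power2_eq_square ennreal_mult_top)
next
 case False
 then obtain x y where xy: "a = ennreal x" "b = ennreal y" "x \<ge> 0" "y \<ge> 0"
  by (metis ennreal_cases)
 have "(x + y)\<^sup>2 \<le> 2 * x\<^sup>2 + 2 * y\<^sup>2"
  using sum_squares_bound[of x y] by (simp add: power2_eq_square algebra_simps)
 then have "ennreal ((x + y)\<^sup>2) \<le> ennreal (2 * x\<^sup>2 + 2 * y\<^sup>2)" by (rule ennreal_leI)
 then show ?thesis using xy
  by (simp add: ennreal_power[symmetric] ennreal_mult)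
qed

text \<open>Multiplication by \<open>\<eta>\<close> convolves the transform with
  \<open>ft \<eta>\<close>. Frequencies of the same sign are handled by Young's inequality. For the
  others only boundedness of \<open>ft f\<close> is available, but their distance is
  \<open>\<bar>\<xi>\<bar> + \<bar>\<tau>\<bar>\<close>, so the decay of \<open>ft \<eta>\<close>
  controls both variables. The fourth power of decay is split as 1 + 3 in the first case and as 2 +
  2 in the second.\<close>

theorem wL2_mult_half:
 fixes f :: "real => complex"
 assumes f: "integrable lborel f" and \<eta>: "test_function \<eta>" and \<sigma>: "\<sigma> = 1 \<or> \<sigma> = -1"
  and w: "wL2 f {\<xi>. \<sigma> * \<xi> > 0}"
 shows "wL2 (\<lambda>x. \<eta> x * f x) {\<xi>. \<sigma> * \<xi> > 0}"
proof -
 have i\<eta>: "integrable lborel \<eta>" by (rule test_function_integrable[OF \<eta>])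
 have [measurable]: "ft f \<in> borel_measurable borel" "ft \<eta> \<in> borel_measurable borel" "\<eta> \<in> borel_measurable borel"
  using f i\<eta> \<eta> by auto
 obtain M where M: "\<And>x. norm (\<eta> x) \<le> M" using test_function_bounded[OF \<eta>] by blast
 have i\<eta>f: "integrable lborel (\<lambda>x. \<eta> x * f x)"
  by (rule integrable_mult_bounded[OF f _ M]) auto
 have [measurable]: "ft (\<lambda>x. \<eta> x * f x) \<in> borel_measurable borel" using i\<eta>f by auto
 obtain C where C: "\<And>\<xi>. (1 + norm \<xi>) ^ 4 * norm (ft \<eta> \<xi>) \<le> C"
  using test_function_ft_decay[OF \<eta>] by metis
 have "norm (ft \<eta> 0) \<le> C" using C[of 0] by simp
 then have C0: "C \<ge> 0" using norm_ge_zero order_trans by blast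
 define A where "A = (LB x. norm (f x))"
 have A: "norm (ft f \<xi>) \<le> A" for \<xi> unfolding A_def by (rule norm_ft_le)
 have A0: "A \<ge> 0" using A[of 0] norm_ge_zero order_trans by blast
 let ?m = "(gauss_mass TYPE(real))\<^sup>2"
 have m: "?m > 0" by (rule gauss_mass_real)
 define k where "k \<xi> = C * (1 / (1 + \<bar>\<xi>\<bar>) ^ 3)" for \<xi> :: real
 define q where "q \<tau> = (1 + \<bar>\<tau>\<bar>) * norm (ft f \<tau>) * indicator {\<xi>. \<sigma> * \<xi> > 0} \<tau>" for \<tau> :: real
 have [measurable]: "k \<in> borel_measurable borel" "q \<in> borel_measurable borel" unfolding k_def q_def by measurable
 have k0: "k \<xi> \<ge> 0" and q0: "q \<xi> \<ge> 0" for \<xi> using C0 by (auto simp: k_def q_def)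
 define P where "P \<xi> = (NN \<tau>. ennreal (k (\<xi> - \<tau>) * q \<tau>))" for \<xi>
 have [measurable]: "P \<in> borel_measurable borel" unfolding P_def by measurable
 have kfin: "(NN x. ennreal (k x)) < \<infinity>"
 proof -
  have "integrable lborel k" unfolding k_def by (intro integrable_mult_right integrable_decay_real) auto
  then show ?thesis using k0 by (simp add: nn_integral_eq_integral)
 qed
 have qfin: "(NN x. ennreal ((q x)\<^sup>2)) < \<infinity>"
 proof -
  have "(NN x. ennreal ((q x)\<^sup>2)) \<le>
   (NN \<xi>. ennreal 2 * (ennreal ((1 + \<xi>\<^sup>2) * (norm (ft f \<xi>))\<^sup>2) * indicator {\<xi>. \<sigma> * \<xi> > 0} \<xi>))"
  proof (intro nn_integral_mono)
   fix \<xi> :: real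
   have "(1 + \<bar>\<xi>\<bar>)\<^sup>2 \<le> 2 * (1 + \<xi>\<^sup>2)"
    using sum_squares_bound[of 1 "\<bar>\<xi>\<bar>"] by (simp add: power2_eq_square algebra_simps)
   then have "(1 + \<bar>\<xi>\<bar>)\<^sup>2 * (norm (ft f \<xi>))\<^sup>2 \<le> 2 * ((1 + \<xi>\<^sup>2) * (norm (ft f \<xi>))\<^sup>2)"
    unfolding mult.assoc[symmetric] by (intro mult_right_mono) auto
   then show "ennreal ((q \<xi>)\<^sup>2) \<le> ennreal 2 * (ennreal ((1 + \<xi>\<^sup>2) * (norm (ft f \<xi>))\<^sup>2) * indicator {\<xi>. \<sigma> * \<xi> > 0} \<xi>)"
    by (cases "\<sigma> * \<xi> > 0") (auto simp: q_def power_mult_distrib ennreal_mult'[symmetric] mult.assoc simp del: ennreal_numeral intro!: ennreal_leI)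
  qed
  also have "... = ennreal 2 * (NN \<xi>. (ennreal ((1 + \<xi>\<^sup>2) * (norm (ft f \<xi>))\<^sup>2) * indicator {\<xi>. \<sigma> * \<xi> > 0} \<xi>))"
   by (rule nn_integral_cmult) measurable
  also have "... < \<infinity>" using w unfolding wL2_def by (simp add: ennreal_mult_less_top)
  finally show ?thesis .
 qed
 have Pfin: "(NN \<xi>. (P \<xi>)\<^sup>2) < \<infinity>"
  unfolding P_def using kfin qfin
  by (intro le_less_trans[OF young_L2]) (auto simp: k0 q0 ennreal_mult_less_top power_less_top_ennreal)
 define K2 where "K2 = (LB \<tau>. 1 / (1 + \<bar>\<tau>::real\<bar>) ^ 2)"
 have K20: "K2 \<ge> 0" unfolding K2_def by (intro Bochner_Integration.integral_nonneg) simp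
 define B where "B = C * A * K2"
 have B0: "B \<ge> 0" unfolding B_def using C0 A0 K20 by simp
 have bd: "ennreal ((1 + \<bar>\<xi>\<bar>) * (?m * norm (ft (\<lambda>x. \<eta> x * f x) \<xi>))) \<le> P \<xi> + ennreal (B * (1 / (1 + \<bar>\<xi>\<bar>)))"
  if x: "\<sigma> * \<xi> > 0" for \<xi>
 proof -
  have xp: "1 + \<bar>\<xi>\<bar> > 0" by linarith
  have int: "integrable lborel (\<lambda>\<tau>. ft \<eta> (\<xi> - \<tau>) * ft f \<tau>)"
  proof -
   have "integrable lborel (\<lambda>\<tau>. ft \<eta> (\<xi> - \<tau>))"
    using lborel_integrable_scale[OF _ test_function_ft_integrable[OF \<eta>], of "-1" \<xi>] by simp
   from integrable_mult_bounded[OF this _ A] show ?thesis by (simp add: mult.commute)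
  qed
  have "ennreal (?m * norm (ft (\<lambda>x. \<eta> x * f x) \<xi>)) = ennreal (norm (LB \<tau>. ft \<eta> (\<xi> - \<tau>) * ft f \<tau>))"
   unfolding ft_test_mult[OF \<eta> f, symmetric] norm_mult norm_of_real by simp
  also have "... \<le> (NN \<tau>. ennreal (norm (ft \<eta> (\<xi> - \<tau>) * ft f \<tau>)))"
   by (rule integral_norm_bound_ennreal[OF int])
  finally have 1: "ennreal (?m * norm (ft (\<lambda>x. \<eta> x * f x) \<xi>)) \<le> (NN \<tau>. ennreal (norm (ft \<eta> (\<xi> - \<tau>)) * norm (ft f \<tau>)))"
   by (simp add: norm_mult)
  have "ennreal ((1 + \<bar>\<xi>\<bar>) * (?m * norm (ft (\<lambda>x. \<eta> x * f x) \<xi>))) \<le>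
    ennreal (1 + \<bar>\<xi>\<bar>) * (NN \<tau>. ennreal (norm (ft \<eta> (\<xi> - \<tau>)) * norm (ft f \<tau>)))"
   using 1 by (subst ennreal_mult) (auto intro!: mult_left_mono)
  also have "... = (NN \<tau>. ennreal ((1 + \<bar>\<xi>\<bar>) * (norm (ft \<eta> (\<xi> - \<tau>)) * norm (ft f \<tau>))))"
   by (subst nn_integral_cmult[symmetric]) (auto simp: ennreal_mult)
  also have "... \<le> (NN \<tau>. ennreal (k (\<xi> - \<tau>) * q \<tau>) + ennreal (C * A * (1 / (1 + \<bar>\<xi>\<bar>)) * (1 / (1 + \<bar>\<tau>\<bar>) ^ 2)))"
  proof (intro nn_integral_mono)
   fix \<tau> :: real
   define E where "E = norm (ft \<eta> (\<xi> - \<tau>))"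
   define z where "z = 1 + \<bar>\<xi> - \<tau>\<bar>"
   have z: "z > 0" unfolding z_def by linarith
   have E0: "E \<ge> 0" by (simp add: E_def)
   have Ez: "z ^ 4 * E \<le> C" using C[of "\<xi> - \<tau>"] by (simp add: E_def z_def)
   show "ennreal ((1 + \<bar>\<xi>\<bar>) * (norm (ft \<eta> (\<xi> - \<tau>)) * norm (ft f \<tau>))) \<le>
     ennreal (k (\<xi> - \<tau>) * q \<tau>) + ennreal (C * A * (1 / (1 + \<bar>\<xi>\<bar>)) * (1 / (1 + \<bar>\<tau>\<bar>) ^ 2))"
   proof (cases "\<sigma> * \<tau> > 0")
    case True
    have "z * E \<le> C * (1 / z ^ 3)"
     using Ez z by (simp add: field_simps eval_nat_numeral)
    then have zE: "z * E \<le> k (\<xi> - \<tau>)" by (simp add: k_def z_def)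
    have "(1 + \<bar>\<xi>\<bar>) * (E * norm (ft f \<tau>)) \<le> (z * (1 + \<bar>\<tau>\<bar>)) * (E * norm (ft f \<tau>))"
     using one_add_le_mult[of \<xi> \<tau>] E0 by (intro mult_right_mono) (auto simp: z_def)
    also have "... = (z * E) * ((1 + \<bar>\<tau>\<bar>) * norm (ft f \<tau>))" by simp
    also have "... \<le> k (\<xi> - \<tau>) * ((1 + \<bar>\<tau>\<bar>) * norm (ft f \<tau>))"
     by (intro mult_right_mono zE) auto
    also have "... = k (\<xi> - \<tau>) * q \<tau>" using True by (simp add: q_def)
    finally have "ennreal ((1 + \<bar>\<xi>\<bar>) * (E * norm (ft f \<tau>))) \<le> ennreal (k (\<xi> - \<tau>) * q \<tau>)"
     by (rule ennreal_leI)
    then show ?thesis unfolding E_def by (rule add_increasing2[rotated]) simp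
   next
    case False
    have zz: "\<bar>\<xi> - \<tau>\<bar> = \<bar>\<xi>\<bar> + \<bar>\<tau>\<bar>" using \<sigma> x False by auto
    have tp: "1 + \<bar>\<tau>\<bar> > 0" by linarith
    have "(1 + \<bar>\<xi>\<bar>) * (1 + \<bar>\<xi>\<bar>) * ((1 + \<bar>\<tau>\<bar>) * (1 + \<bar>\<tau>\<bar>)) \<le> z * z * (z * z)"
     using zz by (intro mult_mono) (auto simp: z_def)
    also have "z * z * (z * z) = z ^ 4" by (simp add: eval_nat_numeral)
    finally have "(1 + \<bar>\<xi>\<bar>) * (1 + \<bar>\<xi>\<bar>) * ((1 + \<bar>\<tau>\<bar>) * (1 + \<bar>\<tau>\<bar>)) * E \<le> C"
     using Ez E0 by (meson mult_right_mono order_trans)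
    then have "(1 + \<bar>\<xi>\<bar>) * E \<le> C * (1 / (1 + \<bar>\<xi>\<bar>)) * (1 / (1 + \<bar>\<tau>\<bar>) ^ 2)"
     using xp tp by (simp add: pos_le_divide_eq power2_eq_square mult_ac)
    then have "(1 + \<bar>\<xi>\<bar>) * E * norm (ft f \<tau>) \<le> C * (1 / (1 + \<bar>\<xi>\<bar>)) * (1 / (1 + \<bar>\<tau>\<bar>) ^ 2) * A"
     by (rule mult_mono) (use C0 A in auto)
    then have "ennreal ((1 + \<bar>\<xi>\<bar>) * (E * norm (ft f \<tau>))) \<le> ennreal (C * A * (1 / (1 + \<bar>\<xi>\<bar>)) * (1 / (1 + \<bar>\<tau>\<bar>) ^ 2))"
     by (intro ennreal_leI) (simp add: mult_ac)
    then show ?thesis unfolding E_def by (rule add_increasing[rotated]) simp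
   qed
  qed
  also have "... = P \<xi> + (NN \<tau>. ennreal (C * A * (1 / (1 + \<bar>\<xi>\<bar>)) * (1 / (1 + \<bar>\<tau>\<bar>) ^ 2)))"
   unfolding P_def by (rule nn_integral_add) measurable
  also have "(NN \<tau>. ennreal (C * A * (1 / (1 + \<bar>\<xi>\<bar>)) * (1 / (1 + \<bar>\<tau>\<bar>) ^ 2))) = ennreal (C * A * (1 / (1 + \<bar>\<xi>\<bar>)) * K2)"
  proof -
   have K2i: "(NN \<tau>. ennreal (c * (1 / (1 + \<bar>\<tau>\<bar>) ^ 2))) = ennreal (c * K2)" if "c \<ge> 0" for c
    unfolding K2_def integral_mult_right_zero[symmetric]
    by (rule nn_integral_eq_integral, rule integrable_mult_right, rule integrable_decay_real)
      (use that in \<open>auto intro!: AE_I2\<close>)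
   show ?thesis by (rule K2i) (use C0 A0 in simp)
  qed
  finally show ?thesis by (simp add: B_def mult_ac)
 qed
 have "(NN \<xi>. ennreal ((1 + \<xi>\<^sup>2) * (norm (ft (\<lambda>x. \<eta> x * f x) \<xi>))\<^sup>2) * indicator {\<xi>. \<sigma> * \<xi> > 0} \<xi>) \<le>
   (NN \<xi>. ennreal (1 / ?m\<^sup>2) * (2 * (P \<xi>)\<^sup>2 + 2 * ennreal (B\<^sup>2 * (1 / (1 + \<bar>\<xi>\<bar>) ^ 2))))"
 proof (intro nn_integral_mono)
  fix \<xi> :: real
  show "ennreal ((1 + \<xi>\<^sup>2) * (norm (ft (\<lambda>x. \<eta> x * f x) \<xi>))\<^sup>2) * indicator {\<xi>. \<sigma> * \<xi> > 0} \<xi> \<le>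
   ennreal (1 / ?m\<^sup>2) * (2 * (P \<xi>)\<^sup>2 + 2 * ennreal (B\<^sup>2 * (1 / (1 + \<bar>\<xi>\<bar>) ^ 2)))"
  proof (cases "\<sigma> * \<xi> > 0")
   case True
   let ?n = "norm (ft (\<lambda>x. \<eta> x * f x) \<xi>)"
   have "1 + \<xi>\<^sup>2 \<le> (1 + \<bar>\<xi>\<bar>)\<^sup>2" by (simp add: power2_eq_square algebra_simps)
   then have "(1 + \<xi>\<^sup>2) * ?n\<^sup>2 \<le> (1 + \<bar>\<xi>\<bar>)\<^sup>2 * ?n\<^sup>2" by (intro mult_right_mono) auto
   also have "... = 1 / ?m\<^sup>2 * ((1 + \<bar>\<xi>\<bar>) * (?m * ?n))\<^sup>2"
    using m by (simp add: power_mult_distrib)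
   finally have "ennreal ((1 + \<xi>\<^sup>2) * ?n\<^sup>2) \<le> ennreal (1 / ?m\<^sup>2) * (ennreal ((1 + \<bar>\<xi>\<bar>) * (?m * ?n)))\<^sup>2"
    by (subst ennreal_power, simp, subst ennreal_mult'[symmetric], simp, intro ennreal_leI)
   also have "... \<le> ennreal (1 / ?m\<^sup>2) * (P \<xi> + ennreal (B * (1 / (1 + \<bar>\<xi>\<bar>))))\<^sup>2"
    by (intro mult_left_mono power_mono bd True) auto
   also have "(P \<xi> + ennreal (B * (1 / (1 + \<bar>\<xi>\<bar>))))\<^sup>2 \<le> 2 * (P \<xi>)\<^sup>2 + 2 * (ennreal (B * (1 / (1 + \<bar>\<xi>\<bar>))))\<^sup>2"
    by (rule power2_add_le_ennreal)
   also have "(ennreal (B * (1 / (1 + \<bar>\<xi>\<bar>))))\<^sup>2 = ennreal (B\<^sup>2 * (1 / (1 + \<bar>\<xi>\<bar>) ^ 2))"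
    using B0 by (simp add: ennreal_power power_mult_distrib power_divide)
   finally show ?thesis using True by (simp add: mult_left_mono)
  qed simp
 qed
 also have "... = ennreal (1 / ?m\<^sup>2) * (2 * (NN \<xi>. (P \<xi>)\<^sup>2) + 2 * (NN \<xi>. ennreal (B\<^sup>2 * (1 / (1 + \<bar>\<xi>\<bar>) ^ 2))))"
  by (simp add: nn_integral_cmult nn_integral_add)
 also have "... < \<infinity>"
 proof -
  have "(NN \<xi>. ennreal (B\<^sup>2 * (1 / (1 + \<bar>\<xi>\<bar>) ^ 2))) = ennreal (B\<^sup>2 * K2)"
   unfolding K2_def integral_mult_right_zero[symmetric]
   by (rule nn_integral_eq_integral, rule integrable_mult_right, rule integrable_decay_real)
     (auto intro!: AE_I2)
  then show ?thesis using Pfin by (simp add: ennreal_mult_less_top ennreal_add_less_top)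
 qed
 finally show ?thesis unfolding wL2_def .
qed

lemma wL2_UNIV_iff: "integrable lborel f ==> wL2 f UNIV \<longleftrightarrow> wL2 f {\<xi>. 1 * \<xi> > 0} \<and> wL2 f {\<xi>. -1 * \<xi> > 0}"
proof -
 assume f: "integrable lborel f"
 have [measurable]: "ft f \<in> borel_measurable borel" using f by auto
 let ?G = "\<lambda>\<xi>. ennreal ((1 + \<xi>\<^sup>2) * (norm (ft f \<xi>))\<^sup>2)"
 have "(NN \<xi>. ?G \<xi> * indicator UNIV \<xi>) =
  (NN \<xi>. ?G \<xi> * indicator {\<xi>. 1 * \<xi> > 0} \<xi> + ?G \<xi> * indicator {\<xi>. -1 * \<xi> > 0} \<xi>)"
  using AE_lborel_singleton[of "0::real"]
  by (intro nn_integral_cong_AE) (auto simp: indicator_def elim!: eventually_mono)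
 also have "... = (NN \<xi>. ?G \<xi> * indicator {\<xi>. 1 * \<xi> > 0} \<xi>) + (NN \<xi>. ?G \<xi> * indicator {\<xi>. -1 * \<xi> > 0} \<xi>)"
  by (rule nn_integral_add) measurable
 finally show ?thesis unfolding wL2_def by (simp add: ennreal_add_less_top)
qed

lemma wL2_mult:
 fixes f :: "real => complex"
 assumes f: "integrable lborel f" and \<eta>: "test_function \<eta>" and w: "wL2 f UNIV"
 shows "wL2 (\<lambda>x. \<eta> x * f x) UNIV"
proof -
 obtain M where M: "\<And>x. norm (\<eta> x) \<le> M" using test_function_bounded[OF \<eta>] by blast
 have "integrable lborel (\<lambda>x. \<eta> x * f x)"
  using \<eta> by (intro integrable_mult_bounded[OF f _ M]) auto
 then show ?thesis
  using w wL2_mult_half[OF f \<eta>] by (simp only: wL2_UNIV_iff f) blast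
qed

text \<open>Since \<open>g\<close> is real, regularity of \<open>\<eta> g\<close> in one direction is regularity of \<open>cnj \<eta> g\<close> in the
 opposite one.\<close>

lemma wL2_real_symmetric:
 fixes g :: "real => real"
 assumes g: "locally_bounded g" and \<eta>: "test_function \<eta>" and \<sigma>: "\<sigma> = 1 \<or> \<sigma> = -1"
  and w: "wL2 (\<lambda>x. \<eta> x * complex_of_real (g x)) {\<xi>. \<sigma> * \<xi> > 0}"
 shows "wL2 (\<lambda>x. cnj (\<eta> x) * (\<eta> x * complex_of_real (g x))) UNIV"
proof -
 note \<eta>c = test_function_cnj[OF \<eta>]
 have i1: "integrable lborel (\<lambda>x. \<eta> x * complex_of_real (g x))" by (rule integrable_test_mult[OF g \<eta>])
 have i2: "integrable lborel (\<lambda>x. cnj (\<eta> x) * complex_of_real (g x))" by (rule integrable_test_mult[OF g \<eta>c])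
 have [measurable]: "ft (\<lambda>x. \<eta> x * complex_of_real (g x)) \<in> borel_measurable borel"
  "ft (\<lambda>x. cnj (\<eta> x) * complex_of_real (g x)) \<in> borel_measurable borel" using i1 i2 by auto
 let ?G = "\<lambda>\<xi>. ennreal ((1 + \<xi>\<^sup>2) * (norm (ft (\<lambda>x. \<eta> x * complex_of_real (g x)) \<xi>))\<^sup>2) * indicator {\<xi>. \<sigma> * \<xi> > 0} \<xi>"
 have sy: "norm (ft (\<lambda>x. cnj (\<eta> x) * complex_of_real (g x)) \<xi>) = norm (ft (\<lambda>x. \<eta> x * complex_of_real (g x)) (- \<xi>))" for \<xi>
  using arg_cong[OF ft_cnj[of "\<lambda>x. \<eta> x * complex_of_real (g x)" "- \<xi>"], of norm] by simp
 have "wL2 (\<lambda>x. cnj (\<eta> x) * complex_of_real (g x)) {\<xi>. - \<sigma> * \<xi> > 0}"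
 proof -
  have "(NN \<xi>. ennreal ((1 + \<xi>\<^sup>2) * (norm (ft (\<lambda>x. cnj (\<eta> x) * complex_of_real (g x)) \<xi>))\<^sup>2) * indicator {\<xi>. - \<sigma> * \<xi> > 0} \<xi>)
   = (NN \<xi>. ?G (0 - \<xi>))"
   unfolding sy by (intro nn_integral_cong) (auto simp: indicator_def)
  also have "... = (NN \<xi>. ?G \<xi>)"
   by (rule lborel_nn_integral_shift(2)) measurable
  finally show ?thesis using w by (simp add: wL2_def)
 qed
 \<comment> \<open>Each half-line is multiplied by the cutoff of the other, so that both refer to
   the common cutoff \<open>cnj \<eta> * \<eta>\<close>.\<close>
 then have "wL2 (\<lambda>x. \<eta> x * (cnj (\<eta> x) * complex_of_real (g x))) {\<xi>. - \<sigma> * \<xi> > 0}"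
  using \<sigma> by (intro wL2_mult_half[OF i2 \<eta>]) auto
 then have a: "wL2 (\<lambda>x. cnj (\<eta> x) * (\<eta> x * complex_of_real (g x))) {\<xi>. - \<sigma> * \<xi> > 0}"
  by (simp only: mult_ac)
 have b: "wL2 (\<lambda>x. cnj (\<eta> x) * (\<eta> x * complex_of_real (g x))) {\<xi>. \<sigma> * \<xi> > 0}"
  by (rule wL2_mult_half[OF i1 \<eta>c \<sigma> w])
 have "integrable lborel (\<lambda>x. cnj (\<eta> x) * (\<eta> x * complex_of_real (g x)))"
 proof -
  obtain M where M: "\<And>x. norm (cnj (\<eta> x)) \<le> M" using test_function_bounded[OF \<eta>c] by blast
  show ?thesis using \<eta>c by (intro integrable_mult_bounded[OF i1 _ M]) auto
 qed
 then show ?thesis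
  using a b \<sigma> by (auto simp: wL2_UNIV_iff)
qed


section \<open>From the wavefront set to rapid decay, and Sobolev kernels tested on
  Gaussians\<close>

definition rapid_decay :: "('a::real_normed_vector => complex) => bool" where
 "rapid_decay F \<longleftrightarrow> (\<forall>N. \<exists>C. \<forall>\<xi>. (1 + norm \<xi>) ^ N * norm (F \<xi>) \<le> C)"

text \<open>A point is outside the singular support if and only if some cutoff makes the Fourier transform
 decay rapidly in all directions: finitely many of the conic neighbourhoods cover the sphere, and
 multiplication by a further cutoff only smears the Fourier transform by a rapidly decaying kernel.\<close>

theorem rapid_decay_outside_ssupp:
 fixes g :: "'a::euclidean_space => real"
 assumes g: "locally_bounded g" and y: "y \<notin> ssupp (distr_of g)"
 shows "\<exists>\<eta>. test_function \<eta> \<and> \<eta> y \<noteq> 0 \<and> rapid_decay (ft (\<lambda>x. \<eta> x * complex_of_real (g x)))"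
proof -
 have gm: "g \<in> borel_measurable borel" using g by (rule locally_bounded_measurable)
 have "\<forall>\<xi>. \<exists>\<eta> \<Gamma>. \<xi> \<noteq> 0 --> test_function \<eta> \<and> \<eta> y \<noteq> 0 \<and> open \<Gamma> \<and> \<xi> \<in> \<Gamma> \<and>
   (\<forall>t \<xi>. t > 0 --> \<xi> \<in> \<Gamma> --> t *\<^sub>R \<xi> \<in> \<Gamma>) \<and>
   (\<forall>N. \<exists>C. \<forall>\<xi>\<in>\<Gamma>. (1 + norm \<xi>) ^ N * norm (fourier_loc \<eta> (distr_of g) \<xi>) \<le> C)"
 proof
  fix \<xi>
  have "(y, \<xi>) \<notin> WF (distr_of g)" using y unfolding ssupp_def by force
  then show "\<exists>\<eta> \<Gamma>. \<xi> \<noteq> 0 --> test_function \<eta> \<and> \<eta> y \<noteq> 0 \<and> open \<Gamma> \<and> \<xi> \<in> \<Gamma> \<and>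
   (\<forall>t \<xi>. t > 0 --> \<xi> \<in> \<Gamma> --> t *\<^sub>R \<xi> \<in> \<Gamma>) \<and>
   (\<forall>N. \<exists>C. \<forall>\<xi>\<in>\<Gamma>. (1 + norm \<xi>) ^ N * norm (fourier_loc \<eta> (distr_of g) \<xi>) \<le> C)"
   unfolding WF_def by blast
 qed
 then obtain E where "\<forall>\<xi>. \<exists>\<Gamma>. \<xi> \<noteq> 0 --> test_function (E \<xi>) \<and> E \<xi> y \<noteq> 0 \<and> open \<Gamma> \<and> \<xi> \<in> \<Gamma> \<and>
   (\<forall>t \<xi>. t > 0 --> \<xi> \<in> \<Gamma> --> t *\<^sub>R \<xi> \<in> \<Gamma>) \<and>
   (\<forall>N. \<exists>C. \<forall>\<tau>\<in>\<Gamma>. (1 + norm \<tau>) ^ N * norm (fourier_loc (E \<xi>) (distr_of g) \<tau>) \<le> C)"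
  by (atomize_elim, rule choice)
 then obtain \<Gamma> where "\<forall>\<xi>. \<xi> \<noteq> 0 --> test_function (E \<xi>) \<and> E \<xi> y \<noteq> 0 \<and> open (\<Gamma> \<xi>) \<and> \<xi> \<in> \<Gamma> \<xi> \<and>
   (\<forall>t \<tau>. t > 0 --> \<tau> \<in> \<Gamma> \<xi> --> t *\<^sub>R \<tau> \<in> \<Gamma> \<xi>) \<and>
   (\<forall>N. \<exists>C. \<forall>\<tau>\<in>\<Gamma> \<xi>. (1 + norm \<tau>) ^ N * norm (fourier_loc (E \<xi>) (distr_of g) \<tau>) \<le> C)"
  by (atomize_elim, rule choice)
 note * = this
 have E: "test_function (E \<xi>)" "E \<xi> y \<noteq> 0" and o: "open (\<Gamma> \<xi>)" and mem: "\<xi> \<in> \<Gamma> \<xi>"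
  and cone: "\<And>t \<tau>. t > 0 ==> \<tau> \<in> \<Gamma> \<xi> ==> t *\<^sub>R \<tau> \<in> \<Gamma> \<xi>"
  and dec: "\<And>N. \<exists>C. \<forall>\<tau>\<in>\<Gamma> \<xi>. (1 + norm \<tau>) ^ N * norm (fourier_loc (E \<xi>) (distr_of g) \<tau>) \<le> C"
  if "\<xi> \<noteq> 0" for \<xi>
  using * that by blast+
 let ?S = "sphere (0::'a) 1"
 have S0: "u \<noteq> 0" if "u \<in> ?S" for u using that by auto
 obtain I where I: "I \<subseteq> ?S" "finite I" "?S \<subseteq> (\<Union>u\<in>I. \<Gamma> u)"
 proof (rule compactE_image[OF compact_sphere, of "?S" \<Gamma>])
  show "open (\<Gamma> u)" if "u \<in> ?S" for u using o[OF S0[OF that]] .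
  show "?S \<subseteq> (\<Union>u\<in>?S. \<Gamma> u)" using mem S0 by blast
 qed blast
 have I0: "u \<noteq> 0" if "u \<in> I" for u using I(1) S0 that by blast
 obtain u0 where u0: "u0 \<in> ?S"
  using SOME_Basis by (metis mem_sphere_0 norm_Basis)
 have Ine: "I \<noteq> {}" using I(3) u0 by blast
 \<comment> \<open>A Lebesgue number of the cover: a unit vector together with its
   \<open>e\<close>-neighbourhood lies in one cone, which separates near from far frequencies
   below.\<close>
 obtain e where e: "e > 0" "\<And>u. u \<in> ?S ==> \<exists>i\<in>I. ball u e \<subseteq> \<Gamma> i"
 proof -
  have "\<exists>e>0. \<forall>u\<in>?S. \<exists>G\<in>\<Gamma> ` I. ball u e \<subseteq> G"
   by (rule Heine_Borel_lemma[OF compact_sphere, of 0 1 "\<Gamma> ` I"]) (use I o I0 in \<open>auto\<close>)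
  then show ?thesis using that by blast
 qed
 define P where "P x = (\<Prod>i\<in>I. E i x)" for x
 have P: "test_function P"
 proof -
  obtain i where i: "i \<in> I" using Ine by blast
  have "P = (\<lambda>x. E i x * (\<Prod>j\<in>I - {i}. E j x))"
   unfolding P_def using I(2) i by (auto simp: prod.remove)
  moreover have "test_function (\<lambda>x. E i x * (\<Prod>j\<in>I - {i}. E j x))"
   using E I0 i by (intro test_function_mult smooth_on_prod test_function_smooth) auto
  ultimately show ?thesis by simp
 qed
 define Q where "Q i x = P x * (\<Prod>j\<in>I - {i}. E j x)" for i x
 have Q: "test_function (Q i)" for i
  unfolding Q_def[abs_def] using E I0 by (intro test_function_mult[OF P] smooth_on_prod test_function_smooth) auto
 define H where "H i x = E i x * complex_of_real (g x)" for i x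
 \<comment> \<open>The square of \<open>P\<close> is taken because \<open>Q i\<close>, the factor
   left after removing one \<open>E i\<close>, must still have compact support, even when
   \<open>I\<close> has a single element.\<close>
 define \<eta> where "\<eta> x = P x * P x" for x
 have \<eta>: "test_function \<eta>" unfolding \<eta>_def[abs_def] by (intro test_function_mult P test_function_smooth)
 have \<eta>y: "\<eta> y \<noteq> 0" using E I0 I(2) by (simp add: \<eta>_def P_def)
 have fac: "\<eta> x * complex_of_real (g x) = Q i x * H i x" if "i \<in> I" for i x
  using that I(2) by (simp add: \<eta>_def Q_def H_def P_def[of x] prod.remove mult_ac)
 have iH: "integrable lborel (H i)" if "i \<in> I" for i
  unfolding H_def[abs_def] using E I0 that by (intro integrable_test_mult g) auto
 let ?m = "(gauss_mass TYPE('a))\<^sup>2"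
 have m: "?m > 0" by (rule gauss_mass_real)
 have "\<exists>C. \<forall>\<xi>. (1 + norm \<xi>) ^ N * norm (ft (\<lambda>x. \<eta> x * complex_of_real (g x)) \<xi>) \<le> C" for N
 proof -
  have "\<forall>i. \<exists>C. i \<in> I --> (\<forall>\<tau>\<in>\<Gamma> i. (1 + norm \<tau>) ^ N * norm (ft (H i) \<tau>) \<le> C)"
  proof
   fix i
   show "\<exists>C. i \<in> I --> (\<forall>\<tau>\<in>\<Gamma> i. (1 + norm \<tau>) ^ N * norm (ft (H i) \<tau>) \<le> C)"
    using dec[OF I0, of i N] E(1)[OF I0, of i]
    by (auto simp: fourier_loc_distr_of[OF gm] H_def[abs_def])
  qed
  then obtain C1 where C1: "\<And>i \<tau>. i \<in> I ==> \<tau> \<in> \<Gamma> i ==> (1 + norm \<tau>) ^ N * norm (ft (H i) \<tau>) \<le> C1 i"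
   by metis
  define A where "A i = (LB x. norm (H i x))" for i
  have A: "norm (ft (H i) \<tau>) \<le> A i" for i \<tau> unfolding A_def by (rule norm_ft_le)
  define D where "D i = max \<bar>C1 i\<bar> ((1 + 1 / e) ^ N * A i)" for i
  define L where "L i = (LB \<tau>. (1 + norm \<tau>) ^ N * norm (ft (Q i) \<tau>))" for i
  have iQ: "integrable lborel (\<lambda>\<tau>. complex_of_real ((1 + norm \<tau>) ^ N) * ft (Q i) \<tau>)" for i
  proof -
   obtain C where C: "\<And>\<xi>. (1 + norm \<xi>) ^ (2 * DIM('a) + N) * norm (ft (Q i) \<xi>) \<le> C"
    using test_function_ft_decay[OF Q] by metis
   show ?thesis
   proof (rule integrable_decay[of _ C])
    show "(\<lambda>\<tau>. complex_of_real ((1 + norm \<tau>) ^ N) * ft (Q i) \<tau>) \<in> borel_measurable borel"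
     using ft_measurable[OF test_function_integrable[OF Q]] by measurable
    show "(1 + norm \<xi>) ^ (2 * DIM('a)) * norm (complex_of_real ((1 + norm \<xi>) ^ N) * ft (Q i) \<xi>) \<le> C" for \<xi>
     using C[of \<xi>] by (simp only: norm_mult norm_of_real) (simp add: power_add mult.assoc)
   qed
  qed
  have key: "(1 + norm \<xi>) ^ N * (?m * norm (ft (\<lambda>x. \<eta> x * complex_of_real (g x)) \<xi>)) \<le> D i * L i"
   if i: "i \<in> I" and b: "ball ((1 / norm \<xi>) *\<^sub>R \<xi>) e \<subseteq> \<Gamma> i" and x: "\<xi> \<noteq> 0" for i \<xi>
  proof -
   have D0: "D i \<ge> 0" by (simp add: D_def)
   let ?f = "\<lambda>\<tau>. ft (Q i) (\<xi> - \<tau>) * ft (H i) \<tau>"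
   have iQ1: "integrable lborel (\<lambda>\<tau>. (1 + norm (\<xi> - \<tau>)) ^ N * norm (ft (Q i) (\<xi> - \<tau>)))"
    using integrable_norm[OF lborel_integrable_scale[OF _ iQ, of "-1" \<xi> i]]
    by (simp add: norm_mult del: of_real_power of_real_add)
   have int: "integrable lborel ?f"
   proof -
    have "integrable lborel (\<lambda>\<tau>. ft (Q i) (\<xi> - \<tau>))"
     using lborel_integrable_scale[OF _ test_function_ft_integrable[OF Q[of i]], of "-1" \<xi>] by simp
    from integrable_mult_bounded[OF this _ A] show ?thesis using iH[OF i] by (simp add: mult.commute)
   qed
   \<comment> \<open>If \<open>\<tau>\<close> is close to \<open>\<xi>\<close> relative to
     \<open>norm \<xi>\<close>, it lies in the cone and \<open>ft (H i)\<close> decays; otherwise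
     \<open>norm \<xi>\<close> is at most a multiple of \<open>norm (\<xi> - \<tau>)\<close> and
     \<open>ft (Q i)\<close> supplies the decay.\<close>
   have pw: "(1 + norm \<xi>) ^ N * norm (?f \<tau>) \<le> D i * ((1 + norm (\<xi> - \<tau>)) ^ N * norm (ft (Q i) (\<xi> - \<tau>)))" for \<tau>
   proof (cases "norm (\<xi> - \<tau>) < e * norm \<xi>")
    case True
    have "norm ((1 / norm \<xi>) *\<^sub>R \<xi> - (1 / norm \<xi>) *\<^sub>R \<tau>) = norm (\<xi> - \<tau>) / norm \<xi>"
     by (simp add: scaleR_diff_right[symmetric] divide_inverse mult.commute)
    also have "... < e" using True x by (simp add: field_simps)
    finally have "(1 / norm \<xi>) *\<^sub>R \<tau> \<in> \<Gamma> i" using b by (auto simp: dist_norm)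
    from cone[OF I0[OF i] _ this, of "norm \<xi>"] have "\<tau> \<in> \<Gamma> i" using x by simp
    then have c: "(1 + norm \<tau>) ^ N * norm (ft (H i) \<tau>) \<le> D i"
     using C1[OF i, of \<tau>] unfolding D_def by linarith
    have "(1 + norm \<xi>) ^ N \<le> ((1 + norm (\<xi> - \<tau>)) * (1 + norm \<tau>)) ^ N"
     by (intro power_mono one_add_le_mult) auto
    then have "(1 + norm \<xi>) ^ N * norm (?f \<tau>) \<le> ((1 + norm (\<xi> - \<tau>)) * (1 + norm \<tau>)) ^ N * norm (?f \<tau>)"
     by (intro mult_right_mono) auto
    also have "... = ((1 + norm \<tau>) ^ N * norm (ft (H i) \<tau>)) * ((1 + norm (\<xi> - \<tau>)) ^ N * norm (ft (Q i) (\<xi> - \<tau>)))"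
     by (simp add: norm_mult power_mult_distrib)
    also have "... \<le> D i * ((1 + norm (\<xi> - \<tau>)) ^ N * norm (ft (Q i) (\<xi> - \<tau>)))"
     by (intro mult_right_mono c) auto
    finally show ?thesis .
   next
    case False
    then have "norm \<xi> \<le> (1 / e) * norm (\<xi> - \<tau>)" using e(1) by (simp add: field_simps)
    moreover have "(1 + 1 / e) * (1 + norm (\<xi> - \<tau>)) = 1 + norm (\<xi> - \<tau>) + 1 / e + (1 / e) * norm (\<xi> - \<tau>)"
     by (simp add: algebra_simps)
    moreover have "1 / e > 0" "norm (\<xi> - \<tau>) \<ge> 0" using e(1) by auto
    ultimately have "1 + norm \<xi> \<le> (1 + 1 / e) * (1 + norm (\<xi> - \<tau>))" by linarith
    then have "(1 + norm \<xi>) ^ N \<le> ((1 + 1 / e) * (1 + norm (\<xi> - \<tau>))) ^ N"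
     by (intro power_mono) auto
    then have "(1 + norm \<xi>) ^ N * norm (?f \<tau>) \<le> ((1 + 1 / e) * (1 + norm (\<xi> - \<tau>))) ^ N * norm (?f \<tau>)"
     by (intro mult_right_mono) auto
    also have "... = ((1 + 1 / e) ^ N * norm (ft (H i) \<tau>)) * ((1 + norm (\<xi> - \<tau>)) ^ N * norm (ft (Q i) (\<xi> - \<tau>)))"
     by (simp add: norm_mult power_mult_distrib)
    also have "... \<le> D i * ((1 + norm (\<xi> - \<tau>)) ^ N * norm (ft (Q i) (\<xi> - \<tau>)))"
    proof (intro mult_right_mono)
     have "(1 + 1 / e) ^ N * norm (ft (H i) \<tau>) \<le> (1 + 1 / e) ^ N * A i"
      using e(1) by (intro mult_left_mono A) auto
     then show "(1 + 1 / e) ^ N * norm (ft (H i) \<tau>) \<le> D i" by (simp add: D_def)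
    qed auto
    finally show ?thesis .
   qed
   have "complex_of_real ?m * ft (\<lambda>x. \<eta> x * complex_of_real (g x)) \<xi> = (LB \<tau>. ?f \<tau>)"
    unfolding fac[OF i] by (rule ft_test_mult[OF Q iH[OF i]])
   then have "?m * norm (ft (\<lambda>x. \<eta> x * complex_of_real (g x)) \<xi>) = norm (LB \<tau>. ?f \<tau>)"
    using m by (metis abs_of_pos norm_mult norm_of_real)
   then have "(1 + norm \<xi>) ^ N * (?m * norm (ft (\<lambda>x. \<eta> x * complex_of_real (g x)) \<xi>)) \<le>
     (1 + norm \<xi>) ^ N * (LB \<tau>. norm (?f \<tau>))"
    by (auto intro!: mult_left_mono integral_norm_bound simp del: norm_mult)
   also have "... = (LB \<tau>. (1 + norm \<xi>) ^ N * norm (?f \<tau>))"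
    by (rule integral_mult_right_zero[symmetric])
   also have "... \<le> (LB \<tau>. D i * ((1 + norm (\<xi> - \<tau>)) ^ N * norm (ft (Q i) (\<xi> - \<tau>))))"
    by (rule integral_mono) (use int iQ1 pw in \<open>auto intro!: integrable_mult_right simp del: norm_mult\<close>)
   also have "... = D i * (LB \<tau>. (1 + norm (\<xi> - \<tau>)) ^ N * norm (ft (Q i) (\<xi> - \<tau>)))"
    by (rule integral_mult_right_zero)
   also have "(LB \<tau>. (1 + norm (\<xi> - \<tau>)) ^ N * norm (ft (Q i) (\<xi> - \<tau>))) = L i"
    unfolding L_def
    using ft_measurable[OF test_function_integrable[OF Q]]
    by (subst lborel_integral_scale[of "-1" _ \<xi>]) auto
   finally show ?thesis .
  qed
  have L0: "L i \<ge> 0" "D i \<ge> 0" for i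
   unfolding L_def D_def by (auto intro!: Bochner_Integration.integral_nonneg)
  define C where "C = (\<Sum>i\<in>I. D i * L i) / ?m"
  have all: "(1 + norm \<xi>) ^ N * norm (ft (\<lambda>x. \<eta> x * complex_of_real (g x)) \<xi>) \<le> C" if x: "\<xi> \<noteq> 0" for \<xi>
  proof -
   have "(1 / norm \<xi>) *\<^sub>R \<xi> \<in> ?S" using x by simp
   then obtain i where i: "i \<in> I" "ball ((1 / norm \<xi>) *\<^sub>R \<xi>) e \<subseteq> \<Gamma> i" using e(2) by blast
   have "(1 + norm \<xi>) ^ N * (?m * norm (ft (\<lambda>x. \<eta> x * complex_of_real (g x)) \<xi>)) \<le> D i * L i"
    by (rule key[OF i x])
   also have "... \<le> (\<Sum>i\<in>I. D i * L i)"
    using I(2) i(1) L0 by (intro member_le_sum) auto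
   finally show ?thesis unfolding C_def using m by (simp add: pos_le_divide_eq mult_ac)
  qed
  show ?thesis
  proof (intro exI allI)
   fix \<xi>
   show "(1 + norm \<xi>) ^ N * norm (ft (\<lambda>x. \<eta> x * complex_of_real (g x)) \<xi>) \<le> max C (norm (ft (\<lambda>x. \<eta> x * complex_of_real (g x)) 0))"
    by (cases "\<xi> = 0") (use all[of \<xi>] in auto)
  qed
 qed
 then show ?thesis using \<eta> \<eta>y unfolding rapid_decay_def by blast
qed

text \<open>Inversion at both points, with
  \<open>norm (cis a - cis b) \<le> \<bar>a - b\<bar>\<close> bringing in one power of
  \<open>norm \<xi>\<close>. It is restricted to points of continuity because it will be applied
  along a single slice.\<close>

lemma rapid_decay_lipschitz:
 fixes f :: "'a::euclidean_space => complex"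
 assumes f: "integrable lborel f" and M: "\<And>x. norm (f x) \<le> M" and r: "rapid_decay (ft f)"
 shows "\<exists>C. \<forall>x y. isCont f x --> isCont f y --> norm (f x - f y) \<le> C * norm (x - y)"
proof -
 have [measurable]: "ft f \<in> borel_measurable borel" using f by (rule ft_measurable)
 obtain C0 where "\<And>\<xi>. (1 + norm \<xi>) ^ (2 * DIM('a)) * norm (ft f \<xi>) \<le> C0"
  using r unfolding rapid_decay_def by metis
 then have 1: "integrable lborel (ft f)"
  by (rule integrable_decay[rotated]) measurable
 obtain C where C: "\<And>\<xi>. (1 + norm \<xi>) ^ (2 * DIM('a) + 1) * norm (ft f \<xi>) \<le> C"
  using r unfolding rapid_decay_def by metis
 have 2: "integrable lborel (\<lambda>\<xi>. complex_of_real (norm \<xi>) * ft f \<xi>)"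
 proof (rule integrable_decay[of _ C])
  fix \<xi> :: 'a
  have "(1 + norm \<xi>) ^ (2 * DIM('a)) * norm (complex_of_real (norm \<xi>) * ft f \<xi>) \<le> (1 + norm \<xi>) ^ (2 * DIM('a)) * ((1 + norm \<xi>) * norm (ft f \<xi>))"
   by (intro mult_left_mono) (auto simp: norm_mult intro!: mult_right_mono)
  also have "... \<le> C" using C[of \<xi>] by (simp add: mult_ac)
  finally show "(1 + norm \<xi>) ^ (2 * DIM('a)) * norm (complex_of_real (norm \<xi>) * ft f \<xi>) \<le> C" .
 qed measurable
 define A where "A = (LB \<xi>. norm (complex_of_real (norm \<xi>) * ft f \<xi>))"
 let ?m = "(gauss_mass TYPE('a))\<^sup>2"
 have m: "?m > 0" by (rule gauss_mass_real)
 have ix: "integrable lborel (\<lambda>\<xi>. ft f \<xi> * cis (x \<bullet> \<xi>))" for x :: 'a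
  using integrable_cis_mult[OF 1, of "\<lambda>\<xi>. x \<bullet> \<xi>"] by (simp add: mult.commute)
 have "norm (f x - f y) \<le> (A / ?m) * norm (x - y)" if "isCont f x" "isCont f y" for x y
 proof -
  have "complex_of_real ?m * (f x - f y) = (LB \<xi>. ft f \<xi> * (cis (x \<bullet> \<xi>) - cis (y \<bullet> \<xi>)))"
   unfolding right_diff_distrib ft_inversion[OF f M that(1) 1, symmetric] ft_inversion[OF f M that(2) 1, symmetric]
   by (rule Bochner_Integration.integral_diff[symmetric]) (rule ix)+
  then have "?m * norm (f x - f y) = norm (LB \<xi>. ft f \<xi> * (cis (x \<bullet> \<xi>) - cis (y \<bullet> \<xi>)))"
   using m by (metis abs_of_pos norm_mult norm_of_real)
  also have "... \<le> (LB \<xi>. norm (ft f \<xi> * (cis (x \<bullet> \<xi>) - cis (y \<bullet> \<xi>))))"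
   by (rule integral_norm_bound)
  also have "... \<le> (LB \<xi>. norm (x - y) * norm (complex_of_real (norm \<xi>) * ft f \<xi>))"
  proof (rule integral_mono)
   show "integrable lborel (\<lambda>\<xi>. norm (ft f \<xi> * (cis (x \<bullet> \<xi>) - cis (y \<bullet> \<xi>))))"
    unfolding right_diff_distrib by (intro integrable_norm Bochner_Integration.integrable_diff ix)
   show "integrable lborel (\<lambda>\<xi>. norm (x - y) * norm (complex_of_real (norm \<xi>) * ft f \<xi>))"
    by (intro integrable_mult_right integrable_norm 2)
   fix \<xi>
   have "norm (cis (x \<bullet> \<xi>) - cis (y \<bullet> \<xi>)) \<le> \<bar>(x - y) \<bullet> \<xi>\<bar>"
    using norm_cis_diff_le by (simp add: inner_diff_left)
   also have "... \<le> norm (x - y) * norm \<xi>" by (rule Cauchy_Schwarz_ineq2)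
   finally have "norm (ft f \<xi>) * norm (cis (x \<bullet> \<xi>) - cis (y \<bullet> \<xi>)) \<le> norm (ft f \<xi>) * (norm (x - y) * norm \<xi>)"
    by (intro mult_left_mono) auto
   then show "norm (ft f \<xi> * (cis (x \<bullet> \<xi>) - cis (y \<bullet> \<xi>))) \<le> norm (x - y) * norm (complex_of_real (norm \<xi>) * ft f \<xi>)"
    by (simp add: norm_mult mult_ac)
  qed
  also have "... = norm (x - y) * A" unfolding A_def by (rule integral_mult_right_zero)
  finally show ?thesis using m by (simp add: pos_le_divide_eq mult_ac)
 qed
 then show ?thesis by blast
qed

lemma completion_ex_borel_complex:
 fixes h :: "'a => complex"
 assumes "h \<in> borel_measurable (completion M)"
 shows "\<exists>h'\<in>borel_measurable M. AE x in M. h x = h' x"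
proof -
 have "(\<lambda>x. Re (h x)) \<in> borel_measurable (completion M)" "(\<lambda>x. Im (h x)) \<in> borel_measurable (completion M)"
  using assms by measurable
 then obtain p q where pq: "p \<in> borel_measurable M" "AE x in M. Re (h x) = p x"
  "q \<in> borel_measurable M" "AE x in M. Im (h x) = q x"
  using completion_ex_borel_measurable_real[of "\<lambda>x. Re (h x)" M] completion_ex_borel_measurable_real[of "\<lambda>x. Im (h x)" M]
  by blast
 show ?thesis
 proof (rule bexI[where x="\<lambda>x. complex_of_real (p x) + \<i> * complex_of_real (q x)"])
  show "AE x in M. h x = complex_of_real (p x) + \<i> * complex_of_real (q x)"
   using pq(2,4) by eventually_elim (simp add: complex_eq_iff)
  show "(\<lambda>x. complex_of_real (p x) + \<i> * complex_of_real (q x)) \<in> borel_measurable M"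
   using pq(1,3) by measurable
 qed
qed

text \<open>The Fourier transform \<open>h\<close> of \<open>\<phi>\<close> is only known by duality; testing it on modulated Gaussians
 yields the Gaussian means of \<open>\<phi>\<close>.\<close>

lemma sobolev_gauss_means:
 fixes \<phi> \<phi>' :: "'a::euclidean_space => real"
 assumes S: "distr_of \<phi> \<in> sobolev lam \<infinity>"
  and \<phi>: "\<phi> \<in> borel_measurable lebesgue" "\<phi>' \<in> borel_measurable borel" "AE x in lborel. \<phi> x = \<phi>' x"
 obtains h C where "h \<in> borel_measurable borel" "\<And>\<xi>. norm (h \<xi>) \<le> C * (1 + (norm \<xi>)\<^sup>2) powr (- (lam / 2))"
  "\<And>z a. a > 0 ==> (LB y. complex_of_real (\<phi>' y) * complex_of_real (gker a (z - y))) =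
    (LB \<xi>. h \<xi> * (cis (z \<bullet> \<xi>) * complex_of_real (gauss (a *\<^sub>R \<xi>))))"
proof -
 obtain h C where h: "h \<in> borel_measurable lebesgue"
  "\<And>\<psi>. schwartz \<psi> ==> distr_of \<phi> (fourier \<psi>) = (LINT \<xi>|lebesgue. h \<xi> * \<psi> \<xi>)"
  "AE \<xi> in lebesgue. norm (complex_of_real ((1 + (norm \<xi>)\<^sup>2) powr (lam / 2)) * h \<xi>) \<le> C"
  using S unfolding sobolev_def in_Lp_def by auto
 obtain h' where h': "h' \<in> borel_measurable borel" "AE \<xi> in lborel. h \<xi> = h' \<xi>"
  using completion_ex_borel_complex[OF h(1)] by auto
 have p: "1 + (norm \<xi>)\<^sup>2 > 0" for \<xi> :: 'a by (simp add: add_pos_nonneg)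
 \<comment> \<open>Setting \<open>h'\<close> to zero where the decay bound fails changes it only on
   a null set and makes the bound hold everywhere.\<close>
 define H where "H \<xi> = (if norm (h' \<xi>) \<le> \<bar>C\<bar> * (1 + (norm \<xi>)\<^sup>2) powr (- (lam / 2)) then h' \<xi> else 0)" for \<xi>
 have Hm [measurable]: "H \<in> borel_measurable borel" unfolding H_def using h'(1) by measurable
 have "AE \<xi> in lborel. norm (complex_of_real ((1 + (norm \<xi>)\<^sup>2) powr (lam / 2)) * h \<xi>) \<le> C"
  using h(3) by (simp add: AE_completion_iff)
 with h'(2) have hH: "AE \<xi> in lborel. h \<xi> = H \<xi>"
 proof eventually_elim
  case (elim \<xi>)
  define P where "P = (1 + (norm \<xi>)\<^sup>2) powr (lam / 2)"
  have P: "P > 0" unfolding P_def using p[of \<xi>] by simp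
  have "P * norm (h \<xi>) \<le> \<bar>C\<bar>" using elim(2) P by (simp add: norm_mult P_def)
  then have "norm (h \<xi>) \<le> \<bar>C\<bar> * inverse P" using P by (simp add: field_simps)
  then show ?case using elim(1) by (simp add: H_def P_def powr_minus)
 qed
 show ?thesis
 proof (rule that[of H "\<bar>C\<bar>"])
  fix z :: 'a and a :: real assume a: "a > 0"
  let ?\<psi> = "\<lambda>\<xi>. cis (z \<bullet> \<xi>) * complex_of_real (gauss (a *\<^sub>R \<xi>))"
  note [measurable] = \<phi>(2)
  have f: "fourier ?\<psi> = (\<lambda>y. complex_of_real (gker a (z - y)))"
   using a by (auto simp: fun_eq_iff fourier_eq_ft ft_mod_gauss)
  have "(LB y. complex_of_real (\<phi>' y) * complex_of_real (gker a (z - y))) =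
    (LINT y|lebesgue. complex_of_real (\<phi>' y) * complex_of_real (gker a (z - y)))"
   by (intro integral_completion[symmetric]) measurable
  also have "... = (LINT y|lebesgue. complex_of_real (\<phi> y) * complex_of_real (gker a (z - y)))"
  proof (rule integral_cong_AE)
   have gm: "(\<lambda>y. complex_of_real (gker a (z - y))) \<in> borel_measurable lebesgue"
    by (rule measurable_completion) measurable
   have pm: "\<phi>' \<in> borel_measurable lebesgue" using \<phi>(2) by (intro measurable_completion) simp
   show "(\<lambda>y. complex_of_real (\<phi>' y) * complex_of_real (gker a (z - y))) \<in> borel_measurable lebesgue"
    using gm pm by measurable
   show "(\<lambda>y. complex_of_real (\<phi> y) * complex_of_real (gker a (z - y))) \<in> borel_measurable lebesgue"
    using gm \<phi>(1) by measurable
   show "AE y in lebesgue. complex_of_real (\<phi>' y) * complex_of_real (gker a (z - y)) = complex_of_real (\<phi> y) * complex_of_real (gker a (z - y))"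
    using \<phi>(3) by (auto simp: AE_completion_iff intro!: AE_completion elim!: eventually_mono)
  qed
  also have "... = (LINT \<xi>|lebesgue. h \<xi> * ?\<psi> \<xi>)"
   using h(2)[OF schwartz_mod_gauss[OF a, of z]] unfolding f distr_of_def .
  also have "... = (LINT \<xi>|lebesgue. H \<xi> * ?\<psi> \<xi>)"
  proof (rule integral_cong_AE)
   have gm: "?\<psi> \<in> borel_measurable lebesgue"
    by (rule measurable_completion) measurable
   have pm: "H \<in> borel_measurable lebesgue" by (intro measurable_completion) simp
   show "(\<lambda>\<xi>. H \<xi> * ?\<psi> \<xi>) \<in> borel_measurable lebesgue" "(\<lambda>\<xi>. h \<xi> * ?\<psi> \<xi>) \<in> borel_measurable lebesgue"
    using gm pm h(1) by measurable
   show "AE \<xi> in lebesgue. h \<xi> * ?\<psi> \<xi> = H \<xi> * ?\<psi> \<xi>"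
    using hH by (auto intro!: AE_completion elim!: eventually_mono)
  qed
  also have "... = (LB \<xi>. H \<xi> * ?\<psi> \<xi>)"
   by (rule integral_completion) measurable
  finally show "(LB y. complex_of_real (\<phi>' y) * complex_of_real (gker a (z - y))) = (LB \<xi>. H \<xi> * ?\<psi> \<xi>)" .
 qed (auto simp: H_def)
qed

section \<open>Convolution with the smoothing kernel\<close>

text \<open>The multiplier of the convolution is \<open>h\<close>, square integrable as
  \<open>2 * lam\<close> exceeds the dimension, and \<open>ft D\<close> is bounded by the
  \<open>L^1\<close> norm of \<open>D\<close>. As \<open>h\<close> is tied to the kernel only
  through Gaussian means, the product formula is derived for regularised functions, and Fatou keeps
  the bound in the limit.\<close>

theorem sobolev_conv_L2:
 fixes \<phi> \<phi>' :: "'a::euclidean_space => real"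
 assumes S: "distr_of \<phi> \<in> sobolev lam \<infinity>" and lam: "lam > DIM('a) / 2"
  and \<phi>: "\<phi> \<in> borel_measurable lebesgue" "AE x in lborel. \<phi> x = \<phi>' x" and \<phi>': "integrable lborel \<phi>'"
 shows "\<exists>K. \<forall>D B. continuous_on UNIV D --> integrable lborel D --> (\<forall>x. \<bar>D x\<bar> \<le> B) -->
   (NN x. ennreal ((LB y. \<phi>' y * D (x - y))\<^sup>2)) \<le> ennreal (K * (LB x. \<bar>D x\<bar>)\<^sup>2)"
proof -
 have \<phi>'m [measurable]: "\<phi>' \<in> borel_measurable borel" using \<phi>' by (rule borel_measurable_integrable_lborel)
 obtain h C where hm [measurable]: "h \<in> borel_measurable borel"
  and h: "\<And>\<xi>. norm (h \<xi>) \<le> C * (1 + (norm \<xi>)\<^sup>2) powr (- (lam / 2))"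
  and means: "\<And>z a. a > 0 ==> (LB y. complex_of_real (\<phi>' y) * complex_of_real (gker a (z - y))) =
    (LB \<xi>. h \<xi> * (cis (z \<bullet> \<xi>) * complex_of_real (gauss (a *\<^sub>R \<xi>))))"
  by (rule sobolev_gauss_means[OF S \<phi>(1) \<phi>'m \<phi>(2)]) (rule that)
 let ?m = "(gauss_mass TYPE('a))\<^sup>2"
 have m: "?m > 0" by (rule gauss_mass_real)
 have lam0: "lam > 0"
 proof -
  have "real DIM('a) / 2 > 0" by simp
  then show ?thesis using lam by linarith
 qed
 have C0: "C \<ge> 0" using order_trans[OF norm_ge_zero h[of 0]] by simp
 have hb: "norm (h \<xi>) \<le> C" for \<xi>
 proof -
  have "1 \<le> 1 + (norm \<xi>)\<^sup>2" by simp
  then have "(1 + (norm \<xi>)\<^sup>2) powr (- (lam / 2)) \<le> 1 powr (- (lam / 2))"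
   using lam0 by (intro powr_mono2') auto
  then have "C * (1 + (norm \<xi>)\<^sup>2) powr (- (lam / 2)) \<le> C * 1"
   using C0 by (intro mult_left_mono) auto
  then show ?thesis using h[of \<xi>] by linarith
 qed
 have h2fin: "(NN \<xi>. ennreal ((norm (h \<xi>))\<^sup>2)) < \<infinity>"
 proof -
  have "(NN \<xi>. ennreal ((norm (h \<xi>))\<^sup>2)) \<le> (NN \<xi>. ennreal (C\<^sup>2) * ennreal ((1 + (norm (\<xi>::'a))\<^sup>2) powr (- lam)))"
  proof (intro nn_integral_mono)
   fix \<xi> :: 'a
   have "1 + (norm \<xi>)\<^sup>2 > 0" by (simp add: add_pos_nonneg)
   then have "((1 + (norm \<xi>)\<^sup>2) powr (- (lam / 2)))\<^sup>2 = (1 + (norm \<xi>)\<^sup>2) powr (- lam)"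
    by (subst powr_power) auto
   moreover have "(norm (h \<xi>))\<^sup>2 \<le> (C * (1 + (norm \<xi>)\<^sup>2) powr (- (lam / 2)))\<^sup>2"
    by (intro power_mono h) auto
   ultimately have "(norm (h \<xi>))\<^sup>2 \<le> C\<^sup>2 * (1 + (norm \<xi>)\<^sup>2) powr (- lam)"
    by (simp only: power_mult_distrib)
   then show "ennreal ((norm (h \<xi>))\<^sup>2) \<le> ennreal (C\<^sup>2) * ennreal ((1 + (norm \<xi>)\<^sup>2) powr (- lam))"
    by (subst ennreal_mult'[symmetric]) (auto intro: ennreal_leI)
  qed
  also have "... = ennreal (C\<^sup>2) * (NN \<xi>. ennreal ((1 + (norm (\<xi>::'a))\<^sup>2) powr (- lam)))"
   by (rule nn_integral_cmult) measurable
  also have "... < \<infinity>"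
   using nn_integral_japanese_euclidean[OF lam] by (simp add: ennreal_mult_less_top)
  finally show ?thesis .
 qed
 then obtain W where W: "(NN \<xi>. ennreal ((norm (h \<xi>))\<^sup>2)) = ennreal W" "W \<ge> 0"
  by (metis ennreal_cases infinity_ennreal_def less_irrefl)
 have main: "(NN x. ennreal ((LB y. \<phi>' y * D (x - y))\<^sup>2)) \<le> ennreal ((W / ?m) * (LB x. \<bar>D x\<bar>)\<^sup>2)"
  if Dc: "continuous_on UNIV D" and Di: "integrable lborel D" and Db: "\<And>x. \<bar>D x\<bar> \<le> B" for D B
 proof -
  have Dm [measurable]: "D \<in> borel_measurable borel" using Di by (rule borel_measurable_integrable_lborel)
  have B0: "B \<ge> 0" using Db[of 0] by simp
  define Dz where "Dz x = complex_of_real (D x)" for x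
  define \<phi>z where "\<phi>z x = complex_of_real (\<phi>' x)" for x
  have Dz: "integrable lborel Dz" "Dz \<in> borel_measurable borel" "\<And>x. norm (Dz x) \<le> B" "\<And>x. isCont Dz x"
  proof -
   show "isCont Dz x" for x
    using Dc unfolding Dz_def[abs_def] by (auto simp: continuous_on_eq_continuous_at)
  qed (use Di Db in \<open>auto simp: Dz_def[abs_def]\<close>)
  have \<phi>z: "integrable lborel \<phi>z" "\<phi>z \<in> borel_measurable borel" using \<phi>' by (auto simp: \<phi>z_def[abs_def])
  note [measurable] = Dz(2) \<phi>z(2)
  define L where "L = (LB x. \<bar>D x\<bar>)"
  have L: "norm (ft Dz \<xi>) \<le> L" for \<xi> using norm_ft_le[of Dz \<xi>] by (simp add: L_def Dz_def)
  let ?a = "\<lambda>n. 1 / real (Suc n)"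
  have a: "?a n > 0" for n by simp
  \<comment> \<open>Regularised transform of the convolution; the Gaussian factor makes it
    integrable and gives access to \<open>means\<close>.\<close>
  define k where "k n \<xi> = h \<xi> * (complex_of_real (gauss (?a n *\<^sub>R \<xi>)) * ft Dz \<xi>)" for n \<xi>
  have k2: "integrable lborel (\<lambda>\<xi>. h \<xi> * (cis (z \<bullet> \<xi>) * complex_of_real (gauss (?a n *\<^sub>R \<xi>))))" for z n
   by (rule integrable_mult_bounded[OF integrable_mod_gauss[OF a] _ hb]) measurable
  have ki: "integrable lborel (k n)" for n
  proof -
   have "integrable lborel (\<lambda>\<xi>. ft Dz \<xi> * (h \<xi> * (cis (0 \<bullet> \<xi>) * complex_of_real (gauss (?a n *\<^sub>R \<xi>)))))"
    by (rule integrable_mult_bounded[OF k2 _ L]) (rule ft_measurable[OF Dz(1)])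
   then show ?thesis by (simp add: k_def[abs_def] mult_ac)
  qed
  have gb: "norm (complex_of_real (gker (?a n) (z :: 'a))) \<le> gauss_mass TYPE('a) / ?a n ^ DIM('a)" for n z
   using a[of n] gauss_mass_pos[where 'a='a] gauss_le_1
   by (auto simp: gker_def norm_mult norm_divide norm_power simp del: of_nat_Suc intro!: divide_right_mono mult_left_le)
  \<comment> \<open>Duality leads to modulated Gaussian integrals of \<open>h\<close>, which
    \<open>means\<close> rewrites as means of the kernel; Fubini regroups them as means of
    \<open>D\<close>.\<close>
  have eq: "ft (k n) (- x) = (LB y. \<phi>z y * (LB w. Dz w * complex_of_real (gker (?a n) ((x - y) - w))))" for n x
  proof -
   let ?k2 = "\<lambda>\<xi>. h \<xi> * (cis (x \<bullet> \<xi>) * complex_of_real (gauss (?a n *\<^sub>R \<xi>)))"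
   have "ft (k n) (- x) = (LB \<xi>. ft Dz \<xi> * ?k2 \<xi>)"
    unfolding ft_def[of "k n"] k_def by (intro Bochner_Integration.integral_cong refl) (simp add: inner_commute)
   also have "... = (LB w. Dz w * ft ?k2 w)"
    by (rule ft_duality[OF Dz(1) k2])
   also have "... = (LB w. LB y. complex_of_real (gker (?a n) ((x - y) - w)) * (Dz w * \<phi>z y))"
   proof (intro Bochner_Integration.integral_cong refl)
    fix w
    have "ft ?k2 w = (LB \<xi>. h \<xi> * (cis ((x - w) \<bullet> \<xi>) * complex_of_real (gauss (?a n *\<^sub>R \<xi>))))"
     unfolding ft_def
     by (intro Bochner_Integration.integral_cong refl) (simp add: inner_diff_left inner_diff_right inner_commute mult_ac cis_mult)
    also have "... = (LB y. \<phi>z y * complex_of_real (gker (?a n) ((x - w) - y)))"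
     using means[OF a[of n], of "x - w"] by (simp add: \<phi>z_def)
    finally have "Dz w * ft ?k2 w = (LB y. Dz w * (\<phi>z y * complex_of_real (gker (?a n) ((x - w) - y))))"
     by simp
    also have "... = (LB y. complex_of_real (gker (?a n) ((x - y) - w)) * (Dz w * \<phi>z y))"
     by (intro Bochner_Integration.integral_cong refl) (simp add: mult_ac algebra_simps)
    finally show "Dz w * ft ?k2 w = (LB y. complex_of_real (gker (?a n) ((x - y) - w)) * (Dz w * \<phi>z y))" .
   qed
   also have "... = (LB y. LB w. complex_of_real (gker (?a n) ((x - y) - w)) * (Dz w * \<phi>z y))"
   proof -
    have "integrable (lborel \<Otimes>\<^sub>M lborel) (\<lambda>(w, y). (\<lambda>(w, y). complex_of_real (gker (?a n) ((x - y) - w))) (w, y) * (Dz w * \<phi>z y))"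
     by (rule integrable_pair_bounded[OF Dz(1) \<phi>z(1), where M="gauss_mass TYPE('a) / ?a n ^ DIM('a)"]) (use gb in auto)
    then show ?thesis
     by (intro lborel_pair.Fubini_integral[symmetric]) simp
   qed
   also have "... = (LB y. \<phi>z y * (LB w. Dz w * complex_of_real (gker (?a n) ((x - y) - w))))"
    by (subst integral_mult_right_zero[symmetric]) (simp add: mult_ac)
   finally show ?thesis .
  qed
  have lim: "(\<lambda>n. ft (k n) (- x)) \<longlonglongrightarrow> complex_of_real (?m * (LB y. \<phi>' y * D (x - y)))" for x
  proof -
   have "(\<lambda>n. LB y. \<phi>z y * (LB w. Dz w * complex_of_real (gker (?a n) ((x - y) - w))))
     \<longlonglongrightarrow> (LB y. \<phi>z y * (complex_of_real ?m * Dz (x - y)))"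
   proof (rule integral_dominated_convergence[where w="\<lambda>y. B * ?m * norm (\<phi>z y)"])
    show "integrable lborel (\<lambda>y. B * ?m * norm (\<phi>z y))" using \<phi>z(1) by simp
    show "AE y in lborel. (\<lambda>n. \<phi>z y * (LB w. Dz w * complex_of_real (gker (?a n) ((x - y) - w))))
      \<longlonglongrightarrow> \<phi>z y * (complex_of_real ?m * Dz (x - y))"
     by (intro AE_I2 tendsto_mult tendsto_const gker_tendsto[OF Dz(2) Dz(3) Dz(4)])
    show "AE y in lborel. norm (\<phi>z y * (LB w. Dz w * complex_of_real (gker (?a n) ((x - y) - w)))) \<le> B * ?m * norm (\<phi>z y)" for n
    proof (rule AE_I2)
     fix y
     have "ennreal (norm (LB w. Dz w * complex_of_real (gker (?a n) ((x - y) - w)))) \<le>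
      (NN w. ennreal (norm (Dz w * complex_of_real (gker (?a n) ((x - y) - w)))))"
     proof (rule integral_norm_bound_ennreal)
      have "integrable lborel (\<lambda>w. complex_of_real (gker (?a n) ((x - y) - w)) * Dz w)"
       by (rule integrable_mult_bounded[OF Dz(1) _ gb]) measurable
      then show "integrable lborel (\<lambda>w. Dz w * complex_of_real (gker (?a n) ((x - y) - w)))" by (simp add: mult.commute)
     qed
     also have "... \<le> (NN w. ennreal B * ennreal (gker (?a n) ((x - y) - w)))"
     proof (intro nn_integral_mono)
      fix w
      have "norm (Dz w) * gker (?a n) ((x - y) - w) \<le> B * gker (?a n) ((x - y) - w)"
       by (intro mult_right_mono Dz(3) gker_nonneg[OF a])
      then show "ennreal (norm (Dz w * complex_of_real (gker (?a n) ((x - y) - w)))) \<le> ennreal B * ennreal (gker (?a n) ((x - y) - w))"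
       using B0 gker_nonneg[OF a[of n], of "(x - y) - w"]
       by (subst ennreal_mult'[symmetric]) (auto simp: norm_mult simp del: of_nat_Suc intro!: ennreal_leI)
     qed
     also have "... = ennreal B * (NN w. ennreal (gker (?a n) ((x - y) - w)))"
      by (rule nn_integral_cmult) measurable
     also have "(NN w. ennreal (gker (?a n) ((x - y) - w))) = ennreal ?m"
      by (subst lborel_nn_integral_shift(2)[of "\<lambda>w. ennreal (gker (?a n) w)"]) (use nn_integral_gker[OF a] in auto)
     also have "ennreal B * ennreal ?m = ennreal (B * ?m)" using B0 by (simp add: ennreal_mult)
     finally have "norm (LB w. Dz w * complex_of_real (gker (?a n) ((x - y) - w))) \<le> B * ?m"
      using B0 by simp
     then have "norm (\<phi>z y) * norm (LB w. Dz w * complex_of_real (gker (?a n) ((x - y) - w))) \<le> norm (\<phi>z y) * (B * ?m)"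
      by (intro mult_left_mono) auto
     then show "norm (\<phi>z y * (LB w. Dz w * complex_of_real (gker (?a n) ((x - y) - w)))) \<le> B * ?m * norm (\<phi>z y)"
      by (simp only: norm_mult mult.commute)
    qed
   qed measurable
   moreover have "(LB y. \<phi>z y * (complex_of_real ?m * Dz (x - y))) = complex_of_real (?m * (LB y. \<phi>' y * D (x - y)))"
   proof -
    have "(LB y. \<phi>z y * (complex_of_real ?m * Dz (x - y))) = (LB y. complex_of_real (?m * (\<phi>' y * D (x - y))))"
     by (intro Bochner_Integration.integral_cong refl) (simp add: \<phi>z_def Dz_def)
    also have "... = complex_of_real (LB y. ?m * (\<phi>' y * D (x - y)))"
     by (rule integral_complex_of_real)
    also have "(LB y. ?m * (\<phi>' y * D (x - y))) = ?m * (LB y. \<phi>' y * D (x - y))"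
     by (rule integral_mult_right_zero)
    finally show ?thesis .
   qed
   ultimately show ?thesis unfolding eq by (simp only:)
  qed
  have "(NN x. ennreal ((?m * (LB y. \<phi>' y * D (x - y)))\<^sup>2)) \<le> ennreal (?m * (L\<^sup>2 * W))"
  proof (rule nn_integral_limit_le)
   fix n
   have [measurable]: "ft (k n) \<in> borel_measurable borel" by (rule ft_measurable[OF ki])
   show "(\<lambda>x. ennreal ((norm (ft (k n) (- x)))\<^sup>2)) \<in> borel_measurable lborel" by measurable
   have "(NN x. ennreal ((norm (ft (k n) (- x)))\<^sup>2)) = (NN x. ennreal ((norm (ft (k n) x))\<^sup>2))"
    using lborel_nn_integral_shift(2)[of "\<lambda>x. ennreal ((norm (ft (k n) x))\<^sup>2)" 0] by simp
   also have "... \<le> ennreal ?m * (NN x. ennreal ((norm (k n x))\<^sup>2))"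
    by (rule bessel_ft[OF ki])
   also have "... \<le> ennreal ?m * (NN x. ennreal (L\<^sup>2) * ennreal ((norm (h x))\<^sup>2))"
   proof (intro mult_left_mono nn_integral_mono)
    fix x
    have "norm (k n x) \<le> norm (h x) * (1 * L)"
     unfolding k_def norm_mult using gauss_le_1 L by (intro mult_left_mono mult_mono) (auto simp del: of_nat_Suc)
    then have "(norm (k n x))\<^sup>2 \<le> (L * norm (h x))\<^sup>2" by (intro power_mono) (auto simp: mult.commute)
    then show "ennreal ((norm (k n x))\<^sup>2) \<le> ennreal (L\<^sup>2) * ennreal ((norm (h x))\<^sup>2)"
     by (subst ennreal_mult'[symmetric]) (auto simp: power_mult_distrib intro: ennreal_leI)
   qed auto
   also have "... = ennreal ?m * (ennreal (L\<^sup>2) * ennreal W)"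
    by (subst nn_integral_cmult) (auto simp: W(1))
   also have "... = ennreal (?m * (L\<^sup>2 * W))"
    using W(2) by (simp add: ennreal_mult)
   finally show "(NN x. ennreal ((norm (ft (k n) (- x)))\<^sup>2)) \<le> ennreal (?m * (L\<^sup>2 * W))" .
  next
   fix x
   have "(\<lambda>n. ennreal ((norm (ft (k n) (- x)))\<^sup>2)) \<longlonglongrightarrow> ennreal ((norm (complex_of_real (?m * (LB y. \<phi>' y * D (x - y)))))\<^sup>2)"
    by (intro tendsto_ennrealI tendsto_power tendsto_norm lim)
   then show "(\<lambda>n. ennreal ((norm (ft (k n) (- x)))\<^sup>2)) \<longlonglongrightarrow> ennreal ((?m * (LB y. \<phi>' y * D (x - y)))\<^sup>2)"
    by (simp only: norm_of_real power2_abs)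
  qed
  then have "ennreal (1 / ?m\<^sup>2) * (NN x. ennreal ((?m * (LB y. \<phi>' y * D (x - y)))\<^sup>2)) \<le> ennreal (1 / ?m\<^sup>2) * ennreal (?m * (L\<^sup>2 * W))"
   by (intro mult_left_mono) auto
  moreover have "ennreal (1 / ?m\<^sup>2) * ennreal (?m * (L\<^sup>2 * W)) = ennreal (W / ?m * L\<^sup>2)"
  proof -
   have "1 / mm\<^sup>2 * (mm * (L\<^sup>2 * W)) = W / mm * L\<^sup>2" if "mm > 0" for mm
    using that by (simp add: field_simps power2_eq_square)
   then have "1 / ?m\<^sup>2 * (?m * (L\<^sup>2 * W)) = W / ?m * L\<^sup>2" using m by blast
   moreover have "ennreal (1 / ?m\<^sup>2) * ennreal (?m * (L\<^sup>2 * W)) = ennreal (1 / ?m\<^sup>2 * (?m * (L\<^sup>2 * W)))"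
    by (rule ennreal_mult'[symmetric]) simp
   ultimately show ?thesis by (simp only:)
  qed
  moreover have "ennreal (1 / ?m\<^sup>2) * (NN x. ennreal ((?m * (LB y. \<phi>' y * D (x - y)))\<^sup>2)) =
    (NN x. ennreal ((LB y. \<phi>' y * D (x - y))\<^sup>2))"
  proof -
   have "(\<lambda>x. LB y. \<phi>' y * D (x - y)) \<in> borel_measurable borel" by measurable
   then show ?thesis using m
    by (subst nn_integral_cmult[symmetric]) (auto simp: ennreal_mult'[symmetric] power_mult_distrib)
  qed
  ultimately show ?thesis by (simp add: L_def)
 qed
 show ?thesis by (intro exI[of _ "W / ?m"] allI impI) (rule main, auto)
qed

section \<open>Tangent lines of a smooth boundary\<close>

text \<open>The parametrisation inside \<open>line_integral\<close>; \<open>(s, t)\<close> are the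
  coordinates of a point in the frame rotated by \<open>th\<close>.\<close>

definition pt :: "real => real => real => real \<times> real" where
 "pt th s t = s *\<^sub>R dir th + t *\<^sub>R dir_perp th"

lemma norm_dir [simp]: "norm (dir th) = 1" "norm (dir_perp th) = 1"
 by (simp_all add: dir_def dir_perp_def norm_Pair)

lemma dir_inner [simp]: "dir th \<bullet> dir th = 1" "dir_perp th \<bullet> dir_perp th = 1"
 "dir th \<bullet> dir_perp th = 0" "dir_perp th \<bullet> dir th = 0"
 by (simp_all add: dot_square_norm) (simp_all add: dir_def dir_perp_def)

lemma dir_decomp: "z = (z \<bullet> dir th) *\<^sub>R dir th + (z \<bullet> dir_perp th) *\<^sub>R dir_perp th"
proof (cases z)
 case (Pair a b)
 have "(a * cos th + b * sin th) * cos th + (b * cos th - a * sin th) * (- sin th) = a * ((sin th)\<^sup>2 + (cos th)\<^sup>2)"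
  unfolding power2_eq_square by algebra
 moreover have "(a * cos th + b * sin th) * sin th + (b * cos th - a * sin th) * cos th = b * ((sin th)\<^sup>2 + (cos th)\<^sup>2)"
  unfolding power2_eq_square by algebra
 ultimately show ?thesis using Pair by (simp add: dir_def dir_perp_def mult.commute del: mult_minus_right)
qed

lemma norm_dir_decomp: "(norm z)\<^sup>2 = (z \<bullet> dir th)\<^sup>2 + (z \<bullet> dir_perp th)\<^sup>2"
proof -
 have "z \<bullet> z = z \<bullet> ((z \<bullet> dir th) *\<^sub>R dir th + (z \<bullet> dir_perp th) *\<^sub>R dir_perp th)"
  using dir_decomp[of z th] by simp
 then show ?thesis
  unfolding power2_norm_eq_inner by (simp add: inner_add_right power2_eq_square)
qed

lemma norm_le_dir: "norm z \<le> \<bar>z \<bullet> dir th\<bar> + \<bar>z \<bullet> dir_perp th\<bar>"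
 using norm_triangle_ineq[of "(z \<bullet> dir th) *\<^sub>R dir th" "(z \<bullet> dir_perp th) *\<^sub>R dir_perp th"]
 by (simp add: dir_decomp[of z th, symmetric])

lemma pt_inner [simp]: "pt th s t \<bullet> dir th = s" "pt th s t \<bullet> dir_perp th = t"
 by (simp_all add: pt_def inner_add_left)

lemma pt_inverse: "pt th (x \<bullet> dir th) (x \<bullet> dir_perp th) = x"
 using dir_decomp[of x th] by (simp add: pt_def)

lemma pt_diff: "pt th s t - pt th s' t' = (s - s') *\<^sub>R dir th + (t - t') *\<^sub>R dir_perp th"
 by (simp add: pt_def algebra_simps)

lemma dist_pt: "dist (pt th s t) (pt th s' t') \<le> \<bar>s - s'\<bar> + \<bar>t - t'\<bar>"
 unfolding dist_norm pt_diff by (rule order_trans[OF norm_triangle_ineq]) simp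

lemma abs_le_norm_pt: "\<bar>s\<bar> \<le> norm (pt th s t)" "\<bar>t\<bar> \<le> norm (pt th s t)"
 using Cauchy_Schwarz_ineq2[of "pt th s t" "dir th"] Cauchy_Schwarz_ineq2[of "pt th s t" "dir_perp th"] by simp_all

lemma continuous_on_cos_sin:
 fixes f :: "'a::topological_space => real"
 assumes "continuous_on S f"
 shows "continuous_on S (\<lambda>x. cos (f x))" "continuous_on S (\<lambda>x. sin (f x))"
proof -
 have "continuous_on UNIV (cos :: real => real)" "continuous_on UNIV (sin :: real => real)"
  by (simp_all add: continuous_at_imp_continuous_on)
 then show "continuous_on S (\<lambda>x. cos (f x))" "continuous_on S (\<lambda>x. sin (f x))"
  using assms by (auto intro: continuous_on_compose2)
qed

lemma continuous_pt [continuous_intros]: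
 "continuous_on S f ==> continuous_on S g ==> continuous_on S h ==> continuous_on S (\<lambda>x. pt (f x) (g x) (h x))"
 unfolding pt_def dir_def dir_perp_def
 by (intro continuous_intros continuous_on_cos_sin)

lemma pt_measurable [measurable]:
 "(\<lambda>(s, t). pt th s t) \<in> borel_measurable (borel \<Otimes>\<^sub>M borel)" "pt th s \<in> borel_measurable borel"
 "(\<lambda>s. pt th s t) \<in> borel_measurable borel"
 unfolding pt_def by measurable

lemma dir_inner_diff: "dir th \<bullet> dir_perp th' = - sin (th' - th)" "dir_perp th \<bullet> dir th' = sin (th' - th)"
 by (simp_all add: dir_def dir_perp_def sin_diff)

lemma norm_dir_diff: "norm (dir th' - dir th) \<le> \<bar>th' - th\<bar>" "norm (dir_perp th' - dir_perp th) \<le> \<bar>th' - th\<bar>"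
proof -
 have c: "norm (cis th' - cis th) \<le> \<bar>th' - th\<bar>" by (rule norm_cis_diff_le)
 have "norm (dir th' - dir th) = norm (cis th' - cis th)"
  by (simp add: dir_def norm_Pair cmod_def)
 then show "norm (dir th' - dir th) \<le> \<bar>th' - th\<bar>" using c by simp
 have "norm (dir_perp th' - dir_perp th) = norm (cis th' - cis th)"
  by (simp add: dir_perp_def norm_Pair cmod_def power2_commute add.commute)
 then show "norm (dir_perp th' - dir_perp th) \<le> \<bar>th' - th\<bar>" using c by simp
qed

text \<open>On this range the derivative of sine stays above \<open>cos 1\<close>, which is at least
  1/2 because \<open>1 < pi / 3\<close>.\<close>

lemma abs_sin_ge_half: fixes d :: real shows "\<bar>d\<bar> \<le> 1 ==> \<bar>d\<bar> / 2 \<le> \<bar>sin d\<bar>"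
proof -
 have pos: "d / 2 \<le> sin d" if "0 \<le> d" "d \<le> 1" for d :: real
 proof -
  have "cos 1 \<ge> (1/2::real)"
   using cos_monotone_0_pi_le[of 1 "pi/3"] pi_gt3 by (simp add: cos_60)
  have "(\<lambda>x. sin x - x / 2) 0 \<le> (\<lambda>x. sin x - x / 2) d"
  proof (rule DERIV_nonneg_imp_nondecreasing[OF that(1)])
   fix x assume x: "0 \<le> x" "x \<le> d"
   have "cos x \<ge> cos 1" using x that pi_gt3 by (intro cos_monotone_0_pi_le) auto
   then have "0 \<le> cos x - 1 / 2" using \<open>cos 1 \<ge> 1/2\<close> by linarith
   then show "\<exists>y. ((\<lambda>x. sin x - x / 2) has_real_derivative y) (at x) \<and> 0 \<le> y"
    by (intro exI[of _ "cos x - 1 / 2"]) (auto intro!: derivative_eq_intros)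
  qed
  then show ?thesis by simp
 qed
 assume "\<bar>d\<bar> \<le> 1"
 then show ?thesis
  using pos[of d] pos[of "- d"] by (cases "d \<ge> 0") auto
qed

text \<open>\<open>g\<close> is the gradient of the defining function and \<open>H y\<close> the
  differential of \<open>g\<close> at \<open>y\<close>. At a boundary point,
  \<open>H x v \<bullet> v\<close> for a unit tangent vector \<open>v\<close> is, up to sign and the
  factor \<open>norm (g x)\<close>, the curvature of the boundary.\<close>

definition chart :: "(real \<times> real) set => (real \<times> real) set => (real \<times> real => real) =>
  (real \<times> real => real \<times> real) => (real \<times> real => real \<times> real => real \<times> real) => bool" where
 "chart \<Omega> U \<rho> g H \<longleftrightarrow> open U \<and> \<Omega> \<inter> U = {y \<in> U. \<rho> y \<le> 0} \<and>
   (\<forall>y\<in>U. (\<rho> has_derivative (\<lambda>v. g y \<bullet> v)) (at y) \<and> (g has_derivative H y) (at y) \<and> g y \<noteq> 0)"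

lemma chart_exists:
 assumes "compact_smooth_domain \<Omega>" "x \<in> frontier \<Omega>"
 shows "\<exists>U \<rho> g H. x \<in> U \<and> chart \<Omega> U \<rho> g H"
proof -
 obtain U and \<rho> :: "real \<times> real => real" where U: "open U" "x \<in> U" "smooth_on U \<rho>"
  "\<And>y. y \<in> U ==> frechet_derivative \<rho> (at y) \<noteq> (\<lambda>v. 0)" "\<Omega> \<inter> U = {y\<in>U. \<rho> y \<le> 0}"
  using assms unfolding compact_smooth_domain_def by blast
 define g where "g y = (iter_deriv [(1, 0)] \<rho> y, iter_deriv [(0, 1)] \<rho> y)" for y
 have d: "(\<rho> has_derivative frechet_derivative \<rho> (at y)) (at y)" if "y \<in> U" for y
  using smooth_on_differentiable[OF U(3) that] by (simp add: frechet_derivative_works)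
 have ge: "frechet_derivative \<rho> (at y) = (\<lambda>v. g y \<bullet> v)" if "y \<in> U" for y
 proof
  fix v :: "real \<times> real"
  obtain a b where v: "v = (a, b)" by (cases v)
  interpret linear "frechet_derivative \<rho> (at y)" using d[OF that] by (rule has_derivative_linear)
  have "v = a *\<^sub>R (1, 0) + b *\<^sub>R (0, 1)" by (simp add: v)
  then have "frechet_derivative \<rho> (at y) v = a * frechet_derivative \<rho> (at y) (1, 0) + b * frechet_derivative \<rho> (at y) (0, 1)"
   by (simp only: add scale) simp
  then show "frechet_derivative \<rho> (at y) v = g y \<bullet> v" by (simp add: g_def v mult.commute)
 qed
 have dg: "(g has_derivative frechet_derivative g (at y)) (at y)" if "y \<in> U" for y
 proof -
  have "iter_deriv [v] \<rho> differentiable (at y)" for v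
   using U(3) that unfolding smooth_on_def by blast
  then have "g differentiable (at y)"
   unfolding g_def[abs_def] by (intro differentiable_Pair)
  then show ?thesis by (simp add: frechet_derivative_works)
 qed
 have "chart \<Omega> U \<rho> g (\<lambda>y. frechet_derivative g (at y))"
  unfolding chart_def
 proof (intro conjI ballI)
  fix y assume y: "y \<in> U"
  show "(\<rho> has_derivative (\<lambda>v. g y \<bullet> v)) (at y)" using d[OF y] ge[OF y] by simp
  show "(g has_derivative frechet_derivative g (at y)) (at y)" by (rule dg[OF y])
  show "g y \<noteq> 0" using U(4)[OF y] ge[OF y] by auto
 qed (use U in auto)
 then show ?thesis using U(2) by blast
qed

lemma chart_mem: "chart \<Omega> U \<rho> g H ==> y \<in> U ==> y \<in> \<Omega> \<longleftrightarrow> \<rho> y \<le> 0"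
 unfolding chart_def by blast

lemma chart_isCont:
 assumes "chart \<Omega> U \<rho> g H" "y \<in> U"
 shows "isCont \<rho> y" "isCont g y"
 using assms has_derivative_continuous unfolding chart_def by blast+

text \<open>A negative value of \<open>\<rho>\<close> would persist nearby and put \<open>y\<close>
  into the interior.\<close>

lemma chart_frontier:
 assumes c: "chart \<Omega> U \<rho> g H" and "y \<in> U" "y \<in> frontier \<Omega>" "closed \<Omega>"
 shows "\<rho> y = 0"
proof -
 have "y \<in> \<Omega>" using assms(3,4) by (metis Diff_iff closure_closed frontier_def)
 then have le: "\<rho> y \<le> 0" using chart_mem[OF c] assms by blast
 moreover have "\<not> \<rho> y < 0"
 proof
  assume "\<rho> y < 0"
  then have "eventually (\<lambda>z. \<rho> z < 0) (nhds y)"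
   using chart_isCont[OF c assms(2)] by (metis isCont_def order_tendstoD(2) tendsto_at_iff_tendsto_nhds)
  moreover have "eventually (\<lambda>z. z \<in> U) (nhds y)"
   using c assms(2) unfolding chart_def by (simp add: eventually_nhds_in_open)
  ultimately have "eventually (\<lambda>z. z \<in> \<Omega>) (nhds y)"
   by eventually_elim (use chart_mem[OF c] in force)
  then have "y \<in> interior \<Omega>" by (auto simp: eventually_nhds interior_def)
  then show False using assms(3) by (simp add: frontier_def)
 qed
 ultimately show ?thesis by linarith
qed

lemma chart_ball:
 assumes c: "chart \<Omega> U \<rho> g H" and "x \<in> U" "e > 0"
 shows "\<exists>r>0. ball x r \<subseteq> U \<and> (\<forall>z\<in>ball x r. norm (g z - g x) < e)"
proof -
 obtain r1 where r1: "r1 > 0" "ball x r1 \<subseteq> U"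
  using c assms(2) unfolding chart_def by (meson openE)
 obtain r2 where r2: "r2 > 0" "\<And>z. dist z x < r2 ==> dist (g z) (g x) < e"
  using chart_isCont(2)[OF c assms(2)] assms(3) unfolding continuous_at_eps_delta by (auto simp: dist_norm)
 show ?thesis
  using r1 r2 by (intro exI[of _ "min r1 r2"]) (auto simp: dist_norm norm_minus_commute)
qed

lemma chart_mvt:
 assumes c: "chart \<Omega> U \<rho> g H" and b: "ball x r \<subseteq> U" and y: "y \<in> ball x r" "y' \<in> ball x r"
 shows "\<exists>z\<in>ball x r. \<rho> y' - \<rho> y = g z \<bullet> (y' - y)"
proof -
 have seg: "y + \<tau> *\<^sub>R (y' - y) \<in> ball x r" if "0 \<le> \<tau>" "\<tau> \<le> 1" for \<tau>
 proof -
  have "y + \<tau> *\<^sub>R (y' - y) = (1 - \<tau>) *\<^sub>R y + \<tau> *\<^sub>R y'" by (simp add: algebra_simps)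
  then show ?thesis using convexD[OF convex_ball y, of "1 - \<tau>" \<tau>] that by simp
 qed
 have "\<exists>\<tau>>0. \<tau> < 1 \<and> \<rho> (y + 1 *\<^sub>R (y' - y)) - \<rho> (y + 0 *\<^sub>R (y' - y)) = (1 - 0) * (g (y + \<tau> *\<^sub>R (y' - y)) \<bullet> (y' - y))"
 proof (rule MVT2)
  fix \<tau> :: real assume t: "0 \<le> \<tau>" "\<tau> \<le> 1"
  have "(\<rho> has_derivative (\<lambda>v. g (y + \<tau> *\<^sub>R (y' - y)) \<bullet> v)) (at (y + \<tau> *\<^sub>R (y' - y)))"
   using c b seg[OF t] unfolding chart_def by blast
  then have "((\<lambda>\<tau>. \<rho> (y + \<tau> *\<^sub>R (y' - y))) has_derivative (\<lambda>s. g (y + \<tau> *\<^sub>R (y' - y)) \<bullet> (s *\<^sub>R (y' - y)))) (at \<tau>)"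
   by (intro has_derivative_compose[where f="\<lambda>\<tau>. y + \<tau> *\<^sub>R (y' - y)" and f'="\<lambda>s. s *\<^sub>R (y' - y)" and g=\<rho>
      and g'="\<lambda>v. g (y + \<tau> *\<^sub>R (y' - y)) \<bullet> v"]) (auto intro!: derivative_eq_intros)
  then show "((\<lambda>\<tau>. \<rho> (y + \<tau> *\<^sub>R (y' - y))) has_real_derivative g (y + \<tau> *\<^sub>R (y' - y)) \<bullet> (y' - y)) (at \<tau>)"
   by (simp add: has_field_derivative_def mult_commute_abs)
 qed simp
 then obtain \<tau> where "0 < \<tau>" "\<tau> < 1" "\<rho> y' - \<rho> y = g (y + \<tau> *\<^sub>R (y' - y)) \<bullet> (y' - y)" by auto
 then show ?thesis using seg[of \<tau>] by (intro bexI[of _ "y + \<tau> *\<^sub>R (y' - y)"]) auto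
qed

lemma chart_taylor1:
 assumes c: "chart \<Omega> U \<rho> g H" and "x \<in> U" "e > 0"
 shows "\<exists>r>0. ball x r \<subseteq> U \<and> (\<forall>z. norm z < r --> norm (g (x + z) - g x - H x z) \<le> e * norm z)"
proof -
 have "(g has_derivative H x) (at x)" using assms unfolding chart_def by blast
 then obtain d where d: "d > 0" "\<And>y. norm (y - x) < d ==> norm (g y - g x - H x (y - x)) \<le> e * norm (y - x)"
  using \<open>e > 0\<close> unfolding has_derivative_at_alt by blast
 obtain r1 where r1: "r1 > 0" "ball x r1 \<subseteq> U"
  using c assms(2) unfolding chart_def by (meson openE)
 have "norm (g (x + z) - g x - H x z) \<le> e * norm z" if "norm z < min d r1" for z
  using d(2)[of "x + z"] that by simp
 then show ?thesis using r1 d(1)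
  by (intro exI[of _ "min d r1"]) auto
qed

text \<open>The mean value theorem for \<open>\<rho>\<close> minus its quadratic Taylor polynomial
  along the segment; differentiability of \<open>g\<close> at the one point \<open>x\<close> makes
  the remainder \<open>o((norm z)\<^sup>2)\<close>.\<close>

lemma chart_taylor2:
 assumes c: "chart \<Omega> U \<rho> g H" and "x \<in> U" "e > 0"
 shows "\<exists>r>0. ball x r \<subseteq> U \<and> (\<forall>z. norm z < r --> \<bar>\<rho> (x + z) - \<rho> x - g x \<bullet> z - H x z \<bullet> z / 2\<bar> \<le> e * (norm z)\<^sup>2)"
proof -
 obtain r where r: "r > 0" "ball x r \<subseteq> U" "\<And>z. norm z < r ==> norm (g (x + z) - g x - H x z) \<le> e * norm z"
  using chart_taylor1[OF assms] by blast
 have lin: "H x (\<tau> *\<^sub>R z) = \<tau> *\<^sub>R H x z" for \<tau> z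
  using c assms(2) unfolding chart_def by (metis has_derivative_linear linear_scale)
 have "\<bar>\<rho> (x + z) - \<rho> x - g x \<bullet> z - H x z \<bullet> z / 2\<bar> \<le> e * (norm z)\<^sup>2" if z: "norm z < r" for z
 proof -
  have sm: "norm (\<tau> *\<^sub>R z) < r" if "0 \<le> \<tau>" "\<tau> \<le> 1" for \<tau>
  proof -
   have "\<tau> * norm z \<le> norm z" using that by (simp add: mult_left_le_one_le)
   then show ?thesis using z that by simp
  qed
  let ?d = "\<lambda>\<tau>. \<rho> (x + \<tau> *\<^sub>R z) - \<tau> * (g x \<bullet> z) - \<tau>\<^sup>2 / 2 * (H x z \<bullet> z)"
  have "\<exists>\<tau>>0. \<tau> < 1 \<and> ?d 1 - ?d 0 = (1 - 0) * (g (x + \<tau> *\<^sub>R z) \<bullet> z - g x \<bullet> z - \<tau> * (H x z \<bullet> z))"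
  proof (rule MVT2)
   fix \<tau> :: real assume t: "0 \<le> \<tau>" "\<tau> \<le> 1"
   have "x + \<tau> *\<^sub>R z \<in> U" using sm[OF t] r(2) by (auto simp: dist_norm)
   then have "(\<rho> has_derivative (\<lambda>v. g (x + \<tau> *\<^sub>R z) \<bullet> v)) (at (x + \<tau> *\<^sub>R z))"
    using c unfolding chart_def by blast
   then have "((\<lambda>\<tau>. \<rho> (x + \<tau> *\<^sub>R z)) has_derivative (\<lambda>s. g (x + \<tau> *\<^sub>R z) \<bullet> (s *\<^sub>R z))) (at \<tau>)"
    by (intro has_derivative_compose[where f="\<lambda>\<tau>. x + \<tau> *\<^sub>R z" and f'="\<lambda>s. s *\<^sub>R z" and g=\<rho>
       and g'="\<lambda>v. g (x + \<tau> *\<^sub>R z) \<bullet> v"]) (auto intro!: derivative_eq_intros)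
   then have "((\<lambda>\<tau>. \<rho> (x + \<tau> *\<^sub>R z)) has_real_derivative g (x + \<tau> *\<^sub>R z) \<bullet> z) (at \<tau>)"
    by (simp add: has_field_derivative_def mult_commute_abs)
   then show "(?d has_real_derivative g (x + \<tau> *\<^sub>R z) \<bullet> z - g x \<bullet> z - \<tau> * (H x z \<bullet> z)) (at \<tau>)"
    by (auto intro!: derivative_eq_intros)
  qed simp
  then obtain \<tau> where t: "0 < \<tau>" "\<tau> < 1" and e: "?d 1 - ?d 0 = g (x + \<tau> *\<^sub>R z) \<bullet> z - g x \<bullet> z - \<tau> * (H x z \<bullet> z)" by auto
  have "\<rho> (x + z) - \<rho> x - g x \<bullet> z - H x z \<bullet> z / 2 = ?d 1 - ?d 0" by simp
  also have "... = (g (x + \<tau> *\<^sub>R z) - g x - H x (\<tau> *\<^sub>R z)) \<bullet> z"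
   unfolding e lin by (simp add: inner_diff_left)
  also have "\<bar>...\<bar> \<le> norm (g (x + \<tau> *\<^sub>R z) - g x - H x (\<tau> *\<^sub>R z)) * norm z"
   by (rule Cauchy_Schwarz_ineq2)
  also have "... \<le> (e * norm (\<tau> *\<^sub>R z)) * norm z"
   using t by (intro mult_right_mono r(3) sm) auto
  also have "... \<le> (e * norm z) * norm z"
   using t \<open>e > 0\<close> by (intro mult_right_mono mult_left_mono) (auto simp: mult_left_le_one_le)
  finally show ?thesis by (simp add: power2_eq_square mult.assoc)
 qed
 then show ?thesis using r by blast
qed

lemma chart_H_bound:
 assumes c: "chart \<Omega> U \<rho> g H" and "x \<in> U"
 shows "\<exists>K\<ge>0. \<forall>z. norm (H x z) \<le> K * norm z"
proof -
 have "bounded_linear (H x)" using assms has_derivative_bounded_linear unfolding chart_def by blast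
 from bounded_linear.nonneg_bounded[OF this] show ?thesis by (auto simp: mult.commute)
qed

lemma chart_H_linear:
 assumes c: "chart \<Omega> U \<rho> g H" and "x \<in> U"
 shows "linear (H x)"
 using assms has_derivative_linear unfolding chart_def by blast

section \<open>Transversal crossings and nondegenerate tangencies\<close>

lemma emeasure_small_diameter:
 fixes S :: "real set"
 assumes "\<And>t t'. t \<in> S ==> t' \<in> S ==> \<bar>t - t'\<bar> \<le> d" "d \<ge> 0"
 shows "emeasure lborel S \<le> ennreal (2 * d)"
proof (cases "S = {}")
 case False
 then obtain a where a: "a \<in> S" by blast
 have "S \<subseteq> {a - d..a + d}" using assms(1)[OF _ a] by (force simp: abs_le_iff)
 then have "emeasure lborel S \<le> emeasure lborel {a - d..a + d}" by (intro emeasure_mono) auto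
 then show ?thesis using assms(2) by simp
qed simp

text \<open>Along the line \<open>\<rho>\<close> has slope at least \<open>k / 2\<close>, across it
  at most \<open>M\<close>. Where membership differs between \<open>s\<close> and \<open>s'\<close>,
  the absolute value of \<open>\<rho>\<close> is at most \<open>M * \<bar>s - s'\<bar>\<close>, so
  such \<open>t\<close> form a set of proportional diameter. The second claim isolates a crossing on
  its line.\<close>

lemma chart_transversal:
 assumes c: "chart \<Omega> U \<rho> g H" and x: "pt th s0 t0 \<in> U" and tr: "g (pt th s0 t0) \<bullet> dir_perp th \<noteq> 0"
 shows "\<exists>\<delta>>0. \<exists>L\<ge>0. \<forall>s\<in>ball s0 \<delta>. \<forall>s'\<in>ball s0 \<delta>.
  emeasure lborel {t. t \<in> ball t0 \<delta> \<and> (pt th s t \<in> \<Omega>) \<noteq> (pt th s' t \<in> \<Omega>)} \<le> ennreal (L * \<bar>s - s'\<bar>)"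
  and "\<exists>\<delta>>0. \<forall>t\<in>ball t0 \<delta>. t \<noteq> t0 --> pt th s0 t \<in> U \<and> \<rho> (pt th s0 t) \<noteq> \<rho> (pt th s0 t0)"
proof -
 define x where "x = pt th s0 t0"
 define k where "k = \<bar>g x \<bullet> dir_perp th\<bar>"
 have k: "k > 0" using tr by (simp add: k_def x_def)
 obtain r where r: "r > 0" "ball x r \<subseteq> U" "\<And>z. z \<in> ball x r ==> norm (g z - g x) < k / 2"
  using chart_ball[OF c, of x "k / 2"] x k by (auto simp: x_def)
 define M where "M = norm (g x) + k / 2"
 have M: "norm (g z) \<le> M" if "z \<in> ball x r" for z
  using r(3)[OF that] norm_triangle_ineq[of "g z - g x" "g x"] by (simp add: M_def)
 have M0: "M \<ge> 0" using k by (simp add: M_def)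
 have lb: "k / 2 \<le> \<bar>g z \<bullet> dir_perp th\<bar>" if "z \<in> ball x r" for z
 proof -
  have "\<bar>(g z - g x) \<bullet> dir_perp th\<bar> \<le> norm (g z - g x) * norm (dir_perp th)" by (rule Cauchy_Schwarz_ineq2)
  then have "\<bar>(g z - g x) \<bullet> dir_perp th\<bar> \<le> k / 2" using r(3)[OF that] by simp
  then show ?thesis unfolding k_def inner_diff_left by linarith
 qed
 define \<delta> where "\<delta> = r / 2"
 have \<delta>: "\<delta> > 0" using r(1) by (simp add: \<delta>_def)
 have inb: "pt th s t \<in> ball x r" if "s \<in> ball s0 \<delta>" "t \<in> ball t0 \<delta>" for s t
  using dist_pt[of th s0 t0 s t] that by (simp add: x_def \<delta>_def dist_real_def)
 have t_est: "k / 2 * \<bar>t - t'\<bar> \<le> \<bar>\<rho> (pt th s t) - \<rho> (pt th s t')\<bar>"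
  if s: "s \<in> ball s0 \<delta>" and t: "t \<in> ball t0 \<delta>" "t' \<in> ball t0 \<delta>" for s t t'
 proof -
  obtain z where z: "z \<in> ball x r" "\<rho> (pt th s t) - \<rho> (pt th s t') = g z \<bullet> (pt th s t - pt th s t')"
   using chart_mvt[OF c r(2) inb[OF s t(2)] inb[OF s t(1)]] by blast
  have "\<bar>\<rho> (pt th s t) - \<rho> (pt th s t')\<bar> = \<bar>t - t'\<bar> * \<bar>g z \<bullet> dir_perp th\<bar>"
   unfolding z(2) pt_diff by (simp add: abs_mult)
  then show ?thesis using mult_left_mono[OF lb[OF z(1)], of "\<bar>t - t'\<bar>"] by (simp add: mult.commute)
 qed
 have s_est: "\<bar>\<rho> (pt th s t) - \<rho> (pt th s' t)\<bar> \<le> M * \<bar>s - s'\<bar>"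
  if s: "s \<in> ball s0 \<delta>" "s' \<in> ball s0 \<delta>" and t: "t \<in> ball t0 \<delta>" for s s' t
 proof -
  obtain z where z: "z \<in> ball x r" "\<rho> (pt th s t) - \<rho> (pt th s' t) = g z \<bullet> (pt th s t - pt th s' t)"
   using chart_mvt[OF c r(2) inb[OF s(2) t] inb[OF s(1) t]] by blast
  have "\<bar>g z \<bullet> (pt th s t - pt th s' t)\<bar> \<le> norm (g z) * norm (pt th s t - pt th s' t)"
   by (rule Cauchy_Schwarz_ineq2)
  also have "... = norm (g z) * \<bar>s - s'\<bar>" by (simp add: pt_diff)
  also have "... \<le> M * \<bar>s - s'\<bar>" by (intro mult_right_mono M z) auto
  finally show ?thesis using z by simp
 qed
 show "\<exists>\<delta>>0. \<exists>L\<ge>0. \<forall>s\<in>ball s0 \<delta>. \<forall>s'\<in>ball s0 \<delta>.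
  emeasure lborel {t. t \<in> ball t0 \<delta> \<and> (pt th s t \<in> \<Omega>) \<noteq> (pt th s' t \<in> \<Omega>)} \<le> ennreal (L * \<bar>s - s'\<bar>)"
 proof (rule exI[of _ \<delta>], rule conjI[OF \<delta>], rule exI[of _ "8 * M / k"], intro conjI ballI)
  fix s s' assume s: "s \<in> ball s0 \<delta>" "s' \<in> ball s0 \<delta>"
  define m where "m = M * \<bar>s - s'\<bar>"
  have m: "\<bar>\<rho> (pt th s t)\<bar> \<le> m" if "t \<in> ball t0 \<delta>" "(pt th s t \<in> \<Omega>) \<noteq> (pt th s' t \<in> \<Omega>)" for t
  proof -
   have "pt th s t \<in> \<Omega> \<longleftrightarrow> \<rho> (pt th s t) \<le> 0" "pt th s' t \<in> \<Omega> \<longleftrightarrow> \<rho> (pt th s' t) \<le> 0"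
    using chart_mem[OF c] r(2) inb that(1) s by blast+
   then show ?thesis using that(2) s_est[OF s that(1)] unfolding m_def by linarith
  qed
  have "emeasure lborel {t. t \<in> ball t0 \<delta> \<and> (pt th s t \<in> \<Omega>) \<noteq> (pt th s' t \<in> \<Omega>)} \<le> ennreal (2 * (4 * m / k))"
  proof (rule emeasure_small_diameter)
   fix t t' assume t: "t \<in> {t. t \<in> ball t0 \<delta> \<and> (pt th s t \<in> \<Omega>) \<noteq> (pt th s' t \<in> \<Omega>)}"
    "t' \<in> {t. t \<in> ball t0 \<delta> \<and> (pt th s t \<in> \<Omega>) \<noteq> (pt th s' t \<in> \<Omega>)}"
   then have "\<bar>\<rho> (pt th s t)\<bar> \<le> m" "\<bar>\<rho> (pt th s t')\<bar> \<le> m" "k / 2 * \<bar>t - t'\<bar> \<le> \<bar>\<rho> (pt th s t) - \<rho> (pt th s t')\<bar>"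
    using t_est[OF s(1), of t t'] m[of t] m[of t'] by blast+
   then have "k / 2 * \<bar>t - t'\<bar> \<le> 2 * m" by linarith
   then show "\<bar>t - t'\<bar> \<le> 4 * m / k" using k by (simp add: field_simps)
  qed (use M0 k in \<open>simp add: m_def\<close>)
  then show "emeasure lborel {t. t \<in> ball t0 \<delta> \<and> (pt th s t \<in> \<Omega>) \<noteq> (pt th s' t \<in> \<Omega>)} \<le> ennreal (8 * M / k * \<bar>s - s'\<bar>)"
   by (simp add: m_def mult.assoc)
 qed (use \<delta> M0 k in auto)
 show "\<exists>\<delta>>0. \<forall>t\<in>ball t0 \<delta>. t \<noteq> t0 --> pt th s0 t \<in> U \<and> \<rho> (pt th s0 t) \<noteq> \<rho> (pt th s0 t0)"
 proof (intro exI[of _ \<delta>] conjI ballI impI \<delta>)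
  fix t assume t: "t \<in> ball t0 \<delta>" "t \<noteq> t0"
  show "pt th s0 t \<in> U" using inb[of s0 t] t \<delta> r(2) by auto
  have "0 < k / 2 * \<bar>t - t0\<bar>" using k t(2) by simp
  then show "\<rho> (pt th s0 t) \<noteq> \<rho> (pt th s0 t0)" using t_est[of s0 t t0] t \<delta> by auto
 qed
qed

text \<open>\<open>touching\<close> records the local shape of \<open>\<Omega>\<close> at a nondegenerate tangency: on one side of the line
 \<open>s = s0\<close> membership is constantly \<open>v\<close>, on the other side the opposite holds on a chord of half
 length \<open>c \<surd>\<bar>s - s0\<bar>\<close>.\<close>

definition touching :: "(real \<times> real) set => real => real => real => real => bool => real => real => bool" where
 "touching \<Omega> th s0 t0 \<sigma> v c d \<longleftrightarrow> (\<sigma> = 1 \<or> \<sigma> = -1) \<and> c > 0 \<and> d > 0 \<and>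
   (\<forall>s t. \<bar>s - s0\<bar> < d --> \<bar>t - t0\<bar> < d -->
    (\<sigma> * (s - s0) \<ge> 0 --> s \<noteq> s0 \<or> t \<noteq> t0 --> (pt th s t \<in> \<Omega>) = v) \<and>
    (\<sigma> * (s - s0) < 0 --> \<bar>t - t0\<bar> \<le> c * sqrt \<bar>s - s0\<bar> --> (pt th s t \<in> \<Omega>) = (\<not> v)))"

lemma chart_normal:
 assumes c: "chart \<Omega> U \<rho> g H" and "x \<in> U" "g x \<bullet> dir_perp th = 0"
 shows "g x = (g x \<bullet> dir th) *\<^sub>R dir th" "g x \<bullet> dir th \<noteq> 0"
proof -
 show 1: "g x = (g x \<bullet> dir th) *\<^sub>R dir th" using dir_decomp[of "g x" th] assms(3) by simp
 show "g x \<bullet> dir th \<noteq> 0" using 1 assms c unfolding chart_def by (metis scaleR_zero_left)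
qed

text \<open>The parabola model of the boundary: first order in the normal coordinate
  \<open>a\<close>, second order in the tangential coordinate \<open>b\<close>. The other quadratic
  terms contain a factor \<open>a\<close> times something small and are absorbed by the linear
  term.\<close>

lemma chart_tangency_quadratic:
 assumes c: "chart \<Omega> U \<rho> g H" and x: "x \<in> U" "\<rho> x = 0" and tg: "g x \<bullet> dir_perp th = 0"
  and nd: "H x (dir_perp th) \<bullet> dir_perp th \<noteq> 0"
 shows "\<exists>d>0. \<forall>a b. \<bar>a\<bar> < d --> \<bar>b\<bar> < d --> x + a *\<^sub>R dir th + b *\<^sub>R dir_perp th \<in> U \<and>
  \<bar>\<rho> (x + a *\<^sub>R dir th + b *\<^sub>R dir_perp th) - (g x \<bullet> dir th) * a - (H x (dir_perp th) \<bullet> dir_perp th) * b\<^sup>2 / 2\<bar>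
   \<le> \<bar>g x \<bullet> dir th\<bar> * \<bar>a\<bar> / 4 + \<bar>H x (dir_perp th) \<bullet> dir_perp th\<bar> * b\<^sup>2 / 8"
proof -
 let ?T = "dir th" and ?P = "dir_perp th"
 define p where "p = g x \<bullet> ?T"
 define \<kappa> where "\<kappa> = H x ?P \<bullet> ?P"
 have p: "\<bar>p\<bar> > 0" using chart_normal[OF c x(1) tg] by (simp add: p_def)
 have \<kappa>: "\<bar>\<kappa>\<bar> > 0" using nd by (simp add: \<kappa>_def)
 \<comment> \<open>With this tolerance the Taylor error in \<open>b\<close> costs a quarter of the
   quadratic term \<open>\<kappa> * b\<^sup>2 / 2\<close>.\<close>
 define e where "e = \<bar>\<kappa>\<bar> / 8"
 have e: "e > 0" using \<kappa> by (simp add: e_def)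
 obtain r where r: "r > 0" "ball x r \<subseteq> U"
  "\<And>z. norm z < r ==> \<bar>\<rho> (x + z) - \<rho> x - g x \<bullet> z - H x z \<bullet> z / 2\<bar> \<le> e * (norm z)\<^sup>2"
  using chart_taylor2[OF c x(1) e] by blast
 define K where "K = \<bar>H x ?T \<bullet> ?T\<bar> + \<bar>H x ?T \<bullet> ?P\<bar> + \<bar>H x ?P \<bullet> ?T\<bar>"
 have K: "K \<ge> 0" by (simp add: K_def)
 \<comment> \<open>Small enough that the mixed terms and the Taylor error in \<open>a\<close> stay
   below a quarter of the linear term; this is \<open>dp\<close>.\<close>
 define d where "d = min (r / 2) (\<bar>p\<bar> / (4 * (K + e)))"
 have Ke: "K + e > 0" using K e by simp
 have d: "d > 0" using r(1) p Ke by (simp add: d_def)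
 have dp: "(K + e) * d \<le> \<bar>p\<bar> / 4"
 proof -
  have "(K + e) * d \<le> (K + e) * (\<bar>p\<bar> / (4 * (K + e)))" using Ke by (intro mult_left_mono) (auto simp: d_def)
  moreover have "X * (q / (4 * X)) = q / 4" if "X > 0" for X q :: real using that by simp
  from this[OF Ke, of "\<bar>p\<bar>"] have "(K + e) * (\<bar>p\<bar> / (4 * (K + e))) = \<bar>p\<bar> / 4" .
  ultimately show ?thesis by linarith
 qed
 have "x + a *\<^sub>R ?T + b *\<^sub>R ?P \<in> U \<and> \<bar>\<rho> (x + a *\<^sub>R ?T + b *\<^sub>R ?P) - p * a - \<kappa> * b\<^sup>2 / 2\<bar> \<le> \<bar>p\<bar> * \<bar>a\<bar> / 4 + \<bar>\<kappa>\<bar> * b\<^sup>2 / 8"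
  if a: "\<bar>a\<bar> < d" and b: "\<bar>b\<bar> < d" for a b
 proof -
  define z where "z = a *\<^sub>R ?T + b *\<^sub>R ?P"
  have z_in: "z \<bullet> ?T = a" "z \<bullet> ?P = b" by (simp_all add: z_def inner_add_left)
  have zr: "norm z < r" using norm_le_dir[of z th] a b by (simp add: z_in d_def)
  have xz: "x + a *\<^sub>R ?T + b *\<^sub>R ?P = x + z" by (simp add: z_def)
  have z2: "(norm z)\<^sup>2 = a\<^sup>2 + b\<^sup>2" using norm_dir_decomp[of z th] by (simp add: z_in)
  have gz: "g x \<bullet> z = p * a" using tg by (simp add: z_def inner_add_right p_def)
  interpret lin: linear "H x" by (rule chart_H_linear[OF c x(1)])
  have Hz: "H x z \<bullet> z = a\<^sup>2 * (H x ?T \<bullet> ?T) + a * b * (H x ?T \<bullet> ?P) + a * b * (H x ?P \<bullet> ?T) + \<kappa> * b\<^sup>2"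
   by (simp add: z_def lin.add lin.scale inner_add_left inner_add_right \<kappa>_def power2_eq_square algebra_simps)
  have "\<bar>a\<^sup>2 * (H x ?T \<bullet> ?T) + a * b * (H x ?T \<bullet> ?P) + a * b * (H x ?P \<bullet> ?T)\<bar> \<le> \<bar>a\<bar> * d * K"
  proof -
   have "\<bar>a\<^sup>2 * (H x ?T \<bullet> ?T)\<bar> \<le> \<bar>a\<bar> * d * \<bar>H x ?T \<bullet> ?T\<bar>"
    unfolding power2_eq_square abs_mult using a by (intro mult_right_mono mult_left_mono) auto
   moreover have "\<bar>a * b * y\<bar> \<le> \<bar>a\<bar> * d * \<bar>y\<bar>" for y
    unfolding abs_mult using b by (intro mult_right_mono mult_left_mono) auto
   ultimately show ?thesis unfolding K_def distrib_left by (smt (verit))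
  qed
  moreover have "e * (norm z)\<^sup>2 \<le> e * (\<bar>a\<bar> * d) + e * b\<^sup>2"
  proof -
   have "a\<^sup>2 \<le> \<bar>a\<bar> * d" using a mult_left_mono[of "\<bar>a\<bar>" d "\<bar>a\<bar>"] by (simp add: power2_eq_square)
   then have "e * a\<^sup>2 \<le> e * (\<bar>a\<bar> * d)" using e by (intro mult_left_mono) auto
   then show ?thesis by (simp add: z2 distrib_left)
  qed
  moreover have "\<bar>\<rho> (x + z) - p * a - H x z \<bullet> z / 2\<bar> \<le> e * (norm z)\<^sup>2" using r(3)[OF zr] x(2) gz by simp
  moreover have "\<bar>a\<bar> * d * K + e * (\<bar>a\<bar> * d) \<le> \<bar>p\<bar> * \<bar>a\<bar> / 4"
   using mult_left_mono[OF dp, of "\<bar>a\<bar>"] by (simp add: algebra_simps)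
  moreover have "\<bar>a\<bar> * d * K \<ge> 0" using d K by simp
  moreover have "\<bar>R - Q - B / 2\<bar> \<le> X + F" if "\<bar>W\<bar> \<le> A" "N \<le> E + F" "\<bar>R - Q - (W + B) / 2\<bar> \<le> N" "A + E \<le> X" "A \<ge> 0"
   for R Q B X F W A N E :: real using that by (auto simp: abs_le_iff add_divide_distrib)
  ultimately have "\<bar>\<rho> (x + z) - p * a - \<kappa> * b\<^sup>2 / 2\<bar> \<le> \<bar>p\<bar> * \<bar>a\<bar> / 4 + e * b\<^sup>2"
   unfolding Hz by blast
  moreover have "x + z \<in> U" using zr r(2) by (auto simp: dist_norm)
  ultimately show ?thesis by (simp add: xz e_def)
 qed
 then show ?thesis using d unfolding p_def \<kappa>_def by blast
qed


text \<open>In the parabola model the two terms have equal signs on one side of the line, so that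
  \<open>\<rho>\<close> has the sign of \<open>\<kappa>\<close> there; on the other side the linear
  term prevails as long as \<open>b\<^sup>2\<close> is at most a fixed multiple of
  \<open>\<bar>a\<bar>\<close>.\<close>

lemma chart_touching:
 assumes c: "chart \<Omega> U \<rho> g H" and x: "pt th s0 t0 \<in> U" "\<rho> (pt th s0 t0) = 0"
  and tg: "g (pt th s0 t0) \<bullet> dir_perp th = 0"
  and nd: "H (pt th s0 t0) (dir_perp th) \<bullet> dir_perp th \<noteq> 0"
 shows "\<exists>\<sigma> v k d. touching \<Omega> th s0 t0 \<sigma> v k d"
  and "\<exists>\<delta>>0. \<forall>t\<in>ball t0 \<delta>. t \<noteq> t0 --> pt th s0 t \<in> U \<and> \<rho> (pt th s0 t) \<noteq> 0"
proof -
 define x where "x = pt th s0 t0"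
 define p where "p = g x \<bullet> dir th"
 define \<kappa> where "\<kappa> = H x (dir_perp th) \<bullet> dir_perp th"
 have p: "p \<noteq> 0" unfolding p_def x_def by (rule chart_normal[OF c x(1) tg])
 have \<kappa>: "\<kappa> \<noteq> 0" using nd by (simp add: \<kappa>_def x_def)
 obtain d where d: "d > 0" and q: "\<And>a b. \<bar>a\<bar> < d ==> \<bar>b\<bar> < d ==> x + a *\<^sub>R dir th + b *\<^sub>R dir_perp th \<in> U \<and>
  \<bar>\<rho> (x + a *\<^sub>R dir th + b *\<^sub>R dir_perp th) - p * a - \<kappa> * b\<^sup>2 / 2\<bar> \<le> \<bar>p\<bar> * \<bar>a\<bar> / 4 + \<bar>\<kappa>\<bar> * b\<^sup>2 / 8"
  using chart_tangency_quadratic[OF c x tg nd] unfolding x_def p_def \<kappa>_def by blast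
 have pte: "x + (s - s0) *\<^sub>R dir th + (t - t0) *\<^sub>R dir_perp th = pt th s t" for s t
  by (simp add: x_def pt_def algebra_simps)
 have Q: "pt th s t \<in> U" "\<bar>\<rho> (pt th s t) - p * (s - s0) - \<kappa> * (t - t0)\<^sup>2 / 2\<bar> \<le> \<bar>p\<bar> * \<bar>s - s0\<bar> / 4 + \<bar>\<kappa>\<bar> * (t - t0)\<^sup>2 / 8"
  if "\<bar>s - s0\<bar> < d" "\<bar>t - t0\<bar> < d" for s t
  using q[OF that] unfolding pte by auto
 \<comment> \<open>For \<open>\<bar>b\<bar> \<le> k * sqrt \<bar>a\<bar>\<close> the quadratic term
   is at most half of the linear one, and errors of a quarter of each cannot reverse the
   sign.\<close>
 define k where "k = sqrt (\<bar>p\<bar> / \<bar>\<kappa>\<bar>)"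
 have k: "k > 0" using p \<kappa> by (simp add: k_def)
 have sgn: "w > 0 \<longleftrightarrow> \<kappa> > 0" "w \<le> 0 \<longleftrightarrow> \<kappa> < 0" if "\<bar>w - A - B\<bar> \<le> \<bar>A\<bar> / 4 + \<bar>B\<bar> / 4" "A \<noteq> 0 \<or> B \<noteq> 0" "A * \<kappa> \<ge> 0" "B * \<kappa> \<ge> 0" for w A B
 proof -
  have "(A > 0 --> \<kappa> > 0) \<and> (A < 0 --> \<kappa> < 0) \<and> (B > 0 --> \<kappa> > 0) \<and> (B < 0 --> \<kappa> < 0)"
   using that(3,4) \<kappa> by (auto simp: zero_le_mult_iff)
  then show "w > 0 \<longleftrightarrow> \<kappa> > 0" "w \<le> 0 \<longleftrightarrow> \<kappa> < 0"
   using that(1,2) \<kappa> by (auto simp: abs_if split: if_splits)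
 qed
 \<comment> \<open>\<open>\<sigma>\<close> points to the side on which \<open>p * a\<close> has the
   sign of \<open>\<kappa>\<close>.\<close>
 define \<sigma> :: real where "\<sigma> = (if p * \<kappa> > 0 then 1 else -1)"
 have \<sigma>: "\<sigma> = 1 \<or> \<sigma> = -1" "\<sigma> * \<sigma> = 1" "\<sigma> * \<bar>p * \<kappa>\<bar> = p * \<kappa>"
  using p \<kappa> by (auto simp: \<sigma>_def abs_if)
 have side: "p * a * \<kappa> = (\<sigma> * a) * \<bar>p * \<kappa>\<bar>" for a
 proof -
  have "p * a * \<kappa> = a * (p * \<kappa>)" by simp
  also have "... = a * (\<sigma> * \<bar>p * \<kappa>\<bar>)" by (simp only: \<sigma>(3))
  finally show ?thesis by simp
 qed
 have "touching \<Omega> th s0 t0 \<sigma> (\<kappa> < 0) k d"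
  unfolding touching_def
 proof (intro conjI allI impI)
  fix s t assume s: "\<bar>s - s0\<bar> < d" and t: "\<bar>t - t0\<bar> < d" and sg: "\<sigma> * (s - s0) \<ge> 0" and ne: "s \<noteq> s0 \<or> t \<noteq> t0"
  have "\<rho> (pt th s t) \<le> 0 \<longleftrightarrow> \<kappa> < 0"
  proof (rule sgn(2)[of _ "p * (s - s0)" "\<kappa> * (t - t0)\<^sup>2 / 2"])
   show "\<bar>\<rho> (pt th s t) - p * (s - s0) - \<kappa> * (t - t0)\<^sup>2 / 2\<bar> \<le> \<bar>p * (s - s0)\<bar> / 4 + \<bar>\<kappa> * (t - t0)\<^sup>2 / 2\<bar> / 4"
    using Q(2)[OF s t] by (simp add: abs_mult)
   show "p * (s - s0) * \<kappa> \<ge> 0" unfolding side using sg by simp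
   show "p * (s - s0) \<noteq> 0 \<or> \<kappa> * (t - t0)\<^sup>2 / 2 \<noteq> 0" using ne p \<kappa> by auto
   have "\<kappa> * (t - t0)\<^sup>2 / 2 * \<kappa> = (\<kappa> * (t - t0))\<^sup>2 / 2" by (simp add: power2_eq_square)
   then show "\<kappa> * (t - t0)\<^sup>2 / 2 * \<kappa> \<ge> 0" by simp
  qed
  then show "(pt th s t \<in> \<Omega>) = (\<kappa> < 0)" using chart_mem[OF c Q(1)[OF s t]] by simp
 next
  fix s t assume s: "\<bar>s - s0\<bar> < d" and t: "\<bar>t - t0\<bar> < d" and sg: "\<sigma> * (s - s0) < 0" and b: "\<bar>t - t0\<bar> \<le> k * sqrt \<bar>s - s0\<bar>"
  have "(t - t0)\<^sup>2 \<le> (k * sqrt \<bar>s - s0\<bar>)\<^sup>2" using b by (metis abs_ge_zero power2_abs power_mono)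
  also have "... = \<bar>p\<bar> / \<bar>\<kappa>\<bar> * \<bar>s - s0\<bar>" by (simp add: power_mult_distrib k_def)
  finally have b2: "\<bar>\<kappa>\<bar> * (t - t0)\<^sup>2 \<le> \<bar>p\<bar> * \<bar>s - s0\<bar>" using \<kappa> by (simp add: field_simps)
  have "p * (s - s0) * \<kappa> < 0" unfolding side using sg p \<kappa> by (simp add: mult_neg_pos)
  then have opp: "(p * (s - s0) > 0 \<and> \<kappa> < 0) \<or> (p * (s - s0) < 0 \<and> \<kappa> > 0)" by (auto simp: mult_less_0_iff)
  have B: "\<bar>\<kappa> * (t - t0)\<^sup>2 / 2\<bar> \<le> \<bar>p * (s - s0)\<bar> / 2" using b2 by (simp add: abs_mult)
  have q2: "\<bar>\<rho> (pt th s t) - p * (s - s0) - \<kappa> * (t - t0)\<^sup>2 / 2\<bar> \<le> \<bar>p * (s - s0)\<bar> / 4 + \<bar>\<kappa> * (t - t0)\<^sup>2 / 2\<bar> / 4"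
   using Q(2)[OF s t] by (simp add: abs_mult)
  have "\<rho> (pt th s t) \<le> 0 \<longleftrightarrow> \<not> \<kappa> < 0"
   using opp B q2 unfolding abs_if by (auto split: if_splits)
  then show "(pt th s t \<in> \<Omega>) = (\<not> \<kappa> < 0)" using chart_mem[OF c Q(1)[OF s t]] by simp
 qed (use \<sigma> k d in auto)
 then show "\<exists>\<sigma> v k d. touching \<Omega> th s0 t0 \<sigma> v k d" by blast
 show "\<exists>\<delta>>0. \<forall>t\<in>ball t0 \<delta>. t \<noteq> t0 --> pt th s0 t \<in> U \<and> \<rho> (pt th s0 t) \<noteq> 0"
 proof (intro exI[of _ d] conjI d ballI impI)
  fix t assume "t \<in> ball t0 d" and ne: "t \<noteq> t0"
  then have t: "\<bar>t - t0\<bar> < d" by (simp add: dist_real_def abs_minus_commute)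
  have s: "\<bar>s0 - s0\<bar> < d" using d by simp
  show "pt th s0 t \<in> U" by (rule Q(1)[OF s t])
  have "\<bar>\<kappa>\<bar> * (t - t0)\<^sup>2 > 0" using \<kappa> ne by simp
  moreover have "\<bar>\<kappa> * (t - t0)\<^sup>2 / 2\<bar> = \<bar>\<kappa>\<bar> * (t - t0)\<^sup>2 / 2" by (simp add: abs_mult)
  ultimately show "\<rho> (pt th s0 t) \<noteq> 0" using Q(2)[OF s t] by auto
 qed
qed

text \<open>Boundary points leave the tangent line quadratically. Differentiating the tangency
  equation relates displacement and turning angle:
  \<open>H x (dir_perp th) \<bullet> dir_perp th\<close> times the tangential displacement equals
  \<open>g x \<bullet> dir th\<close> times the angle to first order. Where the former factor
  vanishes this feeds Sard's theorem, elsewhere it separates bitangents.\<close>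

lemma chart_tangent_comparison:
 assumes c: "chart \<Omega> U \<rho> g H" and x: "x \<in> U" "\<rho> x = 0" and tg: "g x \<bullet> dir_perp th = 0"
 shows "\<exists>r>0. \<exists>C\<ge>0. \<forall>x'. norm (x' - x) < r --> \<rho> x' = 0 --> \<bar>(x' - x) \<bullet> dir th\<bar> \<le> C * (norm (x' - x))\<^sup>2"
  and "e > 0 ==> \<exists>r>0. \<forall>x' th'. norm (x' - x) < r --> \<bar>th' - th\<bar> \<le> 1 --> \<rho> x' = 0 --> g x' \<bullet> dir_perp th' = 0 -->
   \<bar>H x (dir_perp th) \<bullet> dir_perp th * ((x' - x) \<bullet> dir_perp th) - (g x \<bullet> dir th) * sin (th' - th)\<bar> \<le> e * norm (x' - x)"
proof -
 define p where "p = g x \<bullet> dir th"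
 have p: "g x = p *\<^sub>R dir th" "\<bar>p\<bar> > 0" using chart_normal[OF c x(1) tg] by (simp_all add: p_def)
 obtain K where K: "K \<ge> 0" "\<And>z. norm (H x z) \<le> K * norm z" using chart_H_bound[OF c x(1)] by blast
 obtain r1 where r1: "r1 > 0" "\<And>z. norm z < r1 ==> \<bar>\<rho> (x + z) - \<rho> x - g x \<bullet> z - H x z \<bullet> z / 2\<bar> \<le> 1 * (norm z)\<^sup>2"
  using chart_taylor2[OF c x(1), of 1] by auto
 define C where "C = (1 + K) / \<bar>p\<bar>"
 have C: "C \<ge> 0" using K(1) p(2) by (simp add: C_def)
 have q: "\<bar>(x' - x) \<bullet> dir th\<bar> \<le> C * (norm (x' - x))\<^sup>2" if "norm (x' - x) < r1" "\<rho> x' = 0" for x'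
 proof -
  let ?z = "x' - x"
  have "\<bar>H x ?z \<bullet> ?z\<bar> \<le> norm (H x ?z) * norm ?z" by (rule Cauchy_Schwarz_ineq2)
  also have "... \<le> (K * norm ?z) * norm ?z" by (intro mult_right_mono K) auto
  finally have "\<bar>H x ?z \<bullet> ?z\<bar> \<le> K * (norm ?z)\<^sup>2" by (simp add: power2_eq_square mult.assoc)
  moreover have "\<bar>g x \<bullet> ?z + H x ?z \<bullet> ?z / 2\<bar> \<le> (norm ?z)\<^sup>2" using r1(2)[of ?z] that x(2) by simp
  moreover have "0 \<le> K * (norm ?z)\<^sup>2" using K(1) by simp
  ultimately have "\<bar>g x \<bullet> ?z\<bar> \<le> (norm ?z)\<^sup>2 + K * (norm ?z)\<^sup>2" by linarith
  moreover have gz: "g x \<bullet> ?z = p * (?z \<bullet> dir th)" by (subst p(1)) (simp add: inner_commute)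
  ultimately have "\<bar>p\<bar> * \<bar>?z \<bullet> dir th\<bar> \<le> (1 + K) * (norm ?z)\<^sup>2"
   unfolding gz abs_mult distrib_right mult_1_left by linarith
  then show ?thesis using p(2) by (simp add: C_def field_simps)
 qed
 then show "\<exists>r>0. \<exists>C\<ge>0. \<forall>x'. norm (x' - x) < r --> \<rho> x' = 0 --> \<bar>(x' - x) \<bullet> dir th\<bar> \<le> C * (norm (x' - x))\<^sup>2"
  using r1(1) C by blast
 assume e: "e > 0"
 obtain r2 where r2: "r2 > 0" "\<And>z. norm z < r2 ==> norm (g (x + z) - g x - H x z) \<le> min (e / 2) 1 * norm z"
  using chart_taylor1[OF c x(1), of "min (e / 2) 1"] e by auto
 define C2 where "C2 = 2 * (1 + K) / \<bar>p\<bar>"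
 have C2: "C2 \<ge> 0" using K(1) p(2) by (simp add: C2_def)
 \<comment> \<open>The last entry lets the two second-order errors fit into
   \<open>e / 2 * norm z\<close>.\<close>
 define r where "r = min (min r1 r2) (e / (2 * (K * (C2 + C) + 1)))"
 have KC: "K * (C2 + C) + 1 > 0" using K(1) C C2 by (simp add: add_nonneg_pos)
 have r: "r > 0" using r1 r2 e KC by (simp add: r_def)
 show "\<exists>r>0. \<forall>x' th'. norm (x' - x) < r --> \<bar>th' - th\<bar> \<le> 1 --> \<rho> x' = 0 --> g x' \<bullet> dir_perp th' = 0 -->
   \<bar>H x (dir_perp th) \<bullet> dir_perp th * ((x' - x) \<bullet> dir_perp th) - (g x \<bullet> dir th) * sin (th' - th)\<bar> \<le> e * norm (x' - x)"
 proof (intro exI[of _ r] conjI r allI impI)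
  fix x' th' assume xr: "norm (x' - x) < r" and th: "\<bar>th' - th\<bar> \<le> 1" and rho: "\<rho> x' = 0" and tg': "g x' \<bullet> dir_perp th' = 0"
  define z where "z = x' - x"
  have zr: "norm z < r1" "norm z < r2" "norm z \<le> e / (2 * (K * (C2 + C) + 1))" using xr by (auto simp: r_def z_def)
  define \<tau> where "\<tau> = z \<bullet> dir_perp th"
  let ?P = "dir_perp th" and ?P' = "dir_perp th'"
  have xz: "x + z = x'" by (simp add: z_def)
  have lin: "linear (H x)" by (rule chart_H_linear[OF c x(1)])
  have rem: "norm (g x' - g x - H x z) \<le> min (e / 2) 1 * norm z" using r2(2)[OF zr(2)] by (simp add: xz)
  \<comment> \<open>Exact, not linearised: the tangency condition at \<open>x'\<close> removes the
    term \<open>g x' \<bullet> ?P'\<close>.\<close>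
  have psin: "p * sin (th' - th) = (g x' - g x) \<bullet> ?P'"
  proof -
   have "g x \<bullet> ?P' = - p * sin (th' - th)" by (subst p(1)) (simp add: dir_inner_diff)
   then show ?thesis using tg' by (simp add: inner_diff_left)
  qed
  have "\<bar>(g x' - g x) \<bullet> ?P'\<bar> \<le> norm (g x' - g x)"
   using Cauchy_Schwarz_ineq2[of "g x' - g x" ?P'] by simp
  also have "... \<le> norm (g x' - g x - H x z) + norm (H x z)"
   using norm_triangle_ineq[of "g x' - g x - H x z" "H x z"] by simp
  also have "... \<le> 1 * norm z + K * norm z"
   using K(2)[of z] order_trans[OF rem mult_right_mono[of "min (e / 2) 1" 1 "norm z"]] by (intro add_mono) auto
  finally have "\<bar>p\<bar> * \<bar>sin (th' - th)\<bar> \<le> (1 + K) * norm z" unfolding psin[symmetric] by (simp add: abs_mult algebra_simps)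
  moreover have "\<bar>p\<bar> * (\<bar>th' - th\<bar> / 2) \<le> \<bar>p\<bar> * \<bar>sin (th' - th)\<bar>" by (intro mult_left_mono abs_sin_ge_half th) auto
  ultimately have "\<bar>p\<bar> * (\<bar>th' - th\<bar> / 2) \<le> (1 + K) * norm z" by linarith
  \<comment> \<open>A first bound on the angle; it makes replacing \<open>?P'\<close> by
    \<open>?P\<close> a second-order error.\<close>
  then have dth: "\<bar>th' - th\<bar> \<le> C2 * norm z" using p(2) by (simp add: C2_def field_simps)
  have zd: "\<bar>z \<bullet> dir th\<bar> \<le> C * (norm z)\<^sup>2" using q[of x'] zr rho by (simp add: z_def)
  have Hz: "H x z = (z \<bullet> dir th) *\<^sub>R H x (dir th) + \<tau> *\<^sub>R H x ?P"
  proof -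
   have "H x z = H x ((z \<bullet> dir th) *\<^sub>R dir th + \<tau> *\<^sub>R ?P)"
    unfolding \<tau>_def using arg_cong[OF dir_decomp[of z th], of "H x"] .
   then show ?thesis by (simp add: linear_add[OF lin] linear_scale[OF lin])
  qed
  have "p * sin (th' - th) - (H x ?P \<bullet> ?P) * \<tau> =
   (g x' - g x - H x z) \<bullet> ?P' + H x z \<bullet> (?P' - ?P) + (z \<bullet> dir th) * (H x (dir th) \<bullet> ?P)"
   unfolding psin using arg_cong[OF Hz, of "\<lambda>y. y \<bullet> ?P"] by (simp add: inner_diff_left inner_diff_right inner_add_left)
  moreover have "\<bar>(g x' - g x - H x z) \<bullet> ?P'\<bar> \<le> e / 2 * norm z"
  proof -
   have "\<bar>(g x' - g x - H x z) \<bullet> ?P'\<bar> \<le> norm (g x' - g x - H x z)"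
    using Cauchy_Schwarz_ineq2[of "g x' - g x - H x z" ?P'] by simp
   also have "... \<le> min (e / 2) 1 * norm z" by (rule rem)
   also have "... \<le> e / 2 * norm z" by (intro mult_right_mono) auto
   finally show ?thesis .
  qed
  moreover have "\<bar>H x z \<bullet> (?P' - ?P)\<bar> \<le> (K * norm z) * (C2 * norm z)"
  proof -
   have "\<bar>H x z \<bullet> (?P' - ?P)\<bar> \<le> norm (H x z) * norm (?P' - ?P)" by (rule Cauchy_Schwarz_ineq2)
   also have "... \<le> (K * norm z) * (C2 * norm z)"
    using K norm_dir_diff(2)[of th' th] dth by (intro mult_mono) auto
   finally show ?thesis .
  qed
  moreover have "\<bar>(z \<bullet> dir th) * (H x (dir th) \<bullet> ?P)\<bar> \<le> (C * (norm z)\<^sup>2) * K"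
  proof -
   have "\<bar>H x (dir th) \<bullet> ?P\<bar> \<le> K"
    using Cauchy_Schwarz_ineq2[of "H x (dir th)" ?P] K(2)[of "dir th"] by simp
   then show ?thesis unfolding abs_mult using zd C by (intro mult_mono) auto
  qed
  ultimately have "\<bar>p * sin (th' - th) - (H x ?P \<bullet> ?P) * \<tau>\<bar> \<le> e / 2 * norm z + (K * norm z) * (C2 * norm z) + (C * (norm z)\<^sup>2) * K"
   by linarith
  also have "... = e / 2 * norm z + (K * (C2 + C)) * norm z * norm z"
   by (simp add: algebra_simps power2_eq_square)
  also have "(K * (C2 + C)) * norm z * norm z \<le> e / 2 * norm z"
  proof (intro mult_right_mono)
   have "(K * (C2 + C)) * norm z \<le> (K * (C2 + C) + 1) * norm z" by (simp add: algebra_simps)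
   also have "... \<le> (K * (C2 + C) + 1) * (e / (2 * (K * (C2 + C) + 1)))"
    using zr(3) KC by (intro mult_left_mono) auto
   also have "... = e / 2"
   proof -
    have "X * (e / (2 * X)) = e / 2" if "X > 0" for X :: real using that by simp
    then show ?thesis using KC by blast
   qed
   finally show "(K * (C2 + C)) * norm z \<le> e / 2" .
  qed simp
  finally show "\<bar>H x ?P \<bullet> ?P * ((x' - x) \<bullet> ?P) - (g x \<bullet> dir th) * sin (th' - th)\<bar> \<le> e * norm (x' - x)"
   by (simp add: z_def \<tau>_def p_def abs_minus_commute)
 qed
qed

section \<open>Exceptional directions\<close>

lemma discrete_countable:
 fixes S :: "'a::{metric_space, second_countable_topology} set"
 assumes "\<And>p. p \<in> S ==> \<exists>r>0. \<forall>q\<in>S. dist q p < r --> q = p"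
 shows "countable S"
proof -
 obtain B :: "'a set set" where B: "countable B" "topological_basis B"
  using ex_countable_basis by blast
 have "\<forall>p. \<exists>b. p \<in> S --> b \<in> B \<and> p \<in> b \<and> (\<forall>q\<in>S \<inter> b. q = p)"
 proof
  fix p
  show "\<exists>b. p \<in> S --> b \<in> B \<and> p \<in> b \<and> (\<forall>q\<in>S \<inter> b. q = p)"
  proof (cases "p \<in> S")
   case True
   then obtain r where r: "r > 0" "\<forall>q\<in>S. dist q p < r --> q = p" using assms by blast
   obtain b where b: "b \<in> B" "p \<in> b" "b \<subseteq> ball p r"
    using topological_basisE[OF B(2) open_ball, of p p r] r(1) by auto
   then show ?thesis using r(2) by (intro exI[of _ b]) (auto simp: dist_commute subset_iff)
  qed blast
 qed
 then obtain b where b: "\<And>p. p \<in> S ==> b p \<in> B \<and> p \<in> b p \<and> (\<forall>q\<in>S \<inter> b p. q = p)"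
  by metis
 have "inj_on b S" using b by (intro inj_onI) (metis IntI)
 moreover have "countable (b ` S)" using B(1) b by (meson countable_subset image_subsetI)
 ultimately show ?thesis using countable_image_inj_on by blast
qed

text \<open>One-dimensional Sard, transported to \<open>real^1\<close>, the setting of
  \<open>baby_Sard\<close>.\<close>

lemma negligible_image_zero_derivative:
 fixes f :: "real => real"
 assumes "\<And>y. y \<in> Y ==> (f has_derivative (\<lambda>_. 0)) (at y within Y)"
 shows "negligible (f ` Y)"
proof -
 define V where "V y = (\<chi> i::1. (y::real))" for y
 have V1: "V y $ i = y" for y i by (simp add: V_def)
 have V: "norm (V y) = \<bar>y\<bar>" for y
  by (simp add: norm_vec_def L2_set_def V1 sum.neutral_const)
 have lin: "linear V" unfolding V_def by (rule linearI) (auto simp: vec_eq_iff)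
 have blV: "bounded_linear V" using lin linear_conv_bounded_linear by blast
 have blp: "bounded_linear (\<lambda>x::real^1. x $ 1)" by (rule bounded_linear_vec_nth)
 define F where "F x = V (f (x $ 1))" for x :: "real^1"
 let ?Z = "{x::real^1. x $ 1 \<in> Y}"
 have "negligible (F ` ?Z)"
 proof (rule baby_Sard)
  fix x assume x: "x \<in> ?Z"
  have "(f has_derivative (\<lambda>_. 0)) (at (x $ 1) within (\<lambda>x. x $ 1) ` ?Z)"
   by (rule has_derivative_subset[OF assms]) (use x in auto)
  with bounded_linear_imp_has_derivative[OF blp, of "at x within ?Z"]
  have "((\<lambda>x. f (x $ 1)) has_derivative (\<lambda>v. 0)) (at x within ?Z)"
   by (rule has_derivative_in_compose[where f="\<lambda>x::real^1. x $ 1" and g=f and f'="\<lambda>x. x $ 1" and g'="\<lambda>_. 0" and x=x and s="?Z"])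
  from bounded_linear.has_derivative[OF blV this]
  show "(F has_derivative (\<lambda>v. 0)) (at x within ?Z)"
   using linear_0[OF lin] by (simp add: F_def[abs_def])
  have "matrix (\<lambda>v. 0 :: real^1) = (0 :: real^1^1)"
   by (simp add: matrix_def vec_eq_iff)
  then show "rank (matrix (\<lambda>v::real^1. 0 :: real^1)) < CARD(1)" by simp
 qed simp
 moreover have "V ` (f ` Y) \<subseteq> F ` ?Z"
  by (force simp: F_def V1 image_iff intro: exI[of _ "V _"])
 ultimately have n: "negligible (V ` f ` Y)" by (rule negligible_subset)
 have "negligible ((\<lambda>x::real^1. x $ 1) ` V ` f ` Y)"
 proof (rule negligible_differentiable_image_negligible[OF _ n])
  show "(\<lambda>x::real^1. x $ 1) differentiable_on V ` f ` Y"
   by (intro linear_imp_differentiable_on bounded_linear.linear blp)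
 qed simp
 then show ?thesis by (simp add: image_image V1)
qed

text \<open>Applied with \<open>y q = y p\<close>, the hypothesis makes \<open>th\<close> a function
  of \<open>y\<close> on \<open>S\<close>; for small distances it says that this function has
  derivative zero on the image of \<open>S\<close> under \<open>y\<close>.\<close>

lemma negligible_sard_relation:
 fixes y th :: "'a => real"
 assumes "\<And>p e. p \<in> S ==> e > 0 ==> \<exists>r>0. \<forall>q\<in>S. \<bar>y q - y p\<bar> < r --> \<bar>th q - th p\<bar> \<le> e * \<bar>y q - y p\<bar>"
 shows "negligible (th ` S)"
proof -
 define f where "f z = th (SOME p. p \<in> S \<and> y p = z)" for z
 have f: "f (y p) = th p" if p: "p \<in> S" for p
 proof -
  have "(SOME q. q \<in> S \<and> y q = y p) \<in> S \<and> y (SOME q. q \<in> S \<and> y q = y p) = y p"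
   by (rule someI[of _ p]) (use p in simp)
  then show ?thesis
   using assms[OF p, of 1] unfolding f_def by force
 qed
 have "negligible (f ` y ` S)"
 proof (rule negligible_image_zero_derivative)
  fix z assume "z \<in> y ` S"
  then obtain p where p: "p \<in> S" "z = y p" by blast
  show "(f has_derivative (\<lambda>_. 0)) (at z within y ` S)"
   unfolding has_derivative_within_alt
  proof (intro conjI allI impI)
   fix e :: real assume "e > 0"
   from assms[OF p(1) this] obtain r where r: "r > 0" "\<forall>q\<in>S. \<bar>y q - y p\<bar> < r --> \<bar>th q - th p\<bar> \<le> e * \<bar>y q - y p\<bar>" by blast
   show "\<exists>d>0. \<forall>x\<in>y ` S. norm (x - z) < d --> norm (f x - f z - 0) \<le> e * norm (x - z)"
    using r p by (intro exI[of _ r]) (auto simp: f)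
  qed (rule bounded_linear_zero)
 qed
 moreover have "f ` y ` S = th ` S" using f by (auto simp: image_image)
 ultimately show ?thesis by simp
qed

text \<open>By Sard's theorem, applied to the normal direction of the boundary curve.\<close>

lemma negligible_degenerate:
 assumes c: "chart \<Omega> U \<rho> g H"
 shows "negligible {th. \<exists>x\<in>U. \<rho> x = 0 \<and> g x \<bullet> dir_perp th = 0 \<and> H x (dir_perp th) \<bullet> dir_perp th = 0}"
proof -
 define D where "D = {(x, th). x \<in> U \<and> \<rho> x = 0 \<and> g x \<bullet> dir_perp th = 0 \<and> H x (dir_perp th) \<bullet> dir_perp th = 0}"
 have loc: "\<exists>r>0. negligible (snd ` (D \<inter> (ball (fst w) r \<times> ball (snd w) r)))" if w: "w \<in> D" for w
 proof -
  obtain x0 th0 where w0: "w = (x0, th0)" by (cases w)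
  have x0: "x0 \<in> U" "\<rho> x0 = 0" "g x0 \<bullet> dir_perp th0 = 0" using w by (auto simp: D_def w0)
  define p0 where "p0 = g x0 \<bullet> dir th0"
  have p0: "g x0 = p0 *\<^sub>R dir th0" "\<bar>p0\<bar> > 0" using chart_normal[OF c x0(1,3)] by (simp_all add: p0_def)
  obtain r1 where r1: "r1 > 0" "ball x0 r1 \<subseteq> U" "\<And>z. z \<in> ball x0 r1 ==> norm (g z - g x0) < \<bar>p0\<bar> / 2"
   using chart_ball[OF c x0(1), of "\<bar>p0\<bar> / 2"] p0 by auto
  \<comment> \<open>The half keeps any two angles of the neighbourhood within distance one, the
    range of the sine estimate.\<close>
  define r where "r = min r1 (1/2)"
  have r: "r > 0" using r1 by (simp add: r_def)
  let ?S = "D \<inter> (ball x0 r \<times> ball th0 r)"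
  let ?y = "\<lambda>q::(real \<times> real) \<times> real. fst q \<bullet> dir_perp th0"
  \<comment> \<open>Near \<open>x0\<close> the boundary is a graph over its tangent line, so the
    tangential coordinate \<open>?y\<close> controls distances on it.\<close>
  have inj: "norm (fst q - fst p) \<le> 2 * \<bar>?y q - ?y p\<bar>" if pq: "p \<in> ?S" "q \<in> ?S" for p q
  proof -
   let ?z = "fst q - fst p"
   have b: "fst p \<in> ball x0 r1" "fst q \<in> ball x0 r1" using pq by (auto simp: r_def)
   obtain z where z: "z \<in> ball x0 r1" "\<rho> (fst q) - \<rho> (fst p) = g z \<bullet> ?z"
    using chart_mvt[OF c r1(2) b] by blast
   have "\<rho> (fst q) = 0" "\<rho> (fst p) = 0" using pq by (auto simp: D_def)
   then have "g z \<bullet> ?z = 0" using z by simp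
   then have "g x0 \<bullet> ?z = - ((g z - g x0) \<bullet> ?z)" by (simp add: inner_diff_left)
   moreover have "g x0 \<bullet> ?z = p0 * (?z \<bullet> dir th0)" by (subst p0(1)) (simp add: inner_commute)
   ultimately have "p0 * (?z \<bullet> dir th0) = - ((g z - g x0) \<bullet> ?z)" by simp
   then have "\<bar>p0\<bar> * \<bar>?z \<bullet> dir th0\<bar> = \<bar>(g z - g x0) \<bullet> ?z\<bar>" by (metis abs_minus_cancel abs_mult)
   also have "... \<le> norm (g z - g x0) * norm ?z" by (rule Cauchy_Schwarz_ineq2)
   also have "... \<le> \<bar>p0\<bar> / 2 * norm ?z" using r1(3)[OF z(1)] by (intro mult_right_mono) auto
   finally have "\<bar>?z \<bullet> dir th0\<bar> \<le> norm ?z / 2" using p0(2) by (simp add: field_simps)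
   then show ?thesis using norm_le_dir[of ?z th0] by (simp add: inner_diff_left)
  qed
  have "negligible (snd ` ?S)"
  proof (rule negligible_sard_relation[where y = ?y])
   fix p and e :: real assume p: "p \<in> ?S" and e: "e > 0"
   obtain x th where p1: "p = (x, th)" by (cases p)
   have x: "x \<in> U" "\<rho> x = 0" "g x \<bullet> dir_perp th = 0" "H x (dir_perp th) \<bullet> dir_perp th = 0" using p by (auto simp: D_def p1)
   define p2 where "p2 = g x \<bullet> dir th"
   have p2: "\<bar>p2\<bar> > 0" using chart_normal[OF c x(1,3)] by (simp add: p2_def)
   \<comment> \<open>Compensates a factor 2 lost in \<open>inj\<close> and a factor 2 lost in the
     sine estimate.\<close>
   define e' where "e' = e * \<bar>p2\<bar> / 4"
   have e': "e' > 0" using e p2 by (simp add: e'_def)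
   obtain r' where r': "r' > 0" "\<And>x' th'. norm (x' - x) < r' ==> \<bar>th' - th\<bar> \<le> 1 ==> \<rho> x' = 0 ==> g x' \<bullet> dir_perp th' = 0 ==>
     \<bar>0 * ((x' - x) \<bullet> dir_perp th) - p2 * sin (th' - th)\<bar> \<le> e' * norm (x' - x)"
    using chart_tangent_comparison(2)[OF c x(1,2,3) e'] unfolding x(4) p2_def by blast
   show "\<exists>r>0. \<forall>q\<in>?S. \<bar>?y q - ?y p\<bar> < r --> \<bar>snd q - snd p\<bar> \<le> e * \<bar>?y q - ?y p\<bar>"
   proof (intro exI[of _ "r' / 2"] conjI ballI impI)
    fix q assume q: "q \<in> ?S" and yq: "\<bar>?y q - ?y p\<bar> < r' / 2"
    obtain x' th' where q1: "q = (x', th')" by (cases q)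
    have n: "norm (x' - x) \<le> 2 * \<bar>?y q - ?y p\<bar>" using inj[OF p q] by (simp add: p1 q1)
    have th: "\<bar>th' - th\<bar> \<le> 1"
    proof -
     have "\<bar>th0 - th\<bar> < 1/2" "\<bar>th0 - th'\<bar> < 1/2" using p q by (auto simp: p1 q1 dist_real_def r_def)
     then show ?thesis by linarith
    qed
    have "\<bar>p2\<bar> * \<bar>sin (th' - th)\<bar> \<le> e' * norm (x' - x)"
     using r'(2)[of x' th'] n yq th q by (simp add: D_def q1 abs_mult)
    also have "... \<le> e' * (2 * \<bar>?y q - ?y p\<bar>)" using e' n by (intro mult_left_mono) auto
    finally have "\<bar>p2\<bar> * \<bar>sin (th' - th)\<bar> \<le> e' * (2 * \<bar>?y q - ?y p\<bar>)" .
    moreover have "\<bar>p2\<bar> * (\<bar>th' - th\<bar> / 2) \<le> \<bar>p2\<bar> * \<bar>sin (th' - th)\<bar>" by (intro mult_left_mono abs_sin_ge_half th) auto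
    ultimately have "\<bar>p2\<bar> * (\<bar>th' - th\<bar> / 2) \<le> e * \<bar>p2\<bar> / 4 * (2 * \<bar>?y q - ?y p\<bar>)" unfolding e'_def by linarith
    also have "... = \<bar>p2\<bar> * (e * \<bar>?y q - ?y p\<bar> / 2)" by simp
    finally have "\<bar>th' - th\<bar> / 2 \<le> e * \<bar>?y q - ?y p\<bar> / 2" using p2 by (simp only: mult_le_cancel_left_pos)
    then show "\<bar>snd q - snd p\<bar> \<le> e * \<bar>?y q - ?y p\<bar>" by (simp add: p1 q1)
   qed (use r' in simp)
  qed
  then show ?thesis using r unfolding w0 fst_conv snd_conv by (intro exI[of _ r] conjI)
 qed
 then have "\<forall>w. \<exists>r. w \<in> D --> r > 0 \<and> negligible (snd ` (D \<inter> (ball (fst w) r \<times> ball (snd w) r)))"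
  by blast
 then obtain R where "\<forall>w. w \<in> D --> R w > 0 \<and> negligible (snd ` (D \<inter> (ball (fst w) (R w) \<times> ball (snd w) (R w))))"
  by (atomize_elim, rule choice)
 note R = this[rule_format]
 define N where "N w = ball (fst w) (R w) \<times> ball (snd w) (R w)" for w
 have op: "open G" if "G \<in> N ` D" for G
  using that by (auto simp: N_def intro: open_Times)
 \<comment> \<open>Lindelof's theorem reduces the local statement to countably many
   neighbourhoods.\<close>
 obtain W where W: "W \<subseteq> N ` D" "countable W" "\<Union>W = \<Union>(N ` D)"
  by (rule Lindelof[of "N ` D", OF op]) auto
 have "snd ` D \<subseteq> (\<Union>G\<in>W. snd ` (D \<inter> G))"
 proof
  fix th assume "th \<in> snd ` D"
  then obtain w where w: "w \<in> D" "th = snd w" by blast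
  have "w \<in> N w" using R[OF w(1)] by (simp add: N_def mem_Times_iff)
  then have "w \<in> \<Union>W" using W(3) w(1) by blast
  then show "th \<in> (\<Union>G\<in>W. snd ` (D \<inter> G))" using w by blast
 qed
 moreover have "negligible (\<Union>G\<in>W. snd ` (D \<inter> G))"
 proof -
  have "negligible (\<Union>((\<lambda>G. snd ` (D \<inter> G)) ` W))"
  proof (rule negligible_countable_Union)
   show "countable ((\<lambda>G. snd ` (D \<inter> G)) ` W)" using W(2) by simp
   show "negligible G'" if "G' \<in> (\<lambda>G. snd ` (D \<inter> G)) ` W" for G'
    using that W(1) R by (auto simp: N_def)
  qed
  then show ?thesis .
 qed
 moreover have "{th. \<exists>x\<in>U. \<rho> x = 0 \<and> g x \<bullet> dir_perp th = 0 \<and> H x (dir_perp th) \<bullet> dir_perp th = 0} = snd ` D"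
  unfolding D_def by (auto simp: image_iff) blast
 ultimately show ?thesis using negligible_subset by simp
qed

text \<open>Two distinct nondegenerate tangencies on one line separate at first order when the line turns,
 so that bitangent directions are isolated.\<close>

lemma countable_bitangent:
 assumes c: "chart \<Omega> U \<rho> g H" and c': "chart \<Omega> U' \<rho>' g' H'"
 shows "countable {(x, y, th). x \<noteq> y \<and> x \<bullet> dir th = y \<bullet> dir th \<and>
   x \<in> U \<and> \<rho> x = 0 \<and> g x \<bullet> dir_perp th = 0 \<and> H x (dir_perp th) \<bullet> dir_perp th \<noteq> 0 \<and>
   y \<in> U' \<and> \<rho>' y = 0 \<and> g' y \<bullet> dir_perp th = 0 \<and> H' y (dir_perp th) \<bullet> dir_perp th \<noteq> 0}" (is "countable ?W")
proof (rule discrete_countable)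
 \<comment> \<open>At a nondegenerate tangency the point moves at most linearly with the angle, and
   in the direction normal to the line only quadratically.\<close>
 have one: "\<exists>r>0. \<exists>C\<ge>0. \<forall>x' th'. norm (x' - x) < r --> \<bar>th' - th\<bar> \<le> 1 --> \<rho> x' = 0 --> g x' \<bullet> dir_perp th' = 0 -->
   norm (x' - x) \<le> C * \<bar>th' - th\<bar> \<and> \<bar>(x' - x) \<bullet> dir th\<bar> \<le> C * (th' - th)\<^sup>2"
  if c: "chart \<Omega> U \<rho> g H" and x: "x \<in> U" "\<rho> x = 0" "g x \<bullet> dir_perp th = 0" and nd: "H x (dir_perp th) \<bullet> dir_perp th \<noteq> 0"
  for U \<rho> g H x th
 proof -
  define p where "p = g x \<bullet> dir th"
  define \<kappa> where "\<kappa> = H x (dir_perp th) \<bullet> dir_perp th"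
  have \<kappa>: "\<bar>\<kappa>\<bar> > 0" using nd by (simp add: \<kappa>_def)
  obtain r1 C1 where r1: "r1 > 0" "C1 \<ge> 0" "\<And>x'. norm (x' - x) < r1 ==> \<rho> x' = 0 ==> \<bar>(x' - x) \<bullet> dir th\<bar> \<le> C1 * (norm (x' - x))\<^sup>2"
   using chart_tangent_comparison(1)[OF c x] by blast
  obtain r2 where r2: "r2 > 0" "\<And>x' th'. norm (x' - x) < r2 ==> \<bar>th' - th\<bar> \<le> 1 ==> \<rho> x' = 0 ==> g x' \<bullet> dir_perp th' = 0 ==>
     \<bar>\<kappa> * ((x' - x) \<bullet> dir_perp th) - p * sin (th' - th)\<bar> \<le> \<bar>\<kappa>\<bar> / 4 * norm (x' - x)"
   using chart_tangent_comparison(2)[OF c x, of "\<bar>\<kappa>\<bar> / 4"] \<kappa> unfolding \<kappa>_def p_def by auto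
  \<comment> \<open>The last entry makes the normal part of the displacement at most half of its
    length, so that the tangential part is at least half.\<close>
  define r where "r = min (min r1 r2) (1 / (2 * (C1 + 1)))"
  define C where "C = 4 * \<bar>p\<bar> / \<bar>\<kappa>\<bar>"
  have C: "C \<ge> 0" by (simp add: C_def)
  have r: "r > 0" using r1 r2 by (simp add: r_def)
  have 1: "norm (x' - x) \<le> C * \<bar>th' - th\<bar>" and 2: "\<bar>(x' - x) \<bullet> dir th\<bar> \<le> C1 * (norm (x' - x))\<^sup>2"
   if a: "norm (x' - x) < r" "\<bar>th' - th\<bar> \<le> 1" "\<rho> x' = 0" "g x' \<bullet> dir_perp th' = 0" for x' th'
  proof -
   let ?n = "norm (x' - x)"
   show q: "\<bar>(x' - x) \<bullet> dir th\<bar> \<le> C1 * ?n\<^sup>2" using r1(3)[of x'] a by (simp add: r_def)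
   have "C1 * ?n \<le> (C1 + 1) * ?n" by (simp add: algebra_simps)
   also have "... \<le> (C1 + 1) * (1 / (2 * (C1 + 1)))" using a(1) r1(2) by (intro mult_left_mono) (auto simp: r_def)
   also have "... = 1 / 2" using r1(2) by simp
   finally have "C1 * ?n * ?n \<le> 1 / 2 * ?n" by (rule mult_right_mono) simp
   then have "\<bar>(x' - x) \<bullet> dir th\<bar> \<le> ?n / 2" using q by (simp add: power2_eq_square mult.assoc)
   then have t: "?n / 2 \<le> \<bar>(x' - x) \<bullet> dir_perp th\<bar>" using norm_le_dir[of "x' - x" th] by linarith
   have "\<bar>\<kappa>\<bar> * (?n / 2) \<le> \<bar>\<kappa>\<bar> * \<bar>(x' - x) \<bullet> dir_perp th\<bar>" by (intro mult_left_mono t) auto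
   moreover have "\<bar>\<kappa> * ((x' - x) \<bullet> dir_perp th) - p * sin (th' - th)\<bar> \<le> \<bar>\<kappa>\<bar> / 4 * ?n" using r2(2) a by (simp add: r_def)
   moreover have "\<bar>\<kappa> * ((x' - x) \<bullet> dir_perp th)\<bar> = \<bar>\<kappa>\<bar> * \<bar>(x' - x) \<bullet> dir_perp th\<bar>" by (rule abs_mult)
   moreover have "\<bar>p * sin (th' - th)\<bar> \<le> \<bar>p\<bar> * \<bar>th' - th\<bar>"
    unfolding abs_mult by (intro mult_left_mono abs_sin_x_le_abs_x) auto
   ultimately have "\<bar>\<kappa>\<bar> * (?n / 2) \<le> \<bar>\<kappa>\<bar> / 4 * ?n + \<bar>p\<bar> * \<bar>th' - th\<bar>" by linarith
   then have "\<bar>\<kappa>\<bar> * ?n \<le> 4 * (\<bar>p\<bar> * \<bar>th' - th\<bar>)" by simp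
   then show "?n \<le> C * \<bar>th' - th\<bar>" using \<kappa> by (simp add: C_def field_simps)
  qed
  show ?thesis
  proof (rule exI[of _ r], rule conjI[OF r], rule exI[of _ "max C (C1 * C\<^sup>2)"], intro conjI allI impI)
   fix x' th' assume a: "norm (x' - x) < r" "\<bar>th' - th\<bar> \<le> 1" "\<rho> x' = 0" "g x' \<bullet> dir_perp th' = 0"
   have "C * \<bar>th' - th\<bar> \<le> max C (C1 * C\<^sup>2) * \<bar>th' - th\<bar>" by (intro mult_right_mono) auto
   then show "norm (x' - x) \<le> max C (C1 * C\<^sup>2) * \<bar>th' - th\<bar>" using 1[OF a] by linarith
   have "(norm (x' - x))\<^sup>2 \<le> (C * \<bar>th' - th\<bar>)\<^sup>2" by (intro power_mono 1[OF a]) auto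
   then have "C1 * (norm (x' - x))\<^sup>2 \<le> C1 * (C * \<bar>th' - th\<bar>)\<^sup>2" using r1(2) by (intro mult_left_mono) auto
   also have "... = (C1 * C\<^sup>2) * (th' - th)\<^sup>2" by (simp add: power_mult_distrib)
   also have "... \<le> max C (C1 * C\<^sup>2) * (th' - th)\<^sup>2" by (intro mult_right_mono) auto
   finally show "\<bar>(x' - x) \<bullet> dir th\<bar> \<le> max C (C1 * C\<^sup>2) * (th' - th)\<^sup>2" using 2[OF a] by linarith
  qed (use C in simp)
 qed
 fix w assume w: "w \<in> ?W"
 obtain x y th where w0: "w = (x, y, th)" by (cases w) auto
 have X: "x \<in> U" "\<rho> x = 0" "g x \<bullet> dir_perp th = 0" "H x (dir_perp th) \<bullet> dir_perp th \<noteq> 0"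
  and Y: "y \<in> U'" "\<rho>' y = 0" "g' y \<bullet> dir_perp th = 0" "H' y (dir_perp th) \<bullet> dir_perp th \<noteq> 0"
  and ne: "x \<noteq> y" "x \<bullet> dir th = y \<bullet> dir th" using w by (auto simp: w0)
 obtain r1 C1 where 1: "r1 > 0" "C1 \<ge> 0" "\<And>x' th'. norm (x' - x) < r1 ==> \<bar>th' - th\<bar> \<le> 1 ==> \<rho> x' = 0 ==> g x' \<bullet> dir_perp th' = 0 ==>
   norm (x' - x) \<le> C1 * \<bar>th' - th\<bar> \<and> \<bar>(x' - x) \<bullet> dir th\<bar> \<le> C1 * (th' - th)\<^sup>2"
  using one[OF c X] by blast
 obtain r2 C2 where 2: "r2 > 0" "C2 \<ge> 0" "\<And>x' th'. norm (x' - y) < r2 ==> \<bar>th' - th\<bar> \<le> 1 ==> \<rho>' x' = 0 ==> g' x' \<bullet> dir_perp th' = 0 ==>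
   norm (x' - y) \<le> C2 * \<bar>th' - th\<bar> \<and> \<bar>(x' - y) \<bullet> dir th\<bar> \<le> C2 * (th' - th)\<^sup>2"
  using one[OF c' Y] by blast
 define q where "q = (x - y) \<bullet> dir_perp th"
 have xy: "x - y = q *\<^sub>R dir_perp th"
  using dir_decomp[of "x - y" th] ne(2) by (simp add: q_def inner_diff_left)
 have q: "\<bar>q\<bar> > 0" using xy ne(1) by auto
 define K where "K = 2 * C1 + 2 * C2 + 1"
 have K: "K > 0" using 1(2) 2(2) by (simp add: K_def)
 define r where "r = min (min r1 r2) (min 1 (\<bar>q\<bar> / (2 * K)))"
 have r: "r > 0" using 1(1) 2(1) q K by (simp add: r_def)
 show "\<exists>r>0. \<forall>w'\<in>?W. dist w' w < r --> w' = w"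
 proof (intro exI[of _ r] conjI r ballI impI)
  fix w' assume w': "w' \<in> ?W" "dist w' w < r"
  obtain x' y' th' where w1: "w' = (x', y', th')" by (cases w') auto
  have d: "norm (x' - x) < r" "norm (y' - y) < r" "\<bar>th' - th\<bar> < r"
  proof -
   have "dist x' x \<le> dist w' w" "dist (y', th') (y, th) \<le> dist w' w"
    using dist_fst_le[of w' w] dist_snd_le[of w' w] by (simp_all add: w0 w1)
   moreover have "dist y' y \<le> dist (y', th') (y, th)" "dist th' th \<le> dist (y', th') (y, th)"
    using dist_fst_le[of "(y', th')" "(y, th)"] dist_snd_le[of "(y', th')" "(y, th)"] by simp_all
   ultimately show "norm (x' - x) < r" "norm (y' - y) < r" "\<bar>th' - th\<bar> < r" using w'(2) by (auto simp: dist_norm)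
  qed
  let ?d = "th' - th"
  have d1: "\<bar>?d\<bar> \<le> 1" using d(3) by (simp add: r_def)
  have e1: "norm (x' - x) \<le> C1 * \<bar>?d\<bar>" "\<bar>(x' - x) \<bullet> dir th\<bar> \<le> C1 * ?d\<^sup>2"
   using 1(3)[of x' th'] d d1 w'(1) by (auto simp: w1 r_def)
  have e2: "norm (y' - y) \<le> C2 * \<bar>?d\<bar>" "\<bar>(y' - y) \<bullet> dir th\<bar> \<le> C2 * ?d\<^sup>2"
   using 2(3)[of y' th'] d d1 w'(1) by (auto simp: w1 r_def)
  have f: "\<bar>z \<bullet> dir th'\<bar> \<le> 2 * C * ?d\<^sup>2" if z: "norm z \<le> C * \<bar>?d\<bar>" "\<bar>z \<bullet> dir th\<bar> \<le> C * ?d\<^sup>2" for z C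
  proof -
   have "\<bar>z \<bullet> (dir th' - dir th)\<bar> \<le> norm z * norm (dir th' - dir th)" by (rule Cauchy_Schwarz_ineq2)
   also have "... \<le> (C * \<bar>?d\<bar>) * \<bar>?d\<bar>"
    using z(1) norm_dir_diff(1) by (intro mult_mono) (auto intro: order_trans[OF norm_ge_zero])
   finally have "\<bar>z \<bullet> (dir th' - dir th)\<bar> \<le> C * ?d\<^sup>2" by (simp add: power2_eq_square mult.assoc)
   then show ?thesis using z(2) unfolding inner_diff_right by linarith
  qed
  \<comment> \<open>If the line turned by \<open>?d\<close> is again bitangent near the same points,
    then \<open>(x - y) \<bullet> dir th'\<close> is of second order in \<open>?d\<close>. But it
    equals \<open>q * sin ?d\<close>, which is of first order; hence \<open>?d = 0\<close>, and then
    both points are unchanged.\<close>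
  have "(x' - y') \<bullet> dir th' = 0" using w'(1) by (simp add: w1 inner_diff_left)
  then have "(x - y) \<bullet> dir th' = - ((x' - x) \<bullet> dir th') + (y' - y) \<bullet> dir th'"
   by (simp add: inner_diff_left)
  then have "\<bar>(x - y) \<bullet> dir th'\<bar> \<le> 2 * C1 * ?d\<^sup>2 + 2 * C2 * ?d\<^sup>2"
   using f[OF e1] f[OF e2] by linarith
  moreover have "(x - y) \<bullet> dir th' = q * sin ?d" unfolding xy by (simp add: dir_inner_diff)
  ultimately have "\<bar>q\<bar> * \<bar>sin ?d\<bar> \<le> (2 * C1 + 2 * C2) * ?d\<^sup>2" by (simp add: abs_mult algebra_simps)
  moreover have "\<bar>q\<bar> * (\<bar>?d\<bar> / 2) \<le> \<bar>q\<bar> * \<bar>sin ?d\<bar>" by (intro mult_left_mono abs_sin_ge_half d1) auto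
  moreover have "(2 * C1 + 2 * C2) * ?d\<^sup>2 \<le> K * ?d\<^sup>2" by (intro mult_right_mono) (auto simp: K_def)
  ultimately have "\<bar>q\<bar> * (\<bar>?d\<bar> / 2) \<le> K * ?d\<^sup>2" by linarith
  then have k: "(\<bar>q\<bar> / 2) * \<bar>?d\<bar> \<le> (K * \<bar>?d\<bar>) * \<bar>?d\<bar>" by (simp add: power2_eq_square mult.assoc)
  have "?d = 0"
  proof (rule ccontr)
   assume "?d \<noteq> 0"
   then have "\<bar>q\<bar> / 2 \<le> K * \<bar>?d\<bar>" by (intro mult_right_le_imp_le[OF k]) simp
   moreover have "\<bar>?d\<bar> < \<bar>q\<bar> / (2 * K)" using d(3) by (simp add: r_def)
   then have "K * \<bar>?d\<bar> < \<bar>q\<bar> / 2" using K by (simp add: field_simps)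
   ultimately show False by linarith
  qed
  then show "w' = w" using e1(1) e2(1) by (simp add: w0 w1)
 qed
qed

text \<open>The exempt set \<open>J\<close> is where a tangency is cut out. Two arbitrary nearby
  offsets are compared, not only \<open>s\<close> and \<open>s0\<close>, because difference
  quotients are needed throughout a neighbourhood.\<close>

definition regular :: "(real \<times> real) set => real => real => real set => bool" where
 "regular \<Omega> th s0 J \<longleftrightarrow> (\<exists>\<delta>>0. \<exists>L\<ge>0. \<forall>s\<in>ball s0 \<delta>. \<forall>s'\<in>ball s0 \<delta>.
  emeasure lborel {t. t \<notin> J \<and> (pt th s t \<in> \<Omega>) \<noteq> (pt th s' t \<in> \<Omega>)} \<le> ennreal (L * \<bar>s - s'\<bar>))"

text \<open>Away from the frontier membership is locally constant and contributes nothing, so a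
  finite subcover of the relevant part of the line outside \<open>J\<close> adds up finitely many
  Lipschitz constants.\<close>

lemma regular_from_local:
 assumes \<Omega>: "compact \<Omega>" and J: "open J"
  and loc: "\<And>t. t \<notin> J ==> pt th s0 t \<in> frontier \<Omega> ==> \<exists>\<delta>>0. \<exists>L\<ge>0. \<forall>s\<in>ball s0 \<delta>. \<forall>s'\<in>ball s0 \<delta>.
   emeasure lborel {t'. t' \<in> ball t \<delta> \<and> (pt th s t' \<in> \<Omega>) \<noteq> (pt th s' t' \<in> \<Omega>)} \<le> ennreal (L * \<bar>s - s'\<bar>)"
 shows "regular \<Omega> th s0 J"
proof -
 have cl: "closed \<Omega>" using \<Omega> by (rule compact_imp_closed)
 have [measurable]: "\<Omega> \<in> sets borel" using cl by (rule borel_closed)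
 obtain R where R: "\<And>x. x \<in> \<Omega> ==> norm x \<le> R"
  using \<Omega> compact_imp_bounded bounded_iff by metis
 define K where "K = cball (0::real) R - J"
 have K: "compact K" unfolding K_def using J by (intro compact_diff) auto
 define P where "P t \<delta> L \<longleftrightarrow> (\<forall>s\<in>ball s0 \<delta>. \<forall>s'\<in>ball s0 \<delta>.
   emeasure lborel {t'. t' \<in> ball t \<delta> \<and> (pt th s t' \<in> \<Omega>) \<noteq> (pt th s' t' \<in> \<Omega>)} \<le> ennreal (L * \<bar>s - s'\<bar>))" for t \<delta> L
 have "\<exists>\<delta>>0. \<exists>L\<ge>0. P t \<delta> L" if t: "t \<in> K" for t
 proof (cases "pt th s0 t \<in> frontier \<Omega>")
  case True
  have "t \<notin> J" using t by (simp add: K_def)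
  from loc[OF this True] show ?thesis unfolding P_def .
 next
  case False
  have "\<exists>e>0. \<forall>x\<in>ball (pt th s0 t) e. (x \<in> \<Omega>) = (pt th s0 t \<in> \<Omega>)"
  proof (cases "pt th s0 t \<in> \<Omega>")
   case True
   then have "pt th s0 t \<in> interior \<Omega>" using False closure_subset by (auto simp: frontier_def)
   then obtain e where e: "e > 0" "ball (pt th s0 t) e \<subseteq> \<Omega>" by (meson mem_interior)
   then show ?thesis using True by blast
  next
   case nin: False
   then have "pt th s0 t \<in> - \<Omega>" by simp
   then obtain e where e: "e > 0" "ball (pt th s0 t) e \<subseteq> - \<Omega>"
    using cl by (meson open_Compl openE)
   then show ?thesis using nin by blast
  qed
  then obtain e where e: "e > 0" "\<And>x. x \<in> ball (pt th s0 t) e ==> (x \<in> \<Omega>) = (pt th s0 t \<in> \<Omega>)" by blast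
  have in_b: "pt th s t' \<in> ball (pt th s0 t) e" if "s \<in> ball s0 (e/2)" "t' \<in> ball t (e/2)" for s t'
   using dist_pt[of th s0 t s t'] that by (simp add: dist_real_def)
  show ?thesis
  proof (rule exI[of _ "e / 2"], rule conjI, use e in simp, rule exI[of _ 0], unfold P_def, intro conjI ballI order_refl)
   fix s s' assume "s \<in> ball s0 (e / 2)" "s' \<in> ball s0 (e / 2)"
   then have "{t'. t' \<in> ball t (e / 2) \<and> (pt th s t' \<in> \<Omega>) \<noteq> (pt th s' t' \<in> \<Omega>)} = {}"
    using e(2) in_b by blast
   then show "emeasure lborel {t'. t' \<in> ball t (e / 2) \<and> (pt th s t' \<in> \<Omega>) \<noteq> (pt th s' t' \<in> \<Omega>)} \<le> ennreal (0 * \<bar>s - s'\<bar>)"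
    by (simp only: emeasure_empty zero_le)
  qed
 qed
 then obtain \<delta> L where \<delta>: "\<And>t. t \<in> K ==> \<delta> t > 0" and L0: "\<And>t. t \<in> K ==> L t \<ge> 0" and P: "\<And>t. t \<in> K ==> P t (\<delta> t) (L t)"
  by metis
 obtain I where I: "I \<subseteq> K" "finite I" "K \<subseteq> (\<Union>t\<in>I. ball t (\<delta> t))"
 proof (rule compactE_image[OF K, of K "\<lambda>t. ball t (\<delta> t)"])
  show "K \<subseteq> (\<Union>t\<in>K. ball t (\<delta> t))" using \<delta> by force
 qed auto
 define d where "d = Min (insert 1 (\<delta> ` I))"
 have d: "d > 0" unfolding d_def using I \<delta> by (subst Min_gr_iff) auto
 have dle: "d \<le> \<delta> t" if "t \<in> I" for t unfolding d_def using I(2) that by (intro Min_le) auto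
 show ?thesis
  unfolding regular_def
 proof (rule exI[of _ d], rule conjI[OF d], rule exI[of _ "\<Sum>t\<in>I. L t"], intro conjI ballI)
  show "0 \<le> (\<Sum>t\<in>I. L t)" using L0 I(1) by (intro sum_nonneg) blast
  fix s s' assume s: "s \<in> ball s0 d" "s' \<in> ball s0 d"
  let ?D = "\<lambda>t. {t'. t' \<in> ball t (\<delta> t) \<and> (pt th s t' \<in> \<Omega>) \<noteq> (pt th s' t' \<in> \<Omega>)}"
  have m: "?D t \<in> sets borel" for t by measurable
  have "{t. t \<notin> J \<and> (pt th s t \<in> \<Omega>) \<noteq> (pt th s' t \<in> \<Omega>)} \<subseteq> (\<Union>t\<in>I. ?D t)"
  proof
   fix t assume t: "t \<in> {t. t \<notin> J \<and> (pt th s t \<in> \<Omega>) \<noteq> (pt th s' t \<in> \<Omega>)}"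
   then have "\<bar>t\<bar> \<le> R" using R abs_le_norm_pt(2)[of t th s] abs_le_norm_pt(2)[of t th s'] by fastforce
   then have "t \<in> K" using t by (simp add: K_def)
   then show "t \<in> (\<Union>t\<in>I. ?D t)" using I(3) t by blast
  qed
  then have "emeasure lborel {t. t \<notin> J \<and> (pt th s t \<in> \<Omega>) \<noteq> (pt th s' t \<in> \<Omega>)} \<le> emeasure lborel (\<Union>t\<in>I. ?D t)"
   using I(2) m by (intro emeasure_mono) auto
  also have "... \<le> (\<Sum>t\<in>I. emeasure lborel (?D t))"
   using I(2) m by (intro emeasure_subadditive_finite) auto
  also have "... \<le> (\<Sum>t\<in>I. ennreal (L t * \<bar>s - s'\<bar>))"
  proof (rule sum_mono)
   fix t assume t: "t \<in> I"
   then have "s \<in> ball s0 (\<delta> t)" "s' \<in> ball s0 (\<delta> t)" using s dle[OF t] by auto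
   then show "emeasure lborel (?D t) \<le> ennreal (L t * \<bar>s - s'\<bar>)"
    using P[of t] I(1) t unfolding P_def by blast
  qed
  also have "... = ennreal ((\<Sum>t\<in>I. L t) * \<bar>s - s'\<bar>)"
   using L0 I(1) by (subst sum_ennreal) (auto simp: sum_distrib_right)
  finally show "emeasure lborel {t. t \<notin> J \<and> (pt th s t \<in> \<Omega>) \<noteq> (pt th s' t \<in> \<Omega>)} \<le> ennreal ((\<Sum>t\<in>I. L t) * \<bar>s - s'\<bar>)" .
 qed
qed

text \<open>Along a curve in the frontier \<open>\<rho>\<close> vanishes, so the chain rule makes
  \<open>g x\<close> orthogonal to its velocity.\<close>

lemma tangency_set_chart:
 assumes c: "chart \<Omega> U \<rho> g H" and cl: "closed \<Omega>" and x: "x \<in> U" "x \<in> tangency_set \<Omega> s th"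
 shows "x \<in> frontier \<Omega>" "x = pt th s (x \<bullet> dir_perp th)" "g x \<bullet> dir_perp th = 0"
proof -
 obtain \<gamma> \<epsilon> where \<gamma>: "\<epsilon> > 0" "\<gamma> ` {-\<epsilon><..<\<epsilon>} \<subseteq> frontier \<Omega>" "\<gamma> 0 = x" "(\<gamma> has_vector_derivative dir_perp th) (at 0)"
  using x(2) unfolding tangency_set_def tangent_vector_def curve_through_def by blast
 show xf: "x \<in> frontier \<Omega>" using \<gamma> by force
 show "x = pt th s (x \<bullet> dir_perp th)"
  using x(2) pt_inverse[of th x] by (simp add: tangency_set_def Line_def)
 have d: "(\<rho> has_derivative (\<lambda>v. g x \<bullet> v)) (at (\<gamma> 0))" using c x(1) \<gamma>(3) unfolding chart_def by blast
 have gd: "(\<gamma> has_derivative (\<lambda>s. s *\<^sub>R dir_perp th)) (at 0)" using \<gamma>(4) by (simp add: has_vector_derivative_def)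
 have 1: "((\<lambda>t. \<rho> (\<gamma> t)) has_derivative (\<lambda>s. g x \<bullet> (s *\<^sub>R dir_perp th))) (at 0)"
  by (rule has_derivative_compose[where f=\<gamma> and g=\<rho> and g'="\<lambda>v. g x \<bullet> v", OF gd d])
 have "isCont \<gamma> 0" using gd by (rule has_derivative_continuous)
 then have "eventually (\<lambda>t. \<gamma> t \<in> U) (at 0)"
  using c x(1) \<gamma>(3) unfolding chart_def isCont_def by (metis topological_tendstoD)
 then have "eventually (\<lambda>t. \<gamma> t \<in> U) (nhds 0)" using x(1) \<gamma>(3) by (simp add: eventually_nhds_conv_at)
 moreover have "eventually (\<lambda>t. t \<in> {-\<epsilon><..<\<epsilon>}) (nhds 0)"
  using \<gamma>(1) by (intro eventually_nhds_in_open) auto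
 ultimately have ev: "eventually (\<lambda>t. \<rho> (\<gamma> t) = 0) (nhds 0)"
  by eventually_elim (use \<gamma>(2) chart_frontier[OF c _ _ cl] in blast)
 have "((\<lambda>t. \<rho> (\<gamma> t)) has_derivative (\<lambda>s. 0)) (at 0)"
  by (rule has_derivative_transform_eventually[of "\<lambda>_. 0"])
    (use ev in \<open>auto simp: eventually_nhds_conv_at elim!: eventually_mono\<close>)
 from has_derivative_unique[OF 1 this] have "g x \<bullet> (1 *\<^sub>R dir_perp th) = 0" by meson
 then show "g x \<bullet> dir_perp th = 0" by simp
qed

text \<open>Finitely many charts cover the frontier; the exceptional set collects the degenerate
  directions of each chart and the bitangent directions of each pair of charts, a chart paired with
  itself included.\<close>

theorem generic_lines:
 assumes dom: "compact_smooth_domain \<Omega>"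
 shows "\<exists>N. negligible N \<and> (\<forall>th. th \<notin> N --> (\<forall>s. countable {t. pt th s t \<in> frontier \<Omega>} \<and>
   ((tangency_set \<Omega> s th = {} \<and> regular \<Omega> th s {}) \<or>
   (\<exists>t0. pt th s t0 \<in> frontier \<Omega> \<and> (\<exists>\<sigma> v k d. touching \<Omega> th s t0 \<sigma> v k d) \<and> (\<forall>e>0. regular \<Omega> th s (ball t0 e))))))"
proof -
 have cp: "compact \<Omega>" and cl: "closed \<Omega>" using dom compact_imp_closed unfolding compact_smooth_domain_def by blast+
 have "\<forall>x. \<exists>w. x \<in> frontier \<Omega> --> x \<in> fst w \<and> chart \<Omega> (fst w) (fst (snd w)) (fst (snd (snd w))) (snd (snd (snd w)))"
 proof
  fix x
  show "\<exists>w. x \<in> frontier \<Omega> --> x \<in> fst w \<and> chart \<Omega> (fst w) (fst (snd w)) (fst (snd (snd w))) (snd (snd (snd w)))"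
  proof (cases "x \<in> frontier \<Omega>")
   case True
   then obtain U \<rho> g H where "x \<in> U" "chart \<Omega> U \<rho> g H" using chart_exists[OF dom] by blast
   then show ?thesis by (intro exI[of _ "(U, \<rho>, g, H)"]) simp
  qed simp
 qed
 then obtain w where w: "\<forall>x. x \<in> frontier \<Omega> --> x \<in> fst (w x) \<and> chart \<Omega> (fst (w x)) (fst (snd (w x))) (fst (snd (snd (w x)))) (snd (snd (snd (w x))))"
  by (atomize_elim, rule choice)
 define U \<rho> g H where "U x = fst (w x)" and "\<rho> x = fst (snd (w x))" and "g x = fst (snd (snd (w x)))" and "H x = snd (snd (snd (w x)))" for x
 have ch: "x \<in> U x" "chart \<Omega> (U x) (\<rho> x) (g x) (H x)" if "x \<in> frontier \<Omega>" for x
  using w that unfolding U_def \<rho>_def g_def H_def by blast+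
 have "compact (frontier \<Omega>)" using cp by (rule compact_frontier)
 then obtain I where I: "I \<subseteq> frontier \<Omega>" "finite I" "frontier \<Omega> \<subseteq> (\<Union>i\<in>I. U i)"
 proof (rule compactE_image[of _ "frontier \<Omega>" U])
  show "open (U x)" if "x \<in> frontier \<Omega>" for x using ch(2)[OF that] by (simp add: chart_def)
  show "frontier \<Omega> \<subseteq> (\<Union>x\<in>frontier \<Omega>. U x)" using ch(1) by blast
 qed
 have ci: "chart \<Omega> (U i) (\<rho> i) (g i) (H i)" if "i \<in> I" for i using ch(2) I(1) that by blast
 define Dg where "Dg i = {th. \<exists>x\<in>U i. \<rho> i x = 0 \<and> g i x \<bullet> dir_perp th = 0 \<and> H i x (dir_perp th) \<bullet> dir_perp th = 0}" for i
 define W where "W i j = {(x, y, th). x \<noteq> y \<and> x \<bullet> dir th = y \<bullet> dir th \<and>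
   x \<in> U i \<and> \<rho> i x = 0 \<and> g i x \<bullet> dir_perp th = 0 \<and> H i x (dir_perp th) \<bullet> dir_perp th \<noteq> 0 \<and>
   y \<in> U j \<and> \<rho> j y = 0 \<and> g j y \<bullet> dir_perp th = 0 \<and> H j y (dir_perp th) \<bullet> dir_perp th \<noteq> 0}" for i j
 define N where "N = (\<Union>i\<in>I. Dg i) \<union> (\<Union>i\<in>I. \<Union>j\<in>I. (\<lambda>z. snd (snd z)) ` W i j)"
 have negN: "negligible N"
  unfolding N_def
 proof (intro negligible_Un)
  have nD: "negligible (Dg i)" if "i \<in> I" for i
   unfolding Dg_def by (rule negligible_degenerate[OF ci[OF that]])
  show "negligible (\<Union>i\<in>I. Dg i)"
   by (intro negligible_Union) (use I(2) nD in auto)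
  have cW: "countable (W i j)" if "i \<in> I" "j \<in> I" for i j
   unfolding W_def by (rule countable_bitangent[OF ci[OF that(1)] ci[OF that(2)]])
  have "countable (\<Union>i\<in>I. \<Union>j\<in>I. (\<lambda>z. snd (snd z)) ` W i j)"
   by (intro countable_UN countable_finite[OF I(2)] countable_image cW)
  then show "negligible (\<Union>i\<in>I. \<Union>j\<in>I. (\<lambda>z. snd (snd z)) ` W i j)"
   by (intro countable_imp_null_set_lborel[THEN null_sets_completionI, folded negligible_iff_null_sets])
 qed
 have main: "countable {t. pt th s t \<in> frontier \<Omega>} \<and>
   ((tangency_set \<Omega> s th = {} \<and> regular \<Omega> th s {}) \<or>
   (\<exists>t0. pt th s t0 \<in> frontier \<Omega> \<and> (\<exists>\<sigma> v k d. touching \<Omega> th s t0 \<sigma> v k d) \<and> (\<forall>e>0. regular \<Omega> th s (ball t0 e))))"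
  if th: "th \<notin> N" for th s
 proof -
  \<comment> \<open>Tangency expressed by the gradient instead of curves; by
    \<open>tangency_set_chart\<close> every point of \<open>tangency_set\<close> satisfies
    \<open>T\<close> at its coordinate.\<close>
  define T where "T t \<longleftrightarrow> pt th s t \<in> frontier \<Omega> \<and> (\<exists>i\<in>I. pt th s t \<in> U i \<and> g i (pt th s t) \<bullet> dir_perp th = 0)" for t
  have T: "\<exists>i\<in>I. pt th s t \<in> U i \<and> \<rho> i (pt th s t) = 0 \<and> g i (pt th s t) \<bullet> dir_perp th = 0 \<and> H i (pt th s t) (dir_perp th) \<bullet> dir_perp th \<noteq> 0"
   if t: "T t" for t
  proof -
   obtain i where i: "i \<in> I" "pt th s t \<in> U i" "g i (pt th s t) \<bullet> dir_perp th = 0"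
    using t unfolding T_def by blast
   have r: "\<rho> i (pt th s t) = 0" using chart_frontier[OF ci[OF i(1)] i(2) _ cl] t by (simp add: T_def)
   have "th \<notin> Dg i" using th i(1) by (auto simp: N_def)
   then have "H i (pt th s t) (dir_perp th) \<bullet> dir_perp th \<noteq> 0" using i r by (auto simp: Dg_def)
   then show ?thesis using i r by blast
  qed
  have nT: "\<exists>i\<in>I. pt th s t \<in> U i \<and> g i (pt th s t) \<bullet> dir_perp th \<noteq> 0"
   if "\<not> T t" "pt th s t \<in> frontier \<Omega>" for t
   using that I(3) unfolding T_def by blast
  have uniq: "t = t'" if tt: "T t" "T t'" for t t'
  proof (rule ccontr)
   assume ne: "t \<noteq> t'"
   then have "pt th s t \<noteq> pt th s t'" by (metis pt_inner(2))
   moreover obtain i where i: "i \<in> I" "pt th s t \<in> U i \<and> \<rho> i (pt th s t) = 0 \<and> g i (pt th s t) \<bullet> dir_perp th = 0 \<and> H i (pt th s t) (dir_perp th) \<bullet> dir_perp th \<noteq> 0"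
    using T[OF tt(1)] by blast
   moreover obtain j where j: "j \<in> I" "pt th s t' \<in> U j \<and> \<rho> j (pt th s t') = 0 \<and> g j (pt th s t') \<bullet> dir_perp th = 0 \<and> H j (pt th s t') (dir_perp th) \<bullet> dir_perp th \<noteq> 0"
    using T[OF tt(2)] by blast
   ultimately have "(pt th s t, pt th s t', th) \<in> W i j" by (simp add: W_def)
   then have "th \<in> (\<lambda>z. snd (snd z)) ` W i j" by force
   then show False using th i(1) j(1) by (auto simp: N_def)
  qed
  \<comment> \<open>Frontier points on the line are isolated: at tangencies by the parabola model,
    elsewhere by transversality.\<close>
  have cnt: "countable {t. pt th s t \<in> frontier \<Omega>}"
  proof (rule discrete_countable)
   fix t assume "t \<in> {t. pt th s t \<in> frontier \<Omega>}"
   then have t: "pt th s t \<in> frontier \<Omega>" by simp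
   have "\<exists>i\<in>I. \<exists>\<delta>>0. \<forall>t'\<in>ball t \<delta>. t' \<noteq> t --> pt th s t' \<in> U i \<and> \<rho> i (pt th s t') \<noteq> 0"
   proof (cases "T t")
    case True
    then obtain i where i: "i \<in> I" "pt th s t \<in> U i" "\<rho> i (pt th s t) = 0" "g i (pt th s t) \<bullet> dir_perp th = 0" "H i (pt th s t) (dir_perp th) \<bullet> dir_perp th \<noteq> 0"
     using T by blast
    show ?thesis using chart_touching(2)[OF ci[OF i(1)] i(2-5)] i(1) by blast
   next
    case False
    then obtain i where i: "i \<in> I" "pt th s t \<in> U i" "g i (pt th s t) \<bullet> dir_perp th \<noteq> 0" using nT t by blast
    have "\<rho> i (pt th s t) = 0" by (rule chart_frontier[OF ci[OF i(1)] i(2) t cl])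
    then show ?thesis using chart_transversal(2)[OF ci[OF i(1)] i(2,3)] i(1) by auto
   qed
   then obtain i \<delta> where i: "i \<in> I" "\<delta> > 0" "\<And>t'. t' \<in> ball t \<delta> ==> t' \<noteq> t ==> pt th s t' \<in> U i \<and> \<rho> i (pt th s t') \<noteq> 0" by blast
   show "\<exists>r>0. \<forall>q\<in>{t. pt th s t \<in> frontier \<Omega>}. dist q t < r --> q = t"
   proof (intro exI[of _ \<delta>] conjI i(2) ballI impI)
    fix q assume q: "q \<in> {t. pt th s t \<in> frontier \<Omega>}" "dist q t < \<delta>"
    show "q = t"
    proof (rule ccontr)
     assume "q \<noteq> t"
     then have "pt th s q \<in> U i" "\<rho> i (pt th s q) \<noteq> 0" using i(3)[of q] q(2) by (auto simp: dist_commute)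
     then show False using chart_frontier[OF ci[OF i(1)] _ _ cl] q(1) by blast
    qed
   qed
  qed
  have reg: "regular \<Omega> th s J" if J: "open J" "\<And>t. T t ==> t \<in> J" for J
  proof (rule regular_from_local[OF cp J(1)])
   fix t assume t: "t \<notin> J" "pt th s t \<in> frontier \<Omega>"
   then obtain i where i: "i \<in> I" "pt th s t \<in> U i" "g i (pt th s t) \<bullet> dir_perp th \<noteq> 0" using nT J(2) by blast
   show "\<exists>\<delta>>0. \<exists>L\<ge>0. \<forall>s'\<in>ball s \<delta>. \<forall>s''\<in>ball s \<delta>.
    emeasure lborel {t'. t' \<in> ball t \<delta> \<and> (pt th s' t' \<in> \<Omega>) \<noteq> (pt th s'' t' \<in> \<Omega>)} \<le> ennreal (L * \<bar>s' - s''\<bar>)"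
    by (rule chart_transversal(1)[OF ci[OF i(1)] i(2,3)])
  qed
  have dich: "(tangency_set \<Omega> s th = {} \<and> regular \<Omega> th s {}) \<or>
   (\<exists>t0. pt th s t0 \<in> frontier \<Omega> \<and> (\<exists>\<sigma> v k d. touching \<Omega> th s t0 \<sigma> v k d) \<and> (\<forall>e>0. regular \<Omega> th s (ball t0 e)))"
  proof (cases "\<exists>t. T t")
   case True
   then obtain t0 where t0: "T t0" by blast
   obtain i where i: "i \<in> I" "pt th s t0 \<in> U i" "\<rho> i (pt th s t0) = 0" "g i (pt th s t0) \<bullet> dir_perp th = 0" "H i (pt th s t0) (dir_perp th) \<bullet> dir_perp th \<noteq> 0"
    using T[OF t0] by blast
   have "\<exists>\<sigma> v k d. touching \<Omega> th s t0 \<sigma> v k d" by (rule chart_touching(1)[OF ci[OF i(1)] i(2-5)])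
   moreover have "regular \<Omega> th s (ball t0 e)" if "e > 0" for e
    using uniq[OF _ t0] that by (intro reg) auto
   moreover have "pt th s t0 \<in> frontier \<Omega>" using t0 by (simp add: T_def)
   ultimately show ?thesis by blast
  next
   case False
   have "tangency_set \<Omega> s th = {}"
   proof (rule ccontr)
    assume "tangency_set \<Omega> s th \<noteq> {}"
    then obtain x where x: "x \<in> tangency_set \<Omega> s th" by blast
    then obtain \<gamma> and \<epsilon> :: real where "\<epsilon> > 0" "\<gamma> ` {-\<epsilon><..<\<epsilon>} \<subseteq> frontier \<Omega>" "\<gamma> 0 = x"
     unfolding tangency_set_def tangent_vector_def curve_through_def by blast
    then have "x \<in> frontier \<Omega>" by force
    then obtain i where i: "i \<in> I" "x \<in> U i" using I(3) by blast
    note * = tangency_set_chart[OF ci[OF i(1)] cl i(2) x]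
    have "T (x \<bullet> dir_perp th)" unfolding T_def *(2)[symmetric] using *(1,3) i by blast
    then show False using False by blast
   qed
   moreover have "regular \<Omega> th s {}" using False by (intro reg) auto
   ultimately show ?thesis by blast
  qed
  show ?thesis by (rule conjI[OF cnt dich])
 qed
 show ?thesis
  by (rule exI[of _ N], intro conjI[OF negN] allI impI) (rule main)
qed

section \<open>Tubes around the boundary, translations and rotations\<close>

lemma emeasure_thin_slices:
 fixes A :: "(real \<times> real) set"
 assumes [measurable]: "A \<in> sets borel" and r: "\<And>y. y \<in> A ==> dist y x < r" and "r \<ge> 0" "d \<ge> 0"
  and e: "e = (1, 0) \<or> e = (0, 1)"
  and thin: "\<And>y \<tau>. y \<in> A ==> y + \<tau> *\<^sub>R e \<in> A ==> \<bar>\<tau>\<bar> \<le> d"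
 shows "emeasure lborel A \<le> ennreal (4 * d * r)"
proof -
 have m: "A \<in> sets (lborel \<Otimes>\<^sub>M lborel)" using assms(1) by (metis lborel_prod sets_lborel)
 have b: "(NN a. ennreal (2 * d) * indicator {c - r..c + r} a) \<le> ennreal (4 * d * r)" for c :: real
  using assms(3,4) by (simp add: nn_integral_cmult_indicator ennreal_mult[symmetric])
 show ?thesis
  using e
 proof
  assume e: "e = (0, 1)"
  have "emeasure lborel A = (NN a. emeasure lborel (Pair a -` A))"
   using lborel.emeasure_pair_measure_alt[OF m] by (simp add: lborel_prod)
  also have "... \<le> (NN a. ennreal (2 * d) * indicator {fst x - r..fst x + r} a)"
  proof (intro nn_integral_mono)
   fix a
   show "emeasure lborel (Pair a -` A) \<le> ennreal (2 * d) * indicator {fst x - r..fst x + r} a"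
   proof (cases "Pair a -` A = {}")
    case False
    then obtain b where "(a, b) \<in> A" by blast
    then have "\<bar>a - fst x\<bar> < r" using r[of "(a, b)"] dist_fst_le[of "(a, b)" x] by (simp add: dist_real_def)
    moreover have "emeasure lborel (Pair a -` A) \<le> ennreal (2 * d)"
    proof (rule emeasure_small_diameter[OF _ assms(4)])
     fix t t' assume "t \<in> Pair a -` A" "t' \<in> Pair a -` A"
     then show "\<bar>t - t'\<bar> \<le> d" using thin[of "(a, t')" "t - t'"] by (simp add: e)
    qed
    ultimately show ?thesis by (simp add: indicator_def abs_less_iff)
   qed simp
  qed
  finally show ?thesis using b order_trans by blast
 next
  assume e: "e = (1, 0)"
  have "emeasure lborel A = (NN b. emeasure lborel ((\<lambda>a. (a, b)) -` A))"
   using lborel_pair.emeasure_pair_measure_alt2[OF m] by (simp add: lborel_prod)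
  also have "... \<le> (NN b. ennreal (2 * d) * indicator {snd x - r..snd x + r} b)"
  proof (intro nn_integral_mono)
   fix b
   show "emeasure lborel ((\<lambda>a. (a, b)) -` A) \<le> ennreal (2 * d) * indicator {snd x - r..snd x + r} b"
   proof (cases "(\<lambda>a. (a, b)) -` A = {}")
    case False
    then obtain a where "(a, b) \<in> A" by blast
    then have "\<bar>b - snd x\<bar> < r" using r[of "(a, b)"] dist_snd_le[of "(a, b)" x] by (simp add: dist_real_def)
    moreover have "emeasure lborel ((\<lambda>a. (a, b)) -` A) \<le> ennreal (2 * d)"
    proof (rule emeasure_small_diameter[OF _ assms(4)])
     fix t t' assume "t \<in> (\<lambda>a. (a, b)) -` A" "t' \<in> (\<lambda>a. (a, b)) -` A"
     then show "\<bar>t - t'\<bar> \<le> d" using thin[of "(t', b)" "t - t'"] by (simp add: e)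
    qed
    ultimately show ?thesis by (simp add: indicator_def abs_less_iff)
   qed simp
  qed
  finally show ?thesis using b order_trans by blast
 qed
qed

text \<open>Some coordinate direction \<open>e\<close> is transversal to the level sets of
  \<open>\<rho>\<close>. On the tube of width \<open>h\<close> the absolute value of
  \<open>\<rho>\<close> is at most \<open>M * h\<close>, and its slope along \<open>e\<close> is at
  least \<open>k / 2\<close> in size, so slices in direction \<open>e\<close> are short and Fubini
  gives the measure.\<close>

lemma tube_local:
 assumes c: "chart \<Omega> U \<rho> g H" and x: "x \<in> U" "x \<in> frontier \<Omega>" and cl: "closed \<Omega>"
 shows "\<exists>\<delta>>0. \<exists>L\<ge>0. \<forall>h. 0 < h --> h < \<delta> -->
  emeasure lborel {y. infdist y (frontier \<Omega> \<inter> cball x \<delta>) \<le> h} \<le> ennreal (L * h)"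
proof -
 have g0: "g x \<noteq> 0" using c x(1) unfolding chart_def by blast
 obtain e where e: "e = (1, 0) \<or> e = (0, 1::real)" "g x \<bullet> e \<noteq> 0"
 proof (cases "g x \<bullet> (1, 0) = 0")
  case True
  then have "g x \<bullet> (0, 1) \<noteq> 0" using g0 by (cases "g x") (auto simp: zero_prod_def)
  then show ?thesis using that by blast
 qed (use that in blast)
 have ne: "norm e = 1" using e(1) by (auto simp: norm_Pair)
 define k where "k = \<bar>g x \<bullet> e\<bar>"
 have k: "k > 0" using e by (simp add: k_def)
 obtain r where r: "r > 0" "ball x r \<subseteq> U" "\<And>z. z \<in> ball x r ==> norm (g z - g x) < k / 2"
  using chart_ball[OF c x(1), of "k / 2"] k by auto
 define M where "M = norm (g x) + k / 2"
 have M: "norm (g z) \<le> M" if "z \<in> ball x r" for z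
  using r(3)[OF that] norm_triangle_ineq[of "g z - g x" "g x"] by (simp add: M_def)
 have M0: "M \<ge> 0" using k by (simp add: M_def)
 have lb: "k / 2 \<le> \<bar>g z \<bullet> e\<bar>" if "z \<in> ball x r" for z
 proof -
  have "\<bar>(g z - g x) \<bullet> e\<bar> \<le> norm (g z - g x) * norm e" by (rule Cauchy_Schwarz_ineq2)
  then have "\<bar>(g z - g x) \<bullet> e\<bar> \<le> k / 2" using r(3)[OF that] ne by simp
  then show ?thesis unfolding k_def inner_diff_left by linarith
 qed
 \<comment> \<open>With a quarter of the radius, points of the tube and their nearest points in
   \<open>K\<close> both stay in \<open>ball x r\<close>.\<close>
 define \<delta> where "\<delta> = r / 4"
 have \<delta>: "\<delta> > 0" using r(1) by (simp add: \<delta>_def)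
 define K where "K = frontier \<Omega> \<inter> cball x \<delta>"
 have K: "closed K" "K \<noteq> {}" using x(2) \<delta> by (auto simp: K_def intro!: closed_Int)
 show ?thesis
 proof (rule exI[of _ \<delta>], rule conjI[OF \<delta>], rule exI[of _ "16 * M / k * r"], intro conjI allI impI)
  fix h assume h: "0 < h" "h < \<delta>"
  let ?A = "{y. infdist y K \<le> h}"
  have "closed ?A" by (intro closed_Collect_le continuous_intros)
  then have Am: "?A \<in> sets borel" by (rule borel_closed)
  have A: "y \<in> ball x r \<and> \<bar>\<rho> y\<bar> \<le> M * h" if y: "y \<in> ?A" for y
  proof -
   obtain z where z': "z \<in> K" "infdist y K = dist y z" using infdist_attains_inf[OF K] by blast
   then have z: "z \<in> K" "dist y z \<le> h" using y by simp_all
   have zx: "dist x z \<le> \<delta>" "z \<in> frontier \<Omega>" using z(1) by (auto simp: K_def)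
   have "dist x y \<le> dist x z + dist z y" by (rule dist_triangle)
   then have yb: "y \<in> ball x r" using zx z(2) h r(1) by (simp add: \<delta>_def dist_commute)
   have zb: "z \<in> ball x r" using zx r(1) by (simp add: \<delta>_def)
   have "\<rho> z = 0" using chart_frontier[OF c _ zx(2) cl] zb r(2) by blast
   obtain p where p: "p \<in> ball x r" "\<rho> y - \<rho> z = g p \<bullet> (y - z)" using chart_mvt[OF c r(2) zb yb] by blast
   have "\<bar>\<rho> y\<bar> = \<bar>g p \<bullet> (y - z)\<bar>" using p(2) \<open>\<rho> z = 0\<close> by simp
   also have "... \<le> norm (g p) * norm (y - z)" by (rule Cauchy_Schwarz_ineq2)
   also have "... \<le> M * h" using M[OF p(1)] z(2) M0 by (intro mult_mono) (auto simp: dist_norm)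
   finally show ?thesis using yb by simp
  qed
  have "emeasure lborel ?A \<le> ennreal (4 * (4 * M * h / k) * r)"
  proof (rule emeasure_thin_slices[OF Am _ _ _ e(1), of x])
   show "dist y x < r" if "y \<in> ?A" for y using A[OF that] by (simp add: dist_commute)
   show "\<bar>\<tau>\<bar> \<le> 4 * M * h / k" if y: "y \<in> ?A" "y + \<tau> *\<^sub>R e \<in> ?A" for y \<tau>
   proof -
    obtain p where p: "p \<in> ball x r" "\<rho> (y + \<tau> *\<^sub>R e) - \<rho> y = g p \<bullet> (y + \<tau> *\<^sub>R e - y)"
     using chart_mvt[OF c r(2), of y "y + \<tau> *\<^sub>R e"] A[OF y(1)] A[OF y(2)] by blast
    have "\<bar>\<tau>\<bar> * (k / 2) \<le> \<bar>\<tau>\<bar> * \<bar>g p \<bullet> e\<bar>" by (intro mult_left_mono lb p) auto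
    also have "... = \<bar>\<rho> (y + \<tau> *\<^sub>R e) - \<rho> y\<bar>" unfolding p(2) by (simp add: abs_mult)
    also have "... \<le> 2 * (M * h)" using A[OF y(1)] A[OF y(2)] by linarith
    finally show ?thesis using k by (simp add: field_simps)
   qed
  qed (use r(1) M0 h k in auto)
  then show "emeasure lborel {y. infdist y (frontier \<Omega> \<inter> cball x \<delta>) \<le> h} \<le> ennreal (16 * M / k * r * h)"
   by (simp add: K_def mult_ac)
 qed (use M0 k r in auto)
qed

text \<open>The Borel set is a finite union of local tubes, each closed because
  \<open>infdist\<close> is continuous.\<close>

lemma tube_measure:
 assumes dom: "compact_smooth_domain \<Omega>"
 shows "\<exists>\<delta>>0. \<exists>L\<ge>0. \<forall>h. 0 < h --> h < \<delta> -->
  (\<exists>B\<in>sets borel. {y. \<exists>z\<in>frontier \<Omega>. dist y z \<le> h} \<subseteq> B \<and> emeasure lborel B \<le> ennreal (L * h))"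
proof -
 have cp: "compact \<Omega>" and cl: "closed \<Omega>" using dom compact_imp_closed unfolding compact_smooth_domain_def by blast+
 define P where "P x \<delta> L \<longleftrightarrow> (\<forall>h. 0 < h --> h < \<delta> --> emeasure lborel {y. infdist y (frontier \<Omega> \<inter> cball x \<delta>) \<le> h} \<le> ennreal (L * h))" for x \<delta> L
 have "\<exists>\<delta>>0. \<exists>L\<ge>0. P x \<delta> L" if x: "x \<in> frontier \<Omega>" for x
 proof -
  obtain U \<rho> g H where "x \<in> U" "chart \<Omega> U \<rho> g H" using chart_exists[OF dom x] by blast
  then show ?thesis using tube_local[OF _ _ x cl] unfolding P_def by blast
 qed
 then obtain \<delta> L where \<delta>: "\<And>x. x \<in> frontier \<Omega> ==> \<delta> x > 0" and L0: "\<And>x. x \<in> frontier \<Omega> ==> L x \<ge> 0"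
  and P: "\<And>x. x \<in> frontier \<Omega> ==> P x (\<delta> x) (L x)"
  by metis
 have cf: "compact (frontier \<Omega>)" using cp by (rule compact_frontier)
 have cov: "frontier \<Omega> \<subseteq> (\<Union>x\<in>frontier \<Omega>. ball x (\<delta> x))" using \<delta> by force
 obtain I where I: "I \<subseteq> frontier \<Omega>" "finite I" "frontier \<Omega> \<subseteq> (\<Union>x\<in>I. ball x (\<delta> x))"
  by (rule compactE_image[OF cf _ cov]) auto
 define d where "d = Min (insert 1 (\<delta> ` I))"
 have d: "d > 0" unfolding d_def using I \<delta> by (subst Min_gr_iff) auto
 have dle: "d \<le> \<delta> x" if "x \<in> I" for x unfolding d_def using I(2) that by (intro Min_le) auto
 show ?thesis
 proof (rule exI[of _ d], rule conjI[OF d], rule exI[of _ "\<Sum>x\<in>I. L x"], intro conjI allI impI)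
  show "0 \<le> (\<Sum>x\<in>I. L x)" using L0 I(1) by (intro sum_nonneg) blast
  fix h assume h: "0 < h" "h < d"
  let ?A = "\<lambda>x. {y. infdist y (frontier \<Omega> \<inter> cball x (\<delta> x)) \<le> h}"
  have m: "?A x \<in> sets borel" for x by (intro borel_closed closed_Collect_le continuous_intros)
  show "\<exists>B\<in>sets borel. {y. \<exists>z\<in>frontier \<Omega>. dist y z \<le> h} \<subseteq> B \<and> emeasure lborel B \<le> ennreal ((\<Sum>x\<in>I. L x) * h)"
  proof (intro bexI[of _ "\<Union>x\<in>I. ?A x"] conjI)
   show "(\<Union>x\<in>I. ?A x) \<in> sets borel" using m I(2) by auto
   show "{y. \<exists>z\<in>frontier \<Omega>. dist y z \<le> h} \<subseteq> (\<Union>x\<in>I. ?A x)"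
   proof safe
    fix y z assume z: "z \<in> frontier \<Omega>" "dist y z \<le> h"
    then obtain x where x: "x \<in> I" "z \<in> ball x (\<delta> x)" using I(3) by blast
    then have "z \<in> frontier \<Omega> \<inter> cball x (\<delta> x)" using z(1) by simp
    then have "infdist y (frontier \<Omega> \<inter> cball x (\<delta> x)) \<le> h" by (rule order_trans[OF infdist_le z(2)])
    then show "y \<in> (\<Union>x\<in>I. ?A x)" using x(1) by blast
   qed
   have "emeasure lborel (\<Union>x\<in>I. ?A x) \<le> (\<Sum>x\<in>I. emeasure lborel (?A x))"
    using I(2) m by (intro emeasure_subadditive_finite) auto
   also have "... \<le> (\<Sum>x\<in>I. ennreal (L x * h))"
   proof (rule sum_mono)
    fix x assume x: "x \<in> I"
    then show "emeasure lborel (?A x) \<le> ennreal (L x * h)"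
     using P[of x] I(1) h dle[OF x] unfolding P_def by (meson less_le_trans subsetD)
   qed
   also have "... = ennreal ((\<Sum>x\<in>I. L x) * h)"
    using L0 I(1) h by (subst sum_ennreal) (auto simp: sum_distrib_right)
   finally show "emeasure lborel (\<Union>x\<in>I. ?A x) \<le> ennreal ((\<Sum>x\<in>I. L x) * h)" .
  qed
 qed
qed

lemma smooth_lipschitz:
 fixes u :: "real \<times> real => real"
 assumes "smooth_on UNIV u"
 shows "\<exists>L\<ge>0. \<forall>x\<in>cball 0 R. \<forall>y\<in>cball 0 R. \<bar>u x - u y\<bar> \<le> L * norm (x - y)"
proof -
 have d: "(u has_derivative frechet_derivative u (at x)) (at x)" for x
  using smooth_on_differentiable[OF assms] by (simp add: frechet_derivative_works)
 have "\<exists>B. \<forall>x\<in>cball 0 R. \<bar>frechet_derivative u (at x) v\<bar> \<le> B" for v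
 proof -
  have "continuous_on (cball 0 R) (\<lambda>x. frechet_derivative u (at x) v)"
   using smooth_on_continuous_on[OF smooth_on_deriv[OF assms]] continuous_on_subset by blast
  then have "bounded ((\<lambda>x. frechet_derivative u (at x) v) ` cball 0 R)"
   by (intro compact_imp_bounded compact_continuous_image) auto
  then show ?thesis unfolding bounded_iff by auto
 qed
 then obtain B where B: "\<And>v x. x \<in> cball 0 R ==> \<bar>frechet_derivative u (at x) v\<bar> \<le> B v" by metis
 define L where "L = \<bar>B (1, 0)\<bar> + \<bar>B (0, 1)\<bar>"
 have "\<bar>u x - u y\<bar> \<le> L * norm (x - y)" if "x \<in> cball 0 R" "y \<in> cball 0 R" for x y
 proof -
  have "norm (u x - u y) \<le> L * norm (x - y)"
  proof (rule differentiable_bound[OF convex_cball _ _ that])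
   fix z :: "real \<times> real" assume z: "z \<in> cball 0 R"
   show "(u has_derivative frechet_derivative u (at z)) (at z within cball 0 R)"
    using d by (rule has_derivative_at_withinI)
   show "onorm (frechet_derivative u (at z)) \<le> L"
   proof (rule onorm_le)
    fix v :: "real \<times> real"
    obtain a b where v: "v = (a, b)" by (cases v)
    interpret linear "frechet_derivative u (at z)" using d by (rule has_derivative_linear)
    have nv: "\<bar>a\<bar> \<le> norm v" "\<bar>b\<bar> \<le> norm v"
     unfolding v using norm_fst_le[of a b] norm_snd_le[of b a] by simp_all
    have "v = a *\<^sub>R (1, 0) + b *\<^sub>R (0, 1)" by (simp add: v)
    then have "frechet_derivative u (at z) v = a * frechet_derivative u (at z) (1, 0) + b * frechet_derivative u (at z) (0, 1)"
     by (simp only: add scale) simp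
    also have "\<bar>...\<bar> \<le> \<bar>a\<bar> * \<bar>frechet_derivative u (at z) (1, 0)\<bar> + \<bar>b\<bar> * \<bar>frechet_derivative u (at z) (0, 1)\<bar>"
     using abs_triangle_ineq by (metis abs_mult)
    also have "... \<le> norm v * \<bar>B (1, 0)\<bar> + norm v * \<bar>B (0, 1)\<bar>"
     using B[OF z, of "(1, 0)"] B[OF z, of "(0, 1)"] nv
     by (intro add_mono mult_mono) linarith+
    finally show "norm (frechet_derivative u (at z) v) \<le> L * norm v" by (simp add: L_def algebra_simps)
   qed
  qed
  then show ?thesis by simp
 qed
 then show ?thesis by (intro exI[of _ L]) (auto simp: L_def)
qed

lemma continuous_bounded_cball:
 fixes u :: "'a::euclidean_space => real"
 assumes "continuous_on UNIV u"
 shows "\<exists>M\<ge>0. \<forall>x\<in>cball 0 R. \<bar>u x\<bar> \<le> M"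
proof -
 have "bounded (u ` cball 0 R)"
  by (intro compact_imp_bounded compact_continuous_image continuous_on_subset[OF assms]) auto
 then obtain M where "\<forall>x\<in>cball 0 R. \<bar>u x\<bar> \<le> M" unfolding bounded_iff by auto
 then show ?thesis by (intro exI[of _ "max M 0"]) (auto intro: le_max_iff_disj[THEN iffD2])
qed

text \<open>Where both points lie in the domain, \<open>u\<close> is Lipschitz; where only one does,
  the segment between them meets the frontier, so \<open>x\<close> lies in a tube of width
  \<open>norm v\<close>.\<close>

lemma translation_L1:
 fixes u :: "real \<times> real => real"
 assumes dom: "compact_smooth_domain \<Omega>" and \<Omega>1: "\<Omega> \<subseteq> ball 0 1" and u: "smooth_on UNIV u"
 shows "\<exists>h0>0. \<exists>C\<ge>0. \<forall>v. norm v < h0 -->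
  (NN x. ennreal \<bar>u (x + v) * indicator \<Omega> (x + v) - u x * indicator \<Omega> x\<bar>) \<le> ennreal (C * norm v)"
proof -
 have cl: "closed \<Omega>" using dom compact_imp_closed unfolding compact_smooth_domain_def by blast
 obtain \<delta> L where t: "\<delta> > 0" "L \<ge> 0" "\<And>h. 0 < h ==> h < \<delta> ==>
  \<exists>B\<in>sets borel. {y. \<exists>z\<in>frontier \<Omega>. dist y z \<le> h} \<subseteq> B \<and> emeasure lborel B \<le> ennreal (L * h)"
  using tube_measure[OF dom] by blast
 obtain Lu where Lu: "Lu \<ge> 0" "\<And>x y. x \<in> cball 0 1 ==> y \<in> cball 0 1 ==> \<bar>u x - u y\<bar> \<le> Lu * norm (x - y)"
  using smooth_lipschitz[OF u, of 1] by blast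
 obtain M where M: "M \<ge> 0" "\<And>x. x \<in> cball 0 1 ==> \<bar>u x\<bar> \<le> M"
  using continuous_bounded_cball[OF smooth_on_continuous_on[OF u], of 1] by blast
 define m where "m = measure lborel (cball (0::real \<times> real) 1)"
 have m: "emeasure lborel (cball (0::real \<times> real) 1) = ennreal m" "m \<ge> 0"
  unfolding m_def using emeasure_bounded_finite[of "cball (0::real \<times> real) 1"]
  by (auto intro!: emeasure_eq_ennreal_measure)
 have main: "(NN x. ennreal \<bar>u (x + v) * indicator \<Omega> (x + v) - u x * indicator \<Omega> x\<bar>) \<le> ennreal ((Lu * m + M * L) * norm v)"
  if v: "norm v < \<delta>" for v
 proof (cases "v = 0")
  case False
  then obtain B where B: "B \<in> sets borel" "{y. \<exists>z\<in>frontier \<Omega>. dist y z \<le> norm v} \<subseteq> B" "emeasure lborel B \<le> ennreal (L * norm v)"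
   using t(3)[of "norm v"] v by auto
  have pw: "ennreal \<bar>u (x + v) * indicator \<Omega> (x + v) - u x * indicator \<Omega> x\<bar> \<le>
    ennreal (Lu * norm v) * indicator (cball 0 1) x + ennreal M * indicator B x" for x
  proof (cases "(x + v \<in> \<Omega>) = (x \<in> \<Omega>)")
   case True
   show ?thesis
   proof (cases "x \<in> \<Omega>")
    case xin: True
    then have "x \<in> cball 0 1" "x + v \<in> cball 0 1" using True \<Omega>1 by auto
    then show ?thesis using Lu(2)[of "x + v" x] xin True
     by (auto intro!: add_increasing2 ennreal_leI)
   qed (use True in simp)
  next
   case False
   have "closed_segment x (x + v) \<inter> frontier \<Omega> \<noteq> {}"
   proof (rule connected_Int_frontier)
    show "connected (closed_segment x (x + v))" by (rule connected_segment)
    show "closed_segment x (x + v) \<inter> \<Omega> \<noteq> {}" "closed_segment x (x + v) - \<Omega> \<noteq> {}"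
     using False ends_in_segment[of x "x + v"] ends_in_segment[of "x + v" x] by blast+
   qed
   then obtain z where z: "z \<in> closed_segment x (x + v)" "z \<in> frontier \<Omega>" by blast
   then have "dist x z \<le> norm v" using segment_bound[OF z(1)] by (simp add: dist_norm norm_minus_commute)
   then have "x \<in> B" using B(2) z(2) by blast
   moreover have "\<bar>u (x + v) * indicator \<Omega> (x + v) - u x * indicator \<Omega> x\<bar> \<le> M"
    using False M(2)[of x] M(2)[of "x + v"] subsetD[OF \<Omega>1, of x] subsetD[OF \<Omega>1, of "x + v"] by (cases "x \<in> \<Omega>") auto
   ultimately show ?thesis by (auto intro!: add_increasing ennreal_leI)
  qed
  have "(NN x. ennreal \<bar>u (x + v) * indicator \<Omega> (x + v) - u x * indicator \<Omega> x\<bar>) \<le>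
   (NN x. ennreal (Lu * norm v) * indicator (cball 0 1) x + ennreal M * indicator B x)"
   by (intro nn_integral_mono pw)
  also have "... = ennreal (Lu * norm v) * ennreal m + ennreal M * emeasure lborel B"
  proof -
   have [measurable]: "B \<in> sets borel" by (rule B(1))
   have "(\<lambda>x. ennreal (Lu * norm v) * indicator (cball 0 1) (x::real \<times> real)) \<in> borel_measurable lborel"
    "(\<lambda>x. ennreal M * indicator B x) \<in> borel_measurable lborel"
    by (intro borel_measurable_times_ennreal borel_measurable_const borel_measurable_indicator; simp)+
   then show ?thesis by (subst nn_integral_add) (simp_all add: nn_integral_cmult_indicator m(1))
  qed
  also have "... \<le> ennreal (Lu * norm v) * ennreal m + ennreal M * ennreal (L * norm v)"
   by (intro add_left_mono mult_left_mono B) auto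
  also have "... = ennreal ((Lu * m + M * L) * norm v)"
   using Lu(1) M(1) t(2) m(2) by (simp add: ennreal_mult[symmetric] ennreal_plus[symmetric] algebra_simps del: ennreal_plus)
  finally show ?thesis .
 qed simp
 show ?thesis
 proof (rule exI[of _ \<delta>], rule conjI[OF t(1)], rule exI[of _ "Lu * m + M * L"], intro conjI allI impI)
  show "0 \<le> Lu * m + M * L" using Lu(1) M(1) t(2) m(2) by simp
 qed (rule main)
qed

text \<open>The rotation is carried out by two one-variable substitutions, interleaved with Fubini;
  the first has Jacobian \<open>1 / cos th\<close> in absolute value and the second its inverse,
  whence the condition on \<open>cos th\<close>.\<close>

lemma rotation_nn_integral:
 fixes G :: "real \<times> real => ennreal"
 assumes [measurable]: "G \<in> borel_measurable borel" and c: "cos th \<noteq> 0"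
 shows "(NN s. \<integral>\<^sup>+t. G (pt th s t) \<partial>lborel) = (NN x. G x)"
proof -
 have [measurable]: "G \<in> borel_measurable (borel \<Otimes>\<^sub>M borel)" using assms(1) by (simp add: borel_prod)
 define C S where "C = cos th" and "S = sin th"
 have C: "C \<noteq> 0" using c by (simp add: C_def)
 have CS: "S * S / C + C = 1 / C"
 proof -
  have "S * S + C * C = 1" using sin_cos_squared_add3[of th] by (simp add: C_def S_def add.commute)
  moreover have "S * S / C + C = (S * S + C * C) / C" using C by (simp add: add_divide_distrib)
  ultimately show ?thesis by simp
 qed
 have pt: "pt th s t = (s * C - t * S, s * S + t * C)" for s t
  by (simp add: pt_def dir_def dir_perp_def C_def S_def)
 have 1: "(NN s. G (s * C - t * S, s * S + t * C)) = ennreal \<bar>1 / C\<bar> * (NN a. G (a, a * S / C + t / C))" for t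
 proof -
  have m: "(\<lambda>s. G (s * C - t * S, s * S + t * C)) \<in> borel_measurable borel" by measurable
  have e: "(t * S / C + (1 / C) *\<^sub>R a) * C - t * S = a" "(t * S / C + (1 / C) *\<^sub>R a) * S + t * C = a * S / C + t / C" for a
  proof -
   show "(t * S / C + (1 / C) *\<^sub>R a) * C - t * S = a"
    using C by (simp add: distrib_right)
   have "(t * S / C + (1 / C) *\<^sub>R a) * S + t * C = a * S / C + t * (S * S / C + C)" by (simp add: algebra_simps)
   then show "(t * S / C + (1 / C) *\<^sub>R a) * S + t * C = a * S / C + t / C" unfolding CS by simp
  qed
  have "(NN s. G (s * C - t * S, s * S + t * C)) = ennreal (\<bar>1 / C\<bar> ^ DIM(real)) *
   (NN a. G ((t * S / C + (1 / C) *\<^sub>R a) * C - t * S, (t * S / C + (1 / C) *\<^sub>R a) * S + t * C))"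
   using lborel_nn_integral_scale[OF _ m, of "1 / C" "t * S / C"] C by simp
  then show ?thesis unfolding e by simp
 qed
 have 2: "ennreal \<bar>1 / C\<bar> * (NN t. G (a, a * S / C + t / C)) = (NN b. G (a, b))" for a
 proof -
  have m: "(\<lambda>b. G (a, b)) \<in> borel_measurable borel" by measurable
  have "(NN b. G (a, b)) = ennreal (\<bar>1 / C\<bar> ^ DIM(real)) * (NN t. G (a, a * S / C + (1 / C) *\<^sub>R t))"
   using lborel_nn_integral_scale[OF _ m, of "1 / C" "a * S / C"] C by simp
  then show ?thesis by simp
 qed
 let ?D = "\<lambda>a t. G (a, a * S / C + t / C)"
 have m1: "(\<lambda>(t, s). G (s * C - t * S, s * S + t * C)) \<in> borel_measurable (lborel \<Otimes>\<^sub>M lborel)"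
  by measurable
 have m2: "(\<lambda>(a, t). ?D a t) \<in> borel_measurable (lborel \<Otimes>\<^sub>M lborel)" by measurable
 have m3: "(\<lambda>t. NN a. ?D a t) \<in> borel_measurable lborel"
  and m4: "(\<lambda>a. NN t. ?D a t) \<in> borel_measurable lborel" by measurable
 have a1: "(NN s. \<integral>\<^sup>+t. G (pt th s t) \<partial>lborel) = (NN t. \<integral>\<^sup>+s. G (s * C - t * S, s * S + t * C) \<partial>lborel)"
  unfolding pt by (rule lborel_pair.Fubini'[OF m1])
 have a2: "... = ennreal \<bar>1 / C\<bar> * (NN t. \<integral>\<^sup>+a. ?D a t \<partial>lborel)"
  unfolding 1 by (rule nn_integral_cmult[OF m3])
 have a3: "(NN t. \<integral>\<^sup>+a. ?D a t \<partial>lborel) = (NN a. \<integral>\<^sup>+t. ?D a t \<partial>lborel)"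
  by (rule lborel_pair.Fubini'[OF m2])
 have a4: "(NN a. ennreal \<bar>1 / C\<bar> * (NN t. ?D a t)) = ennreal \<bar>1 / C\<bar> * (NN a. \<integral>\<^sup>+t. ?D a t \<partial>lborel)"
  by (rule nn_integral_cmult[OF m4])
 have a5: "(NN a. \<integral>\<^sup>+b. G (a, b) \<partial>lborel) = (\<integral>\<^sup>+x. G x \<partial>(lborel \<Otimes>\<^sub>M lborel))"
  by (rule lborel.nn_integral_fst) simp
 have a6: "(NN a. ennreal \<bar>1 / C\<bar> * (NN t. ?D a t)) = (NN a. \<integral>\<^sup>+b. G (a, b) \<partial>lborel)"
  by (rule nn_integral_cong) (rule 2)
 have a7: "integral\<^sup>N (lborel \<Otimes>\<^sub>M lborel) G = integral\<^sup>N lborel G"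
  by (rule arg_cong[OF lborel_prod, of "\<lambda>M. integral\<^sup>N M G"])
 show ?thesis
  by (rule trans[OF a1 trans[OF a2 trans[OF arg_cong[OF a3, of "\<lambda>z. ennreal \<bar>1 / C\<bar> * z"] trans[OF a4[symmetric] trans[OF a6 trans[OF a5 a7]]]]]])
qed

section \<open>Integrals over lines near a tangency\<close>

text \<open>Sequential dominated convergence; the majorant may depend on a bound for the parameter,
  and continuity may fail for a null set of \<open>t\<close>.\<close>

lemma isCont_param_integral:
 fixes f :: "'a::euclidean_space => 'b::euclidean_space => real"
 assumes meas: "\<And>x. f x \<in> borel_measurable borel"
  and dom: "\<And>S. \<exists>W. integrable lborel W \<and> (\<forall>x t. norm x \<le> S --> \<bar>f x t\<bar> \<le> W t)"
  and cont: "AE t in lborel. isCont (\<lambda>x. f x t) a"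
 shows "isCont (\<lambda>x. LB t. f x t) a"
 unfolding continuous_at_sequentially comp_def
proof (intro allI impI)
 fix X assume X: "X \<longlonglongrightarrow> a"
 then have "Bseq X" by (intro convergent_imp_Bseq convergentI)
 then obtain S where S: "\<And>n. norm (X n) \<le> S" unfolding Bseq_def by blast
 obtain W where W: "integrable lborel W" "\<And>x t. norm x \<le> S ==> \<bar>f x t\<bar> \<le> W t" using dom by blast
 show "(\<lambda>n. LB t. f (X n) t) \<longlonglongrightarrow> (LB t. f a t)"
 proof (rule integral_dominated_convergence[where w = W])
  show "AE t in lborel. (\<lambda>n. f (X n) t) \<longlonglongrightarrow> f a t"
   using cont by (rule eventually_mono) (use X in \<open>auto simp: continuous_at_sequentially comp_def\<close>)
 qed (use meas W S in auto)
qed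

lemma wL2_diff:
 assumes f: "integrable lborel f" "wL2 f UNIV" and g: "integrable lborel g" "wL2 g UNIV"
 shows "wL2 (\<lambda>x. f x - g x) UNIV"
proof -
 have [measurable]: "ft f \<in> borel_measurable borel" "ft g \<in> borel_measurable borel" using f g by auto
 let ?A = "\<lambda>h \<xi>. ennreal ((1 + \<xi>\<^sup>2) * (norm (ft h \<xi>))\<^sup>2)"
 have e: "ft (\<lambda>x. f x - g x) \<xi> = ft f \<xi> - ft g \<xi>" for \<xi>
  unfolding ft_def right_diff_distrib
  by (rule Bochner_Integration.integral_diff) (intro integrable_cis_mult f g; measurable)+
 have pw: "?A (\<lambda>x. f x - g x) \<xi> \<le> 2 * ?A f \<xi> + 2 * ?A g \<xi>" for \<xi>
 proof -
  have "(norm (ft f \<xi> - ft g \<xi>))\<^sup>2 \<le> (norm (ft f \<xi>) + norm (ft g \<xi>))\<^sup>2"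
   by (intro power_mono norm_triangle_ineq4) auto
  also have "... \<le> 2 * (norm (ft f \<xi>))\<^sup>2 + 2 * (norm (ft g \<xi>))\<^sup>2"
   using sum_squares_bound[of "norm (ft f \<xi>)" "norm (ft g \<xi>)"] by (simp add: power2_sum)
  finally have "(1 + \<xi>\<^sup>2) * (norm (ft f \<xi> - ft g \<xi>))\<^sup>2 \<le> (1 + \<xi>\<^sup>2) * (2 * (norm (ft f \<xi>))\<^sup>2 + 2 * (norm (ft g \<xi>))\<^sup>2)"
   by (intro mult_left_mono) auto
  then have "ennreal ((1 + \<xi>\<^sup>2) * (norm (ft f \<xi> - ft g \<xi>))\<^sup>2) \<le>
    ennreal (2 * ((1 + \<xi>\<^sup>2) * (norm (ft f \<xi>))\<^sup>2) + 2 * ((1 + \<xi>\<^sup>2) * (norm (ft g \<xi>))\<^sup>2))"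
   by (intro ennreal_leI) (simp add: algebra_simps)
  then show ?thesis unfolding e
   by (simp add: ennreal_mult)
 qed
 have "(NN \<xi>. ?A (\<lambda>x. f x - g x) \<xi>) \<le> (NN \<xi>. 2 * ?A f \<xi> + 2 * ?A g \<xi>)"
  by (intro nn_integral_mono pw)
 also have "... = 2 * (NN \<xi>. ?A f \<xi>) + 2 * (NN \<xi>. ?A g \<xi>)"
  by (subst nn_integral_add) (simp_all add: nn_integral_cmult)
 also have "... < \<infinity>" using f(2) g(2) unfolding wL2_def by (simp add: ennreal_mult_less_top ennreal_add_less_top)
 finally show ?thesis unfolding wL2_def by simp
qed

text \<open>Lipschitz in \<open>L^2\<close> over strips of parallel lines. For a domain in the unit
  disc, the window \<open>{-2..2}\<close> contains every \<open>t\<close> with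
  \<open>pt th s t \<in> \<Omega>\<close>, for which \<open>\<bar>t\<bar> < 1\<close>, and also a
  neighbourhood of radius one of such a \<open>t\<close>.\<close>

definition line_H1 :: "real => (real \<times> real => real) => bool" where
 "line_H1 th F \<longleftrightarrow> (\<forall>R. \<exists>h0>0. \<exists>C\<ge>0. \<forall>h. 0 < h --> h < h0 -->
   (NN s. (NN t. ennreal ((F (pt th (s + h) t) - F (pt th s t))\<^sup>2) * indicator {-2..2} t) * indicator {-R..R} s)
    \<le> ennreal (C * h\<^sup>2))"

text \<open>With \<open>J\<close> a neighbourhood of the point of tangency, the integral over a line splits into a part which
 is as regular in \<open>s\<close> as \<open>F\<close>, and an excess with a square root singularity.\<close>

definition line_int :: "real => (real \<times> real) set => (real \<times> real => real) => real => real" where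
 "line_int th \<Omega> F s = (LB t. F (pt th s t) * indicator \<Omega> (pt th s t))"

text \<open>Inside \<open>J\<close> membership is frozen at \<open>v\<close>, its value on the
  constant side of a tangency, so the moving boundary enters only outside \<open>J\<close>.\<close>

definition core :: "real => (real \<times> real) set => (real \<times> real => real) => real set => bool => real => real" where
 "core th \<Omega> F J v s = (LB t. F (pt th s t) * (if t \<in> J then of_bool v else indicator \<Omega> (pt th s t)) * indicator {-2..2} t)"

definition excess :: "real => (real \<times> real) set => (real \<times> real => real) => real set => bool => real => real" where
 "excess th \<Omega> F J v s = (LB t. F (pt th s t) * (indicator \<Omega> (pt th s t) - of_bool v) * indicator (J \<inter> {-2..2}) t)"

lemma isCont_pt: "isCont (\<lambda>s. pt th s t) s"
 unfolding pt_def by (intro continuous_intros)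

context
 fixes th :: real and \<Omega> :: "(real \<times> real) set" and F :: "real \<times> real => real"
 assumes cl: "closed \<Omega>" and \<Omega>1: "\<Omega> \<subseteq> ball 0 1" and F: "continuous_on UNIV F"
begin

lemma F_measurable [measurable]: "F \<in> borel_measurable borel"
 using F by (rule borel_measurable_continuous_onI)

lemma Omega_measurable [measurable]: "\<Omega> \<in> sets borel"
 using cl by (rule borel_closed)

lemma F_line_bound: "\<exists>M\<ge>0. \<forall>s t. \<bar>s\<bar> \<le> R --> t \<in> {-2..2} --> \<bar>F (pt th s t)\<bar> \<le> M"
proof -
 obtain M where M: "M \<ge> 0" "\<forall>x\<in>cball 0 (R + 2). \<bar>F x\<bar> \<le> M" using continuous_bounded_cball[OF F] by blast
 have "\<bar>F (pt th s t)\<bar> \<le> M" if "\<bar>s\<bar> \<le> R" "t \<in> {-2..2}" for s t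
 proof -
  have "dist (pt th s t) (pt th 0 0) \<le> R + 2" using dist_pt[of th s t 0 0] that by auto
  moreover have "pt th 0 0 = 0" by (simp add: pt_def)
  ultimately have "pt th s t \<in> cball 0 (R + 2)" by (simp add: dist_commute)
  then show ?thesis using M(2) by blast
 qed
 then show ?thesis using M(1) by blast
qed

lemma line_integrand_integrable:
 assumes [measurable]: "k \<in> borel_measurable borel" and k: "\<And>t. \<bar>k t\<bar> \<le> 1" "\<And>t. k t \<noteq> 0 ==> t \<in> {-2..2}"
 shows "integrable lborel (\<lambda>t. F (pt th s t) * k t)"
proof -
 obtain M where M: "M \<ge> 0" "\<And>t. t \<in> {-2..2} ==> \<bar>F (pt th s t)\<bar> \<le> M" using F_line_bound[of "\<bar>s\<bar>"] by blast
 have "\<bar>F (pt th s t) * k t\<bar> \<le> M" for t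
 proof (cases "k t = 0")
  case False
  have "\<bar>F (pt th s t)\<bar> * \<bar>k t\<bar> \<le> M * 1" by (intro mult_mono M k(2) k(1) False) auto
  then show ?thesis by (simp add: abs_mult)
 qed (use M(1) in simp)
 moreover have "norm t \<le> 2" if "F (pt th s t) * k t \<noteq> 0" for t using k(2)[of t] that by auto
 ultimately show ?thesis by (intro integrable_bounded_support[where M = M and R = 2]) simp_all
qed

lemma core_integrable:
 assumes J: "J \<in> sets borel"
 shows "integrable lborel (\<lambda>t. F (pt th s t) * ((if t \<in> J then of_bool v else indicator \<Omega> (pt th s t)) * indicator {-2..2} t))"
proof -
 have [measurable]: "J \<in> sets borel" by (rule J)
 show ?thesis by (rule line_integrand_integrable) (measurable, auto simp: indicator_def)
qed

lemma line_int_split: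
 assumes J: "J \<in> sets borel"
 shows "line_int th \<Omega> F s = core th \<Omega> F J v s + excess th \<Omega> F J v s"
proof -
 have [measurable]: "J \<in> sets borel" by (rule J)
 have out: "indicator \<Omega> (pt th s t) = (0::real)" if "t \<notin> {-2..2}" for t
 proof -
  have "pt th s t \<notin> \<Omega>" using abs_le_norm_pt(2)[of t th s] that \<Omega>1 by force
  then show ?thesis by simp
 qed
 let ?k1 = "\<lambda>t. (if t \<in> J then of_bool v else indicator \<Omega> (pt th s t)) * indicator {-2..2} t :: real"
 let ?k2 = "\<lambda>t. (indicator \<Omega> (pt th s t) - of_bool v) * indicator (J \<inter> {-2..2}) t :: real"
 have i1: "integrable lborel (\<lambda>t. F (pt th s t) * ?k1 t)" by (rule core_integrable[OF J])
 have i2: "integrable lborel (\<lambda>t. F (pt th s t) * ?k2 t)"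
  by (rule line_integrand_integrable) (measurable, auto simp: indicator_def)
 have "F (pt th s t) * indicator \<Omega> (pt th s t) = F (pt th s t) * ?k1 t + F (pt th s t) * ?k2 t" for t
  using out[of t] by (cases "t \<in> {-2..2}") (auto simp: algebra_simps)
 then have "line_int th \<Omega> F s = (LB t. F (pt th s t) * ?k1 t) + (LB t. F (pt th s t) * ?k2 t)"
  unfolding line_int_def by (simp only:) (rule Bochner_Integration.integral_add[OF i1 i2])
 then show ?thesis by (simp only: core_def excess_def mult.assoc)
qed

text \<open>Each line meets the frontier in a countable set, so the indicator is continuous in
  \<open>s\<close> for almost every \<open>t\<close>.\<close>

lemma excess_isCont:
 assumes J: "J \<in> sets borel" and ct: "\<And>s. countable {t. pt th s t \<in> frontier \<Omega>}"
 shows "isCont (excess th \<Omega> F J v) s"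
proof -
 have [measurable]: "J \<in> sets borel" by (rule J)
 have "isCont (\<lambda>s. LB t. F (pt th s t) * ((indicator \<Omega> (pt th s t) - of_bool v) * indicator (J \<inter> {-2..2}) t)) s"
 proof (rule isCont_param_integral)
  fix S
  obtain M where M: "M \<ge> 0" "\<And>s t. \<bar>s\<bar> \<le> S ==> t \<in> {-2..2} ==> \<bar>F (pt th s t)\<bar> \<le> M" using F_line_bound[of S] by blast
  show "\<exists>W. integrable lborel W \<and> (\<forall>s t. norm s \<le> S --> \<bar>F (pt th s t) * ((indicator \<Omega> (pt th s t) - of_bool v) * indicator (J \<inter> {-2..2}) t)\<bar> \<le> W t)"
  proof (intro exI conjI allI impI)
   show "integrable lborel (\<lambda>t::real. M * indicator {-2..2} t)" by simp
   fix s t :: real assume s: "norm s \<le> S"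
   show "\<bar>F (pt th s t) * ((indicator \<Omega> (pt th s t) - of_bool v) * indicator (J \<inter> {-2..2}) t)\<bar> \<le> M * indicator {-2..2} t"
    using M(1) M(2)[of s t] s by (auto simp: indicator_def abs_mult)
  qed
 next
  have "AE t in lborel. t \<notin> {t. pt th s t \<in> frontier \<Omega>}"
   using countable_imp_null_set_lborel[OF ct] by (rule AE_not_in)
  then show "AE t in lborel. isCont (\<lambda>s. F (pt th s t) * ((indicator \<Omega> (pt th s t) - of_bool v) * indicator (J \<inter> {-2..2}) t)) s"
  proof (rule eventually_mono)
   fix t assume "t \<notin> {t. pt th s t \<in> frontier \<Omega>}"
   then have c: "isCont (indicator \<Omega> :: _ => real) (pt th s t)" by (simp add: isCont_indicator)
   have "isCont F (pt th s t)" using F continuous_on_eq_continuous_at[OF open_UNIV] by blast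
   then show "isCont (\<lambda>s. F (pt th s t) * ((indicator \<Omega> (pt th s t) - of_bool v) * indicator (J \<inter> {-2..2}) t)) s"
    by (intro continuous_intros isCont_o2[OF isCont_pt c] isCont_o2[OF isCont_pt])
  qed
 qed measurable
 then show ?thesis unfolding excess_def[abs_def] mult.assoc .
qed

lemma core_measurable: "J \<in> sets borel ==> core th \<Omega> F J v \<in> borel_measurable borel"
proof -
 assume [measurable]: "J \<in> sets borel"
 show ?thesis unfolding core_def[abs_def] by measurable
qed

lemma core_bounded:
 assumes J: "J \<in> sets borel"
 shows "\<exists>M\<ge>0. \<forall>s. \<bar>s\<bar> \<le> R --> \<bar>core th \<Omega> F J v s\<bar> \<le> M"
proof -
 obtain M where M: "M \<ge> 0" "\<And>s t. \<bar>s\<bar> \<le> R ==> t \<in> {-2..2} ==> \<bar>F (pt th s t)\<bar> \<le> M" using F_line_bound[of R] by blast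
 have "\<bar>core th \<Omega> F J v s\<bar> \<le> (LB t. M * indicator {-2..2::real} t)" if "\<bar>s\<bar> \<le> R" for s
  unfolding core_def real_norm_def[symmetric] mult.assoc
 proof (rule Bochner_Integration.integral_norm_bound_integral[OF core_integrable[OF J]])
  fix t
  show "norm (F (pt th s t) * ((if t \<in> J then of_bool v else indicator \<Omega> (pt th s t)) * indicator {-2..2} t)) \<le> M * indicator {-2..2} t"
   using M(1) M(2)[of s] that by (auto simp: indicator_def abs_mult)
 qed simp
 moreover have "0 \<le> (LB t. M * indicator {-2..2::real} t)" using M(1) by (intro Bochner_Integration.integral_nonneg) auto
 ultimately show ?thesis by blast
qed

text \<open>The change of the weight is integrated over the window; the change of membership costs
  at most \<open>M\<close> on a set of measure at most \<open>l\<close>.\<close>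

lemma core_increment:
 assumes J: "J \<in> sets borel" and M: "M \<ge> 0" "\<And>t. t \<in> {-2..2} ==> \<bar>F (pt th s' t)\<bar> \<le> M"
  and L: "emeasure lborel {t. t \<notin> J \<and> (pt th s t \<in> \<Omega>) \<noteq> (pt th s' t \<in> \<Omega>)} \<le> ennreal l" and l: "l \<ge> 0"
 shows "ennreal \<bar>core th \<Omega> F J v s - core th \<Omega> F J v s'\<bar> \<le>
  (NN t. ennreal \<bar>F (pt th s t) - F (pt th s' t)\<bar> * indicator {-2..2} t) + ennreal (M * l)"
proof -
 have [measurable]: "J \<in> sets borel" by (rule J)
 let ?k = "\<lambda>s t. (if t \<in> J then of_bool v else indicator \<Omega> (pt th s t)) * indicator {-2..2} t :: real"
 let ?S = "{t. t \<notin> J \<and> (pt th s t \<in> \<Omega>) \<noteq> (pt th s' t \<in> \<Omega>)}"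
 have Sm [measurable]: "?S \<in> sets borel" by measurable
 have i: "integrable lborel (\<lambda>t. F (pt th s t) * ?k s t)" for s by (rule core_integrable[OF J])
 have e: "core th \<Omega> F J v s - core th \<Omega> F J v s' = (LB t. F (pt th s t) * ?k s t - F (pt th s' t) * ?k s' t)"
  unfolding core_def mult.assoc by (rule Bochner_Integration.integral_diff[symmetric, OF i i])
 have "ennreal \<bar>core th \<Omega> F J v s - core th \<Omega> F J v s'\<bar> \<le> (NN t. ennreal (norm (F (pt th s t) * ?k s t - F (pt th s' t) * ?k s' t)))"
  unfolding e real_norm_def[symmetric] by (rule integral_norm_bound_ennreal[OF Bochner_Integration.integrable_diff[OF i i]])
 also have "... \<le> (NN t. ennreal \<bar>F (pt th s t) - F (pt th s' t)\<bar> * indicator {-2..2} t + ennreal M * indicator ?S t)"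
 proof (intro nn_integral_mono)
  fix t
  consider "t \<notin> {-2..2}" | "t \<in> {-2..2}" "t \<in> ?S" | "t \<in> {-2..2}" "t \<notin> ?S" by blast
  then show "ennreal (norm (F (pt th s t) * ?k s t - F (pt th s' t) * ?k s' t)) \<le> ennreal \<bar>F (pt th s t) - F (pt th s' t)\<bar> * indicator {-2..2} t + ennreal M * indicator ?S t"
  proof cases
   case 2
   have "norm (F (pt th s t) * ?k s t - F (pt th s' t) * ?k s' t) \<le> \<bar>F (pt th s t) - F (pt th s' t)\<bar> + M"
    using 2 M(2)[OF 2(1)] M(1) by (auto simp: indicator_def)
   then have "ennreal (norm (F (pt th s t) * ?k s t - F (pt th s' t) * ?k s' t)) \<le> ennreal (\<bar>F (pt th s t) - F (pt th s' t)\<bar> + M)"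
    by (rule ennreal_leI)
   then show ?thesis using 2 M(1) by (simp add: ennreal_plus)
  next
   case 3
   have "norm (F (pt th s t) * ?k s t - F (pt th s' t) * ?k s' t) \<le> \<bar>F (pt th s t) - F (pt th s' t)\<bar>"
    using 3 by (auto simp: indicator_def)
   then have "ennreal (norm (F (pt th s t) * ?k s t - F (pt th s' t) * ?k s' t)) \<le> ennreal \<bar>F (pt th s t) - F (pt th s' t)\<bar>"
    by (rule ennreal_leI)
   then show ?thesis using 3 by (simp add: add_increasing2)
  qed simp
 qed
 also have "... = (NN t. ennreal \<bar>F (pt th s t) - F (pt th s' t)\<bar> * indicator {-2..2} t) + ennreal M * emeasure lborel ?S"
  by (subst nn_integral_add) (simp_all add: nn_integral_cmult_indicator)
 also have "... \<le> (NN t. ennreal \<bar>F (pt th s t) - F (pt th s' t)\<bar> * indicator {-2..2} t) + ennreal (M * l)"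
  using L M(1) l by (auto intro!: add_left_mono mult_left_mono simp: ennreal_mult)
 finally show ?thesis .
qed

text \<open>The eight is twice the length 4 of the window, from Cauchy-Schwarz and
  \<open>(a + b)\<^sup>2 \<le> 2 * a\<^sup>2 + 2 * b\<^sup>2\<close>.\<close>

lemma core_increment_square:
 assumes J: "J \<in> sets borel" and M: "M \<ge> 0" "\<And>t. t \<in> {-2..2} ==> \<bar>F (pt th s' t)\<bar> \<le> M"
  and L: "emeasure lborel {t. t \<notin> J \<and> (pt th s t \<in> \<Omega>) \<noteq> (pt th s' t \<in> \<Omega>)} \<le> ennreal l" and l: "l \<ge> 0"
 shows "ennreal ((core th \<Omega> F J v s - core th \<Omega> F J v s')\<^sup>2) \<le>
  8 * (NN t. ennreal ((F (pt th s t) - F (pt th s' t))\<^sup>2) * indicator {-2..2} t) + ennreal (2 * (M * l)\<^sup>2)"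
proof -
 let ?a = "\<lambda>t. ennreal \<bar>F (pt th s t) - F (pt th s' t)\<bar>"
 let ?i = "\<lambda>t::real. indicator {-2..2} t :: ennreal"
 have "(NN t. ?a t * ?i t)\<^sup>2 = (NN t. (?a t * ?i t) * ?i t)\<^sup>2"
  by (intro arg_cong[of _ _ "\<lambda>x. x\<^sup>2"] nn_integral_cong) (simp add: indicator_def)
 also have "... \<le> (NN t. (?a t * ?i t)\<^sup>2) * (NN t. (?i t)\<^sup>2)"
  by (rule Cauchy_Schwarz_nn_integral) measurable
 also have "(NN t. (?i t)\<^sup>2) = (NN t. ?i t)"
  by (intro nn_integral_cong) (simp add: indicator_def)
 also have "... = 4" by simp
 also have "(NN t. (?a t * ?i t)\<^sup>2) = (NN t. ennreal ((F (pt th s t) - F (pt th s' t))\<^sup>2) * ?i t)"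
  by (intro nn_integral_cong) (simp add: indicator_def ennreal_power)
 finally have cs: "(NN t. ?a t * ?i t)\<^sup>2 \<le> (NN t. ennreal ((F (pt th s t) - F (pt th s' t))\<^sup>2) * ?i t) * 4" .
 have "ennreal ((core th \<Omega> F J v s - core th \<Omega> F J v s')\<^sup>2) = (ennreal \<bar>core th \<Omega> F J v s - core th \<Omega> F J v s'\<bar>)\<^sup>2"
  by (simp add: ennreal_power)
 also have "... \<le> ((NN t. ?a t * ?i t) + ennreal (M * l))\<^sup>2"
  by (rule power_mono[OF core_increment[OF assms] zero_le])
 also have "... \<le> 2 * (NN t. ?a t * ?i t)\<^sup>2 + 2 * (ennreal (M * l))\<^sup>2"
  by (rule power2_add_le_ennreal)
 also have "... \<le> 2 * ((NN t. ennreal ((F (pt th s t) - F (pt th s' t))\<^sup>2) * ?i t) * 4) + 2 * (ennreal (M * l))\<^sup>2"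
  by (intro add_right_mono mult_left_mono cs) simp
 also have "2 * (ennreal (M * l))\<^sup>2 = ennreal (2 * (M * l)\<^sup>2)"
 proof -
  have "(ennreal (M * l))\<^sup>2 = ennreal ((M * l)\<^sup>2)" using M(1) l by (intro ennreal_power) simp
  then show ?thesis by (simp add: ennreal_mult)
 qed
 finally show ?thesis by (simp add: mult_ac)
qed

text \<open>Difference quotients of the cut-off core are bounded in \<open>L^2\<close>: the cutoff
  is Lipschitz, and the core inherits an \<open>L^2\<close> Lipschitz bound from
  \<open>line_H1\<close> and \<open>regular\<close>.\<close>

lemma wL2_core:
 assumes reg: "regular \<Omega> th s0 J" and J: "J \<in> sets borel" and H: "line_H1 th F"
 shows "\<exists>\<delta>>0. \<forall>\<eta>. test_function \<eta> --> (\<forall>s. \<eta> s \<noteq> 0 --> \<bar>s - s0\<bar> < \<delta>) -->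
  wL2 (\<lambda>s. \<eta> s * complex_of_real (core th \<Omega> F J v s)) UNIV"
proof -
 let ?c = "core th \<Omega> F J v"
 obtain \<delta> L where \<delta>: "\<delta> > 0" and L0: "L \<ge> 0" and L: "\<And>s s'. s \<in> ball s0 \<delta> ==> s' \<in> ball s0 \<delta> ==>
  emeasure lborel {t. t \<notin> J \<and> (pt th s t \<in> \<Omega>) \<noteq> (pt th s' t \<in> \<Omega>)} \<le> ennreal (L * \<bar>s - s'\<bar>)"
  using reg unfolding regular_def by blast
 define R where "R = \<bar>s0\<bar> + \<delta>"
 have R0: "R \<ge> 0" using \<delta> by (simp add: R_def)
 have sR: "\<bar>s\<bar> \<le> R" if "s \<in> ball s0 \<delta>" for s using that by (auto simp: R_def dist_real_def)
 obtain M where M: "M \<ge> 0" "\<And>s t. \<bar>s\<bar> \<le> R ==> t \<in> {-2..2} ==> \<bar>F (pt th s t)\<bar> \<le> M" using F_line_bound[of R] by blast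
 obtain A where A: "A \<ge> 0" "\<And>s. \<bar>s\<bar> \<le> R ==> \<bar>?c s\<bar> \<le> A" using core_bounded[OF J, of R v] by blast
 obtain h1 C where h1: "h1 > 0" "C \<ge> 0" and C: "\<And>h. 0 < h ==> h < h1 ==>
   (NN s. (NN t. ennreal ((F (pt th (s + h) t) - F (pt th s t))\<^sup>2) * indicator {-2..2} t) * indicator {-R..R} s)
    \<le> ennreal (C * h\<^sup>2)"
  using H unfolding line_H1_def by meson
 have [measurable]: "?c \<in> borel_measurable borel" by (rule core_measurable[OF J])
 have "wL2 (\<lambda>s. \<eta> s * complex_of_real (?c s)) UNIV"
  if \<eta>: "test_function \<eta>" and supp: "\<And>s. \<eta> s \<noteq> 0 ==> \<bar>s - s0\<bar> < \<delta> / 2" for \<eta>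
 proof -
  have [measurable]: "\<eta> \<in> borel_measurable borel" using \<eta> by (rule test_function_measurable)
  obtain B where B: "B > 0" "\<And>x. norm (\<eta> x) \<le> B" using test_function_bounded[OF \<eta>] by blast
  obtain B' where B': "B' > 0" "\<And>x. norm (frechet_derivative \<eta> (at x) 1) \<le> B'"
   using test_function_bounded[OF test_function_deriv[OF \<eta>, of 1]] by blast
  have sup\<delta>: "\<bar>s\<bar> \<le> R" if "\<eta> s \<noteq> 0" for s using supp[OF that] \<delta> unfolding R_def by linarith
  let ?f = "\<lambda>s. \<eta> s * complex_of_real (?c s)"
  let ?X = "\<lambda>h s. NN t. ennreal ((F (pt th (s + h) t) - F (pt th s t))\<^sup>2) * indicator {-2..2} t"
  \<comment> \<open>Collects the cutoff term and the membership term; the weight term appears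
    separately with the factor \<open>16 * B\<^sup>2\<close>.\<close>
  define P where "P = 2 * (B' * A)\<^sup>2 + 4 * B\<^sup>2 * (M * L)\<^sup>2"
  have P0: "P \<ge> 0" by (simp add: P_def)
  show ?thesis
  proof (rule wL2_of_difference_quotients[where M = "B * A" and R = R and ?h0.0 = "min h1 (\<delta> / 2)" and C = "2 * R * P + 16 * B\<^sup>2 * C"])
   show "norm (?f s) \<le> B * A" for s
   proof (cases "\<eta> s = 0")
    case False
    show ?thesis unfolding norm_mult using A B sup\<delta>[OF False] by (intro mult_mono) auto
   qed (use A B in simp)
   show "norm s \<le> R" if "?f s \<noteq> 0" for s using that sup\<delta> by auto
   show "min h1 (\<delta> / 2) > 0" using h1 \<delta> by simp
   fix h assume h: "0 < h" "h < min h1 (\<delta> / 2)"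
   have pw: "ennreal ((norm (?f (s + h) - ?f s))\<^sup>2) \<le> ennreal (P * h\<^sup>2) * indicator {-R..R} s + ennreal (16 * B\<^sup>2) * (?X h s * indicator {-R..R} s)" for s
   proof (cases "\<eta> s = 0 \<and> \<eta> (s + h) = 0")
    case False
    \<comment> \<open>Supports within \<open>\<delta> / 2\<close> and steps below
      \<open>\<delta> / 2\<close> keep both \<open>s\<close> and \<open>s + h\<close> where
      \<open>regular\<close> applies.\<close>
    then have "\<bar>s - s0\<bar> < \<delta> / 2 \<or> \<bar>s + h - s0\<bar> < \<delta> / 2" using supp by blast
    moreover have "h < \<delta> / 2" using h by simp
    ultimately have "\<bar>s - s0\<bar> < \<delta>" "\<bar>s + h - s0\<bar> < \<delta>" using h(1) by linarith+
    then have b: "s \<in> ball s0 \<delta>" "s + h \<in> ball s0 \<delta>" by (auto simp: dist_real_def)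
    have d\<eta>: "norm (\<eta> (s + h) - \<eta> s) \<le> B' * h"
    proof -
     have "norm (\<eta> (s + h *\<^sub>R 1) - \<eta> s) \<le> B' * h"
     proof (rule directional_mvt)
      show "\<eta> differentiable at (s + t *\<^sub>R 1)" for t
       using \<eta> smooth_on_differentiable unfolding test_function_def by blast
     qed (use h B' in auto)
     then show ?thesis by simp
    qed
    have "?f (s + h) - ?f s = (\<eta> (s + h) - \<eta> s) * complex_of_real (?c (s + h)) + \<eta> s * complex_of_real (?c (s + h) - ?c s)"
     by (simp add: algebra_simps)
    then have "norm (?f (s + h) - ?f s) \<le> norm (\<eta> (s + h) - \<eta> s) * \<bar>?c (s + h)\<bar> + norm (\<eta> s) * \<bar>?c (s + h) - ?c s\<bar>"
     by (metis norm_triangle_ineq norm_mult norm_of_real)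
    also have "... \<le> (B' * h) * A + B * \<bar>?c (s + h) - ?c s\<bar>"
     using d\<eta> A(2)[OF sR[OF b(2)]] B B' h by (intro add_mono mult_mono) auto
    finally have n: "norm (?f (s + h) - ?f s) \<le> B' * h * A + B * \<bar>?c (s + h) - ?c s\<bar>" .
    have "(norm (?f (s + h) - ?f s))\<^sup>2 \<le> (B' * h * A + B * \<bar>?c (s + h) - ?c s\<bar>)\<^sup>2"
     by (intro power_mono n) auto
    also have "... \<le> 2 * (B' * h * A)\<^sup>2 + 2 * (B * \<bar>?c (s + h) - ?c s\<bar>)\<^sup>2"
     using sum_squares_bound[of "B' * h * A" "B * \<bar>?c (s + h) - ?c s\<bar>"] by (simp only: power2_sum)
    finally have "ennreal ((norm (?f (s + h) - ?f s))\<^sup>2) \<le> ennreal (2 * (B' * h * A)\<^sup>2 + 2 * B\<^sup>2 * (?c (s + h) - ?c s)\<^sup>2)"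
     by (intro ennreal_leI) (simp add: power_mult_distrib)
    also have "... = ennreal (2 * (B' * h * A)\<^sup>2) + ennreal (2 * B\<^sup>2) * ennreal ((?c (s + h) - ?c s)\<^sup>2)"
     by (subst ennreal_plus) (auto simp: ennreal_mult)
    also have "... \<le> ennreal (2 * (B' * h * A)\<^sup>2) + ennreal (2 * B\<^sup>2) * (8 * ?X h s + ennreal (2 * (M * (L * h))\<^sup>2))"
    proof (intro add_left_mono mult_left_mono core_increment_square J M)
     show "\<bar>s\<bar> \<le> R" by (rule sR[OF b(1)])
     show "emeasure lborel {t. t \<notin> J \<and> (pt th (s + h) t \<in> \<Omega>) \<noteq> (pt th s t \<in> \<Omega>)} \<le> ennreal (L * h)"
      using L[OF b(2,1)] h by simp
    qed (use L0 h in auto)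
    also have "... = ennreal (P * h\<^sup>2) + ennreal (16 * B\<^sup>2) * ?X h s"
    proof -
     have "ennreal (2 * B\<^sup>2) * (8 * ?X h s + ennreal (2 * (M * (L * h))\<^sup>2)) = ennreal (2 * B\<^sup>2) * ennreal 8 * ?X h s + ennreal (2 * B\<^sup>2) * ennreal (2 * (M * (L * h))\<^sup>2)"
      by (simp add: distrib_left mult.assoc)
     also have "ennreal (2 * B\<^sup>2) * ennreal 8 = ennreal (16 * B\<^sup>2)"
      by (subst ennreal_mult[symmetric]) auto
     also have "ennreal (2 * B\<^sup>2) * ennreal (2 * (M * (L * h))\<^sup>2) = ennreal (4 * B\<^sup>2 * (M * L)\<^sup>2 * h\<^sup>2)"
      by (subst ennreal_mult[symmetric]) (auto simp: power_mult_distrib mult_ac)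
     finally have e: "ennreal (2 * B\<^sup>2) * (8 * ?X h s + ennreal (2 * (M * (L * h))\<^sup>2)) = ennreal (16 * B\<^sup>2) * ?X h s + ennreal (4 * B\<^sup>2 * (M * L)\<^sup>2 * h\<^sup>2)" .
     have "ennreal (P * h\<^sup>2) = ennreal (2 * (B' * h * A)\<^sup>2) + ennreal (4 * B\<^sup>2 * (M * L)\<^sup>2 * h\<^sup>2)"
      by (subst ennreal_plus[symmetric]) (auto simp: P_def power_mult_distrib algebra_simps)
     then show ?thesis unfolding e by (simp add: add_ac)
    qed
    finally show ?thesis using sR[OF b(1)] by (auto simp: indicator_def)
   qed simp
   have Xm: "(\<lambda>s. ?X h s * indicator {-R..R} s) \<in> borel_measurable lborel" by measurable
   have "(NN s. ennreal ((norm (?f (s + h) - ?f s))\<^sup>2)) \<le>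
    (NN s. ennreal (P * h\<^sup>2) * indicator {-R..R} s + ennreal (16 * B\<^sup>2) * (?X h s * indicator {-R..R} s))"
    by (intro nn_integral_mono pw)
   also have "... = ennreal (P * h\<^sup>2) * emeasure lborel {-R..R} + ennreal (16 * B\<^sup>2) * (NN s. ?X h s * indicator {-R..R} s)"
    using Xm by (subst nn_integral_add) (simp_all add: nn_integral_cmult nn_integral_cmult_indicator)
   also have "... \<le> ennreal (P * h\<^sup>2) * ennreal (2 * R) + ennreal (16 * B\<^sup>2) * ennreal (C * h\<^sup>2)"
    using R0 h C by (intro add_mono mult_left_mono) auto
   also have "... = ennreal ((2 * R * P + 16 * B\<^sup>2 * C) * h\<^sup>2)"
   proof -
    have "ennreal (P * h\<^sup>2) * ennreal (2 * R) = ennreal (2 * R * P * h\<^sup>2)"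
     using P0 R0 by (subst ennreal_mult[symmetric]) (auto simp: mult_ac)
    moreover have "ennreal (16 * B\<^sup>2) * ennreal (C * h\<^sup>2) = ennreal (16 * B\<^sup>2 * C * h\<^sup>2)"
     using h1(2) by (subst ennreal_mult[symmetric]) (auto simp: mult_ac)
    ultimately show ?thesis
     using P0 R0 h1(2) by (simp only:) (subst ennreal_plus[symmetric], auto simp: algebra_simps)
   qed
   finally show "(NN s. ennreal ((norm (?f (s + h) - ?f s))\<^sup>2)) \<le> ennreal ((2 * R * P + 16 * B\<^sup>2 * C) * h\<^sup>2)" .
  qed measurable
 qed
 then show ?thesis using \<delta> by (intro exI[of _ "\<delta> / 2"]) auto
qed

end

section \<open>Square root singularities at a tangency\<close>

context
 fixes th :: real and \<Omega> :: "(real \<times> real) set" and F :: "real \<times> real => real"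
 assumes cl: "closed \<Omega>" and \<Omega>1: "\<Omega> \<subseteq> ball 0 1" and F: "continuous_on UNIV F"
begin

lemma line_int_eq_core: "line_int th \<Omega> F s = core th \<Omega> F {} False s"
proof -
 have "excess th \<Omega> F {} False s = 0" by (simp add: excess_def)
 then show ?thesis using line_int_split[OF cl \<Omega>1 F, where J = "{}" and s = s and v = False and th = th] by simp
qed

lemma core_locally_bounded: "J \<in> sets borel ==> locally_bounded (core th \<Omega> F J v)"
 unfolding locally_bounded_def
proof (intro conjI allI)
 assume J: "J \<in> sets borel"
 show "core th \<Omega> F J v \<in> borel_measurable borel" by (rule core_measurable[OF cl \<Omega>1 F J])
 show "\<exists>M. \<forall>s. norm s \<le> R --> \<bar>core th \<Omega> F J v s\<bar> \<le> M" for R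
  using core_bounded[OF cl \<Omega>1 F J, where th = th and R = R and v = v] by auto
qed

lemma line_int_locally_bounded: "locally_bounded (line_int th \<Omega> F)"
 using core_locally_bounded[of "{}" False] by (simp add: line_int_eq_core[abs_def])

lemma regular_wL2:
 assumes "regular \<Omega> th s0 {}" "line_H1 th F"
 shows "\<exists>\<delta>>0. \<forall>\<eta>. test_function \<eta> --> (\<forall>s. \<eta> s \<noteq> 0 --> \<bar>s - s0\<bar> < \<delta>) -->
  wL2 (\<lambda>s. \<eta> s * complex_of_real (line_int th \<Omega> F s)) UNIV"
 using wL2_core[OF cl \<Omega>1 F assms(1) _ assms(2), where v = False] by (simp add: line_int_eq_core)

text \<open>On the line \<open>s0\<close> itself membership equals \<open>v\<close> off
  \<open>t0\<close>, so the excess vanishes; at distance \<open>\<rho>\<close> on the side where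
  membership flips it differs from \<open>v\<close> on a chord of half length
  \<open>k * sqrt \<rho>\<close>, where \<open>F\<close> is bounded below. On \<open>J\<close> the
  integrand has one sign, so nothing outside the chord cancels it.\<close>

lemma touching_excess:
 assumes t: "touching \<Omega> th s0 t0 \<sigma> v k d" and p: "pt th s0 t0 \<in> \<Omega>" and pos: "F (pt th s0 t0) > 0"
 shows "\<exists>e>0. excess th \<Omega> F (ball t0 e) v s0 = 0 \<and>
  (\<exists>c>0. \<exists>r0>0. \<forall>\<rho>. 0 < \<rho> --> \<rho> < r0 --> c * sqrt \<rho> \<le> \<bar>excess th \<Omega> F (ball t0 e) v (s0 - \<sigma> * \<rho>)\<bar>)"
proof -
 have \<sigma>: "\<sigma> = 1 \<or> \<sigma> = -1" and k: "k > 0" and d: "d > 0" using t unfolding touching_def by blast+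
 have in1: "(pt th s t \<in> \<Omega>) = v" if "\<bar>s - s0\<bar> < d" "\<bar>t - t0\<bar> < d" "\<sigma> * (s - s0) \<ge> 0" "s \<noteq> s0 \<or> t \<noteq> t0" for s t
  using t that unfolding touching_def by blast
 have in2: "(pt th s t \<in> \<Omega>) = (\<not> v)" if "\<bar>s - s0\<bar> < d" "\<bar>t - t0\<bar> < d" "\<sigma> * (s - s0) < 0" "\<bar>t - t0\<bar> \<le> k * sqrt \<bar>s - s0\<bar>" for s t
  using t that unfolding touching_def by blast
 define m where "m = F (pt th s0 t0) / 2"
 have m: "m > 0" using pos by (simp add: m_def)
 have "isCont F (pt th s0 t0)" using F continuous_on_eq_continuous_at[OF open_UNIV] by blast
 then obtain e1 where e1: "e1 > 0" "\<And>z. dist z (pt th s0 t0) < e1 ==> dist (F z) (F (pt th s0 t0)) < m"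
  using m unfolding continuous_at_eps_delta by blast
 have Fm: "F (pt th s t) \<ge> m" if "\<bar>s - s0\<bar> < e1 / 2" "\<bar>t - t0\<bar> < e1 / 2" for s t
 proof -
  have "dist (pt th s t) (pt th s0 t0) < e1" using dist_pt[of th s t s0 t0] that by linarith
  then have "\<bar>F (pt th s t) - F (pt th s0 t0)\<bar> < m" using e1(2) by (simp add: dist_real_def)
  then show ?thesis unfolding m_def by linarith
 qed
 \<comment> \<open>\<open>e \<le> 1\<close> keeps \<open>J\<close> in the window,
   \<open>e \<le> d\<close> in the range of \<open>touching\<close>, and
   \<open>e \<le> e1 / 2\<close> where \<open>F \<ge> m\<close>.\<close>
 define e where "e = min (e1 / 2) (min d 1)"
 have e: "e > 0" "e \<le> e1 / 2" "e \<le> d" "e \<le> 1" using e1(1) d by (auto simp: e_def)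
 have "\<bar>t0\<bar> < 1" using p \<Omega>1 abs_le_norm_pt(2)[of t0 th s0] by force
 then have J: "ball t0 e \<inter> {-2..2} = ball t0 e" using e(4) by (auto simp: dist_real_def)
 have ex: "excess th \<Omega> F (ball t0 e) v s = (LB t. F (pt th s t) * ((indicator \<Omega> (pt th s t) - of_bool v) * indicator (ball t0 e) t))" for s
  by (simp add: excess_def J mult.assoc)
 have int: "integrable lborel (\<lambda>t. F (pt th s t) * ((indicator \<Omega> (pt th s t) - of_bool v) * indicator (ball t0 e) t))" for s
 proof (rule line_integrand_integrable[OF cl \<Omega>1 F])
  have [measurable]: "\<Omega> \<in> sets borel" using cl by (rule borel_closed)
  have [measurable]: "ball t0 e \<in> sets borel" by simp
  show "(\<lambda>t. (indicator \<Omega> (pt th s t) - of_bool v) * indicator (ball t0 e) t :: real) \<in> borel_measurable borel"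
   by measurable
  show "\<bar>(indicator \<Omega> (pt th s t) - of_bool v) * indicator (ball t0 e) t :: real\<bar> \<le> 1" for t
   by (auto simp: indicator_def)
  show "t \<in> {-2..2}" if "(indicator \<Omega> (pt th s t) - of_bool v) * indicator (ball t0 e) t \<noteq> (0::real)" for t
  proof -
   have "t \<in> ball t0 e" using that by (auto simp: indicator_def split: if_splits)
   then show ?thesis using J by blast
  qed
 qed
 have zero: "excess th \<Omega> F (ball t0 e) v s0 = 0"
 proof -
  have "excess th \<Omega> F (ball t0 e) v s0 = (LINT t|(lborel::real measure). (0::real))"
   unfolding ex
  proof (rule integral_cong_AE)
   show "AE t in lborel. F (pt th s0 t) * ((indicator \<Omega> (pt th s0 t) - of_bool v) * indicator (ball t0 e) t) = 0"
    using AE_lborel_singleton[of t0]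
   proof (rule eventually_mono)
    fix t assume "t \<noteq> t0"
    then show "F (pt th s0 t) * ((indicator \<Omega> (pt th s0 t) - of_bool v) * indicator (ball t0 e) t) = 0"
     using in1[of s0 t] d e(3) by (cases "t \<in> ball t0 e") (auto simp: dist_real_def indicator_def)
   qed
  qed (use borel_measurable_integrable[OF int[of s0]] in auto)
  then show ?thesis by simp
 qed
 \<comment> \<open>The second entry keeps the chord of half length \<open>k * sqrt \<rho>\<close>
   inside \<open>J\<close>.\<close>
 define r0 where "r0 = min e ((e / k)\<^sup>2)"
 have r0: "r0 > 0" using e k by (simp add: r0_def)
 have lower: "2 * m * k * sqrt \<rho> \<le> \<bar>excess th \<Omega> F (ball t0 e) v (s0 - \<sigma> * \<rho>)\<bar>" if \<rho>: "0 < \<rho>" "\<rho> < r0" for \<rho>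
 proof -
  let ?s = "s0 - \<sigma> * \<rho>"
  \<comment> \<open>The sign of the indicator minus \<open>of_bool v\<close> wherever this is
    nonzero.\<close>
  let ?\<epsilon> = "if v then -1 else 1 :: real"
  let ?g = "\<lambda>t. F (pt th ?s t) * ((indicator \<Omega> (pt th ?s t) - of_bool v) * indicator (ball t0 e) t)"
  let ?K = "{t0 - k * sqrt \<rho>..t0 + k * sqrt \<rho>}"
  have s: "\<bar>?s - s0\<bar> = \<rho>" "\<sigma> * (?s - s0) < 0" using \<sigma> \<rho> by auto
  have "sqrt \<rho> < e / k" using \<rho> e k by (auto simp: r0_def intro!: real_less_lsqrt)
  then have ke: "k * sqrt \<rho> < e" using k by (simp add: field_simps)
  have pw: "m * indicator ?K t \<le> ?\<epsilon> * ?g t" for t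
  proof (cases "t \<in> ball t0 e")
   case True
   then have te: "\<bar>t - t0\<bar> < e" by (auto simp: dist_real_def)
   have Fp: "F (pt th ?s t) \<ge> m" using Fm[of ?s t] s(1) \<rho> te e by (simp add: r0_def)
   show ?thesis
   proof (cases "t \<in> ?K")
    case K: True
    then have "\<bar>t - t0\<bar> \<le> k * sqrt \<bar>?s - s0\<bar>" unfolding s(1) by (auto simp: abs_le_iff)
    then have "(pt th ?s t \<in> \<Omega>) = (\<not> v)"
     using in2[of ?s t] s te e \<rho> by (simp add: r0_def)
    then show ?thesis using K True Fp by (auto simp: indicator_def)
   next
    case False
    have "0 \<le> F (pt th ?s t)" using Fp m by linarith
    then show ?thesis using False True by (auto simp: indicator_def)
   qed
  next
   case False
   then have "t \<notin> ?K" using ke by (auto simp: dist_real_def abs_less_iff)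
   then show ?thesis using False by simp
  qed
  have "2 * m * k * sqrt \<rho> = m * measure lborel ?K" using k \<rho> by simp
  also have "... = (LB t. m * indicator ?K t)" by simp
  also have "... \<le> (LB t. ?\<epsilon> * ?g t)"
  proof (rule integral_mono)
   show "integrable lborel (\<lambda>t. m * indicator ?K t)"
    by (intro integrable_mult_right integrable_real_indicator) (auto simp: emeasure_lborel_Icc_eq)
   show "integrable lborel (\<lambda>t. ?\<epsilon> * ?g t)" using int[of ?s] by (rule integrable_mult_right)
  qed (rule pw)
  also have "... = ?\<epsilon> * excess th \<Omega> F (ball t0 e) v ?s" unfolding ex by (rule integral_mult_right_zero)
  also have "... \<le> \<bar>excess th \<Omega> F (ball t0 e) v ?s\<bar>" by auto
  finally show ?thesis .
 qed
 have "2 * m * k > 0" using m k by simp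
 then show ?thesis using e(1) zero r0 lower by blast
qed

text \<open>Subtracting the core, which is \<open>H^1\<close> near \<open>s0\<close>, would leave
  the cut-off excess in \<open>H^1\<close>; it is continuous and vanishes at \<open>s0\<close>, so
  \<open>wL2_sqrt_modulus\<close> contradicts its lower bound of order \<open>sqrt\<close>.\<close>

lemma touching_not_H1:
 assumes t: "touching \<Omega> th s0 t0 \<sigma> v k d" and p: "pt th s0 t0 \<in> \<Omega>" and pos: "F (pt th s0 t0) > 0"
  and reg: "\<And>e. e > 0 ==> regular \<Omega> th s0 (ball t0 e)" and ct: "\<And>s. countable {t. pt th s t \<in> frontier \<Omega>}"
  and H: "line_H1 th F" and \<zeta>: "test_function \<zeta>" "\<zeta> s0 \<noteq> 0"
  and w: "wL2 (\<lambda>s. \<zeta> s * complex_of_real (line_int th \<Omega> F s)) UNIV"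
 shows False
proof -
 have \<sigma>: "\<sigma> = 1 \<or> \<sigma> = -1" using t unfolding touching_def by blast
 obtain e c r0 where e: "e > 0" and zero: "excess th \<Omega> F (ball t0 e) v s0 = 0" and c: "c > 0" and r0: "r0 > 0"
  and lower: "\<And>\<rho>. 0 < \<rho> ==> \<rho> < r0 ==> c * sqrt \<rho> \<le> \<bar>excess th \<Omega> F (ball t0 e) v (s0 - \<sigma> * \<rho>)\<bar>"
  using touching_excess[OF t p pos] by blast
 let ?J = "ball t0 e" and ?q = "line_int th \<Omega> F"
 let ?c = "core th \<Omega> F ?J v" and ?E = "excess th \<Omega> F ?J v"
 have J: "?J \<in> sets borel" by simp
 obtain \<delta> where \<delta>: "\<delta> > 0" and core: "\<And>\<eta>. test_function \<eta> ==> (\<And>s. \<eta> s \<noteq> 0 ==> \<bar>s - s0\<bar> < \<delta>) ==>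
   wL2 (\<lambda>s. \<eta> s * complex_of_real (?c s)) UNIV"
  using wL2_core[OF cl \<Omega>1 F reg[OF e] J H, where v = v] by blast
 \<comment> \<open>\<open>\<zeta>\<close> may have large support, whereas the core is controlled
   only near \<open>s0\<close>; the extra bump localises both.\<close>
 obtain \<eta> where \<eta>: "test_function \<eta>" "\<eta> s0 \<noteq> 0" "\<And>s. \<eta> s \<noteq> 0 ==> \<bar>s - s0\<bar> < \<delta>"
  using bump_function_exists[OF \<delta>, of s0] by blast
 have \<eta>\<zeta>: "test_function (\<lambda>s. \<eta> s * \<zeta> s)" using test_function_mult[OF \<eta>(1)] \<zeta>(1) unfolding test_function_def by blast
 let ?f = "\<lambda>s. \<eta> s * (\<zeta> s * complex_of_real (?q s))"
 let ?g = "\<lambda>s. (\<eta> s * \<zeta> s) * complex_of_real (?c s)"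
 let ?h = "\<lambda>s. (\<eta> s * \<zeta> s) * complex_of_real (?E s)"
 have h: "(\<lambda>s. ?f s - ?g s) = ?h"
  using line_int_split[OF cl \<Omega>1 F J, where v = v] by (simp add: fun_eq_iff algebra_simps)
 have i\<zeta>: "integrable lborel (\<lambda>s. \<zeta> s * complex_of_real (?q s))"
  by (rule integrable_test_mult[OF line_int_locally_bounded \<zeta>(1)])
 have wf: "wL2 ?f UNIV" by (rule wL2_mult[OF i\<zeta> \<eta>(1) w])
 have wg: "wL2 ?g UNIV" by (rule core[OF \<eta>\<zeta>]) (use \<eta>(3) in auto)
 have if1: "integrable lborel (\<lambda>s. (\<eta> s * \<zeta> s) * complex_of_real (?q s))"
  by (rule integrable_test_mult[OF line_int_locally_bounded \<eta>\<zeta>])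
 have if': "integrable lborel ?f" using if1 by (simp only: mult.assoc)
 have ig: "integrable lborel ?g" by (rule integrable_test_mult[OF core_locally_bounded[OF J] \<eta>\<zeta>])
 have wh: "wL2 ?h UNIV" using wL2_diff[OF if' wf ig wg] unfolding h .
 have ih: "integrable lborel ?h" using Bochner_Integration.integrable_diff[OF if' ig] unfolding h .
 have Ec: "isCont ?E s" for s by (rule excess_isCont[OF cl \<Omega>1 F J ct])
 have hc: "isCont ?h s" for s
  using Ec[of s] by (intro isCont_mult[OF test_function_isCont[OF \<eta>\<zeta>]] continuous_of_real)
 obtain M where M: "\<And>x. norm (?h x) \<le> M"
 proof -
  have "locally_bounded ?E"
   unfolding locally_bounded_def
  proof (intro conjI allI)
   have cE: "continuous_on UNIV ?E" using Ec by (simp add: continuous_at_imp_continuous_on)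
   then show "?E \<in> borel_measurable borel" by (rule borel_measurable_continuous_onI)
   show "\<exists>M. \<forall>x. norm x \<le> R --> \<bar>?E x\<bar> \<le> M" for R
   proof -
    obtain M where "\<forall>x\<in>cball 0 R. \<bar>?E x\<bar> \<le> M" using continuous_bounded_cball[OF cE, of R] by blast
    then show ?thesis by (intro exI[of _ M]) simp
   qed
  qed
  then show ?thesis by (rule test_mult_locally_bounded[OF _ \<eta>\<zeta>]) (rule that)
 qed
 define a where "a = norm (\<eta> s0 * \<zeta> s0)"
 have a: "a > 0" using \<eta>(2) \<zeta>(2) by (simp add: a_def)
 have "a / 2 > 0" using a by simp
 then obtain d1 where d1: "d1 > 0" "\<And>s. \<bar>s - s0\<bar> < d1 ==> norm (\<eta> s * \<zeta> s - \<eta> s0 * \<zeta> s0) < a / 2"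
  using test_function_isCont[OF \<eta>\<zeta>, of s0] unfolding continuous_at_eps_delta dist_norm real_norm_def
  by blast
 \<comment> \<open>Half of the lower bound \<open>a / 2 * c\<close> that holds for the cut-off
   excess.\<close>
 obtain d2 where d2: "d2 > 0" "\<And>r. \<bar>r\<bar> < d2 ==> norm (?h (s0 + r) - ?h s0) \<le> (a * c / 4) * sqrt \<bar>r\<bar>"
  using wL2_sqrt_modulus[OF ih M hc wh, of "a * c / 4" s0] a c by auto
 define \<rho> where "\<rho> = min r0 (min d1 d2) / 2"
 have \<rho>: "\<rho> > 0" "\<rho> < r0" "\<rho> < d1" "\<rho> < d2" using r0 d1(1) d2(1) by (auto simp: \<rho>_def)
 have ab: "\<bar>- \<sigma> * \<rho>\<bar> = \<rho>" using \<sigma> \<rho>(1) by auto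
 have hs0: "?h s0 = 0" using zero by simp
 have up: "norm (?h (s0 + (- \<sigma> * \<rho>))) \<le> (a * c / 4) * sqrt \<rho>"
  using d2(2)[of "- \<sigma> * \<rho>"] unfolding ab hs0 using \<rho>(4) by simp
 have "norm (\<eta> (s0 + (- \<sigma> * \<rho>)) * \<zeta> (s0 + (- \<sigma> * \<rho>)) - \<eta> s0 * \<zeta> s0) < a / 2"
  using d1(2)[of "s0 + (- \<sigma> * \<rho>)"] ab \<rho>(3) by simp
 then have "a / 2 \<le> norm (\<eta> (s0 + (- \<sigma> * \<rho>)) * \<zeta> (s0 + (- \<sigma> * \<rho>)))"
  using norm_triangle_ineq2[of "\<eta> s0 * \<zeta> s0" "\<eta> (s0 + (- \<sigma> * \<rho>)) * \<zeta> (s0 + (- \<sigma> * \<rho>))"]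
  unfolding a_def norm_minus_commute[of "\<eta> s0 * \<zeta> s0"] by linarith
 then have "(a / 2) * (c * sqrt \<rho>) \<le> norm (\<eta> (s0 + (- \<sigma> * \<rho>)) * \<zeta> (s0 + (- \<sigma> * \<rho>))) * \<bar>?E (s0 + (- \<sigma> * \<rho>))\<bar>"
  using lower[OF \<rho>(1,2)] c \<rho>(1) by (intro mult_mono) auto
 also have "... = norm (?h (s0 + (- \<sigma> * \<rho>)))" by (simp add: norm_mult)
 also have "... \<le> (a * c / 4) * sqrt \<rho>" by (rule up)
 finally have "(a * c * sqrt \<rho>) / 2 \<le> (a * c * sqrt \<rho>) / 4" by (simp add: mult_ac)
 moreover have "a * c * sqrt \<rho> > 0" using a c \<rho>(1) by simp
 ultimately show False by linarith
qed

text \<open>The scheme of \<open>touching_not_H1\<close> with pointwise bounds: the core is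
  Lipschitz at \<open>s0\<close> because \<open>F\<close> is locally Lipschitz, so the excess would
  be Lipschitz at \<open>s0\<close> too.\<close>

lemma touching_not_lipschitz:
 assumes t: "touching \<Omega> th s0 t0 \<sigma> v k d" and p: "pt th s0 t0 \<in> \<Omega>" and pos: "F (pt th s0 t0) > 0"
  and reg: "\<And>e. e > 0 ==> regular \<Omega> th s0 (ball t0 e)"
  and lip: "\<And>R. \<exists>L\<ge>0. \<forall>x\<in>cball 0 R. \<forall>y\<in>cball 0 R. \<bar>F x - F y\<bar> \<le> L * norm (x - y)"
  and d': "d' > 0" and q: "\<And>s. \<bar>s - s0\<bar> < d' ==> \<bar>line_int th \<Omega> F s - line_int th \<Omega> F s0\<bar> \<le> C * \<bar>s - s0\<bar>"
 shows False
proof -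
 have \<sigma>: "\<sigma> = 1 \<or> \<sigma> = -1" using t unfolding touching_def by blast
 obtain e c r0 where e: "e > 0" and zero: "excess th \<Omega> F (ball t0 e) v s0 = 0" and c: "c > 0" and r0: "r0 > 0"
  and lower: "\<And>\<rho>. 0 < \<rho> ==> \<rho> < r0 ==> c * sqrt \<rho> \<le> \<bar>excess th \<Omega> F (ball t0 e) v (s0 - \<sigma> * \<rho>)\<bar>"
  using touching_excess[OF t p pos] by blast
 let ?J = "ball t0 e" and ?q = "line_int th \<Omega> F"
 let ?c = "core th \<Omega> F ?J v" and ?E = "excess th \<Omega> F ?J v"
 have J: "?J \<in> sets borel" by simp
 obtain \<delta> L where \<delta>: "\<delta> > 0" and L0: "L \<ge> 0" and L: "\<And>s s'. s \<in> ball s0 \<delta> ==> s' \<in> ball s0 \<delta> ==>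
  emeasure lborel {t. t \<notin> ?J \<and> (pt th s t \<in> \<Omega>) \<noteq> (pt th s' t \<in> \<Omega>)} \<le> ennreal (L * \<bar>s - s'\<bar>)"
  using reg[OF e] unfolding regular_def by blast
 define R where "R = \<bar>s0\<bar> + \<delta> + 2"
 have inR: "pt th s t \<in> cball 0 R" if "\<bar>s - s0\<bar> < \<delta>" "t \<in> {-2..2}" for s t
 proof -
  have "dist (pt th s t) (pt th 0 0) \<le> \<bar>s - 0\<bar> + \<bar>t - 0\<bar>" by (rule dist_pt)
  also have "... \<le> R" using that abs_triangle_ineq[of "s - s0" s0] unfolding R_def by auto
  finally have "dist (pt th s t) (pt th 0 0) \<le> R" .
  moreover have "pt th 0 0 = 0" by (simp add: pt_def)
  ultimately show ?thesis by (simp add: dist_commute)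
 qed
 obtain Lf where Lf: "Lf \<ge> 0" "\<And>x y. x \<in> cball 0 R ==> y \<in> cball 0 R ==> \<bar>F x - F y\<bar> \<le> Lf * norm (x - y)"
  using lip[of R] by blast
 obtain M where M: "M \<ge> 0" "\<And>x. x \<in> cball 0 R ==> \<bar>F x\<bar> \<le> M" using continuous_bounded_cball[OF F, of R] by blast
 have core: "\<bar>?c s - ?c s0\<bar> \<le> (4 * Lf + M * L) * \<bar>s - s0\<bar>" if s: "\<bar>s - s0\<bar> < \<delta>" for s
 proof -
  have inc: "ennreal \<bar>?c s - ?c s0\<bar> \<le> (NN t. ennreal \<bar>F (pt th s t) - F (pt th s0 t)\<bar> * indicator {-2..2} t) + ennreal (M * (L * \<bar>s - s0\<bar>))"
  proof (rule core_increment[OF cl \<Omega>1 F J M(1)])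
   show "\<bar>F (pt th s0 t)\<bar> \<le> M" if "t \<in> {-2..2}" for t using M(2) inR[of s0 t] that \<delta> by simp
   show "emeasure lborel {t. t \<notin> ?J \<and> (pt th s t \<in> \<Omega>) \<noteq> (pt th s0 t \<in> \<Omega>)} \<le> ennreal (L * \<bar>s - s0\<bar>)"
    using s \<delta> by (intro L) (auto simp: dist_real_def)
  qed (use L0 in simp)
  have "(NN t. ennreal \<bar>F (pt th s t) - F (pt th s0 t)\<bar> * indicator {-2..2} t) \<le> (NN t. ennreal (Lf * \<bar>s - s0\<bar>) * indicator {-2..2::real} t)"
  proof (intro nn_integral_mono)
   fix t :: real
   show "ennreal \<bar>F (pt th s t) - F (pt th s0 t)\<bar> * indicator {-2..2} t \<le> ennreal (Lf * \<bar>s - s0\<bar>) * indicator {-2..2} t"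
   proof (cases "t \<in> {-2..2}")
    case True
    have "\<bar>F (pt th s t) - F (pt th s0 t)\<bar> \<le> Lf * norm (pt th s t - pt th s0 t)"
     using True s \<delta> by (intro Lf(2) inR) auto
    also have "norm (pt th s t - pt th s0 t) = \<bar>s - s0\<bar>" by (simp add: pt_diff)
    finally show ?thesis using True by (simp add: ennreal_leI)
   qed simp
  qed
  also have "... = ennreal (4 * (Lf * \<bar>s - s0\<bar>))"
   using Lf(1) by (simp add: nn_integral_cmult_indicator ennreal_mult mult.commute)
  finally have "ennreal \<bar>?c s - ?c s0\<bar> \<le> ennreal (4 * (Lf * \<bar>s - s0\<bar>)) + ennreal (M * (L * \<bar>s - s0\<bar>))"
   by (intro order_trans[OF inc] add_right_mono)
  also have "ennreal (4 * (Lf * \<bar>s - s0\<bar>)) + ennreal (M * (L * \<bar>s - s0\<bar>)) = ennreal ((4 * Lf + M * L) * \<bar>s - s0\<bar>)"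
   using Lf(1) M(1) L0 by (subst ennreal_plus[symmetric]) (auto simp: algebra_simps)
  finally show ?thesis using Lf(1) M(1) L0 by (subst (asm) ennreal_le_iff) auto
 qed
 define D where "D = \<bar>C\<bar> + (4 * Lf + M * L) + 1"
 have D: "D > 0" using Lf(1) M(1) L0 by (simp add: D_def add_nonneg_pos)
 have E: "\<bar>?E s\<bar> \<le> D * \<bar>s - s0\<bar>" if s: "\<bar>s - s0\<bar> < \<delta>" "\<bar>s - s0\<bar> < d'" for s
 proof -
  have "?E s = (?q s - ?q s0) - (?c s - ?c s0)"
   using line_int_split[OF cl \<Omega>1 F J, where s = s and v = v and th = th] line_int_split[OF cl \<Omega>1 F J, where s = s0 and v = v and th = th] zero by simp
  then have "\<bar>?E s\<bar> \<le> C * \<bar>s - s0\<bar> + (4 * Lf + M * L) * \<bar>s - s0\<bar>" using q[OF s(2)] core[OF s(1)] by linarith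
  also have "... \<le> D * \<bar>s - s0\<bar>"
   unfolding D_def distrib_right[symmetric] by (rule mult_right_mono) auto
  finally show ?thesis .
 qed
 \<comment> \<open>Offsets are taken as \<open>\<tau>\<^sup>2\<close>, so the two bounds combine to
   \<open>c * \<tau> \<le> D * \<tau>\<^sup>2\<close>, which fails for
   \<open>\<tau> \<le> c / (2 * D)\<close>.\<close>
 define \<tau> where "\<tau> = min 1 (min (c / (2 * D)) (min r0 (min \<delta> d') / 2))"
 have \<tau>: "\<tau> > 0" "\<tau> \<le> 1" "\<tau> \<le> c / (2 * D)" "\<tau> < r0" "\<tau> < \<delta>" "\<tau> < d'" using c D r0 \<delta> d' by (auto simp: \<tau>_def)
 have t2: "\<tau>\<^sup>2 \<le> \<tau>" "\<tau>\<^sup>2 > 0" using \<tau>(1,2) by (auto simp: power2_eq_square mult_left_le)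
 have ab: "\<bar>s0 - \<sigma> * \<tau>\<^sup>2 - s0\<bar> = \<tau>\<^sup>2" using \<sigma> t2(2) by auto
 have "c * sqrt (\<tau>\<^sup>2) \<le> \<bar>?E (s0 - \<sigma> * \<tau>\<^sup>2)\<bar>" using t2 \<tau> by (intro lower) auto
 also have "... \<le> D * \<bar>s0 - \<sigma> * \<tau>\<^sup>2 - s0\<bar>"
 proof (rule E)
  show "\<bar>s0 - \<sigma> * \<tau>\<^sup>2 - s0\<bar> < \<delta>" "\<bar>s0 - \<sigma> * \<tau>\<^sup>2 - s0\<bar> < d'" unfolding ab using t2 \<tau> by linarith+
 qed
 finally have "c * \<tau> \<le> D * \<tau>\<^sup>2" unfolding ab using \<tau>(1) by simp
 then have "c \<le> D * \<tau>" using \<tau>(1) by (simp add: power2_eq_square)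
 moreover have "2 * (D * \<tau>) \<le> c" using \<tau>(3) D by (simp add: pos_le_divide_eq mult_ac)
 ultimately show False using c by linarith
qed

end

section \<open>The V-line transform\<close>

declare F_measurable [measurable del] Omega_measurable [measurable del]

definition ray :: "real => (real \<times> real => real) => real \<times> real => real" where
 "ray \<alpha> f x = (LB t. indicator {0..} t * f (x + t *\<^sub>R dir \<alpha>))"

lemma lebesgue_integral_borel:
 fixes f :: "'a::euclidean_space => real"
 shows "f \<in> borel_measurable borel ==> (LINT x|lebesgue. f x) = (LB x. f x)"
 by (rule integral_completion) simp

lemma vline_eq_ray:
 assumes [measurable]: "f \<in> borel_measurable borel"
 shows "vline a b \<psi> f x \<phi> = a * ray (\<phi> + 2 * \<psi> - pi / 2) f x + b * ray (\<phi> - pi / 2) f x"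
proof -
 have "(LINT t:{0..}|lebesgue. f (x + t *\<^sub>R dir \<alpha>)) = ray \<alpha> f x" for \<alpha>
  unfolding set_lebesgue_integral_def ray_def real_scaleR_def by (rule lebesgue_integral_borel) measurable
 then show ?thesis by (simp add: vline_def)
qed

text \<open>A ray in direction \<open>\<alpha>\<close> lies on a line whose normal has angle
  \<open>\<alpha> - pi / 2\<close>; genericity has to be required of that angle.\<close>

lemma ray_pt: "x + t *\<^sub>R dir \<alpha> = pt (\<alpha> - pi / 2) (x \<bullet> dir (\<alpha> - pi / 2)) (x \<bullet> dir_perp (\<alpha> - pi / 2) + t)"
proof -
 have "dir \<alpha> = dir_perp (\<alpha> - pi / 2)" by (simp add: dir_def dir_perp_def sin_diff cos_diff)
 then show ?thesis
  using pt_inverse[of "\<alpha> - pi / 2" x] by (simp add: pt_def scaleR_add_left add.assoc[symmetric])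
qed

text \<open>Local in \<open>x\<close>, since a ray transform need not have bounded support.\<close>

definition L1_translation :: "(real \<times> real => real) => bool" where
 "L1_translation V \<longleftrightarrow> (\<forall>R. \<exists>h0>0. \<exists>C\<ge>0. \<forall>v. norm v < h0 -->
  (NN x. ennreal \<bar>V (x + v) - V x\<bar> * indicator (cball 0 R) x) \<le> ennreal (C * norm v))"

definition L2_translation :: "(real \<times> real => real) => bool" where
 "L2_translation V \<longleftrightarrow> (\<forall>R. \<exists>h0>0. \<exists>C\<ge>0. \<forall>v. norm v < h0 -->
  (NN x. ennreal ((V (x + v) - V x)\<^sup>2) * indicator (cball 0 R) x) \<le> ennreal (C * (norm v)\<^sup>2))"

context
 fixes \<Omega> :: "(real \<times> real) set" and u :: "real \<times> real => real"
 assumes dom: "compact_smooth_domain \<Omega>" and \<Omega>1: "\<Omega> \<subseteq> ball 0 1" and u: "smooth_on UNIV u"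
begin

lemma closed_Omega: "closed \<Omega>"
 using dom compact_imp_closed unfolding compact_smooth_domain_def by blast

lemma density_measurable: "(\<lambda>x. u x * indicator \<Omega> x) \<in> borel_measurable borel"
proof -
 have [measurable]: "\<Omega> \<in> sets borel" by (rule borel_closed[OF closed_Omega])
 have [measurable]: "u \<in> borel_measurable borel"
  by (rule borel_measurable_continuous_onI[OF smooth_on_continuous_on[OF u]])
 show ?thesis by measurable
qed

lemma density_bounded: "\<exists>M\<ge>0. \<forall>x. \<bar>u x * indicator \<Omega> x\<bar> \<le> M"
proof -
 obtain M where M: "M \<ge> 0" "\<forall>x\<in>cball 0 1. \<bar>u x\<bar> \<le> M"
  using continuous_bounded_cball[OF smooth_on_continuous_on[OF u], of 1] by blast
 have "\<bar>u x * indicator \<Omega> x\<bar> \<le> M" for x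
  using M subsetD[OF \<Omega>1, of x] by (cases "x \<in> \<Omega>") auto
 then show ?thesis using M(1) by blast
qed

lemma ray_support:
 assumes "u (x + t *\<^sub>R dir \<alpha>) * indicator \<Omega> (x + t *\<^sub>R dir \<alpha>) \<noteq> 0"
 shows "\<bar>t\<bar> \<le> norm x + 1"
proof -
 have "x + t *\<^sub>R dir \<alpha> \<in> \<Omega>" using assms by (auto simp: indicator_def)
 then have "x + t *\<^sub>R dir \<alpha> \<in> ball 0 1" using \<Omega>1 by blast
 then have "norm (x + t *\<^sub>R dir \<alpha>) < 1" by simp
 moreover have "norm (t *\<^sub>R dir \<alpha>) - norm (- x) \<le> norm (t *\<^sub>R dir \<alpha> - - x)" by (rule norm_triangle_ineq2)
 ultimately show ?thesis by (simp add: add.commute)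
qed

lemma ray_integrable: "integrable lborel (\<lambda>t. indicator {0..} t * (u (x + t *\<^sub>R dir \<alpha>) * indicator \<Omega> (x + t *\<^sub>R dir \<alpha>)))"
proof -
 obtain M where M: "M \<ge> 0" "\<And>x. \<bar>u x * indicator \<Omega> x\<bar> \<le> M" using density_bounded by blast
 note [measurable] = density_measurable
 show ?thesis
 proof (rule integrable_bounded_support[where M = M and R = "norm x + 1"])
  show "norm (indicator {0..} t * (u (x + t *\<^sub>R dir \<alpha>) * indicator \<Omega> (x + t *\<^sub>R dir \<alpha>))) \<le> M" for t :: real
   using M(1) M(2)[of "x + t *\<^sub>R dir \<alpha>"] by (cases "t \<ge> 0") (auto simp del: abs_mult)
  show "norm t \<le> norm x + 1" if "indicator {0..} t * (u (x + t *\<^sub>R dir \<alpha>) * indicator \<Omega> (x + t *\<^sub>R dir \<alpha>)) \<noteq> 0" for t :: real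
   using ray_support[of x t \<alpha>] that by auto
 qed measurable
qed

lemma ray_nonneg:
 assumes "\<And>x. u x \<ge> 0"
 shows "ray \<alpha> (\<lambda>x. u x * indicator \<Omega> x) x \<ge> 0"
 unfolding ray_def using assms by (intro Bochner_Integration.integral_nonneg) auto

text \<open>The line carrying the ray meets the frontier in a countable set, so the integrand is
  continuous in \<open>x\<close> for almost every \<open>t\<close>; the majorant lives on a bounded
  range of \<open>t\<close>.\<close>

lemma ray_isCont:
 assumes ct: "\<And>s. countable {t. pt (\<alpha> - pi / 2) s t \<in> frontier \<Omega>}"
 shows "isCont (ray \<alpha> (\<lambda>x. u x * indicator \<Omega> x)) x"
proof -
 obtain M where M: "M \<ge> 0" "\<And>x. \<bar>u x * indicator \<Omega> x\<bar> \<le> M" using density_bounded by blast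
 let ?g = "\<lambda>x t. indicator {0..} t * (u (x + t *\<^sub>R dir \<alpha>) * indicator \<Omega> (x + t *\<^sub>R dir \<alpha>))"
 have "isCont (\<lambda>x. LB t. ?g x t) x"
 proof (rule isCont_param_integral)
  show "?g x \<in> borel_measurable borel" for x
   using borel_measurable_integrable[OF ray_integrable, of x \<alpha>] by simp
  fix S
  show "\<exists>W. integrable lborel W \<and> (\<forall>x t. norm x \<le> S --> \<bar>?g x t\<bar> \<le> W t)"
  proof (intro exI conjI allI impI)
   show "integrable lborel (\<lambda>t::real. M * indicator {-(S + 1)..S + 1} t)"
    by (intro integrable_mult_right integrable_real_indicator) (auto simp: emeasure_lborel_Icc_eq)
   fix x :: "real \<times> real" and t :: real assume x: "norm x \<le> S"
   show "\<bar>?g x t\<bar> \<le> M * indicator {-(S + 1)..S + 1} t"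
   proof (cases "?g x t = 0")
    case False
    then have "u (x + t *\<^sub>R dir \<alpha>) * indicator \<Omega> (x + t *\<^sub>R dir \<alpha>) \<noteq> 0" "t \<ge> 0" by (auto simp: indicator_def split: if_splits)
    then have "t \<in> {-(S + 1)..S + 1}" using ray_support[of x t \<alpha>] x by auto
    moreover have "\<bar>?g x t\<bar> \<le> M" using M(2)[of "x + t *\<^sub>R dir \<alpha>"] \<open>t \<ge> 0\<close> by simp
    ultimately show ?thesis by simp
   next
    case True
    show ?thesis unfolding True using M(1) by simp
   qed
  qed
 next
  let ?S = "{t. x + t *\<^sub>R dir \<alpha> \<in> frontier \<Omega>}"
  have "countable ((\<lambda>t. t - x \<bullet> dir_perp (\<alpha> - pi / 2)) ` {t. pt (\<alpha> - pi / 2) (x \<bullet> dir (\<alpha> - pi / 2)) t \<in> frontier \<Omega>})"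
   using ct by (rule countable_image)
  moreover have "?S \<subseteq> (\<lambda>t. t - x \<bullet> dir_perp (\<alpha> - pi / 2)) ` {t. pt (\<alpha> - pi / 2) (x \<bullet> dir (\<alpha> - pi / 2)) t \<in> frontier \<Omega>}"
  proof
   fix t assume "t \<in> ?S"
   then show "t \<in> (\<lambda>t. t - x \<bullet> dir_perp (\<alpha> - pi / 2)) ` {t. pt (\<alpha> - pi / 2) (x \<bullet> dir (\<alpha> - pi / 2)) t \<in> frontier \<Omega>}"
    unfolding ray_pt by (intro image_eqI[of _ _ "x \<bullet> dir_perp (\<alpha> - pi / 2) + t"]) auto
  qed
  ultimately have "countable ?S" by (rule countable_subset[rotated])
  then have "AE t in lborel. t \<notin> ?S" using countable_imp_null_set_lborel by (intro AE_not_in)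
  then show "AE t in lborel. isCont (\<lambda>x. ?g x t) x"
  proof (rule eventually_mono)
   fix t assume "t \<notin> ?S"
   then have c: "isCont (indicator \<Omega> :: _ => real) (x + t *\<^sub>R dir \<alpha>)" by (simp add: isCont_indicator)
   have cu: "isCont u (x + t *\<^sub>R dir \<alpha>)" using smooth_on_isCont[OF u] by blast
   have l: "isCont (\<lambda>x. x + t *\<^sub>R dir \<alpha>) x" by (intro continuous_intros)
   show "isCont (\<lambda>x. ?g x t) x" by (intro continuous_intros isCont_o2[OF l c] isCont_o2[OF l cu])
  qed
 qed
 then show ?thesis unfolding ray_def[abs_def] .
qed

lemma ray_measurable: "ray \<alpha> (\<lambda>x. u x * indicator \<Omega> x) \<in> borel_measurable borel"
proof -
 note [measurable] = density_measurable
 show ?thesis unfolding ray_def[abs_def] by measurable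
qed

text \<open>Integration along the ray commutes with translation, so Fubini reduces the claim to
  \<open>translation_L1\<close> for each \<open>t\<close>; for \<open>x\<close> in the ball only
  \<open>t \<le> T\<close> matter.\<close>

lemma ray_L1: "L1_translation (ray \<alpha> (\<lambda>x. u x * indicator \<Omega> x))"
 unfolding L1_translation_def
proof
 fix R :: real
 define f where "f = (\<lambda>x. u x * indicator \<Omega> x)"
 have fm [measurable]: "f \<in> borel_measurable borel" unfolding f_def by (rule density_measurable)
 obtain h0 C where h0: "h0 > 0" and C: "C \<ge> 0" and tr: "\<And>v. norm v < h0 ==>
  (NN x. ennreal \<bar>f (x + v) - f x\<bar>) \<le> ennreal (C * norm v)"
  unfolding f_def using translation_L1[OF dom \<Omega>1 u] by blast
 \<comment> \<open>Both \<open>x\<close> and \<open>x + v\<close> have norm below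
   \<open>\<bar>R\<bar> + 1\<close>, and \<open>ray_support\<close> adds one.\<close>
 define T where "T = \<bar>R\<bar> + 2"
 have T: "T \<ge> 0" by (simp add: T_def)
 have i: "integrable lborel (\<lambda>t. indicator {0..} t * f (x + t *\<^sub>R dir \<alpha>))" for x unfolding f_def by (rule ray_integrable)
 show "\<exists>h0>0. \<exists>C\<ge>0. \<forall>v. norm v < h0 -->
  (NN x. ennreal \<bar>ray \<alpha> (\<lambda>x. u x * indicator \<Omega> x) (x + v) - ray \<alpha> (\<lambda>x. u x * indicator \<Omega> x) x\<bar> * indicator (cball 0 R) x) \<le> ennreal (C * norm v)"
  unfolding f_def[symmetric]
 proof (rule exI[of _ "min h0 1"], rule conjI, use h0 in simp, rule exI[of _ "T * C"], rule conjI, use T C in simp, intro allI impI)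
  fix v :: "real \<times> real" assume v: "norm v < min h0 1"
  let ?G = "\<lambda>x. ennreal \<bar>f (x + v) - f x\<bar>"
  have pw: "ennreal \<bar>ray \<alpha> f (x + v) - ray \<alpha> f x\<bar> * indicator (cball 0 R) x \<le> (NN t. ?G (t *\<^sub>R dir \<alpha> + x) * indicator {0..T} t)" for x
  proof (cases "x \<in> cball 0 R")
   case True
   have e: "ray \<alpha> f (x + v) - ray \<alpha> f x = (LB t. indicator {0..} t * f (x + v + t *\<^sub>R dir \<alpha>) - indicator {0..} t * f (x + t *\<^sub>R dir \<alpha>))"
    unfolding ray_def by (rule Bochner_Integration.integral_diff[symmetric, OF i i])
   have "ennreal \<bar>ray \<alpha> f (x + v) - ray \<alpha> f x\<bar> \<le> (NN t. ennreal (norm (indicator {0..} t * f (x + v + t *\<^sub>R dir \<alpha>) - indicator {0..} t * f (x + t *\<^sub>R dir \<alpha>))))"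
    unfolding e real_norm_def[symmetric] by (rule integral_norm_bound_ennreal[OF Bochner_Integration.integrable_diff[OF i i]])
   also have "... \<le> (NN t. ?G (t *\<^sub>R dir \<alpha> + x) * indicator {0..T} t)"
   proof (intro nn_integral_mono)
    fix t :: real
    have z: "f (x + v + t *\<^sub>R dir \<alpha>) = 0 \<and> f (x + t *\<^sub>R dir \<alpha>) = 0" if t: "t > T"
    proof -
     have "norm (x + v) < T - 1" "norm x < T - 1" using True v norm_triangle_ineq[of x v] by (auto simp: T_def)
     then show ?thesis using t ray_support[of "x + v" t \<alpha>] ray_support[of x t \<alpha>] unfolding f_def by fastforce
    qed
    have a: "x + t *\<^sub>R dir \<alpha> + v = x + v + t *\<^sub>R dir \<alpha>" "t *\<^sub>R dir \<alpha> + x = x + t *\<^sub>R dir \<alpha>" by (simp_all add: algebra_simps)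
    show "ennreal (norm (indicator {0..} t * f (x + v + t *\<^sub>R dir \<alpha>) - indicator {0..} t * f (x + t *\<^sub>R dir \<alpha>))) \<le> ?G (t *\<^sub>R dir \<alpha> + x) * indicator {0..T} t"
     unfolding a using z by (cases "t \<ge> 0"; cases "t \<le> T") (auto simp: not_le)
   qed
   finally show ?thesis using True by simp
  qed simp
  have "(NN x. ennreal \<bar>ray \<alpha> f (x + v) - ray \<alpha> f x\<bar> * indicator (cball 0 R) x) \<le>
   (NN x. (NN t. ?G (t *\<^sub>R dir \<alpha> + x) * indicator {0..T} t))" (is "_ \<le> ?I")
   by (intro nn_integral_mono pw)
  also have "?I = (NN t. (NN x. ?G (t *\<^sub>R dir \<alpha> + x) * indicator {0..T} t))"
   by (rule lborel_pair.Fubini'[where f = "\<lambda>t x. ?G (t *\<^sub>R dir \<alpha> + x) * indicator {0..T} t"]) measurable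
  also have "... \<le> (NN t. ennreal (C * norm v) * indicator {0..T} t)"
  proof (intro nn_integral_mono)
   fix t :: real
   have Gm: "?G \<in> borel_measurable borel" by measurable
   have "(NN x. ?G (t *\<^sub>R dir \<alpha> + x) * indicator {0..T} t) = (NN x. ?G (t *\<^sub>R dir \<alpha> + x)) * indicator {0..T} t"
    by (rule nn_integral_multc) measurable
   also have "(NN x. ?G (t *\<^sub>R dir \<alpha> + x)) = (NN x. ?G x)"
    using lborel_nn_integral_scale[of 1 ?G "t *\<^sub>R dir \<alpha>"] Gm by simp
   also have "... * indicator {0..T} t \<le> ennreal (C * norm v) * indicator {0..T} t"
    using tr[of v] v by (intro mult_right_mono) auto
   finally show "(NN x. ?G (t *\<^sub>R dir \<alpha> + x) * indicator {0..T} t) \<le> ennreal (C * norm v) * indicator {0..T} t" .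
  qed
  also have "... = ennreal (C * norm v) * ennreal T"
   using T by (simp add: nn_integral_cmult_indicator)
  also have "... = ennreal (T * C * norm v)"
   using T C by (subst ennreal_mult[symmetric]) (auto simp: mult_ac)
  finally show "(NN x. ennreal \<bar>ray \<alpha> f (x + v) - ray \<alpha> f x\<bar> * indicator (cball 0 R) x) \<le> ennreal (T * C * norm v)" .
 qed
qed

end

section \<open>Smoothing and attenuation\<close>

lemma L1_translation_combination:
 assumes a: "a \<ge> 0" "b \<ge> 0" and m [measurable]: "V \<in> borel_measurable borel" "W \<in> borel_measurable borel"
  and V: "L1_translation V" and W: "L1_translation W"
 shows "L1_translation (\<lambda>x. a * V x + b * W x)"
 unfolding L1_translation_def
proof
 fix R :: real
 obtain h1 C1 where 1: "h1 > 0" "C1 \<ge> 0" "\<And>v. norm v < h1 ==> (NN x. ennreal \<bar>V (x + v) - V x\<bar> * indicator (cball 0 R) x) \<le> ennreal (C1 * norm v)"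
  using V unfolding L1_translation_def by meson
 obtain h2 C2 where 2: "h2 > 0" "C2 \<ge> 0" "\<And>v. norm v < h2 ==> (NN x. ennreal \<bar>W (x + v) - W x\<bar> * indicator (cball 0 R) x) \<le> ennreal (C2 * norm v)"
  using W unfolding L1_translation_def by meson
 show "\<exists>h0>0. \<exists>C\<ge>0. \<forall>v. norm v < h0 -->
  (NN x. ennreal \<bar>a * V (x + v) + b * W (x + v) - (a * V x + b * W x)\<bar> * indicator (cball 0 R) x) \<le> ennreal (C * norm v)"
 proof (rule exI[of _ "min h1 h2"], rule conjI, use 1 2 in simp, rule exI[of _ "a * C1 + b * C2"], rule conjI, use 1 2 a in simp, intro allI impI)
  fix v :: "real \<times> real" assume v: "norm v < min h1 h2"
  let ?I = "indicator (cball 0 R) :: real \<times> real => ennreal"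
  have Im: "?I \<in> borel_measurable borel" by (intro borel_measurable_indicator) simp
  note [measurable] = Im
  have "(NN x. ennreal \<bar>a * V (x + v) + b * W (x + v) - (a * V x + b * W x)\<bar> * ?I x) \<le>
   (NN x. ennreal a * (ennreal \<bar>V (x + v) - V x\<bar> * ?I x) + ennreal b * (ennreal \<bar>W (x + v) - W x\<bar> * ?I x))"
  proof (intro nn_integral_mono)
   fix x
   have "\<bar>a * V (x + v) + b * W (x + v) - (a * V x + b * W x)\<bar> = \<bar>a * (V (x + v) - V x) + b * (W (x + v) - W x)\<bar>"
    by (simp add: algebra_simps)
   also have "... \<le> \<bar>a * (V (x + v) - V x)\<bar> + \<bar>b * (W (x + v) - W x)\<bar>" by (rule abs_triangle_ineq)
   also have "... = a * \<bar>V (x + v) - V x\<bar> + b * \<bar>W (x + v) - W x\<bar>" using a by (simp add: abs_mult)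
   finally have "ennreal \<bar>a * V (x + v) + b * W (x + v) - (a * V x + b * W x)\<bar> \<le> ennreal (a * \<bar>V (x + v) - V x\<bar> + b * \<bar>W (x + v) - W x\<bar>)"
    by (rule ennreal_leI)
   also have "... = ennreal a * ennreal \<bar>V (x + v) - V x\<bar> + ennreal b * ennreal \<bar>W (x + v) - W x\<bar>"
    using a by (simp add: ennreal_mult)
   finally show "ennreal \<bar>a * V (x + v) + b * W (x + v) - (a * V x + b * W x)\<bar> * ?I x \<le>
     ennreal a * (ennreal \<bar>V (x + v) - V x\<bar> * ?I x) + ennreal b * (ennreal \<bar>W (x + v) - W x\<bar> * ?I x)"
    by (cases "x \<in> cball 0 R") auto
  qed
  also have "... = ennreal a * (NN x. ennreal \<bar>V (x + v) - V x\<bar> * ?I x) + ennreal b * (NN x. ennreal \<bar>W (x + v) - W x\<bar> * ?I x)"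
  proof -
   have 1: "(NN x. ennreal a * (ennreal \<bar>V (x + v) - V x\<bar> * ?I x)) = ennreal a * (NN x. ennreal \<bar>V (x + v) - V x\<bar> * ?I x)"
    by (rule nn_integral_cmult) measurable
   have 2: "(NN x. ennreal b * (ennreal \<bar>W (x + v) - W x\<bar> * ?I x)) = ennreal b * (NN x. ennreal \<bar>W (x + v) - W x\<bar> * ?I x)"
    by (rule nn_integral_cmult) measurable
   show ?thesis unfolding 1[symmetric] 2[symmetric] by (rule nn_integral_add) measurable
  qed
  also have "... \<le> ennreal a * ennreal (C1 * norm v) + ennreal b * ennreal (C2 * norm v)"
   using 1(3)[of v] 2(3)[of v] v by (intro add_mono mult_left_mono) auto
  also have "... = ennreal ((a * C1 + b * C2) * norm v)"
   using a 1(2) 2(2) by (simp add: ennreal_mult[symmetric] ennreal_plus[symmetric] algebra_simps del: ennreal_plus)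
  finally show "(NN x. ennreal \<bar>a * V (x + v) + b * W (x + v) - (a * V x + b * W x)\<bar> * ?I x) \<le> ennreal ((a * C1 + b * C2) * norm v)" .
 qed
qed

lemma smoothing_isCont:
 fixes V \<phi> :: "'a::euclidean_space => real"
 assumes V: "continuous_on UNIV V" and \<phi>: "integrable lborel \<phi>" and r: "\<And>y. \<phi> y \<noteq> 0 ==> norm y \<le> r"
 shows "isCont (\<lambda>x. LB y. \<phi> y * V (x - y)) x" "integrable lborel (\<lambda>y. \<phi> y * V (x - y))"
proof -
 have [measurable]: "\<phi> \<in> borel_measurable borel" using \<phi> by (rule borel_measurable_integrable_lborel)
 have [measurable]: "V \<in> borel_measurable borel" using V by (rule borel_measurable_continuous_onI)
 have bd: "\<exists>W. integrable lborel W \<and> (\<forall>x t. norm x \<le> S --> \<bar>\<phi> t * V (x - t)\<bar> \<le> W t)" for S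
 proof -
  obtain M where M: "M \<ge> 0" "\<forall>x\<in>cball 0 (S + r). \<bar>V x\<bar> \<le> M" using continuous_bounded_cball[OF V] by blast
  have "\<bar>\<phi> t * V (x - t)\<bar> \<le> \<bar>\<phi> t\<bar> * M" if "norm x \<le> S" for x t
  proof (cases "\<phi> t = 0")
   case False
   then have "norm (x - t) \<le> S + r" using r[OF False] that norm_triangle_ineq4[of x t] by linarith
   then show ?thesis using M(2) by (simp add: abs_mult mult_left_mono)
  qed simp
  moreover have "integrable lborel (\<lambda>t. \<bar>\<phi> t\<bar> * M)" using \<phi> by simp
  ultimately show ?thesis by blast
 qed
 show "isCont (\<lambda>x. LB y. \<phi> y * V (x - y)) x"
 proof (rule isCont_param_integral)
  show "AE t in lborel. isCont (\<lambda>x. \<phi> t * V (x - t)) x"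
  proof (rule AE_I2)
   fix t
   have "isCont V (x - t)" using V continuous_on_eq_continuous_at[OF open_UNIV] by blast
   then have "isCont (\<lambda>x. V (x - t)) x" by (rule isCont_o2[rotated]) (intro continuous_intros)
   then show "isCont (\<lambda>x. \<phi> t * V (x - t)) x" by (intro continuous_intros)
  qed
 qed (measurable, rule bd)
 obtain W where W: "integrable lborel W" "\<And>t. \<bar>\<phi> t * V (x - t)\<bar> \<le> W t" using bd[of "norm x"] by blast
 show "integrable lborel (\<lambda>y. \<phi> y * V (x - y))"
  by (rule Bochner_Integration.integrable_bound[OF W(1)]) (measurable, use W(2) in \<open>auto intro: order_trans[OF _ abs_ge_self]\<close>)
qed

text \<open>The global bound with constant \<open>K\<close> is applied to the increment of
  \<open>V\<close> times a continuous plateau; the bounded support of the kernel makes the plateau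
  invisible on the ball of radius \<open>R\<close>.\<close>

lemma smoothing_L2:
 fixes V \<phi> :: "real \<times> real => real"
 assumes V: "continuous_on UNIV V" and L1: "L1_translation V"
  and \<phi>: "integrable lborel \<phi>" and r: "\<And>y. \<phi> y \<noteq> 0 ==> norm y \<le> r"
  and K: "\<And>D B. continuous_on UNIV D ==> integrable lborel D ==> (\<And>x. \<bar>D x\<bar> \<le> B) ==>
   (NN x. ennreal ((LB y. \<phi> y * D (x - y))\<^sup>2)) \<le> ennreal (K * (LB x. \<bar>D x\<bar>)\<^sup>2)"
 shows "L2_translation (\<lambda>x. LB y. \<phi> y * V (x - y))"
 unfolding L2_translation_def
proof
 fix R :: real
 define S where "S = \<bar>R\<bar> + \<bar>r\<bar> + 1"
 obtain h0 C where h0: "h0 > 0" and C: "C \<ge> 0" and tr: "\<And>v. norm v < h0 ==>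
   (NN x. ennreal \<bar>V (x + v) - V x\<bar> * indicator (cball 0 S) x) \<le> ennreal (C * norm v)"
  using L1 unfolding L1_translation_def by meson
 have Vm [measurable]: "V \<in> borel_measurable borel" using V by (rule borel_measurable_continuous_onI)
 let ?W = "\<lambda>x. LB y. \<phi> y * V (x - y)"
 show "\<exists>h0>0. \<exists>C\<ge>0. \<forall>v. norm v < h0 -->
  (NN x. ennreal ((?W (x + v) - ?W x)\<^sup>2) * indicator (cball 0 R) x) \<le> ennreal (C * (norm v)\<^sup>2)"
 proof (rule exI[of _ h0], rule conjI[OF h0], rule exI[of _ "\<bar>K\<bar> * C\<^sup>2"], rule conjI, simp, intro allI impI)
  fix v :: "real \<times> real" assume v: "norm v < h0"
  \<comment> \<open>Equal to one up to radius \<open>\<bar>R\<bar> + \<bar>r\<bar>\<close>, the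
    range of \<open>x - y\<close> under the kernel, and zero from radius \<open>S\<close>
    on.\<close>
  define \<kappa> where "\<kappa> x = max 0 (min 1 (S - norm x))" for x :: "real \<times> real"
  define D where "D x = \<kappa> x * (V (x + v) - V x)" for x
  have cV: "continuous_on UNIV (\<lambda>x. V (x + v))"
   by (rule continuous_on_compose2[OF V]) (auto intro!: continuous_intros)
  have cD: "continuous_on UNIV D" unfolding D_def[abs_def] \<kappa>_def by (intro continuous_intros cV V)
  have Dm [measurable]: "D \<in> borel_measurable borel" using cD by (rule borel_measurable_continuous_onI)
  have supp: "norm x \<le> S" if "D x \<noteq> 0" for x using that by (auto simp: D_def \<kappa>_def max_def min_def split: if_splits)
  obtain B where B: "B \<ge> 0" "\<forall>x\<in>cball 0 S. \<bar>D x\<bar> \<le> B" using continuous_bounded_cball[OF cD, of S] by blast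
  have DB: "\<bar>D x\<bar> \<le> B" for x
   using B supp[of x] by (cases "D x = 0") auto
  have Di: "integrable lborel D" by (rule integrable_bounded_support[where M = B and R = S]) (use DB supp in auto)
  have Dle: "\<bar>D x\<bar> \<le> \<bar>V (x + v) - V x\<bar>" for x
   unfolding D_def abs_mult by (rule mult_left_le_one_le) (auto simp: \<kappa>_def)
  have I: "(LB x. \<bar>D x\<bar>) \<le> C * norm v"
  proof -
   have "ennreal (LB x. \<bar>D x\<bar>) = (NN x. ennreal \<bar>D x\<bar>)"
    using Di by (intro nn_integral_eq_integral[symmetric]) auto
   also have "... \<le> (NN x. ennreal \<bar>V (x + v) - V x\<bar> * indicator (cball 0 S) x)"
   proof (intro nn_integral_mono)
    fix x show "ennreal \<bar>D x\<bar> \<le> ennreal \<bar>V (x + v) - V x\<bar> * indicator (cball 0 S) x"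
     using supp[of x] Dle[of x] by (cases "D x = 0") (auto intro: ennreal_leI)
   qed
   also have "... \<le> ennreal (C * norm v)" by (rule tr[OF v])
   finally show ?thesis using C by (subst (asm) ennreal_le_iff) auto
  qed
  have I0: "0 \<le> (LB x. \<bar>D x\<bar>)" by (intro Bochner_Integration.integral_nonneg) simp
  have diff: "?W (x + v) - ?W x = (LB y. \<phi> y * D (x - y))" if x: "x \<in> cball 0 R" for x
  proof -
   have "?W (x + v) - ?W x = (LB y. \<phi> y * V (x + v - y) - \<phi> y * V (x - y))"
    by (rule Bochner_Integration.integral_diff[symmetric]) (rule smoothing_isCont(2)[OF V \<phi> r], assumption)+
   also have "... = (LB y. \<phi> y * D (x - y))"
   proof (rule Bochner_Integration.integral_cong[OF refl])
    fix y
    show "\<phi> y * V (x + v - y) - \<phi> y * V (x - y) = \<phi> y * D (x - y)"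
    proof (cases "\<phi> y = 0")
     case False
     have "norm (x - y) \<le> \<bar>R\<bar> + \<bar>r\<bar>" using r[OF False] x norm_triangle_ineq4[of x y] by simp
     then have "\<kappa> (x - y) = 1" by (simp add: \<kappa>_def S_def)
     moreover have e: "x + v - y = x - y + v" by simp
     ultimately show ?thesis unfolding D_def e by (simp only: mult_1 right_diff_distrib)
    qed simp
   qed
   finally show ?thesis .
  qed
  have "(NN x. ennreal ((?W (x + v) - ?W x)\<^sup>2) * indicator (cball 0 R) x) \<le> (NN x. ennreal ((LB y. \<phi> y * D (x - y))\<^sup>2))"
  proof (intro nn_integral_mono)
   fix x show "ennreal ((?W (x + v) - ?W x)\<^sup>2) * indicator (cball 0 R) x \<le> ennreal ((LB y. \<phi> y * D (x - y))\<^sup>2)"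
    using diff[of x] by (cases "x \<in> cball 0 R") (simp_all del: mem_cball mem_cball_0)
  qed
  also have "... \<le> ennreal (K * (LB x. \<bar>D x\<bar>)\<^sup>2)" by (rule K[OF cD Di DB])
  also have "... \<le> ennreal (\<bar>K\<bar> * C\<^sup>2 * (norm v)\<^sup>2)"
  proof (rule ennreal_leI)
   have "K * (LB x. \<bar>D x\<bar>)\<^sup>2 \<le> \<bar>K\<bar> * (C * norm v)\<^sup>2"
    by (intro mult_mono power_mono I I0) auto
   then show "K * (LB x. \<bar>D x\<bar>)\<^sup>2 \<le> \<bar>K\<bar> * C\<^sup>2 * (norm v)\<^sup>2" by (simp add: power_mult_distrib mult.assoc)
  qed
  finally show "(NN x. ennreal ((?W (x + v) - ?W x)\<^sup>2) * indicator (cball 0 R) x) \<le> ennreal (\<bar>K\<bar> * C\<^sup>2 * (norm v)\<^sup>2)" .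
 qed
qed

text \<open>As \<open>W \<ge> 0\<close>, the function \<open>exp (- W)\<close> changes at most by
  the change of \<open>W\<close>, so the \<open>L^2\<close> bound survives;
  \<open>rotation_nn_integral\<close> then turns a bound over the plane into one over parallel
  lines.\<close>

lemma attenuation_line_H1:
 fixes p W :: "real \<times> real => real"
 assumes cp: "continuous_on UNIV p" and lip: "\<And>R. \<exists>L\<ge>0. \<forall>x\<in>cball 0 R. \<forall>y\<in>cball 0 R. \<bar>p x - p y\<bar> \<le> L * norm (x - y)"
  and W: "continuous_on UNIV W" "\<And>x. W x \<ge> 0" "L2_translation W" and c: "cos th \<noteq> 0"
 shows "line_H1 th (\<lambda>x. p x * exp (- W x))"
 unfolding line_H1_def
proof
 fix R :: real
 define S where "S = \<bar>R\<bar> + 2"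
 obtain L where L: "L \<ge> 0" "\<And>x y. x \<in> cball 0 (S + 1) ==> y \<in> cball 0 (S + 1) ==> \<bar>p x - p y\<bar> \<le> L * norm (x - y)"
  using lip[of "S + 1"] by blast
 obtain P where P: "P \<ge> 0" "\<And>x. x \<in> cball 0 S ==> \<bar>p x\<bar> \<le> P" using continuous_bounded_cball[OF cp, of S] by blast
 obtain h0 C where h0: "h0 > 0" and C: "C \<ge> 0" and tr: "\<And>v. norm v < h0 ==>
   (NN x. ennreal ((W (x + v) - W x)\<^sup>2) * indicator (cball 0 S) x) \<le> ennreal (C * (norm v)\<^sup>2)"
  using W(3) unfolding L2_translation_def by meson
 have [measurable]: "p \<in> borel_measurable borel" "W \<in> borel_measurable borel"
  using cp W(1) by (auto intro: borel_measurable_continuous_onI)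
 define F where "F x = p x * exp (- W x)" for x
 have [measurable]: "F \<in> borel_measurable borel" unfolding F_def[abs_def] by measurable
 let ?I = "indicator (cball 0 S) :: real \<times> real => ennreal"
 have Im [measurable]: "?I \<in> borel_measurable borel" by (intro borel_measurable_indicator) simp
 define m where "m = measure lborel (cball (0::real \<times> real) S)"
 have m: "emeasure lborel (cball (0::real \<times> real) S) = ennreal m" "m \<ge> 0"
  unfolding m_def using emeasure_bounded_finite[of "cball (0::real \<times> real) S"]
  by (auto intro!: emeasure_eq_ennreal_measure)
 have ex: "\<bar>exp (- a) - exp (- b)\<bar> \<le> \<bar>a - b\<bar>" if "a \<ge> 0" "b \<ge> 0" for a b :: real
 proof -
  have *: "exp (- x) - exp (- y) \<le> y - x \<and> exp (- y) \<le> exp (- x)" if "0 \<le> x" "x \<le> y" for x y :: real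
  proof -
   have "exp (- x) - exp (- y) = exp (- x) * (1 - exp (x - y))" by (simp add: algebra_simps exp_add[symmetric])
   also have "... \<le> 1 * (y - x)"
   proof (rule mult_mono)
    show "1 - exp (x - y) \<le> y - x" using exp_ge_add_one_self[of "x - y"] by linarith
   qed (use that in auto)
   finally show ?thesis using that by simp
  qed
  show ?thesis using *[of a b] *[of b a] that by (cases "a \<le> b") auto
 qed
 show "\<exists>h0>0. \<exists>C\<ge>0. \<forall>h. 0 < h --> h < h0 -->
   (NN s. (NN t. ennreal ((p (pt th (s + h) t) * exp (- W (pt th (s + h) t)) - p (pt th s t) * exp (- W (pt th s t)))\<^sup>2) * indicator {-2..2} t) * indicator {-R..R} s)
    \<le> ennreal (C * h\<^sup>2)"
  unfolding F_def[symmetric]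
 proof (rule exI[of _ "min h0 1"], rule conjI, use h0 in simp, rule exI[of _ "2 * L\<^sup>2 * m + 2 * P\<^sup>2 * C"], rule conjI, use m C in simp, intro allI impI)
  fix h :: real assume h: "0 < h" "h < min h0 1"
  define v where "v = h *\<^sub>R dir th"
  have nv: "norm v = h" using h by (simp add: v_def)
  have sh: "pt th (s + h) t = pt th s t + v" for s t by (simp add: pt_def v_def scaleR_add_left)
  let ?G = "\<lambda>x. ennreal ((F (x + v) - F x)\<^sup>2) * ?I x"
  have Gm: "?G \<in> borel_measurable borel" by measurable
  have pw: "?G x \<le> ennreal (2 * L\<^sup>2 * h\<^sup>2) * ?I x + ennreal (2 * P\<^sup>2) * (ennreal ((W (x + v) - W x)\<^sup>2) * ?I x)" for x
  proof (cases "x \<in> cball 0 S")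
   case True
   have xv: "x + v \<in> cball 0 (S + 1)" "x \<in> cball 0 (S + 1)" using True h norm_triangle_ineq[of x v] nv by auto
   have "F (x + v) - F x = (p (x + v) - p x) * exp (- W (x + v)) + p x * (exp (- W (x + v)) - exp (- W x))"
    by (simp add: F_def algebra_simps)
   also have "\<bar>...\<bar> \<le> \<bar>p (x + v) - p x\<bar> * exp (- W (x + v)) + \<bar>p x\<bar> * \<bar>exp (- W (x + v)) - exp (- W x)\<bar>"
    by (rule order_trans[OF abs_triangle_ineq]) (simp add: abs_mult)
   also have "... \<le> (L * h) * 1 + P * \<bar>W (x + v) - W x\<bar>"
   proof (intro add_mono mult_mono)
    show "\<bar>p (x + v) - p x\<bar> \<le> L * h" using L(2)[OF xv] nv by simp
    show "\<bar>exp (- W (x + v)) - exp (- W x)\<bar> \<le> \<bar>W (x + v) - W x\<bar>" by (intro ex W)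
   qed (use W(2) P True L(1) h in auto)
   finally have n: "\<bar>F (x + v) - F x\<bar> \<le> L * h + P * \<bar>W (x + v) - W x\<bar>" by simp
   have "(F (x + v) - F x)\<^sup>2 = \<bar>F (x + v) - F x\<bar>\<^sup>2" by simp
   also have "... \<le> (L * h + P * \<bar>W (x + v) - W x\<bar>)\<^sup>2" by (rule power_mono[OF n]) simp
   also have "... \<le> 2 * (L * h)\<^sup>2 + 2 * (P * \<bar>W (x + v) - W x\<bar>)\<^sup>2"
    using sum_squares_bound[of "L * h" "P * \<bar>W (x + v) - W x\<bar>"] by (simp only: power2_sum)
   also have "... = 2 * L\<^sup>2 * h\<^sup>2 + 2 * P\<^sup>2 * (W (x + v) - W x)\<^sup>2" by (simp add: power_mult_distrib)
   finally have "ennreal ((F (x + v) - F x)\<^sup>2) \<le> ennreal (2 * L\<^sup>2 * h\<^sup>2 + 2 * P\<^sup>2 * (W (x + v) - W x)\<^sup>2)" by (rule ennreal_leI)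
   also have "... = ennreal (2 * L\<^sup>2 * h\<^sup>2) + ennreal (2 * P\<^sup>2) * ennreal ((W (x + v) - W x)\<^sup>2)"
    by (subst ennreal_plus) (auto simp: ennreal_mult)
   finally show ?thesis using True by simp
  qed simp
  have "(NN s. (NN t. ennreal ((F (pt th (s + h) t) - F (pt th s t))\<^sup>2) * indicator {-2..2} t) * indicator {-R..R} s) \<le> (NN s. \<integral>\<^sup>+t. ?G (pt th s t) \<partial>lborel)"
  proof (intro nn_integral_mono)
   fix s :: real
   show "(NN t. ennreal ((F (pt th (s + h) t) - F (pt th s t))\<^sup>2) * indicator {-2..2} t) * indicator {-R..R} s \<le> (NN t. ?G (pt th s t))"
   proof (cases "s \<in> {-R..R}")
    case True
    have "(NN t. ennreal ((F (pt th (s + h) t) - F (pt th s t))\<^sup>2) * indicator {-2..2} t) \<le> (NN t. ?G (pt th s t))"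
    proof (intro nn_integral_mono)
     fix t :: real
     show "ennreal ((F (pt th (s + h) t) - F (pt th s t))\<^sup>2) * indicator {-2..2} t \<le> ?G (pt th s t)"
     proof (cases "t \<in> {-2..2}")
      case t: True
      have "dist (pt th s t) (pt th 0 0) \<le> \<bar>s - 0\<bar> + \<bar>t - 0\<bar>" by (rule dist_pt)
      also have "... \<le> S" using True t by (auto simp: S_def)
      finally have "dist (pt th s t) (pt th 0 0) \<le> S" .
      moreover have "pt th 0 0 = 0" by (simp add: pt_def)
      ultimately have "pt th s t \<in> cball 0 S" by (simp add: dist_commute)
      then show ?thesis using t unfolding sh by simp
     qed simp
    qed
    then show ?thesis using True by simp
   qed simp
  qed
  also have "... = (NN x. ?G x)" by (rule rotation_nn_integral[OF Gm c])
  also have "... \<le> (NN x. ennreal (2 * L\<^sup>2 * h\<^sup>2) * ?I x + ennreal (2 * P\<^sup>2) * (ennreal ((W (x + v) - W x)\<^sup>2) * ?I x))"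
   by (intro nn_integral_mono pw)
  also have "... = ennreal (2 * L\<^sup>2 * h\<^sup>2) * ennreal m + ennreal (2 * P\<^sup>2) * (NN x. ennreal ((W (x + v) - W x)\<^sup>2) * ?I x)"
  proof -
   have 1: "(NN x. ennreal (2 * L\<^sup>2 * h\<^sup>2) * ?I x) = ennreal (2 * L\<^sup>2 * h\<^sup>2) * ennreal m"
    by (subst nn_integral_cmult_indicator) (auto simp: m(1))
   have 2: "(NN x. ennreal (2 * P\<^sup>2) * (ennreal ((W (x + v) - W x)\<^sup>2) * ?I x)) = ennreal (2 * P\<^sup>2) * (NN x. ennreal ((W (x + v) - W x)\<^sup>2) * ?I x)"
    by (rule nn_integral_cmult) measurable
   show ?thesis unfolding 1[symmetric] 2[symmetric] by (rule nn_integral_add) measurable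
  qed
  also have "... \<le> ennreal (2 * L\<^sup>2 * h\<^sup>2) * ennreal m + ennreal (2 * P\<^sup>2) * ennreal (C * h\<^sup>2)"
   using tr[of v] h nv by (intro add_left_mono mult_left_mono) auto
  also have "... = ennreal (2 * L\<^sup>2 * h\<^sup>2 * m) + ennreal (2 * P\<^sup>2 * (C * h\<^sup>2))"
   using m(2) C by (simp only: ennreal_mult[symmetric] zero_le_mult_iff zero_le_power2 zero_le_numeral simp_thms)
  also have "... = ennreal ((2 * L\<^sup>2 * m + 2 * P\<^sup>2 * C) * h\<^sup>2)"
   using m(2) C by (subst ennreal_plus[symmetric]) (auto simp: algebra_simps)
  finally show "(NN s. (NN t. ennreal ((F (pt th (s + h) t) - F (pt th s t))\<^sup>2) * indicator {-2..2} t) * indicator {-R..R} s) \<le> ennreal ((2 * L\<^sup>2 * m + 2 * P\<^sup>2 * C) * h\<^sup>2)" .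
 qed
qed

section \<open>The singular supports\<close>

text \<open>Decay of order two leaves \<open>1 / (1 + \<bar>\<xi>\<bar>)\<^sup>2\<close> after
  weighting, which is integrable on the line.\<close>

lemma rapid_decay_wL2:
 assumes f: "integrable lborel f" and r: "rapid_decay (ft f)"
 shows "wL2 f UNIV"
proof -
 have [measurable]: "ft f \<in> borel_measurable borel" using f by auto
 obtain C where C: "\<And>\<xi>. (1 + norm \<xi>) ^ 2 * norm (ft f \<xi>) \<le> C" using r unfolding rapid_decay_def by blast
 have pw: "(1 + \<xi>\<^sup>2) * (norm (ft f \<xi>))\<^sup>2 \<le> C\<^sup>2 * (1 / (1 + \<bar>\<xi>\<bar>) ^ 2)" for \<xi>
 proof -
  let ?a = "1 + \<bar>\<xi>\<bar>" and ?n = "norm (ft f \<xi>)"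
  have a: "?a > 0" by simp
  have "1 + \<xi>\<^sup>2 \<le> ?a\<^sup>2" by (simp add: power2_sum)
  then have "(1 + \<xi>\<^sup>2) * ?n\<^sup>2 \<le> ?a\<^sup>2 * ?n\<^sup>2" by (rule mult_right_mono) simp
  then have "(1 + \<xi>\<^sup>2) * ?n\<^sup>2 * ?a\<^sup>2 \<le> ?a\<^sup>2 * ?n\<^sup>2 * ?a\<^sup>2" by (rule mult_right_mono) simp
  also have "... = (?a\<^sup>2 * ?n)\<^sup>2" by (simp add: power_mult_distrib power2_eq_square mult_ac)
  also have "... \<le> C\<^sup>2" using C[of \<xi>] by (intro power_mono) auto
  finally show ?thesis using a by (simp add: pos_le_divide_eq)
 qed
 have "(NN \<xi>. ennreal ((1 + \<xi>\<^sup>2) * (norm (ft f \<xi>))\<^sup>2)) \<le> (NN \<xi>. ennreal (C\<^sup>2 * (1 / (1 + \<bar>\<xi>\<bar>) ^ 2)))"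
  by (intro nn_integral_mono ennreal_leI pw)
 also have "... = ennreal (LB \<xi>. C\<^sup>2 * (1 / (1 + \<bar>\<xi>\<bar>) ^ 2))"
  by (rule nn_integral_eq_integral, rule integrable_mult_right, rule integrable_decay_real) (auto intro!: AE_I2)
 also have "... < \<infinity>" by simp
 finally show ?thesis unfolding wL2_def by simp
qed

text \<open>No direction is singled out: for real, locally bounded \<open>g\<close>, regularity in
  one direction at a point already implies this two-sided form.\<close>

definition H1_near :: "(real => real) => real => bool" where
 "H1_near g s \<longleftrightarrow> (\<exists>\<zeta>. test_function \<zeta> \<and> \<zeta> s \<noteq> 0 \<and> wL2 (\<lambda>x. \<zeta> x * complex_of_real (g x)) UNIV)"

lemma in_L2_weight:
 fixes \<xi> :: real
 assumes g: "locally_bounded g" and \<eta>: "test_function \<eta>"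
 shows "norm (complex_of_real ((1 + (norm \<xi>)\<^sup>2) powr (1 / 2)) * c * fourier_loc \<eta> (distr_of g) \<xi>) powr enn2real 2
  = (1 + \<xi>\<^sup>2) * (norm c)\<^sup>2 * (norm (ft (\<lambda>x. \<eta> x * complex_of_real (g x)) \<xi>))\<^sup>2"
proof -
 have e: "fourier_loc \<eta> (distr_of g) \<xi> = ft (\<lambda>x. \<eta> x * complex_of_real (g x)) \<xi>"
  by (rule fourier_loc_distr_of[OF locally_bounded_measurable[OF g] \<eta>])
 have p: "1 + \<xi>\<^sup>2 > 0" by (simp add: add_pos_nonneg)
 have n: "norm (complex_of_real ((1 + (norm \<xi>)\<^sup>2) powr (1 / 2)) * c * fourier_loc \<eta> (distr_of g) \<xi>) =
   sqrt (1 + \<xi>\<^sup>2) * norm c * norm (ft (\<lambda>x. \<eta> x * complex_of_real (g x)) \<xi>)"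
  unfolding e using p by (simp add: norm_mult powr_half_sqrt)
 have sq: "norm z powr enn2real 2 = (norm z)\<^sup>2" for z :: complex
  by (cases "z = 0") (simp_all add: powr_numeral)
 show ?thesis unfolding sq unfolding n power_mult_distrib real_sqrt_pow2[OF less_imp_le[OF p]] ..
qed

text \<open>On the line a multiplier homogeneous of degree zero is constant on each half-line, so
  the microlocal condition gives \<open>wL2\<close> on the half-line of \<open>\<xi>0\<close>, and
  \<open>wL2_real_symmetric\<close> extends it to both.\<close>

lemma H1_near_of_microlocal:
 assumes g: "locally_bounded g" and ml: "microlocally_sobolev 1 2 (distr_of g) s \<xi>0" and \<xi>0: "\<xi>0 \<noteq> 0"
 shows "H1_near g s"
proof -
 obtain \<eta> m where \<eta>: "test_function \<eta>" "\<eta> s \<noteq> 0" and hom: "\<And>t \<xi>. t > 0 ==> \<xi> \<noteq> 0 ==> m (t *\<^sub>R \<xi>) = m \<xi>"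
  and m0: "m \<xi>0 \<noteq> 0"
  and L: "in_Lp 2 (\<lambda>\<xi>. complex_of_real ((1 + (norm \<xi>)\<^sup>2) powr (1 / 2)) * m \<xi> * fourier_loc \<eta> (distr_of g) \<xi>)"
  using ml unfolding microlocally_sobolev_def by blast
 define \<sigma> where "\<sigma> = sgn \<xi>0"
 have \<sigma>: "\<sigma> = 1 \<or> \<sigma> = -1" using \<xi>0 by (auto simp: \<sigma>_def sgn_if)
 have m: "m \<xi> = m \<xi>0" if "\<sigma> * \<xi> > 0" for \<xi>
 proof -
  have "\<xi> / \<xi>0 > 0" using that \<xi>0 by (auto simp: \<sigma>_def sgn_if zero_less_divide_iff split: if_splits)
  from hom[OF this \<xi>0] \<xi>0 show ?thesis by simp
 qed
 let ?A = "\<lambda>\<xi>. (1 + \<xi>\<^sup>2) * (norm (ft (\<lambda>x. \<eta> x * complex_of_real (g x)) \<xi>))\<^sup>2"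
 have if1: "integrable lborel (\<lambda>x. \<eta> x * complex_of_real (g x))" by (rule integrable_test_mult[OF g \<eta>(1)])
 have [measurable]: "ft (\<lambda>x. \<eta> x * complex_of_real (g x)) \<in> borel_measurable borel" using if1 by (rule ft_measurable)
 have fin: "(NN \<xi>. ennreal ((1 + \<xi>\<^sup>2) * (norm (m \<xi>))\<^sup>2 * (norm (ft (\<lambda>x. \<eta> x * complex_of_real (g x)) \<xi>))\<^sup>2)) < \<infinity>"
  using L unfolding in_Lp_def in_L2_weight[OF g \<eta>(1)] nn_integral_completion by simp
 have "ennreal ((norm (m \<xi>0))\<^sup>2) * (NN \<xi>. ennreal (?A \<xi>) * indicator {\<xi>. \<sigma> * \<xi> > 0} \<xi>) =
   (NN \<xi>. ennreal ((norm (m \<xi>0))\<^sup>2) * (ennreal (?A \<xi>) * indicator {\<xi>. \<sigma> * \<xi> > 0} \<xi>))"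
  by (rule nn_integral_cmult[symmetric]) measurable
 also have "... \<le> (NN \<xi>. ennreal ((1 + \<xi>\<^sup>2) * (norm (m \<xi>))\<^sup>2 * (norm (ft (\<lambda>x. \<eta> x * complex_of_real (g x)) \<xi>))\<^sup>2))"
 proof (intro nn_integral_mono)
  fix \<xi> :: real
  show "ennreal ((norm (m \<xi>0))\<^sup>2) * (ennreal (?A \<xi>) * indicator {\<xi>. \<sigma> * \<xi> > 0} \<xi>) \<le>
    ennreal ((1 + \<xi>\<^sup>2) * (norm (m \<xi>))\<^sup>2 * (norm (ft (\<lambda>x. \<eta> x * complex_of_real (g x)) \<xi>))\<^sup>2)"
  proof (cases "\<sigma> * \<xi> > 0")
   case True
   have "ennreal ((norm (m \<xi>0))\<^sup>2) * ennreal (?A \<xi>) = ennreal ((1 + \<xi>\<^sup>2) * (norm (m \<xi>0))\<^sup>2 * (norm (ft (\<lambda>x. \<eta> x * complex_of_real (g x)) \<xi>))\<^sup>2)"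
    by (subst ennreal_mult[symmetric]) (auto simp: mult_ac)
   then show ?thesis using True m[OF True] by simp
  qed simp
 qed
 finally have "ennreal ((norm (m \<xi>0))\<^sup>2) * (NN \<xi>. ennreal (?A \<xi>) * indicator {\<xi>. \<sigma> * \<xi> > 0} \<xi>) < \<infinity>"
  using fin by (rule le_less_trans)
 then have "wL2 (\<lambda>x. \<eta> x * complex_of_real (g x)) {\<xi>. \<sigma> * \<xi> > 0}"
  unfolding wL2_def using m0 by (auto simp: ennreal_mult_less_top)
 then have w: "wL2 (\<lambda>x. cnj (\<eta> x) * (\<eta> x * complex_of_real (g x))) UNIV" by (rule wL2_real_symmetric[OF g \<eta>(1) \<sigma>])
 have "test_function (\<lambda>x. cnj (\<eta> x) * \<eta> x)"
  by (rule test_function_mult[OF test_function_cnj[OF \<eta>(1)] test_function_smooth[OF \<eta>(1)]])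
 then show ?thesis using w \<eta>(2) unfolding H1_near_def mult.assoc[symmetric]
  by (intro exI[of _ "\<lambda>x. cnj (\<eta> x) * \<eta> x"]) simp
qed

text \<open>The constant multiplier 1 serves every direction at once.\<close>

lemma microlocal_of_H1_near:
 assumes g: "locally_bounded g" and h: "H1_near g s"
 shows "microlocally_sobolev 1 2 (distr_of g) s \<xi>0"
proof -
 obtain \<zeta> where \<zeta>: "test_function \<zeta>" "\<zeta> s \<noteq> 0" and w: "wL2 (\<lambda>x. \<zeta> x * complex_of_real (g x)) UNIV"
  using h unfolding H1_near_def by blast
 have if1: "integrable lborel (\<lambda>x. \<zeta> x * complex_of_real (g x))" by (rule integrable_test_mult[OF g \<zeta>(1)])
 have [measurable]: "ft (\<lambda>x. \<zeta> x * complex_of_real (g x)) \<in> borel_measurable borel" using if1 by (rule ft_measurable)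
 have e: "fourier_loc \<zeta> (distr_of g) = ft (\<lambda>x. \<zeta> x * complex_of_real (g x))"
  using fourier_loc_distr_of[OF locally_bounded_measurable[OF g] \<zeta>(1)] by (simp add: fun_eq_iff)
 have m: "(\<lambda>\<xi>::real. complex_of_real ((1 + (norm \<xi>)\<^sup>2) powr (1 / 2)) * 1 * fourier_loc \<zeta> (distr_of g) \<xi>) \<in> borel_measurable lebesgue"
  unfolding e by (rule measurable_completion) measurable
 have "in_Lp 2 (\<lambda>\<xi>. complex_of_real ((1 + (norm \<xi>)\<^sup>2) powr (1 / 2)) * 1 * fourier_loc \<zeta> (distr_of g) \<xi>)"
  using m w unfolding in_Lp_def in_L2_weight[OF g \<zeta>(1)] nn_integral_completion wL2_def by simp
 moreover have "smooth_on (UNIV - {0}) (\<lambda>x::real. 1::complex)"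
  using smooth_on_const[where 'a=real and c=1] unfolding smooth_on_def by blast
 ultimately show ?thesis
  unfolding microlocally_sobolev_def using distribution_distr_of[OF g] \<zeta>
  by (intro conjI exI[of _ \<zeta>] exI[of _ "\<lambda>_. 1"]) auto
qed

text \<open>A point of the difference is singular, and in none of its singular directions is
  \<open>g\<close> microlocally \<open>H^1\<close>. By the two preceding lemmas the latter is
  independent of the direction, and a point outside the singular support is \<open>H^1\<close> by
  rapid decay; so the difference is exactly the failure of \<open>H1_near\<close>.\<close>

lemma ssupp_sobolev_iff:
 assumes g: "locally_bounded g"
 shows "s \<in> ssupp (distr_of g) - ssupp_sobolev 1 (distr_of g) \<longleftrightarrow> \<not> H1_near g s"
proof
 assume s: "s \<in> ssupp (distr_of g) - ssupp_sobolev 1 (distr_of g)"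
 then obtain \<xi> where "(s, \<xi>) \<in> WF (distr_of g)" unfolding ssupp_def by force
 moreover have "(s, \<xi>) \<notin> WF_sobolev 1 (distr_of g)" using s unfolding ssupp_sobolev_def by force
 ultimately show "\<not> H1_near g s" using microlocal_of_H1_near[OF g, of s \<xi>] unfolding WF_sobolev_def by blast
next
 assume n: "\<not> H1_near g s"
 have "s \<in> ssupp (distr_of g)"
 proof (rule ccontr)
  assume "s \<notin> ssupp (distr_of g)"
  then obtain \<eta> where "test_function \<eta>" "\<eta> s \<noteq> 0" "rapid_decay (ft (\<lambda>x. \<eta> x * complex_of_real (g x)))"
   using rapid_decay_outside_ssupp[OF g] by blast
  then show False using n rapid_decay_wL2[OF integrable_test_mult[OF g]] unfolding H1_near_def by blast
 qed
 moreover have "s \<notin> ssupp_sobolev 1 (distr_of g)"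
 proof
  assume "s \<in> ssupp_sobolev 1 (distr_of g)"
  then obtain \<xi> where "(s, \<xi>) \<in> WF (distr_of g)" "microlocally_sobolev 1 2 (distr_of g) s \<xi>"
   unfolding ssupp_sobolev_def WF_sobolev_def by force
  then show False using n H1_near_of_microlocal[OF g] unfolding WF_def by blast
 qed
 ultimately show "s \<in> ssupp (distr_of g) - ssupp_sobolev 1 (distr_of g)" by blast
qed

text \<open>The kernel is only Lebesgue measurable; a Borel version, cut to a ball containing the
  support, has the same convolutions.\<close>

lemma kernel_representative:
 fixes \<phi> :: "'a::euclidean_space => real"
 assumes b: "bounded {x. \<phi> x \<noteq> 0}" and i: "integrable lebesgue \<phi>"
 shows "\<exists>\<phi>' r. integrable lborel \<phi>' \<and> (\<forall>y. \<phi>' y \<noteq> 0 --> norm y \<le> r) \<and> (AE y in lborel. \<phi> y = \<phi>' y)"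
proof -
 obtain r where r: "\<And>x. \<phi> x \<noteq> 0 ==> norm x \<le> r" using b unfolding bounded_iff by blast
 have "\<phi> \<in> borel_measurable (completion lborel)" using i by (rule borel_measurable_integrable)
 then obtain g where g: "g \<in> borel_measurable lborel" "AE x in lborel. \<phi> x = g x"
  using completion_ex_borel_measurable_real by blast
 define \<phi>' where "\<phi>' y = g y * indicator (cball 0 r) y" for y
 have [measurable]: "g \<in> borel_measurable borel" using g(1) by simp
 have Im: "indicator (cball 0 r) \<in> (borel_measurable borel :: ('a => real) set)" by (intro borel_measurable_indicator) simp
 have m: "\<phi>' \<in> borel_measurable lborel" unfolding \<phi>'_def[abs_def] using g(1) Im by simp
 have ae: "AE y in lborel. \<phi> y = \<phi>' y"
  using g(2) by (rule eventually_mono) (use r in \<open>force simp: \<phi>'_def indicator_def\<close>)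
 then have ael: "AE y in lebesgue. \<phi> y = \<phi>' y" by (simp add: AE_completion_iff)
 have "integrable lebesgue \<phi>'"
  by (rule integrable_cong_AE_imp[OF i]) (use m ael in \<open>auto intro: measurable_completion elim!: eventually_mono\<close>)
 then have "integrable lborel \<phi>'" using integrable_completion[OF m] by simp
 moreover have "\<forall>y. \<phi>' y \<noteq> 0 --> norm y \<le> r" by (auto simp: \<phi>'_def indicator_def split: if_splits)
 ultimately show ?thesis using ae by blast
qed

section \<open>The unattenuated transform and the final argument\<close>

definition loc_lipschitz :: "(real \<times> real => real) => bool" where
 "loc_lipschitz p \<longleftrightarrow> (\<forall>R. \<exists>L\<ge>0. \<forall>x\<in>cball 0 R. \<forall>y\<in>cball 0 R. \<bar>p x - p y\<bar> \<le> L * norm (x - y))"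

lemma loc_lipschitz_mult:
 assumes p: "loc_lipschitz p" "continuous_on UNIV p" and q: "loc_lipschitz q" "continuous_on UNIV q"
 shows "loc_lipschitz (\<lambda>x. p x * q x)"
 unfolding loc_lipschitz_def
proof
 fix R :: real
 obtain L where L: "L \<ge> 0" "\<And>x y. x \<in> cball 0 R ==> y \<in> cball 0 R ==> \<bar>p x - p y\<bar> \<le> L * norm (x - y)"
  using p(1) unfolding loc_lipschitz_def by meson
 obtain K where K: "K \<ge> 0" "\<And>x y. x \<in> cball 0 R ==> y \<in> cball 0 R ==> \<bar>q x - q y\<bar> \<le> K * norm (x - y)"
  using q(1) unfolding loc_lipschitz_def by meson
 obtain M where M: "M \<ge> 0" "\<And>x. x \<in> cball 0 R ==> \<bar>p x\<bar> \<le> M" using continuous_bounded_cball[OF p(2), of R] by blast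
 obtain N where N: "N \<ge> 0" "\<And>x. x \<in> cball 0 R ==> \<bar>q x\<bar> \<le> N" using continuous_bounded_cball[OF q(2), of R] by blast
 show "\<exists>L\<ge>0. \<forall>x\<in>cball 0 R. \<forall>y\<in>cball 0 R. \<bar>p x * q x - p y * q y\<bar> \<le> L * norm (x - y)"
 proof (rule exI[of _ "L * N + M * K"], intro conjI ballI)
  show "0 \<le> L * N + M * K" using L(1) K(1) M(1) N(1) by simp
  fix x y :: "real \<times> real" assume x: "x \<in> cball 0 R" and y: "y \<in> cball 0 R"
  have "p x * q x - p y * q y = (p x - p y) * q x + p y * (q x - q y)" by (simp add: algebra_simps)
  also have "\<bar>...\<bar> \<le> \<bar>p x - p y\<bar> * \<bar>q x\<bar> + \<bar>p y\<bar> * \<bar>q x - q y\<bar>"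
   by (rule order_trans[OF abs_triangle_ineq]) (simp add: abs_mult)
  also have "... \<le> (L * norm (x - y)) * N + M * (K * norm (x - y))"
   by (intro add_mono mult_mono L(2) K(2) M(2) N(2) x y) (use L(1) M(1) in auto)
  finally show "\<bar>p x * q x - p y * q y\<bar> \<le> (L * N + M * K) * norm (x - y)" by (simp add: algebra_simps)
 qed
qed

lemma loc_lipschitz_smooth: "smooth_on UNIV p ==> loc_lipschitz p"
 unfolding loc_lipschitz_def using smooth_lipschitz by blast

lemma loc_lipschitz_const: "loc_lipschitz (\<lambda>_. c)"
 unfolding loc_lipschitz_def by (auto intro!: exI[of _ 0])

text \<open>A cutoff of the two-variable transform has a rapidly decaying Fourier transform, hence
  is Lipschitz between points of continuity. Over a generic direction all points are of this kind,
  and the cutoff is divided out at its nonzero value.\<close>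

lemma radon_w_locally_lipschitz_outside_ssupp:
 fixes p :: "real \<times> real => real"
 assumes cl: "closed \<Omega>" and \<Omega>1: "\<Omega> \<subseteq> ball 0 1" and p: "continuous_on UNIV p"
  and ct: "\<And>s. countable {t. pt th0 s t \<in> frontier \<Omega>}"
  and ns: "(s0, th0) \<notin> ssupp (distr_of (\<lambda>(s, th). line_int th \<Omega> p s))"
 shows "\<exists>d>0. \<exists>C. \<forall>s. \<bar>s - s0\<bar> < d --> \<bar>line_int th0 \<Omega> p s - line_int th0 \<Omega> p s0\<bar> \<le> C * \<bar>s - s0\<bar>"
proof -
 define G where "G x = line_int (snd x) \<Omega> p (fst x)" for x :: "real \<times> real"
 let ?g = "\<lambda>x t. p (pt (snd x) (fst x) t) * indicator \<Omega> (pt (snd x) (fst x) t)"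
 have [measurable]: "p \<in> borel_measurable borel" using p by (rule borel_measurable_continuous_onI)
 have [measurable]: "\<Omega> \<in> sets borel" using cl by (rule borel_closed)
 have cpt: "continuous_on UNIV (\<lambda>z. pt (snd (fst z)) (fst (fst z)) (snd z) :: real \<times> real)"
  by (intro continuous_intros)
 have ptm: "(\<lambda>z. pt (snd (fst z)) (fst (fst z)) (snd z)) \<in> borel_measurable (borel :: ((real \<times> real) \<times> real) measure)"
  using cpt by (rule borel_measurable_continuous_onI)
 then have ptm' [measurable]: "(\<lambda>z. pt (snd (fst z)) (fst (fst z)) (snd z)) \<in> borel_measurable (borel \<Otimes>\<^sub>M borel)"
  by (simp add: borel_prod)
 obtain M where M: "M \<ge> 0" "\<And>x. x \<in> cball 0 1 ==> \<bar>p x\<bar> \<le> M" using continuous_bounded_cball[OF p, of 1] by blast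
 have gb: "\<bar>?g x t\<bar> \<le> M * indicator {-1..1} t" for x t
 proof (cases "pt (snd x) (fst x) t \<in> \<Omega>")
  case True
  then have b: "pt (snd x) (fst x) t \<in> ball 0 1" using \<Omega>1 by blast
  then have n: "norm (pt (snd x) (fst x) t) < 1" by simp
  have "\<bar>t\<bar> \<le> norm (pt (snd x) (fst x) t)" by (rule abs_le_norm_pt)
  then have "t \<in> {-1..1}" using n by auto
  moreover have "\<bar>p (pt (snd x) (fst x) t)\<bar> \<le> M" using n by (intro M(2)) simp
  ultimately show ?thesis using True by simp
 qed (use M(1) in simp)
 have Wi: "integrable lborel (\<lambda>t::real. M * indicator {-1..1} t)"
  by (intro integrable_mult_right integrable_real_indicator) (auto simp: emeasure_lborel_Icc_eq)
 have Gm: "G \<in> borel_measurable borel"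
 proof -
  have "(\<lambda>x. LB t. (\<lambda>(x, t). ?g x t) (x, t)) \<in> borel_measurable borel"
   by (rule lborel.borel_measurable_lebesgue_integral) (simp add: case_prod_beta, measurable)
  then show ?thesis by (simp add: G_def[abs_def] line_int_def)
 qed
 have Gb: "\<bar>G x\<bar> \<le> (LB t. M * indicator {-1..1::real} t)" for x
 proof (cases "integrable lborel (?g x)")
  case True
  show ?thesis unfolding G_def line_int_def real_norm_def[symmetric]
   by (rule Bochner_Integration.integral_norm_bound_integral[OF True Wi]) (use gb in simp)
 next
  case False
  \<comment> \<open>The integral of a nonintegrable function is 0 by convention, so the bound holds
    in this case as well.\<close>
  have "0 \<le> (LB t. M * indicator {-1..1::real} t)" using M(1) by (intro Bochner_Integration.integral_nonneg) simp
  then show ?thesis using False by (simp add: G_def line_int_def not_integrable_integral_eq)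
 qed
 have Glb: "locally_bounded G" unfolding locally_bounded_def using Gm Gb by blast
 \<comment> \<open>Joint continuity in both variables, claimed only at angle \<open>th0\<close>,
   where the lines meet the frontier in countable sets.\<close>
 have Gc: "isCont G (s, th0)" for s
 proof -
  have "isCont (\<lambda>x. LB t. ?g x t) (s, th0)"
  proof (rule isCont_param_integral)
   show "?g x \<in> borel_measurable borel" for x by measurable
   show "\<exists>W. integrable lborel W \<and> (\<forall>x t. norm x \<le> S --> \<bar>?g x t\<bar> \<le> W t)" for S
    using Wi gb by blast
   have "AE t in lborel. t \<notin> {t. pt th0 s t \<in> frontier \<Omega>}"
    using countable_imp_null_set_lborel[OF ct] by (rule AE_not_in)
   then show "AE t in lborel. isCont (\<lambda>x. ?g x t) (s, th0)"
   proof (rule eventually_mono)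
    fix t assume "t \<notin> {t. pt th0 s t \<in> frontier \<Omega>}"
    then have c: "isCont (indicator \<Omega> :: _ => real) (pt (snd (s, th0)) (fst (s, th0)) t)" by (simp add: isCont_indicator)
    have cp: "isCont p (pt (snd (s, th0)) (fst (s, th0)) t)" using p continuous_on_eq_continuous_at[OF open_UNIV] by blast
    have "continuous_on UNIV (\<lambda>x. pt (snd x) (fst x) t)" by (intro continuous_intros)
    then have l: "isCont (\<lambda>x. pt (snd x) (fst x) t) (s, th0)" using continuous_on_eq_continuous_at[OF open_UNIV] by blast
    show "isCont (\<lambda>x. ?g x t) (s, th0)" by (intro continuous_intros isCont_o2[OF l c] isCont_o2[OF l cp])
   qed
  qed
  then show ?thesis by (simp add: G_def[abs_def] line_int_def)
 qed
 have "(\<lambda>(s, th). line_int th \<Omega> p s) = G" by (auto simp: G_def)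
 then obtain \<eta> where \<eta>: "test_function \<eta>" "\<eta> (s0, th0) \<noteq> 0" and rd: "rapid_decay (ft (\<lambda>x. \<eta> x * complex_of_real (G x)))"
  using rapid_decay_outside_ssupp[OF Glb] ns by metis
 obtain B where B: "\<And>x. norm (\<eta> x * complex_of_real (G x)) \<le> B"
  by (rule test_mult_locally_bounded[OF Glb \<eta>(1)]) (rule that)
 have hc: "isCont (\<lambda>x. \<eta> x * complex_of_real (G x)) (s, th0)" for s
  using Gc[of s] by (intro isCont_mult[OF test_function_isCont[OF \<eta>(1)]] continuous_of_real)
 obtain C where C: "\<And>x y. isCont (\<lambda>x. \<eta> x * complex_of_real (G x)) x ==> isCont (\<lambda>x. \<eta> x * complex_of_real (G x)) y ==>
   norm (\<eta> x * complex_of_real (G x) - \<eta> y * complex_of_real (G y)) \<le> C * norm (x - y)"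
  using rapid_decay_lipschitz[OF integrable_test_mult[OF Glb \<eta>(1)] B rd] by meson
 obtain D where D: "D > 0" "\<And>x. norm (frechet_derivative \<eta> (at x) (1, 0)) \<le> D"
  using test_function_bounded[OF test_function_deriv[OF \<eta>(1), of "(1, 0)"]] by blast
 have d1: "norm (\<eta> (s + h, th0) - \<eta> (s, th0)) \<le> D * h" if "h \<ge> 0" for s h
 proof -
  have "norm (\<eta> ((s, th0) + h *\<^sub>R (1, 0)) - \<eta> (s, th0)) \<le> D * h"
  proof (rule directional_mvt)
   show "\<eta> differentiable at ((s, th0) + t *\<^sub>R (1, 0))" for t
    using smooth_on_differentiable[OF test_function_smooth[OF \<eta>(1)]] by blast
  qed (use that D in auto)
  then show ?thesis by simp
 qed
 have d\<eta>: "norm (\<eta> (s, th0) - \<eta> (s0, th0)) \<le> D * \<bar>s - s0\<bar>" for s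
  using d1[of "s - s0" s0] d1[of "s0 - s" s] by (cases "s \<ge> s0") (auto simp: norm_minus_commute)
 define A where "A = (LB t. M * indicator {-1..1::real} t)"
 have A: "\<bar>G x\<bar> \<le> A" for x unfolding A_def by (rule Gb)
 define n where "n = norm (\<eta> (s0, th0))"
 have n: "n > 0" using \<eta>(2) by (simp add: n_def)
 have "\<bar>G (s, th0) - G (s0, th0)\<bar> \<le> (C + D * A) / n * \<bar>s - s0\<bar>" for s
 proof -
  let ?a = "(s, th0)" and ?b = "(s0, th0)"
  have nn: "norm (?a - ?b) = \<bar>s - s0\<bar>" by (simp add: norm_Pair)
  \<comment> \<open>Only the value of the cutoff at the base point is divided by; its variation is
    charged to the bounded factor \<open>G\<close>.\<close>
  have "\<eta> ?b * complex_of_real (G ?a - G ?b) = (\<eta> ?a * complex_of_real (G ?a) - \<eta> ?b * complex_of_real (G ?b)) - (\<eta> ?a - \<eta> ?b) * complex_of_real (G ?a)"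
   by (simp add: algebra_simps)
  then have "norm (\<eta> ?b * complex_of_real (G ?a - G ?b)) \<le> norm (\<eta> ?a * complex_of_real (G ?a) - \<eta> ?b * complex_of_real (G ?b)) + norm ((\<eta> ?a - \<eta> ?b) * complex_of_real (G ?a))"
   by (simp only: norm_triangle_ineq4)
  also have "... \<le> C * \<bar>s - s0\<bar> + (D * \<bar>s - s0\<bar>) * A"
  proof (rule add_mono)
   show "norm (\<eta> ?a * complex_of_real (G ?a) - \<eta> ?b * complex_of_real (G ?b)) \<le> C * \<bar>s - s0\<bar>"
    using C[OF hc hc, of s s0] unfolding nn .
   show "norm ((\<eta> ?a - \<eta> ?b) * complex_of_real (G ?a)) \<le> (D * \<bar>s - s0\<bar>) * A"
    unfolding norm_mult norm_of_real by (rule mult_mono[OF d\<eta> A]) (use D(1) in auto)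
  qed
  finally have "n * \<bar>G ?a - G ?b\<bar> \<le> (C + D * A) * \<bar>s - s0\<bar>" by (simp only: norm_mult norm_of_real n_def) (simp add: algebra_simps)
  then show ?thesis using n by (simp add: pos_le_divide_eq mult.commute)
 qed
 then have "\<forall>s. \<bar>s - s0\<bar> < 1 --> \<bar>line_int th0 \<Omega> p s - line_int th0 \<Omega> p s0\<bar> \<le> (C + D * A) / n * \<bar>s - s0\<bar>"
  by (simp add: G_def)
 then show ?thesis using zero_less_one by blast
qed

theorem corollary4p15:
  fixes a b \<psi> c\<^sub>0 lam :: real
    and w u \<phi> f :: "real \<times> real \<Rightarrow> real"
    and \<Omega> :: "(real \<times> real) set"
  assumes "a > 0" and "b > 0"
    and "2 * \<psi> \<in> {0<..<pi}"
    and "c\<^sub>0 > 0"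
    and "smooth_on UNIV w" and "\<And>x. x \<in> ball 0 1 \<Longrightarrow> w x > 0"
    and "\<And>x. \<phi> x \<ge> 0" and "bounded {x. \<phi> x \<noteq> 0}"
    and "integrable lebesgue \<phi>" and "(LINT x|lebesgue. \<phi> x) = 1"
    and "lam > 1" and "distr_of \<phi> \<in> sobolev lam \<infinity>"
    and "compact_smooth_domain \<Omega>" and "\<Omega> \<subseteq> ball 0 1"
    and "smooth_on UNIV u" and "\<And>x. u x > 0"
    and "f = (\<lambda>x. u x * indicator \<Omega> x)"
  shows "AE \<theta>\<^sub>0 in lebesgue_on {-pi..pi}.
           (let Rf = distr_of (\<lambda>s. radon_V c\<^sub>0 w \<phi> a b \<psi> f s \<theta>\<^sub>0);
                Rwf = distr_of (\<lambda>(s, \<theta>). radon_w w f s \<theta>)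
            in Pi_set \<Omega> \<theta>\<^sub>0 \<subseteq> ssupp Rf - ssupp_sobolev 1 Rf \<and>
               ssupp Rf - ssupp_sobolev 1 Rf \<subseteq> {s. (s, \<theta>\<^sub>0) \<in> ssupp Rwf})"
proof -
 note dom = assms(13) and \<Omega>1 = assms(14) and u = assms(15) and w = assms(5)
 have cl: "closed \<Omega>" by (rule closed_Omega[OF dom \<Omega>1 u])
 have fm: "f \<in> borel_measurable borel" unfolding assms(17) by (rule density_measurable[OF dom \<Omega>1 u])
 have cu: "continuous_on UNIV u" and cw: "continuous_on UNIV w"
  by (rule smooth_on_continuous_on[OF u], rule smooth_on_continuous_on[OF w])
 have cwu: "continuous_on UNIV (\<lambda>x. w x * u x)" by (intro continuous_intros cu cw)
 have lwu: "loc_lipschitz (\<lambda>x. w x * u x)" by (intro loc_lipschitz_mult loc_lipschitz_smooth u w cu cw)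
 have [measurable]: "u \<in> borel_measurable borel" "w \<in> borel_measurable borel" "\<Omega> \<in> sets borel"
  using cu cw cl by (auto intro: borel_measurable_continuous_onI borel_closed)
 have u0: "u x \<ge> 0" for x using assms(16)[of x] by simp
 obtain N where N: "negligible N" and generic: "\<forall>th. th \<notin> N --> (\<forall>s. countable {t. pt th s t \<in> frontier \<Omega>} \<and>
   ((tangency_set \<Omega> s th = {} \<and> regular \<Omega> th s {}) \<or>
   (\<exists>t0. pt th s t0 \<in> frontier \<Omega> \<and> (\<exists>\<sigma> v k d. touching \<Omega> th s t0 \<sigma> v k d) \<and> (\<forall>e>0. regular \<Omega> th s (ball t0 e)))))"
  using generic_lines[OF dom] by (elim exE conjE)
 note gen = generic[THEN spec, THEN mp, THEN spec]
 obtain \<phi>' r where \<phi>': "integrable lborel \<phi>'" "\<And>y. \<phi>' y \<noteq> 0 ==> norm y \<le> r" "AE y in lborel. \<phi> y = \<phi>' y"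
  using kernel_representative[OF assms(8,9)] by blast
 have \<phi>m: "\<phi> \<in> borel_measurable lebesgue" using assms(9) by (rule borel_measurable_integrable)
 have [measurable]: "\<phi>' \<in> borel_measurable borel" using \<phi>'(1) by (rule borel_measurable_integrable_lborel)
 have lam: "lam > DIM(real \<times> real) / 2" using assms(11) by simp
 obtain K where "\<forall>D B. continuous_on UNIV D --> integrable lborel D --> (\<forall>x. \<bar>D x\<bar> \<le> B) -->
   (NN x. ennreal ((LB y. \<phi>' y * D (x - y))\<^sup>2)) \<le> ennreal (K * (LB x. \<bar>D x\<bar>)\<^sup>2)"
  using sobolev_conv_L2[OF assms(12) lam \<phi>m \<phi>'(3,1)] by (elim exE)
 note K = this[rule_format]
 \<comment> \<open>Besides \<open>th\<close> itself, the angles \<open>th - pi\<close> and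
   \<open>th + 2 * \<psi> - pi\<close> must avoid \<open>N\<close>: they belong to the lines
   carrying the two branches of the V. The condition on \<open>cos th\<close> is that of
   \<open>rotation_nn_integral\<close>.\<close>
 define E where "E = N \<union> (+) pi ` N \<union> (+) (pi - 2 * \<psi>) ` N \<union> {th. cos th = 0}"
 have "countable {th. cos th = (0::real)}"
 proof (rule countable_subset)
  show "{th. cos th = (0::real)} \<subseteq> range (\<lambda>n::int. n * pi + pi / 2)" by (auto simp: cos_zero_iff_int2)
 qed simp
 then have "negligible {th. cos th = (0::real)}"
  unfolding negligible_iff_null_sets by (intro null_sets_completionI countable_imp_null_set_lborel)
 then have E: "negligible E" unfolding E_def by (intro negligible_Un N negligible_translation)
 have wuR: "(\<lambda>(s, th). radon_w w f s th) = (\<lambda>(s, th). line_int th \<Omega> (\<lambda>x. w x * u x) s)"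
 proof -
  have "radon_w w f s th = line_int th \<Omega> (\<lambda>x. w x * u x) s" for s th
  proof -
   have "radon_w w f s th = (LINT t|lebesgue. w (pt th s t) * u (pt th s t) * indicator \<Omega> (pt th s t))"
    by (simp add: radon_w_def line_integral_def pt_def assms(17) mult.assoc)
   also have "... = line_int th \<Omega> (\<lambda>x. w x * u x) s"
    unfolding line_int_def by (rule lebesgue_integral_borel) measurable
   finally show ?thesis .
  qed
  then show ?thesis by simp
 qed
 have main: "let Rf = distr_of (\<lambda>s. radon_V c\<^sub>0 w \<phi> a b \<psi> f s th);
        Rwf = distr_of (\<lambda>(s, th). radon_w w f s th)
      in Pi_set \<Omega> th \<subseteq> ssupp Rf - ssupp_sobolev 1 Rf \<and>
        ssupp Rf - ssupp_sobolev 1 Rf \<subseteq> {s. (s, th) \<in> ssupp Rwf}" if th: "th \<notin> E" for th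
 proof -
  have N0: "th \<notin> N" and N1: "th + 2 * \<psi> - pi / 2 - pi / 2 \<notin> N" and N2: "th - pi / 2 - pi / 2 \<notin> N" and c: "cos th \<noteq> 0"
  proof -
   show "th \<notin> N" "cos th \<noteq> 0" using th by (auto simp: E_def)
   have "th = (pi - 2 * \<psi>) + (th + 2 * \<psi> - pi / 2 - pi / 2)" "th = pi + (th - pi / 2 - pi / 2)" by simp_all
   then show "th + 2 * \<psi> - pi / 2 - pi / 2 \<notin> N" "th - pi / 2 - pi / 2 \<notin> N"
    using th unfolding E_def by blast+
  qed
  have ct: "countable {t. pt th s t \<in> frontier \<Omega>}" for s using gen[OF N0] by blast
  define V where "V x = a * ray (th + 2 * \<psi> - pi / 2) f x + b * ray (th - pi / 2) f x" for x
  have r1: "isCont (ray (th + 2 * \<psi> - pi / 2) f) x" and r2: "isCont (ray (th - pi / 2) f) x" for x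
   unfolding assms(17) using gen[OF N1] gen[OF N2] by (auto intro!: ray_isCont[OF dom \<Omega>1 u])
  have Vc: "continuous_on UNIV V"
   unfolding V_def[abs_def] using r1 r2 by (intro continuous_at_imp_continuous_on ballI continuous_intros)
  have [measurable]: "V \<in> borel_measurable borel" using Vc by (rule borel_measurable_continuous_onI)
  have V0: "V x \<ge> 0" for x
   unfolding V_def assms(17) using assms(1,2) u0 by (intro add_nonneg_nonneg mult_nonneg_nonneg ray_nonneg[OF dom \<Omega>1 u]) auto
  have VL: "L1_translation V"
   unfolding V_def[abs_def] assms(17) using assms(1,2)
   by (intro L1_translation_combination ray_measurable[OF dom \<Omega>1 u] ray_L1[OF dom \<Omega>1 u]) auto
  define W where "W x = (LB y. \<phi>' y * V (x - y))" for x
  have Wc: "continuous_on UNIV W"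
   unfolding W_def[abs_def] using smoothing_isCont(1)[OF Vc \<phi>'(1,2)] by (simp add: continuous_at_imp_continuous_on)
  have [measurable]: "W \<in> borel_measurable borel" using Wc by (rule borel_measurable_continuous_onI)
  have WL: "L2_translation W" unfolding W_def[abs_def] by (rule smoothing_L2[OF Vc VL \<phi>'(1,2) K])
  have sv: "smoothed_vline \<phi> a b \<psi> f x th = (LINT y|lebesgue. \<phi> y * V (x - y))" for x
   unfolding smoothed_vline_def vline_eq_ray[OF fm] V_def ..
  \<comment> \<open>Replacing the kernel by its Borel version changes the integrand only on a null
    set.\<close>
  have sW: "smoothed_vline \<phi> a b \<psi> f x th = W x" for x
  proof -
   have "(LINT y|lebesgue. \<phi> y * V (x - y)) = (LINT y|lebesgue. \<phi>' y * V (x - y))"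
   proof (rule integral_cong_AE)
    have "(\<lambda>y. V (x - y)) \<in> borel_measurable lebesgue" by (rule measurable_completion) measurable
    then show "(\<lambda>y. \<phi> y * V (x - y)) \<in> borel_measurable lebesgue" using \<phi>m by (intro borel_measurable_times)
    show "(\<lambda>y. \<phi>' y * V (x - y)) \<in> borel_measurable lebesgue" by (rule measurable_completion) measurable
    have "AE y in lebesgue. \<phi> y = \<phi>' y" using \<phi>'(3) by (simp add: AE_completion_iff)
    then show "AE y in lebesgue. \<phi> y * V (x - y) = \<phi>' y * V (x - y)" by (rule eventually_mono) simp
   qed
   also have "... = W x" unfolding W_def by (rule lebesgue_integral_borel) measurable
   finally show ?thesis unfolding sv .
  qed
  \<comment> \<open>Read off from \<open>\<phi>\<close>, since \<open>\<phi>'\<close> is known to be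
    nonnegative only almost everywhere.\<close>
  have W0: "W x \<ge> 0" for x
   unfolding sW[symmetric] sv using assms(7) V0 by (intro Bochner_Integration.integral_nonneg) simp
  define F where "F x = c\<^sub>0 * (w x * u x) * exp (- W x)" for x
  have Fc: "continuous_on UNIV F" unfolding F_def[abs_def] by (intro continuous_intros cwu Wc)
  have "loc_lipschitz (\<lambda>x. c\<^sub>0 * (w x * u x))"
   by (intro loc_lipschitz_mult loc_lipschitz_const lwu cwu continuous_on_const)
  then have FH: "line_H1 th F"
   unfolding F_def[abs_def] loc_lipschitz_def
   by (intro attenuation_line_H1 Wc W0 WL c continuous_intros cwu) blast
  have RF: "(\<lambda>s. radon_V c\<^sub>0 w \<phi> a b \<psi> f s th) = line_int th \<Omega> F"
  proof
   fix s
   let ?h = "\<lambda>t. w (pt th s t) * (u (pt th s t) * indicator \<Omega> (pt th s t)) * exp (- W (pt th s t))"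
   have "radon_V c\<^sub>0 w \<phi> a b \<psi> f s th = c\<^sub>0 * (LINT t|lebesgue. w (pt th s t) * f (pt th s t) * exp (- W (pt th s t)))"
    unfolding radon_V_def line_integral_def sW pt_def ..
   also have "... = c\<^sub>0 * (LINT t|lebesgue. ?h t)" by (simp only: assms(17))
   also have "(LINT t|lebesgue. ?h t) = (LB t. ?h t)" by (rule lebesgue_integral_borel) measurable
   also have "c\<^sub>0 * ... = (LB t. c\<^sub>0 * ?h t)" by (rule integral_mult_right_zero[symmetric])
   also have "... = line_int th \<Omega> F s"
    unfolding line_int_def F_def by (rule Bochner_Integration.integral_cong[OF refl]) (simp add: mult_ac)
   finally show "radon_V c\<^sub>0 w \<phi> a b \<psi> f s th = line_int th \<Omega> F s" .
  qed
  have lb: "locally_bounded (line_int th \<Omega> F)" by (rule line_int_locally_bounded[OF cl \<Omega>1 Fc])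
  have in\<Omega>: "x \<in> \<Omega>" if "x \<in> frontier \<Omega>" for x using that cl frontier_subset_closed by blast
  have pos: "w x * u x > 0" "F x > 0" if "x \<in> \<Omega>" for x
  proof -
   have "w x > 0" using that \<Omega>1 by (intro assms(6)) blast
   then show "w x * u x > 0" using assms(16) by (rule mult_pos_pos)
   then show "F x > 0" using assms(4) by (simp add: F_def)
  qed
  have sing: "\<not> H1_near (line_int th \<Omega> F) s"
   if "pt th s t0 \<in> frontier \<Omega>" "touching \<Omega> th s t0 \<sigma> v k d" "\<And>e. e > 0 ==> regular \<Omega> th s (ball t0 e)" for s t0 \<sigma> v k d
   using touching_not_H1[OF cl \<Omega>1 Fc that(2) in\<Omega>[OF that(1)] pos(2)[OF in\<Omega>[OF that(1)]] that(3) ct FH]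
   unfolding H1_near_def by blast
  have smooth: "H1_near (line_int th \<Omega> F) s" if reg: "regular \<Omega> th s {}" for s
  proof -
   obtain \<delta> where \<delta>: "\<delta> > 0" "\<And>\<eta>. test_function \<eta> ==> (\<And>x. \<eta> x \<noteq> 0 ==> \<bar>x - s\<bar> < \<delta>) ==>
     wL2 (\<lambda>x. \<eta> x * complex_of_real (line_int th \<Omega> F x)) UNIV"
    using regular_wL2[OF cl \<Omega>1 Fc reg FH] by blast
   then show ?thesis using bump_function_exists[OF \<delta>(1), of s] unfolding H1_near_def by blast
  qed
  \<comment> \<open>A tangency in \<open>Pi_set\<close> rules out the tangency-free alternative of
    \<open>generic_lines\<close>, so a nondegenerate touching point is available, with regularity
    off its neighbourhoods.\<close>
  have "s \<in> ssupp (distr_of (line_int th \<Omega> F)) - ssupp_sobolev 1 (distr_of (line_int th \<Omega> F))" if s: "s \<in> Pi_set \<Omega> th" for s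
  proof -
   have "tangency_set \<Omega> s th \<noteq> {}" using s unfolding Pi_set_def by force
   then obtain t0 \<sigma> v k d where "pt th s t0 \<in> frontier \<Omega>" "touching \<Omega> th s t0 \<sigma> v k d" "\<And>e. e > 0 ==> regular \<Omega> th s (ball t0 e)"
    using gen[OF N0, of s] by blast
   then show ?thesis unfolding ssupp_sobolev_iff[OF lb] by (rule sing)
  qed
  \<comment> \<open>Failure of \<open>H1_near\<close> rules out the regular alternative, and at a
    touching point the unattenuated transform, whose weight is smooth and positive there, cannot be
    Lipschitz in \<open>s\<close>.\<close>
  moreover have "(s, th) \<in> ssupp (distr_of (\<lambda>(s, th). line_int th \<Omega> (\<lambda>x. w x * u x) s))"
   if s: "s \<in> ssupp (distr_of (line_int th \<Omega> F)) - ssupp_sobolev 1 (distr_of (line_int th \<Omega> F))" for s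
  proof (rule ccontr)
   assume ns: "(s, th) \<notin> ssupp (distr_of (\<lambda>(s, th). line_int th \<Omega> (\<lambda>x. w x * u x) s))"
   have "\<not> regular \<Omega> th s {}" using s smooth unfolding ssupp_sobolev_iff[OF lb] by blast
   then obtain t0 \<sigma> v k d where t: "pt th s t0 \<in> frontier \<Omega>" "touching \<Omega> th s t0 \<sigma> v k d" "\<And>e. e > 0 ==> regular \<Omega> th s (ball t0 e)"
    using gen[OF N0, of s] by blast
   obtain d' C where d': "d' > 0" and q: "\<And>x. \<bar>x - s\<bar> < d' ==>
     \<bar>line_int th \<Omega> (\<lambda>x. w x * u x) x - line_int th \<Omega> (\<lambda>x. w x * u x) s\<bar> \<le> C * \<bar>x - s\<bar>"
    using radon_w_locally_lipschitz_outside_ssupp[OF cl \<Omega>1 cwu ct ns] by blast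
   have lip: "\<exists>L\<ge>0. \<forall>x\<in>cball 0 R. \<forall>y\<in>cball 0 R. \<bar>w x * u x - w y * u y\<bar> \<le> L * norm (x - y)" for R
    using lwu unfolding loc_lipschitz_def by blast
   show False
    by (rule touching_not_lipschitz[OF cl \<Omega>1 cwu t(2) in\<Omega>[OF t(1)] pos(1)[OF in\<Omega>[OF t(1)]] t(3) lip d' q])
  qed
  ultimately show ?thesis unfolding Let_def RF wuR by blast
 qed
 have "AE th in lebesgue. th \<notin> E" using E unfolding negligible_iff_null_sets by (rule AE_not_in)
 then have "AE th in lebesgue. th \<in> {-pi..pi} --> th \<notin> E" by (rule eventually_mono) blast
 then have "AE th in lebesgue_on {-pi..pi}. th \<notin> E" by (subst AE_restrict_space_iff) simp_all
 then show ?thesis by (rule eventually_mono) (rule main)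
qed

end
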